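(* Let $\beta,\gamma\vDash n$ be compositions. The following are equivalent: (1) $r_\beta=r_\gamma$; (2) in all symmetric functions $F=\sum_\alpha c_\alpha F_\alpha$, the coefficient of $F_\beta$ is equal to the coefficient of $F_\gamma$; (3) $\mathcal{M}(\beta)=\mathcal{M}(\gamma)$ (as multisets); (4) for all compositions $\alpha\vDash n$, the number of permutations $\sigma\in S_n$ satisfying $d(\sigma)=S(\alpha)$ and $d(\sigma^{-1})=S(\beta)$ is equal to the number of permutations $\sigma\in S_n$ satisfying $d(\sigma)=S(\alpha)$ and $d(\sigma^{-1})=S(\gamma)$; (5) for some $k\ge1$ there are compositions $\beta_1,\dots,\beta_k,\gamma_1,\dots,\gamma_k$ with $\beta=\beta_1\circ\cdots\circ\beta_k$ and $\gamma=\gamma_1\circ\cdots\circ\gamma_k$, and, for each $i$, either $\gamma_i=\beta_i$ or $\gamma_i=\beta_i^\ast$.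
   Context: A composition $\beta\vDash n$ is a finite list $\beta_1\cdots\beta_k$ of positive integers with sum $n$. Its reversal is $\beta^\ast=\beta_k\cdots\beta_1$; $\lambda(\beta)$ is the partition obtained by sorting its components; $S(\beta)=\{\beta_1,\beta_1+\beta_2,\dots,\beta_1+\cdots+\beta_{k-1}\}\subseteq[n-1]$. $\alpha\ge\beta$ means $\alpha$ is a coarsening of $\beta$ (obtained by adding together adjacent components, possibly none). $\mathcal{M}(\beta)$ is the multiset $\{\lambda(\alpha)\mid\alpha\ge\beta\}$, with one entry for each coarsening $\alpha$. A ribbon is a connected skew diagram with no $2\times2$ array of boxes; ribbons of size $n$ correspond to compositions $\beta\vDash n$ by letting $\beta_i$ be the number of boxes in the $i$-th row from the bottom, and $r_\beta$ is the skew Schur function of the ribbon corresponding to $\beta$. $M_\beta=\sum_{i_1<\cdots<i_k}x_{i_1}^{\beta_1}\cdots x_{i_k}^{\beta_k}$ and $F_\beta=\sum_{\gamma\le\beta}M_\gamma$ (sum over refinements $\gamma$ of $\beta$), $F_0=1$; the $F_\beta$ are a basis of the quasisymmetric functions over $\mathbb{Q}$, which contain the symmetric functions. For $\sigma\in S_n$, $d(\sigma)=\{i\mid\sigma(i)>\sigma(i+1)\}\subseteq[n-1]$. For $\alpha=\alpha_1\cdots\alpha_k$ and $\beta=\beta_1\cdots\beta_l$: $\alpha\cdot\beta=\alpha_1\cdots\alpha_k\beta_1\cdots\beta_l$, $\alpha\odot\beta=\alpha_1\cdots\alpha_{k-1}(\alpha_k+\beta_1)\beta_2\cdots\beta_l$,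 $\beta^{\odot n}=\beta\odot\cdots\odot\beta$ ($n$ factors), and $\alpha\circ\beta=\beta^{\odot\alpha_1}\cdot\beta^{\odot\alpha_2}\cdots\beta^{\odot\alpha_k}$, which is an associative operation. *)

theory Defs
  imports Complex_Main "HOL-Library.Multiset" "HOL-Library.FuncSet" "HOL-Combinatorics.Permutations"
begin

section \<open>Compositions\<close>

definition composition :: "nat list \<Rightarrow> bool" where
  "composition \<beta> \<longleftrightarrow> (\<forall>b\<in>set \<beta>. 0 < b)"

definition composition_of :: "nat list \<Rightarrow> nat \<Rightarrow> bool"  (infix \<open>\<Turnstile>\<^sub>c\<close> 50) where
  "\<beta> \<Turnstile>\<^sub>c n \<longleftrightarrow> composition \<beta> \<and> sum_list \<beta> = n"

definition partition_of :: "nat list \<Rightarrow> nat list" where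
  "partition_of \<beta> = rev (sort \<beta>)"

definition partial_sums :: "nat list \<Rightarrow> nat set" where
  "partial_sums \<beta> = {sum_list (take i \<beta>) | i. 1 \<le> i \<and> i < length \<beta>}"

text \<open>\<open>coarsens \<alpha> \<beta>\<close> is \<open>\<alpha> \<ge> \<beta>\<close>: the blocks \<open>bs\<close> are the groups of adjacent components
  that are added together.\<close>

definition coarsens :: "nat list \<Rightarrow> nat list \<Rightarrow> bool" where
  "coarsens \<alpha> \<beta> \<longleftrightarrow> (\<exists>bs. [] \<notin> set bs \<and> concat bs = \<beta> \<and> map sum_list bs = \<alpha>)"

definition coarsening_partitions :: "nat list \<Rightarrow> nat list multiset" where
  "coarsening_partitions \<beta> = image_mset partition_of (mset_set {\<alpha>. coarsens \<alpha> \<beta>})"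

text \<open>The index sets of \<^const>\<open>coarsening_partitions\<close> and of \<open>F\<^sub>\<beta>\<close> below are finite.\<close>

lemma sum_list_coarsens: "coarsens \<alpha> \<beta> \<Longrightarrow> sum_list \<alpha> = sum_list \<beta>"
proof -
  have "sum_list (concat bs) = sum_list (map sum_list bs)" for bs :: "nat list list"
    by (induction bs) auto
  then show "coarsens \<alpha> \<beta> \<Longrightarrow> sum_list \<alpha> = sum_list \<beta>" unfolding coarsens_def by auto
qed

lemma length_coarsens: "coarsens \<alpha> \<beta> \<Longrightarrow> length \<alpha> \<le> length \<beta>"
proof -
  have "length bs \<le> length (concat bs)" if "[] \<notin> set bs" for bs :: "nat list list"
    using that
  proof (induction bs)
    case (Cons b bs)
    then show ?case by (cases b) auto
  qed simp
  then show "coarsens \<alpha> \<beta> \<Longrightarrow> length \<alpha> \<le> length \<beta>" unfolding coarsens_def by auto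
qed

lemma finite_lists_sum_length: "finite {\<alpha> :: nat list. sum_list \<alpha> = s \<and> length \<alpha> \<le> l}"
  by (rule finite_subset[OF _ finite_lists_length_le[of "{..s}" l]])
    (auto intro: member_le_sum_list)

lemma finite_coarsenings: "finite {\<alpha>. coarsens \<alpha> \<beta>}"
  by (rule finite_subset[OF _ finite_lists_sum_length[of "sum_list \<beta>" "length \<beta>"]])
    (auto simp: sum_list_coarsens length_coarsens)

lemma length_composition_le: "composition \<gamma> \<Longrightarrow> length \<gamma> \<le> sum_list \<gamma>"
  by (induction \<gamma>) (auto simp: composition_def)

lemma finite_refinements: "finite {\<gamma>. composition \<gamma> \<and> coarsens \<beta> \<gamma>}"
  by (rule finite_subset[OF _ finite_lists_sum_length[of "sum_list \<beta>" "sum_list \<beta>"]])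
    (auto simp: sum_list_coarsens dest: length_composition_le)

text \<open>The empty composition is a unit for \<open>\<odot>\<close>; with this convention \<open>\<beta>\<^sup>\<odot>\<^sup>n\<close> can be defined
  by recursion from \<open>n = 0\<close>.\<close>

fun near_concat :: "nat list \<Rightarrow> nat list \<Rightarrow> nat list"  (infixr \<open>\<odot>\<close> 65) where
  "[] \<odot> \<beta> = \<beta>"
| "\<alpha> \<odot> [] = \<alpha>"
| "\<alpha> \<odot> (b # \<beta>) = butlast \<alpha> @ (last \<alpha> + b) # \<beta>"

primrec near_power :: "nat list \<Rightarrow> nat \<Rightarrow> nat list" where
  "near_power \<beta> 0 = []"
| "near_power \<beta> (Suc n) = \<beta> \<odot> near_power \<beta> n"

definition comp_circ :: "nat list \<Rightarrow> nat list \<Rightarrow> nat list"  (infixr \<open>\<circ>\<^sub>c\<close> 70) where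
  "\<alpha> \<circ>\<^sub>c \<beta> = concat (map (near_power \<beta>) \<alpha>)"

text \<open>\<open>\<beta>\<^sub>1 \<circ> \<dots> \<circ> \<beta>\<^sub>k\<close>. The value at the empty list is never used; it is the unit of \<open>\<circ>\<close>.\<close>

fun circ_list :: "nat list list \<Rightarrow> nat list" where
  "circ_list [] = [1]"
| "circ_list [\<beta>] = \<beta>"
| "circ_list (\<beta> # \<gamma> # \<beta>s) = \<beta> \<circ>\<^sub>c circ_list (\<gamma> # \<beta>s)"


section \<open>Symmetric and quasisymmetric functions\<close>

text \<open>A monomial in the variables \<open>x\<^sub>i\<close>, \<open>i\<close> a natural number, is the multiset of the indices
  occurring in it, the exponent of \<open>x\<^sub>i\<close> being the multiplicity of \<open>i\<close>. A formal power series
  is the function giving the coefficient of each monomial.\<close>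

type_synonym series = "nat multiset \<Rightarrow> rat"

definition symmetric_function :: "series \<Rightarrow> bool" where
  "symmetric_function f \<longleftrightarrow>
     (\<exists>d. \<forall>m. f m \<noteq> 0 \<longrightarrow> size m \<le> d) \<and>
     (\<forall>\<pi>. bij \<pi> \<longrightarrow> (\<forall>m. f (image_mset \<pi> m) = f m))"

text \<open>\<open>x\<^bsub>i\<^sub>1\<^esub>\<^sup>\<beta>\<^sup>1 \<cdots> x\<^bsub>i\<^sub>k\<^esub>\<^sup>\<beta>\<^sup>k\<close> for \<open>is = [i\<^sub>1, \<dots>, i\<^sub>k]\<close>.\<close>

definition power_monomial :: "nat list \<Rightarrow> nat list \<Rightarrow> nat multiset" where
  "power_monomial is \<beta> = sum_list (map2 (\<lambda>i b. replicate_mset b i) is \<beta>)"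

text \<open>A formal sum of monomials is encoded by counting, for each monomial, its occurrences in
  the sum.\<close>

definition monomial_qsym :: "nat list \<Rightarrow> series" where
  "monomial_qsym \<beta> = (\<lambda>m. of_nat (card {is. length is = length \<beta> \<and> sorted_wrt (<) is \<and>
                                              power_monomial is \<beta> = m}))"

definition fundamental_qsym :: "nat list \<Rightarrow> series" where
  "fundamental_qsym \<beta> = (\<lambda>m. \<Sum>\<gamma> | composition \<gamma> \<and> coarsens \<beta> \<gamma>. monomial_qsym \<gamma> m)"

text \<open>\<open>f = \<Sum>\<^sub>\<alpha> c\<^sub>\<alpha> F\<^sub>\<alpha>\<close>, a finite linear combination over compositions \<open>\<alpha>\<close>.\<close>

definition fundamental_expansion :: "series \<Rightarrow> (nat list \<Rightarrow> rat) \<Rightarrow> bool" where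
  "fundamental_expansion f c \<longleftrightarrow>
     finite {\<alpha>. c \<alpha> \<noteq> 0} \<and> (\<forall>\<alpha>. c \<alpha> \<noteq> 0 \<longrightarrow> composition \<alpha>) \<and>
     f = (\<lambda>m. \<Sum>\<alpha> | c \<alpha> \<noteq> 0. c \<alpha> * fundamental_qsym \<alpha> m)"


section \<open>Skew diagrams, ribbons and skew Schur functions\<close>

text \<open>Boxes are pairs (row, column), both counted from 0, rows from top to bottom. Partitions bounding
  a skew diagram are given as weakly decreasing sequences that are eventually 0.\<close>

definition skew_diagram :: "(nat \<times> nat) set \<Rightarrow> bool" where
  "skew_diagram D \<longleftrightarrow> (\<exists>lam mu :: nat \<Rightarrow> nat.
     antimono lam \<and> antimono mu \<and> finite {i. lam i \<noteq> 0} \<and> (\<forall>i. mu i \<le> lam i) \<and>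
     D = {(i, j). mu i \<le> j \<and> j < lam i})"

definition adjacent_boxes :: "nat \<times> nat \<Rightarrow> nat \<times> nat \<Rightarrow> bool" where
  "adjacent_boxes p q \<longleftrightarrow>
     (fst p = fst q \<and> (snd q = Suc (snd p) \<or> snd p = Suc (snd q))) \<or>
     (snd p = snd q \<and> (fst q = Suc (fst p) \<or> fst p = Suc (fst q)))"

definition connected_diagram :: "(nat \<times> nat) set \<Rightarrow> bool" where
  "connected_diagram D \<longleftrightarrow>
     (\<forall>p\<in>D. \<forall>q\<in>D. (p, q) \<in> {(a, b). a \<in> D \<and> b \<in> D \<and> adjacent_boxes a b}\<^sup>*)"

definition is_ribbon :: "(nat \<times> nat) set \<Rightarrow> bool" where
  "is_ribbon D \<longleftrightarrow> skew_diagram D \<and> connected_diagram D \<and>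
     \<not> (\<exists>i j. {(i, j), (i, Suc j), (Suc i, j), (Suc i, Suc j)} \<subseteq> D)"

definition semistandard :: "(nat \<times> nat) set \<Rightarrow> (nat \<times> nat \<Rightarrow> nat) \<Rightarrow> bool" where
  "semistandard D T \<longleftrightarrow> T \<in> extensional D \<and>
     (\<forall>i j j'. (i, j) \<in> D \<and> (i, j') \<in> D \<and> j < j' \<longrightarrow> T (i, j) \<le> T (i, j')) \<and>
     (\<forall>i i' j. (i, j) \<in> D \<and> (i', j) \<in> D \<and> i < i' \<longrightarrow> T (i, j) < T (i', j))"

definition skew_schur :: "(nat \<times> nat) set \<Rightarrow> series" where
  "skew_schur D = (\<lambda>m. of_nat (card {T. semistandard D T \<and> image_mset T (mset_set D) = m}))"

text \<open>The ribbon with \<open>\<beta> ! r\<close> boxes in row \<open>r\<close> from the bottom (\<open>r = 0, 1, \<dots>\<close>), placed with its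
  lowest leftmost box in column 0. Walking along the ribbon from that box, the box in row \<open>r\<close> from
  the bottom and column \<open>c\<close> is reached after \<open>c + r\<close> steps.\<close>

definition ribbon :: "nat list \<Rightarrow> (nat \<times> nat) set" where
  "ribbon \<beta> = {(length \<beta> - Suc r, c) | r c. r < length \<beta> \<and>
                 sum_list (take r \<beta>) \<le> c + r \<and> c + r < sum_list (take (Suc r) \<beta>)}"

definition ribbon_schur :: "nat list \<Rightarrow> series" where
  "ribbon_schur \<beta> = skew_schur (ribbon \<beta>)"

lemma length_le_sum_take:
  assumes "composition \<beta>" "r \<le> length \<beta>"
  shows "r \<le> sum_list (take r \<beta>)"
  using assms(2)
proof (induction r)
  case (Suc r)
  then have "0 < \<beta> ! r" using assms(1) by (auto simp: composition_def)
  with Suc show ?case by (simp add: take_Suc_conv_app_nth)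
qed simp

lemma mem_ribbon:
  "(i, j) \<in> ribbon \<beta> \<longleftrightarrow> i < length \<beta> \<and>
     sum_list (take (length \<beta> - Suc i) \<beta>) \<le> j + (length \<beta> - Suc i) \<and>
     j + (length \<beta> - Suc i) < sum_list (take (length \<beta> - i) \<beta>)"
  (is "_ \<longleftrightarrow> ?R")
proof
  assume "(i, j) \<in> ribbon \<beta>"
  then obtain r where r: "i = length \<beta> - Suc r" "r < length \<beta>"
    "sum_list (take r \<beta>) \<le> j + r" "j + r < sum_list (take (Suc r) \<beta>)"
    by (auto simp: ribbon_def)
  then have "length \<beta> - Suc i = r" "length \<beta> - i = Suc r" by auto
  with r show ?R by auto
next
  assume R: ?R
  then have "Suc (length \<beta> - Suc i) = length \<beta> - i" "i = length \<beta> - Suc (length \<beta> - Suc i)" by auto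
  with R show "(i, j) \<in> ribbon \<beta>"
    unfolding ribbon_def by (auto intro!: exI[of _ "length \<beta> - Suc i"])
qed

lemma ribbon_row_card:
  assumes "composition \<beta>" "r < length \<beta>"
  shows "card {c. (length \<beta> - Suc r, c) \<in> ribbon \<beta>} = \<beta> ! r"
proof -
  have eq: "length \<beta> - Suc (length \<beta> - Suc r) = r" "length \<beta> - (length \<beta> - Suc r) = Suc r"
    using assms(2) by auto
  have s: "sum_list (take (Suc r) \<beta>) = sum_list (take r \<beta>) + \<beta> ! r"
    using assms(2) by (simp add: take_Suc_conv_app_nth)
  have le: "r \<le> sum_list (take r \<beta>)" using length_le_sum_take assms by simp
  have "{c. (length \<beta> - Suc r, c) \<in> ribbon \<beta>} =
      {sum_list (take r \<beta>) - r ..< sum_list (take r \<beta>) - r + \<beta> ! r}"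
    unfolding mem_ribbon eq s using assms(2) le by auto
  then show ?thesis by simp
qed

lemma sum_take_mono: "r \<le> s \<Longrightarrow> sum_list (take r \<beta>) \<le> sum_list (take s (\<beta> :: nat list))"
  by (metis le_add1 min.absorb2 sum_list_append take_add le_add_diff_inverse)

lemma sum_take_diff:
  assumes "composition \<beta>" "r \<le> s" "s \<le> length \<beta>"
  shows "sum_list (take r \<beta>) + (s - r) \<le> sum_list (take s \<beta>)"
  using assms(2,3)
proof (induction s rule: dec_induct)
  case (step s)
  then have "0 < \<beta> ! s" using assms(1) by (auto simp: composition_def)
  with step show ?case by (simp add: take_Suc_conv_app_nth)
qed simp

lemma skew_diagram_ribbon:
  assumes "composition \<beta>"
  shows "skew_diagram (ribbon \<beta>)"
proof -
  let ?k = "length \<beta>"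
  define S where "S r = sum_list (take r \<beta>)" for r
  define lam where "lam i = (if i < ?k then S (?k - i) - (?k - Suc i) else 0)" for i
  define mu where "mu i = (if i < ?k then S (?k - Suc i) - (?k - Suc i) else 0)" for i
  have S: "S r + (s - r) \<le> S s" if "r \<le> s" "s \<le> ?k" for r s
    using sum_take_diff[OF assms that] by (simp add: S_def)
  have S0: "r \<le> S r" if "r \<le> ?k" for r
    using length_le_sum_take[OF assms that] by (simp add: S_def)
  have "antimono lam"
  proof (rule antimonoI)
    fix i j :: nat assume "i \<le> j"
    show "lam j \<le> lam i"
    proof (cases "j < ?k")
      case True
      then have "S (?k - j) + (j - i) \<le> S (?k - i)" "?k - j \<le> S (?k - j)"
        using S[of "?k - j" "?k - i"] S0[of "?k - j"] \<open>i \<le> j\<close> by (simp_all add: diff_le_mono2)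
      moreover have "lam i = S (?k - i) - (?k - Suc i)" "lam j = S (?k - j) - (?k - Suc j)"
        using True \<open>i \<le> j\<close> by (simp_all add: lam_def)
      ultimately show ?thesis using True \<open>i \<le> j\<close> by linarith
    qed (simp add: lam_def)
  qed
  moreover have "antimono mu"
  proof (rule antimonoI)
    fix i j :: nat assume "i \<le> j"
    show "mu j \<le> mu i"
    proof (cases "j < ?k")
      case True
      then have "S (?k - Suc j) + (j - i) \<le> S (?k - Suc i)"
        using S[of "?k - Suc j" "?k - Suc i"] \<open>i \<le> j\<close> by (simp add: diff_le_mono2)
      moreover have "mu i = S (?k - Suc i) - (?k - Suc i)" "mu j = S (?k - Suc j) - (?k - Suc j)"
        using True \<open>i \<le> j\<close> by (simp_all add: mu_def)
      ultimately show ?thesis using True \<open>i \<le> j\<close> by linarith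
    qed (simp add: mu_def)
  qed
  moreover have "finite {i. lam i \<noteq> 0}"
    by (rule finite_subset[of _ "{..<?k}"]) (auto simp: lam_def)
  moreover have "\<forall>i. mu i \<le> lam i"
  proof
    fix i show "mu i \<le> lam i"
      using S[of "?k - Suc i" "?k - i"] diff_le_mono2[of i "Suc i" ?k]
      by (auto simp: mu_def lam_def intro!: diff_le_mono)
  qed
  moreover have "ribbon \<beta> = {(i, j). mu i \<le> j \<and> j < lam i}"
  proof -
    have "(i, j) \<in> ribbon \<beta> \<longleftrightarrow> mu i \<le> j \<and> j < lam i" for i j
      unfolding mem_ribbon mu_def lam_def S_def[symmetric] by auto
    then show ?thesis by auto
  qed
  ultimately show ?thesis unfolding skew_diagram_def by blast
qed

text \<open>Consecutive boxes of the walk along the ribbon are adjacent, hence the ribbon is connected.\<close>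

lemma ribbon_walk:
  assumes "composition \<beta>" "p < sum_list \<beta>"
  obtains r where "r < length \<beta>" "r \<le> p"
    "sum_list (take r \<beta>) \<le> p" "p < sum_list (take (Suc r) \<beta>)"
proof -
  let ?P = "\<lambda>r. p < sum_list (take r \<beta>)"
  define s where "s = (LEAST r. ?P r)"
  have ex: "?P (length \<beta>)" using assms(2) by simp
  have Ps: "?P s" unfolding s_def by (rule LeastI[of ?P, OF ex])
  have sl: "s \<le> length \<beta>" unfolding s_def by (rule Least_le[of ?P, OF ex])
  have "s \<noteq> 0" using Ps by (cases "s = 0") auto
  then obtain r where r: "s = Suc r" by (cases s) auto
  have "\<not> ?P r" using not_less_Least[of r ?P] r by (simp add: s_def)
  moreover have "r \<le> sum_list (take r \<beta>)" using length_le_sum_take[OF assms(1), of r] sl r by simp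
  ultimately show ?thesis using that[of r] Ps sl r by auto
qed

lemma is_ribbon_ribbon:
  assumes "composition \<beta>"
  shows "is_ribbon (ribbon \<beta>)"
proof -
  let ?k = "length \<beta>"
  let ?D = "ribbon \<beta>"
  let ?E = "{(a, b). a \<in> ?D \<and> b \<in> ?D \<and> adjacent_boxes a b}"
  define S where "S r = sum_list (take r \<beta>)" for r
  have S: "S r + (s - r) \<le> S s" if "r \<le> s" "s \<le> ?k" for r s
    using sum_take_diff[OF assms that] by (simp add: S_def)
  have mem: "(?k - Suc r, c) \<in> ?D" if "r < ?k" "S r \<le> c + r" "c + r < S (Suc r)" for r c
    using that unfolding ribbon_def S_def by blast
  have Sk: "S (Suc r) \<le> sum_list \<beta>" if "r < ?k" for r
    using sum_take_mono[of "Suc r" ?k \<beta>] that by (simp add: S_def)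
  have walk: "\<exists>r. r < ?k \<and> r \<le> p \<and> S r \<le> p \<and> p < S (Suc r)" if "p < sum_list \<beta>" for p
    using ribbon_walk[OF assms that] unfolding S_def by metis
  have uniq: "r = s" if "r < ?k" "s < ?k" "S r \<le> p" "p < S (Suc r)" "S s \<le> p" "p < S (Suc s)" for r s p
  proof (rule ccontr)
    assume "r \<noteq> s"
    then consider "Suc r \<le> s" | "Suc s \<le> r" by linarith
    then show False using S[of "Suc r" s] S[of "Suc s" r] that by cases auto
  qed
  have sym: "sym ?E" by (auto simp: sym_def adjacent_boxes_def)
  have conn: "(?k - Suc r, c) \<in> ?D \<Longrightarrow> ((?k - 1, 0), (?k - Suc r, c)) \<in> ?E\<^sup>*"
    if "r < ?k" "S r \<le> c + r" "c + r < S (Suc r)" for r c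
    using that
  proof (induction "c + r" arbitrary: r c rule: less_induct)
    case less
    show ?case
    proof (cases "c + r = 0")
      case True
      then show ?thesis by simp
    next
      case False
      define p where "p = c + r - 1"
      have pp: "c + r = Suc p" using False by (simp add: p_def)
      have "p < sum_list \<beta>" using less.prems pp Sk[of r] by linarith
      then obtain q where q: "q < ?k" "q \<le> p" "S q \<le> p" "p < S (Suc q)" using walk by blast
      define d where "d = p - q"
      have d: "d + q = p" using q by (simp add: d_def)
      have Dq: "(?k - Suc q, d) \<in> ?D" using mem[of q d] q d by simp
      have IH: "((?k - 1, 0), (?k - Suc q, d)) \<in> ?E\<^sup>*"
        using less.hyps[of d q] Dq q d pp by simp
      have "q = r \<or> Suc q = r"
      proof (cases "Suc p < S (Suc q)")
        case True
        then show ?thesis using uniq[of q r "Suc p"] q less.prems pp by auto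
      next
        case F: False
        then have e: "S (Suc q) = Suc p" using q by simp
        have "Suc q < ?k"
        proof (rule ccontr)
          assume "\<not> Suc q < ?k"
          then have "Suc q = ?k" using q by simp
          then have "sum_list \<beta> = Suc p" using e by (simp add: S_def)
          then show False using less.prems pp Sk[of r] by simp
        qed
        then have "S (Suc q) + 1 \<le> S (Suc (Suc q))" using S[of "Suc q" "Suc (Suc q)"] by simp
        then show ?thesis using uniq[of "Suc q" r "Suc p"] e \<open>Suc q < ?k\<close> less.prems pp by auto
      qed
      then have "adjacent_boxes (?k - Suc q, d) (?k - Suc r, c)"
      proof
        assume "q = r" then show ?thesis using d pp by (auto simp: adjacent_boxes_def)
      next
        assume "Suc q = r" then show ?thesis
          using d pp less.prems by (auto simp: adjacent_boxes_def)
      qed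
      then have "((?k - Suc q, d), (?k - Suc r, c)) \<in> ?E" using Dq less.prems by simp
      with IH show ?thesis by (rule rtrancl_into_rtrancl)
    qed
  qed
  have base: "((?k - 1, 0), a) \<in> ?E\<^sup>*" if aD: "a \<in> ?D" for a
  proof -
    obtain r c where a: "a = (?k - Suc r, c)" "r < ?k" "S r \<le> c + r" "c + r < S (Suc r)"
      using aD unfolding ribbon_def S_def by blast
    show ?thesis using conn[of r c] a aD by simp
  qed
  have "connected_diagram ?D"
    unfolding connected_diagram_def
  proof (intro ballI)
    fix a b assume ab: "a \<in> ?D" "b \<in> ?D"
    have "(a, (?k - 1, 0)) \<in> ?E\<^sup>*" using base[OF ab(1)] sym_rtrancl[OF sym] by (meson symD)
    then show "(a, b) \<in> ?E\<^sup>*" using base[OF ab(2)] by (rule rtrancl_trans)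
  qed
  moreover have "\<not> {(i, j), (i, Suc j), (Suc i, j), (Suc i, Suc j)} \<subseteq> ?D" for i j
  proof
    assume "{(i, j), (i, Suc j), (Suc i, j), (Suc i, Suc j)} \<subseteq> ?D"
    then have 1: "(i, j) \<in> ?D" and 2: "(Suc i, Suc j) \<in> ?D" by auto
    from 1 have "S (?k - Suc i) \<le> j + (?k - Suc i)" unfolding mem_ribbon S_def by blast
    moreover from 2 have "Suc i < ?k" "Suc j + (?k - Suc (Suc i)) < S (?k - Suc i)"
      unfolding mem_ribbon S_def by blast+
    ultimately show False by linarith
  qed
  ultimately show ?thesis using skew_diagram_ribbon[OF assms] unfolding is_ribbon_def by blast
qed


section \<open>Descents\<close>

definition descents :: "nat \<Rightarrow> (nat \<Rightarrow> nat) \<Rightarrow> nat set" where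
  "descents n \<sigma> = {i. 1 \<le> i \<and> i < n \<and> \<sigma> i > \<sigma> (i + 1)}"

end

theory Submission
  imports Defs "HOL-Computational_Algebra.Computational_Algebra"
begin

text \<open>
  Write \<open>S\<close> for \<open>partial_sums \<beta>\<close>, a subset of \<open>{1..n-1}\<close>. All conditions are compared with (3), and
  the common tool is the coarsening polynomial \<open>csum \<beta> h\<close>: the sum over all coarsenings
  \<open>\<alpha>\<close> of \<open>\<beta>\<close> of the product of the weights \<open>h a\<close> of the components of \<open>\<alpha>\<close>. A coarsening of \<open>\<beta>\<close> is a
  path from 0 to \<open>n\<close> all of whose stops before \<open>n\<close> lie in \<open>S\<close>, so \<open>csum\<close> satisfies simple recursions.
  Condition (3) says that \<open>csum \<beta>\<close> and \<open>csum \<gamma>\<close> are the same polynomial in the weights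
  (\<open>types_separated\<close>).

  (1) and (3). Read along the ribbon, a semistandard tableau is a word whose descent set is \<open>S\<close>
  (\<open>ribbon_schur_words\<close>). Cutting words at a fixed place gives
  \<open>r\<^sub>\<alpha> r\<^sub>\<beta> = r\<^bsub>\<alpha>\<cdot>\<beta>\<^esub> + r\<^bsub>\<alpha>\<odot>\<beta>\<^esub>\<close>. Up to signs this is the recursion of \<open>csum\<close>, whence
  \<open>r\<^sub>\<beta> = \<plusminus> csum \<beta> (- h)\<close> with \<open>h\<close> the complete homogeneous functions (\<open>wsum_csum\<close>). Since the complex
  numbers are algebraically closed, \<open>h\<^sub>1, \<dots>, h\<^sub>n\<close> can be given arbitrary values (\<open>hsum_prescribed\<close>), so
  \<open>r\<^sub>\<beta>\<close> determines \<open>csum \<beta>\<close>, and conversely.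

  (2) and (3). In \<open>\<Sum>\<^sub>\<alpha> c\<^sub>\<alpha> F\<^sub>\<alpha>\<close> the coefficient of a monomial with exponents \<open>\<delta>\<close> is the sum of the
  \<open>c\<^sub>\<alpha>\<close> over the coarsenings \<open>\<alpha>\<close> of \<open>\<delta>\<close>. By Moebius inversion \<open>c\<^sub>\<beta>\<close> is an alternating sum over the
  coarsenings of \<open>\<beta>\<close> whose terms, for a symmetric function, depend only on the sorted coarsening.
  Conversely the monomial symmetric functions isolate the coarsenings with a given type.

  (1) and (4). Standardization matches the words with sorted rearrangement \<open>v\<close> with the
  permutations whose descents are among the ascents of \<open>v\<close>; every subset of \<open>{1..n-1}\<close> is the set of
  ascents of some \<open>v\<close>, and Moebius inversion isolates a single descent set.

  (5) implies (3). One has \<open>csum (\<alpha> \<circ> \<delta>) h = csum \<alpha> H\<close> with \<open>H a = csum (\<delta>\<^sup>\<odot>\<^sup>a) h\<close>, and reversing a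
  composition does not change \<open>csum\<close>.

  (3) implies (5) is the main part. Let \<open>S\<close>, \<open>S'\<close> have the same multiset of path types, and let \<open>R\<close>, \<open>R'\<close> be
  the reversed sets. If \<open>S'\<close> is neither \<open>S\<close> nor \<open>R\<close>, then, after reversing \<open>S'\<close> if necessary, there is a divisor \<open>s\<close>
  of \<open>n\<close>, \<open>1 < s < n\<close>, such that off the multiples of \<open>s\<close> the two sets coincide and are \<open>s\<close>-periodic
  (\<open>equivalent_sets_decompose\<close>). This means \<open>\<beta> = \<alpha> \<circ> \<delta>\<close> and \<open>\<gamma> = \<alpha>' \<circ> \<delta>\<close> up to reversal, with
  \<open>\<delta> \<Turnstile> s\<close>; putting weight only on multiples of \<open>s\<close> shows that \<open>\<alpha>\<close> and \<open>\<alpha>'\<close> again satisfy (3), and induction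
  on \<open>n\<close> finishes. To find \<open>s\<close>, the path polynomial is differentiated with respect to the weights.
  One derivative gives that the product of the path series \<open>p\<close> of \<open>S\<close> and \<open>q\<close> of \<open>R\<close> agrees with
  that of \<open>S'\<close> and \<open>R'\<close> below degree \<open>n\<close>; further derivatives give two more identities.

  At weight 0 these identities concern \<open>d i = [i \<in> S] - [n - i \<in> S]\<close>. They say that \<open>d' = \<plusminus> d\<close>, and that
  the set \<open>A\<close> where \<open>d' = d \<noteq> 0\<close> and the set \<open>B\<close> where \<open>d' = - d \<noteq> 0\<close> interact additively. As a
  consequence, non-empty \<open>A\<close> and \<open>B\<close> cannot each be contained in the subgroup spanned by the other
  (\<open>span_separates\<close>).
  Reversing \<open>S'\<close> exchanges \<open>A\<close> and \<open>B\<close>, so some \<open>a \<in> A\<close> may be assumed to lie outside the span of \<open>B\<close>.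
  The common period \<open>s1\<close> of the elements of \<open>A\<close> outside that span is a first
  approximation to \<open>s\<close>. For weights on the multiples of \<open>s1\<close>, comparison of lowest order terms in the derivative
  identities shows that the word that \<open>S\<close> spells on a residue class modulo \<open>s1\<close> has as periods
  the degrees occurring in \<open>theta = q' / q\<close>, unless the first failure is a jump by a constant
  (\<open>class_periods\<close>). The exact common period \<open>g\<close> of these words then takes
  the place of \<open>s1\<close> (\<open>invar_step\<close>), and a modulus that is no longer enlarged in this way is the required \<open>s\<close>.
\<close>

section \<open>Path polynomials and their derivatives\<close>

definition paths :: "nat set \<Rightarrow> nat \<Rightarrow> nat list set" where
  "paths S k = {\<alpha>. composition \<alpha> \<and> sum_list \<alpha> = k \<and> (\<forall>i\<in>{1..length \<alpha>}. sum_list (take i \<alpha>) \<in> S)}"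

fun path_sum :: "nat set \<Rightarrow> (nat \<Rightarrow> 'a::comm_ring_1) \<Rightarrow> nat \<Rightarrow> 'a" where
  "path_sum S h k = (if k = 0 then 1 else if k \<in> S then \<Sum>i<k. path_sum S h i * h (k - i) else 0)"

declare path_sum.simps [simp del]

lemma path_sum_0 [simp]: "path_sum S h 0 = 1"
  by (simp add: path_sum.simps)

lemma path_sum_pos: "k > 0 \<Longrightarrow> path_sum S h k = (if k \<in> S then \<Sum>i<k. path_sum S h i * h (k - i) else 0)"
  by (simp add: path_sum.simps)

lemma finite_paths [simp]: "finite (paths S k)"
  by (rule finite_subset[OF _ finite_lists_sum_length[of k k]])
    (auto simp: paths_def dest: length_composition_le)

lemma paths_0 [simp]: "paths S 0 = {[]}"
proof -
  have "\<alpha> = []" if "composition \<alpha>" "sum_list \<alpha> = 0" for \<alpha>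
    using length_composition_le[OF that(1)] that(2) by simp
  moreover have "composition []" by (simp add: composition_def)
  ultimately show ?thesis by (auto simp: paths_def)
qed

lemma composition_append [simp]: "composition (\<alpha> @ \<beta>) \<longleftrightarrow> composition \<alpha> \<and> composition \<beta>"
  by (auto simp: composition_def)

lemma composition_Cons [simp]: "composition (b # \<beta>) \<longleftrightarrow> 0 < b \<and> composition \<beta>"
  by (auto simp: composition_def)

lemma composition_Nil [simp]: "composition []"
  by (simp add: composition_def)

lemma composition_rev [simp]: "composition (rev \<beta>) \<longleftrightarrow> composition \<beta>"
  by (auto simp: composition_def)

lemma paths_snoc: "\<alpha> @ [b] \<in> paths S k \<longleftrightarrow> 0 < b \<and> b \<le> k \<and> k \<in> S \<and> \<alpha> \<in> paths S (k - b)"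
proof -
  have "(\<forall>i\<in>{1..length (\<alpha> @ [b])}. sum_list (take i (\<alpha> @ [b])) \<in> S) \<longleftrightarrow>
    sum_list \<alpha> + b \<in> S \<and> (\<forall>i\<in>{1..length \<alpha>}. sum_list (take i \<alpha>) \<in> S)"
  proof -
    have "{1..length (\<alpha> @ [b])} = insert (Suc (length \<alpha>)) {1..length \<alpha>}" by auto
    then show ?thesis by simp
  qed
  then show ?thesis by (auto simp: paths_def)
qed

text \<open>Removing the last step.\<close>

lemma paths_rec:
  assumes "k > 0"
  shows "paths S k = (if k \<in> S then \<Union>i<k. (\<lambda>\<alpha>. \<alpha> @ [k - i]) ` paths S i else {})"
proof -
  have "\<alpha> \<in> paths S k \<longleftrightarrow> k \<in> S \<and> (\<exists>i<k. \<alpha> \<in> (\<lambda>\<alpha>. \<alpha> @ [k - i]) ` paths S i)" for \<alpha>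
  proof (cases \<alpha> rule: rev_cases)
    case Nil
    then show ?thesis using assms by (auto simp: paths_def)
  next
    case (snoc \<alpha>' b)
    have "\<alpha> \<in> paths S k \<longleftrightarrow> 0 < b \<and> b \<le> k \<and> k \<in> S \<and> \<alpha>' \<in> paths S (k - b)"
      by (simp add: snoc paths_snoc)
    also have "\<dots> \<longleftrightarrow> k \<in> S \<and> (\<exists>i<k. b = k - i \<and> \<alpha>' \<in> paths S i)"
      by (auto intro: exI[of _ "k - b"])
    also have "\<dots> \<longleftrightarrow> k \<in> S \<and> (\<exists>i<k. \<alpha> \<in> (\<lambda>\<alpha>. \<alpha> @ [k - i]) ` paths S i)"
      by (auto simp: snoc)
    finally show ?thesis .
  qed
  then have "\<alpha> \<in> paths S k \<longleftrightarrow> \<alpha> \<in> (if k \<in> S then \<Union>i<k. (\<lambda>\<alpha>. \<alpha> @ [k - i]) ` paths S i else {})" for \<alpha>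
    by (cases "k \<in> S") (simp_all add: Bex_def)
  then show ?thesis by blast
qed

lemma path_sum_paths: "path_sum S h k = (\<Sum>\<alpha>\<in>paths S k. prod_list (map h \<alpha>))"
proof (induction k rule: less_induct)
  case (less k)
  show ?case
  proof (cases "k = 0 \<or> k \<notin> S")
    case True
    then show ?thesis by (cases "k = 0") (simp_all add: path_sum_pos paths_rec)
  next
    case False
    then have k: "k > 0" "k \<in> S" by auto
    have disj: "(\<lambda>\<alpha>. \<alpha> @ [k - i]) ` paths S i \<inter> (\<lambda>\<alpha>. \<alpha> @ [k - j]) ` paths S j = {}"
      if "i < k" "j < k" "i \<noteq> j" for i j
      using that by auto
    have "(\<Sum>\<alpha>\<in>paths S k. prod_list (map h \<alpha>)) =
      (\<Sum>\<alpha>\<in>(\<Union>i<k. (\<lambda>\<alpha>. \<alpha> @ [k - i]) ` paths S i). prod_list (map h \<alpha>))"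
      using k by (simp add: paths_rec[OF k(1)])
    also have "\<dots> =
      (\<Sum>i<k. \<Sum>\<alpha>\<in>(\<lambda>\<alpha>. \<alpha> @ [k - i]) ` paths S i. prod_list (map h \<alpha>))"
      by (rule sum.UNION_disjoint) (use disj in auto)
    also have "\<dots> = (\<Sum>i<k. path_sum S h i * h (k - i))"
      by (intro sum.cong refl, subst sum.reindex) (auto simp: inj_on_def less sum_distrib_right)
    finally show ?thesis using k by (simp add: path_sum_pos)
  qed
qed

text \<open>Reading a path backwards exchanges a set of stops with its reflection.\<close>

lemma rev_paths:
  assumes "k > 0" "\<And>i. 0 < i \<Longrightarrow> i < k \<Longrightarrow> i \<in> T \<longleftrightarrow> k - i \<in> S" "\<alpha> \<in> paths (insert k S) k"
  shows "rev \<alpha> \<in> paths (insert k T) k"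
proof -
  have \<alpha>: "composition \<alpha>" "sum_list \<alpha> = k" "\<And>i. 1 \<le> i \<Longrightarrow> i \<le> length \<alpha> \<Longrightarrow> sum_list (take i \<alpha>) \<in> insert k S"
    using assms(3) by (auto simp: paths_def)
  have "sum_list (take i (rev \<alpha>)) \<in> insert k T" if i: "1 \<le> i" "i \<le> length \<alpha>" for i
  proof (cases "i = length \<alpha>")
    case True
    then show ?thesis using \<alpha> by simp
  next
    case False
    define j where "j = length \<alpha> - i"
    have j: "1 \<le> j" "j < length \<alpha>" using i False by (auto simp: j_def)
    have s: "sum_list (take i (rev \<alpha>)) = sum_list (drop j \<alpha>)"
      using i by (simp add: take_rev j_def)
    have sp: "sum_list (take j \<alpha>) + sum_list (drop j \<alpha>) = k"
      using \<alpha>(2) by (metis append_take_drop_id sum_list_append)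
    have "j \<le> sum_list (take j \<alpha>)" using length_le_sum_take[OF \<alpha>(1), of j] j by simp
    moreover have "sum_list (take j \<alpha>) + (length \<alpha> - j) \<le> k"
      using sum_take_diff[OF \<alpha>(1), of j "length \<alpha>"] j \<alpha>(2) by simp
    ultimately have lt: "0 < sum_list (take j \<alpha>)" "sum_list (take j \<alpha>) < k" using j by linarith+
    then have "sum_list (take j \<alpha>) \<in> S" using \<alpha>(3)[of j] j by auto
    then have "k - sum_list (take j \<alpha>) \<in> T" using assms(2)[of "k - sum_list (take j \<alpha>)"] lt by simp
    moreover have "k - sum_list (take j \<alpha>) = sum_list (drop j \<alpha>)" using sp by simp
    ultimately show ?thesis using s by simp
  qed
  then show ?thesis using \<alpha> by (auto simp: paths_def)
qed

lemma bij_betw_rev_paths: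
  assumes "k > 0" "\<And>i. 0 < i \<Longrightarrow> i < k \<Longrightarrow> i \<in> T \<longleftrightarrow> k - i \<in> S"
  shows "bij_betw rev (paths (insert k T) k) (paths (insert k S) k)"
proof (rule bij_betwI[where g = rev])
  have T: "i \<in> S \<longleftrightarrow> k - i \<in> T" if "0 < i" "i < k" for i
    using assms(2)[of "k - i"] that by simp
  show "rev \<in> paths (insert k T) k \<rightarrow> paths (insert k S) k"
    by (intro funcsetI rev_paths[OF assms(1), of S T] T)
  show "rev \<in> paths (insert k S) k \<rightarrow> paths (insert k T) k"
    by (intro funcsetI rev_paths[OF assms(1), of T S] assms(2))
qed simp_all

lemma path_sum_reverse:
  assumes "k > 0" "\<And>i. 0 < i \<Longrightarrow> i < k \<Longrightarrow> i \<in> T \<longleftrightarrow> k - i \<in> S"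
  shows "path_sum (insert k T) h k = path_sum (insert k S) h k"
  unfolding path_sum_paths
  by (subst sum.reindex_bij_betw[OF bij_betw_rev_paths[OF assms], symmetric])
    (auto simp: rev_map[symmetric] prod_list.rev)

lemma path_sum_cong:
  assumes "\<And>i. 0 < i \<Longrightarrow> i \<le> k \<Longrightarrow> i \<in> S \<longleftrightarrow> i \<in> T"
  shows "path_sum S h k = path_sum T h k"
  using assms
proof (induction k rule: less_induct)
  case (less k)
  show ?case
  proof (cases "k = 0")
    case False
    then show ?thesis using less by (auto simp: path_sum_pos intro!: sum.cong)
  qed simp
qed

text \<open>The weight of the paths from \<open>j\<close> to \<open>j + g\<close>, both end points being required to lie in \<open>S\<close>.\<close>

definition seg :: "nat set \<Rightarrow> (nat \<Rightarrow> 'a::comm_ring_1) \<Rightarrow> nat \<Rightarrow> nat \<Rightarrow> 'a" where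
  "seg S h j g = (if j \<in> S then path_sum {i. i + j \<in> S} h g else 0)"

text \<open>The derivative of a path sum with respect to the weight \<open>h m\<close> marks one step of length \<open>m\<close>.
  If \<open>f\<close> describes the part before the marked step, \<open>act S h m f\<close> describes the whole path, the length \<open>m\<close>
  of the marked step not being counted.\<close>

definition act :: "nat set \<Rightarrow> (nat \<Rightarrow> 'a::comm_ring_1) \<Rightarrow> nat \<Rightarrow> (nat \<Rightarrow> 'a) \<Rightarrow> nat \<Rightarrow> 'a" where
  "act S h m f r = (\<Sum>i\<le>r. f i * seg S h (i + m) (r - i))"

definition conv :: "(nat \<Rightarrow> 'a::comm_ring_1) \<Rightarrow> (nat \<Rightarrow> 'a) \<Rightarrow> nat \<Rightarrow> 'a" where
  "conv f g k = (\<Sum>i\<le>k. f i * g (k - i))"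

lemma seg_0: "seg S h j 0 = (if j \<in> S then 1 else 0)"
  by (simp add: seg_def)

lemma seg_rec:
  assumes "g > 0"
  shows "seg S h j g = (if j + g \<in> S then \<Sum>e<g. seg S h j e * h (g - e) else 0)"
  using assms by (auto simp: seg_def path_sum_pos add.commute)

lemma seg_notin: "j + g \<notin> S \<Longrightarrow> seg S h j g = 0"
  by (cases "g = 0") (auto simp: seg_0 seg_rec)

lemma act_rec:
  "act S h m f r = (if m + r \<in> S then f r + (\<Sum>i<r. act S h m f i * h (r - i)) else 0)"
proof (cases "m + r \<in> S")
  case False
  then show ?thesis by (auto simp: act_def seg_notin intro!: sum.neutral)
next
  case True
  have "act S h m f r = f r + (\<Sum>i<r. f i * seg S h (i + m) (r - i))"
    using True by (simp add: act_def lessThan_Suc_atMost[symmetric] seg_0 add.commute)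
  also have "(\<Sum>i<r. f i * seg S h (i + m) (r - i)) =
     (\<Sum>i<r. \<Sum>e<r - i. f i * (seg S h (i + m) e * h (r - i - e)))"
    using True by (intro sum.cong refl) (simp add: seg_rec sum_distrib_left add.commute)
  also have "\<dots> = (\<Sum>(i, e)\<in>(SIGMA i:{..<r}. {..<r - i}). f i * (seg S h (i + m) e * h (r - i - e)))"
    by (simp add: sum.Sigma)
  also have "\<dots> = (\<Sum>(u, i)\<in>(SIGMA u:{..<r}. {..u}). f i * (seg S h (i + m) (u - i) * h (r - u)))"
    by (rule sum.reindex_bij_witness[of _ "\<lambda>(u, i). (i, u - i)" "\<lambda>(i, e). (i + e, i)"]) auto
  also have "\<dots> = (\<Sum>u<r. act S h m f u * h (r - u))"
    by (simp add: act_def sum.Sigma[symmetric] sum_distrib_right mult.assoc)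
  finally show ?thesis using True by simp
qed

text \<open>Weights in the ring of power series in a parameter \<open>\<epsilon>\<close>: the coefficient of \<open>\<epsilon>\<close> in a polynomial
  expression in \<open>perturb h m\<close> is its formal derivative with respect to \<open>h m\<close>.\<close>

definition perturb :: "(nat \<Rightarrow> 'a::comm_ring_1) \<Rightarrow> nat \<Rightarrow> nat \<Rightarrow> 'a fps" where
  "perturb h m k = fps_const (h k) + (if k = m then fps_X else 0)"

lemma perturb_0 [simp]: "perturb h m k $ 0 = h k"
  by (simp add: perturb_def)

lemma perturb_1 [simp]: "perturb h m k $ Suc 0 = (if k = m then 1 else 0)"
  by (simp add: perturb_def)

lemma fps_mult_nth_Suc_0: "(f * g) $ Suc 0 = f $ 0 * g $ Suc 0 + f $ Suc 0 * g $ 0"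
  by (simp add: fps_mult_nth)

lemma path_sum_perturb_0: "path_sum S (perturb h m) k $ 0 = path_sum S h k"
proof (induction k rule: less_induct)
  case (less k)
  then show ?case
    by (cases "k = 0") (auto simp: path_sum_pos fps_sum_nth)
qed

lemma path_sum_perturb_1:
  assumes "m > 0"
  shows "path_sum S (perturb h m) k $ Suc 0 = (if m \<le> k then act S h m (path_sum S h) (k - m) else 0)"
proof (induction k rule: less_induct)
  case (less k)
  show ?case
  proof (cases "k > 0 \<and> k \<in> S")
    case False
    then show ?thesis using assms
      by (cases "k = 0") (auto simp: path_sum_pos act_rec[of _ _ _ _ "k - m"])
  next
    case True
    have "path_sum S (perturb h m) k $ Suc 0 =
      (\<Sum>i<k. path_sum S h i * (if k - i = m then 1 else 0)
        + (if m \<le> i then act S h m (path_sum S h) (i - m) else 0) * h (k - i))"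
      using True by (simp add: path_sum_pos fps_sum_nth fps_mult_nth_Suc_0 path_sum_perturb_0 less)
    also have "\<dots> = (\<Sum>i<k. path_sum S h i * (if k - i = m then 1 else 0))
        + (\<Sum>i<k. (if m \<le> i then act S h m (path_sum S h) (i - m) else 0) * h (k - i))"
      by (simp add: sum.distrib)
    also have "(\<Sum>i<k. path_sum S h i * (if k - i = m then 1 else 0)) =
       (\<Sum>i<k. if i = k - m \<and> m \<le> k then path_sum S h i else 0)"
      using assms by (intro sum.cong) auto
    also have "\<dots> = (if m \<le> k then path_sum S h (k - m) else 0)"
      using assms True by (auto simp: sum.delta)
    also have "(\<Sum>i<k. (if m \<le> i then act S h m (path_sum S h) (i - m) else 0) * h (k - i)) =
       (\<Sum>i\<in>{m..<k}. act S h m (path_sum S h) (i - m) * h (k - i))"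
      by (intro sum.mono_neutral_cong_right) auto
    also have "\<dots> = (\<Sum>i<k - m. act S h m (path_sum S h) i * h (k - m - i))"
      by (rule sum.reindex_bij_witness[of _ "\<lambda>i. i + m" "\<lambda>i. i - m"]) (auto simp: add.commute)
    finally show ?thesis using True by (auto simp: act_rec[of _ _ _ _ "k - m"])
  qed
qed

lemma seg_perturb_0: "seg S (perturb h m) j g $ 0 = seg S h j g"
  by (simp add: seg_def path_sum_perturb_0)

lemma seg_shift: "seg {i. i + j \<in> S} h i g = seg S h (i + j) g"
  by (simp add: seg_def add.assoc)

lemma seg_perturb_1:
  assumes "m > 0"
  shows "seg S (perturb h m) j g $ Suc 0 = (if m \<le> g then act S h (j + m) (seg S h j) (g - m) else 0)"
proof (cases "j \<in> S \<and> m \<le> g")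
  case True
  have "act {i. i + j \<in> S} h m (path_sum {i. i + j \<in> S} h) (g - m) = act S h (j + m) (seg S h j) (g - m)"
    using True by (simp add: act_def seg_shift) (simp add: seg_def add_ac)
  then show ?thesis using True assms by (simp add: seg_def path_sum_perturb_1)
next
  case False
  then show ?thesis using assms by (auto simp: seg_def path_sum_perturb_1 act_def)
qed

text \<open>Multiplication by the \<open>m\<close>-th power of the variable, for coefficient sequences.\<close>

definition delay :: "nat \<Rightarrow> (nat \<Rightarrow> 'a::comm_ring_1) \<Rightarrow> nat \<Rightarrow> 'a" where
  "delay m f k = (if m \<le> k then f (k - m) else 0)"

lemma conv_delay_left: "conv (delay m f) g k = delay m (conv f g) k"
proof (cases "m \<le> k")
  case True
  have "conv (delay m f) g k = (\<Sum>i\<in>{m..k}. f (i - m) * g (k - i))"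
    unfolding conv_def delay_def by (intro sum.mono_neutral_cong_right) auto
  also have "\<dots> = (\<Sum>i\<le>k - m. f i * g (k - m - i))"
    using True by (intro sum.reindex_bij_witness[of _ "\<lambda>i. i + m" "\<lambda>i. i - m"]) (auto simp: add.commute)
  finally show ?thesis using True by (simp add: conv_def delay_def)
qed (auto simp: conv_def delay_def intro!: sum.neutral)

lemma conv_commute: "conv f g k = conv g f k"
  unfolding conv_def
  by (rule sum.reindex_bij_witness[of _ "\<lambda>i. k - i" "\<lambda>i. k - i"]) (auto simp: mult.commute)

lemma conv_delay_right: "conv f (delay m g) k = delay m (conv f g) k"
  by (metis conv_commute conv_delay_left delay_def)

lemma act_delay: "act S h m (delay l f) k = delay l (act S h (m + l) f) k"
proof (cases "l \<le> k")
  case True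
  have "act S h m (delay l f) k = (\<Sum>i\<in>{l..k}. f (i - l) * seg S h (i + m) (k - i))"
    unfolding act_def delay_def by (intro sum.mono_neutral_cong_right) auto
  also have "\<dots> = (\<Sum>i\<le>k - l. f i * seg S h (i + (m + l)) (k - l - i))"
    using True by (intro sum.reindex_bij_witness[of _ "\<lambda>i. i + l" "\<lambda>i. i - l"]) (auto simp: add_ac)
  finally show ?thesis using True by (simp add: act_def delay_def)
qed (auto simp: act_def delay_def intro!: sum.neutral)

lemma act_perturb_0: 
  assumes "\<And>i. F i $ 0 = f i"
  shows "act S (perturb h m) l F r $ 0 = act S h l f r"
  by (simp add: act_def fps_sum_nth assms seg_perturb_0)

lemma act_act: "(\<Sum>i\<le>r. f i * (if m \<le> r - i then act S h (i + l + m) (seg S h (i + l)) (r - i - m) else 0))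
   = delay m (act S h (l + m) (act S h l f)) r"
proof (cases "m \<le> r")
  case False
  then show ?thesis by (auto simp: delay_def intro!: sum.neutral)
next
  case True
  have "(\<Sum>i\<le>r. f i * (if m \<le> r - i then act S h (i + l + m) (seg S h (i + l)) (r - i - m) else 0)) =
     (\<Sum>i\<le>r - m. f i * act S h (i + l + m) (seg S h (i + l)) (r - i - m))"
    using True by (intro sum.mono_neutral_cong_right) auto
  also have "\<dots> = (\<Sum>i\<le>r - m. \<Sum>e\<le>r - m - i. f i * (seg S h (i + l) e * seg S h (e + (i + l + m)) (r - m - i - e)))"
    by (intro sum.cong refl) (simp add: act_def sum_distrib_left diff_right_commute add_ac)
  also have "\<dots> = (\<Sum>(i, e)\<in>(SIGMA i:{..r-m}. {..r - m - i}). f i * (seg S h (i + l) e * seg S h (e + (i + l + m)) (r - m - i - e)))"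
    by (simp add: sum.Sigma)
  also have "\<dots> = (\<Sum>(u, i)\<in>(SIGMA u:{..r-m}. {..u}). f i * (seg S h (i + l) (u - i) * seg S h (u + (l + m)) (r - m - u)))"
    by (rule sum.reindex_bij_witness[of _ "\<lambda>(u, i). (i, u - i)" "\<lambda>(i, e). (i + e, i)"]) (auto simp: add_ac)
  also have "\<dots> = act S h (l + m) (act S h l f) (r - m)"
    by (simp add: act_def sum.Sigma[symmetric] sum_distrib_right mult.assoc)
  finally show ?thesis using True by (simp add: delay_def)
qed

lemma act_perturb_1:
  assumes "m > 0" "\<And>i. F i $ 0 = f i" "\<And>i. F i $ Suc 0 = delay m f' i"
  shows "act S (perturb h m) l F r $ Suc 0 =
     delay m (act S h (l + m) f') r + delay m (act S h (l + m) (act S h l f)) r"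
proof -
  have "act S (perturb h m) l F r $ Suc 0 =
    (\<Sum>i\<le>r. f i * (if m \<le> r - i then act S h (i + l + m) (seg S h (i + l)) (r - i - m) else 0))
    + act S h l (delay m f') r"
    by (simp add: act_def[of S "perturb h m"] act_def[of S h l "delay m f'"] fps_sum_nth assms fps_mult_nth_Suc_0 
       seg_perturb_0 seg_perturb_1 sum.distrib)
  then show ?thesis by (simp add: act_act act_delay)
qed

definition rev_set :: "nat \<Rightarrow> nat set \<Rightarrow> nat set" where
  "rev_set n S = {i. 0 < i \<and> i < n \<and> n - i \<in> S}"

text \<open>The set form of the multiset of partitions obtained from all coarsenings.\<close>

definition path_types :: "nat \<Rightarrow> nat set \<Rightarrow> nat multiset multiset" where
  "path_types n S = image_mset mset (mset_set (paths (insert n S) n))"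

lemma path_sum_path_types:
  "path_sum (insert n S) h n = (\<Sum>t\<in>#path_types n S. \<Prod>x\<in>#t. h x)"
  by (simp add: path_sum_paths path_types_def image_mset.compositionality comp_def
      sum_unfold_sum_mset mset_map[symmetric] prod_mset_prod_list del: mset_map)

text \<open>A path with one marked step of length \<open>m\<close> consists of a path up to that step and, read backwards
  from \<open>n\<close>, a path in the reversed set; this produces the product of the two path series.\<close>

lemma path_sum_perturb_n:
  assumes S: "S \<subseteq> {0<..<n}" and m: "0 < m" "m \<le> n"
  shows "path_sum (insert n S) (perturb h m) n $ Suc 0 =
    conv (path_sum S h) (path_sum (rev_set n S) h) (n - m)"
proof -
  let ?R = "rev_set n S"
  have 1: "path_sum (insert n S) h i = path_sum S h i" if "i \<le> n - m" for i
    using that m by (intro path_sum_cong) auto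
  have 2: "seg (insert n S) h (i + m) (n - m - i) = path_sum ?R h (n - m - i)" if i: "i \<le> n - m" for i
  proof -
    define j where "j = i + m"
    define k where "k = n - j"
    have j: "j \<le> n" "0 < j" using i m by (auto simp: j_def)
    have nmi: "n - m - i = k" by (simp add: k_def j_def)
    consider "k = 0" | "k > 0" "j \<in> S" | "k > 0" "j \<notin> S" by auto
    then have "seg (insert n S) h j k = path_sum ?R h k"
    proof cases
      case 1
      then show ?thesis using j by (simp add: k_def seg_0)
    next
      case 2
      have "seg (insert n S) h j k = path_sum {i. i + j \<in> insert n S} h k"
        using 2 by (simp add: seg_def)
      also have "{i. i + j \<in> insert n S} = insert k {i. i + j \<in> S}"
        using j by (auto simp: k_def)
      also have "path_sum \<dots> h k = path_sum (insert k ?R) h k"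
      proof (rule path_sum_reverse[OF 2(1)])
        fix i assume i: "0 < i" "i < k"
        then have "n - (k - i) = i + j" using j by (auto simp: k_def)
        then show "i \<in> {i. i + j \<in> S} \<longleftrightarrow> k - i \<in> ?R"
          using i j by (auto simp: rev_set_def k_def add.commute)
      qed
      also have "insert k ?R = ?R" using 2 j by (auto simp: rev_set_def k_def)
      finally show ?thesis .
    next
      case 3
      then have "k \<notin> ?R" using j by (auto simp: rev_set_def k_def)
      then show ?thesis using 3 by (auto simp: seg_def path_sum_pos k_def)
    qed
    then show ?thesis unfolding nmi by (simp add: j_def)
  qed
  show ?thesis using m
    by (simp add: path_sum_perturb_1 act_def conv_def 1 2[simplified])
qed

text \<open>The first derivative of the path polynomial with respect to the weight \<open>h (n - k)\<close>. As it holds over every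
  commutative ring, it may be differentiated again, by putting perturbed weights in it.\<close>

theorem conv_path_sum_eq:
  fixes h :: "nat \<Rightarrow> 'a::comm_ring_1"
  assumes "S \<subseteq> {0<..<n}" "S' \<subseteq> {0<..<n}" "path_types n S = path_types n S'" "k < n"
  shows "conv (path_sum S h) (path_sum (rev_set n S) h) k = conv (path_sum S' h) (path_sum (rev_set n S') h) k"
  using path_sum_perturb_n[OF assms(1), of "n - k" h] path_sum_perturb_n[OF assms(2), of "n - k" h] assms(3,4)
  by (simp add: path_sum_path_types)

lemma conv_fps_1:
  assumes "\<And>i. F i $ 0 = f i" "\<And>i. F i $ Suc 0 = f' i" "\<And>i. G i $ 0 = g i" "\<And>i. G i $ Suc 0 = g' i"
  shows "conv F G k $ Suc 0 = conv f g' k + conv f' g k"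
  by (simp add: conv_def fps_sum_nth fps_mult_nth_Suc_0 assms sum.distrib)

lemma delay_add [simp]: "delay m f (m + k) = f k" by (simp add: delay_def)

theorem first_derivative_eq:
  fixes h :: "nat \<Rightarrow> 'a::comm_ring_1"
  assumes "S \<subseteq> {0<..<n}" "S' \<subseteq> {0<..<n}" "path_types n S = path_types n S'" "0 < m" "m + k < n"
  defines "D \<equiv> \<lambda>S. let p = path_sum S h; q = path_sum (rev_set n S) h in
      conv p (act (rev_set n S) h m q) k + conv (act S h m p) q k"
  shows "D S = D S'"
proof -
  have "D S = conv (path_sum S (perturb h m)) (path_sum (rev_set n S) (perturb h m)) (m + k) $ Suc 0" for S
    by (subst conv_fps_1[OF path_sum_perturb_0 _ path_sum_perturb_0,
          where f' = "delay m (act S h m (path_sum S h))"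
          and g' = "delay m (act (rev_set n S) h m (path_sum (rev_set n S) h))"])
       (simp_all add: path_sum_perturb_1[OF assms(4)] conv_delay_left conv_delay_right D_def Let_def delay_def)
  then show ?thesis
    using conv_path_sum_eq[OF assms(1-3,5), of "perturb h m"] by simp
qed

lemma conv_add_left: "conv (\<lambda>i. f i + f' i) g k = conv f g k + conv f' g k"
  by (simp add: conv_def distrib_right sum.distrib)

lemma conv_add_right: "conv f (\<lambda>i. g i + g' i) k = conv f g k + conv f g' k"
  by (simp add: conv_def distrib_left sum.distrib)

theorem second_derivative_eq:
  fixes h :: "nat \<Rightarrow> 'a::comm_ring_1"
  assumes "S \<subseteq> {0<..<n}" "S' \<subseteq> {0<..<n}" "path_types n S = path_types n S'" "0 < m" "0 < l" "m + l + k < n"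
  defines "D \<equiv> \<lambda>S. let R = rev_set n S; p = path_sum S h; q = path_sum R h in
      conv (act S h (m + l) (act S h m p)) q k + conv (act S h (m + l) (act S h l p)) q k
      + conv (act S h m p) (act R h l q) k + conv (act S h l p) (act R h m q) k
      + conv p (act R h (m + l) (act R h m q)) k + conv p (act R h (m + l) (act R h l q)) k"
  shows "D S = D S'"
proof -
  let ?h = "perturb h l"
  have act1: "act T ?h m (path_sum T ?h) r $ Suc 0 = delay l (\<lambda>r. act T h (m + l) (act T h l (path_sum T h)) r
       + act T h (m + l) (act T h m (path_sum T h)) r) r" for T r
    by (subst act_perturb_1[OF assms(5) path_sum_perturb_0, where f' = "act T h l (path_sum T h)"])
       (simp_all add: path_sum_perturb_1[OF assms(5)] delay_def)
  have ps1: "path_sum T ?h k $ Suc 0 = delay l (act T h l (path_sum T h)) k" for T k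
    by (simp add: path_sum_perturb_1[OF assms(5)] delay_def)
  have act0: "act T ?h m (path_sum T ?h) r $ 0 = act T h m (path_sum T h) r" for T r
    by (rule act_perturb_0) (rule path_sum_perturb_0)
  have DS: "D S = (conv (path_sum S ?h) (act (rev_set n S) ?h m (path_sum (rev_set n S) ?h)) (l + k)
     + conv (act S ?h m (path_sum S ?h)) (path_sum (rev_set n S) ?h) (l + k)) $ Suc 0" for S
    unfolding fps_add_nth
    unfolding conv_fps_1[OF path_sum_perturb_0 ps1 act0 act1] conv_fps_1[OF act0 act1 path_sum_perturb_0 ps1]
    by (simp add: conv_delay_left conv_delay_right conv_add_left conv_add_right D_def Let_def)
  have "(conv (path_sum S ?h) (act (rev_set n S) ?h m (path_sum (rev_set n S) ?h)) (l + k)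
     + conv (act S ?h m (path_sum S ?h)) (path_sum (rev_set n S) ?h) (l + k)) =
     (conv (path_sum S' ?h) (act (rev_set n S') ?h m (path_sum (rev_set n S') ?h)) (l + k)
     + conv (act S' ?h m (path_sum S' ?h)) (path_sum (rev_set n S') ?h) (l + k))"
    using first_derivative_eq[OF assms(1-4), of "l + k" ?h] assms(6) by (simp add: Let_def add_ac)
  then show ?thesis unfolding DS by (rule arg_cong)
qed

section \<open>Two interacting sets of integers\<close>

text \<open>For a set closed under negation this is the subgroup generated by it.\<close>

inductive_set span_of :: "int set \<Rightarrow> int set" for X where
  zero: "0 \<in> span_of X"
| add: "h \<in> span_of X \<Longrightarrow> x \<in> X \<Longrightarrow> h + x \<in> span_of X"

lemma span_of_superset: "x \<in> X \<Longrightarrow> x \<in> span_of X"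
  using span_of.add[OF span_of.zero] by simp

lemma span_of_add: "g \<in> span_of X \<Longrightarrow> h \<in> span_of X \<Longrightarrow> h + g \<in> span_of X"
  by (induction rule: span_of.induct) (auto simp: add.assoc[symmetric] intro: span_of.add)

lemma span_of_minus:
  assumes "\<And>x. x \<in> X \<Longrightarrow> - x \<in> X" "h \<in> span_of X"
  shows "- h \<in> span_of X"
  using assms(2)
  by (induction rule: span_of.induct) (auto intro: span_of.intros assms(1) simp: minus_add_distrib simp del: minus_add_distrib[symmetric] dest: span_of.add[OF _ assms(1)])

text \<open>\<open>A\<close> and \<open>B\<close> will be the sets where two compatible antisymmetric sign functions agree and where they
  are opposite. The rule \<open>mix\<close> is what the derivative identities give at weight 0.\<close>

locale two_colors =
  fixes A B :: "int set" and d :: "int \<Rightarrow> int" and n :: int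
  assumes n_pos: "n > 0"
    and perA: "i \<in> A \<Longrightarrow> i + n \<in> A" and perB: "i \<in> B \<Longrightarrow> i + n \<in> B"
    and negA: "i \<in> A \<Longrightarrow> - i \<in> A" and negB: "i \<in> B \<Longrightarrow> - i \<in> B"
    and d_minus: "d (- i) = - d i"
    and d_values: "i \<in> A \<union> B \<Longrightarrow> d i = 1 \<or> d i = -1"
    and disj: "A \<inter> B = {}"
    and mix: "a \<in> A \<Longrightarrow> b \<in> B \<Longrightarrow>
      a + b \<in> A \<and> d (a + b) = d a \<or> a + b \<in> B \<and> d (a + b) = d b"
begin

lemma swap: "two_colors B A d n"
proof
  show "a \<in> B \<Longrightarrow> b \<in> A \<Longrightarrow> a + b \<in> B \<and> d (a + b) = d a \<or> a + b \<in> A \<and> d (a + b) = d b" for a b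
    using mix[of b a] by (auto simp: add.commute)
  show "i \<in> B \<union> A \<Longrightarrow> d i = 1 \<or> d i = -1" for i
    using d_values[of i] by blast
qed (use n_pos perA perB negA negB d_minus d_values disj in auto)

lemma zero_notin: "0 \<notin> A" "0 \<notin> B"
  using d_values[of 0] d_minus[of 0] by auto

lemma not_both: "i \<in> A \<Longrightarrow> i \<in> B \<Longrightarrow> False"
  using disj by auto

lemma negA_iff: "- i \<in> A \<longleftrightarrow> i \<in> A" using negA[of i] negA[of "- i"] by auto

lemma perA_iff: "i + n \<in> A \<longleftrightarrow> i \<in> A"
  using perA[of i] perA[of "- (i + n)"] negA_iff[of i] negA_iff[of "i + n"] by auto

lemma perA_mult: "i + n * k \<in> A \<longleftrightarrow> i \<in> A"
proof -
  have nat: "i + n * int k \<in> A \<longleftrightarrow> i \<in> A" for i k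
  proof (induction k)
    case (Suc k)
    have "i + n * int (Suc k) = (i + n * int k) + n" by (simp add: algebra_simps)
    then show ?case using perA_iff[of "i + n * int k"] Suc by (simp only:)
  qed simp
  show ?thesis
  proof (cases "k \<ge> 0")
    case True
    then show ?thesis using nat[of i "nat k"] by simp
  next
    case False
    then show ?thesis using nat[of "i + n * k" "nat (- k)"] by simp
  qed
qed

text \<open>Adding \<open>- a\<close> to \<open>a + a'\<close> gives \<open>a'\<close>, so by \<open>mix\<close> the signs of \<open>a'\<close> and \<open>- a\<close> are equal.\<close>

lemma sum_in_other:
  assumes "a \<in> A" "a' \<in> A" "a + a' \<in> B"
  shows "d a' = - d a"
  using mix[OF negA[OF assms(1)] assms(3)] assms(2) not_both by (auto simp: d_minus)

text \<open>Under these hypotheses all multiples \<open>k * a\<close> with \<open>k \<ge> 1\<close> stay in \<open>A\<close> with sign 1,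
  together with \<open>k * a - b\<close>. The multiple \<open>n * a\<close> is congruent to 0, which is not in \<open>A\<close>.\<close>

lemma no_bad_pair:
  assumes "a \<in> A" "b \<in> B" "d a = 1" "d b = 1" "a - b \<in> A" "a + b \<in> B"
  shows False
proof -
  have dab: "d (a - b) = 1" "d (a + b) = 1"
    using mix[OF assms(1) negB[OF assms(2)]] mix[OF assms(1,2)] assms not_both by auto
  have "int k * a \<in> A \<and> d (int k * a) = 1 \<and> int k * a - b \<in> A \<and> d (int k * a - b) = 1" if "k \<ge> 1" for k
    using that
  proof (induction k rule: dec_induct)
    case base
    then show ?case using assms dab by simp
  next
    case (step k)
    let ?u = "int k * a"
    have e: "int (Suc k) * a = ?u + a" by (simp add: algebra_simps)
    have u: "?u \<in> A" "d ?u = 1" "?u - b \<in> A" "d (?u - b) = 1" using step by auto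
    have "(?u + a \<in> A \<or> ?u + a \<in> B) \<and> d (?u + a) = 1"
      using mix[OF u(3) assms(6)] u dab by auto
    moreover have "?u + a \<notin> B" using sum_in_other[OF u(1) assms(1)] u assms by auto
    ultimately have v: "?u + a \<in> A" "d (?u + a) = 1" by auto
    have "?u + a - b \<notin> B"
    proof
      assume B: "?u + a - b \<in> B"
      have "b - a \<in> A" "d (b - a) = - 1" using negA[OF assms(5)] d_minus[of "a - b"] dab by auto
      from mix[OF this(1) B] this(2) u show False using not_both[of ?u] by auto
    qed
    then have "?u + a - b \<in> A" "d (?u + a - b) = 1" using mix[OF v(1) negB[OF assms(2)]] v by auto
    then show ?case using v unfolding e by blast
  qed
  from this[of "nat n"] have "n * a \<in> A" using n_pos by auto
  then show False using perA_mult[of 0 a] zero_notin by simp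
qed

text \<open>The other signs reduce to the previous lemma by negation and by exchanging \<open>A\<close> and \<open>B\<close>.\<close>

lemma no_bad_pair':
  assumes ab: "a \<in> A" "b \<in> B" and "a - b \<in> A" "a + b \<in> B"
  shows False
proof -
  interpret s: two_colors B A d n by (rule swap)
  have a: "- a \<in> A" "- a + b \<in> A" "- a - b \<in> B" "b + a \<in> B" "- b \<in> B"
    using negA[OF ab(1)] negA[OF assms(3)] negB[OF assms(4)] assms(4) negB[OF ab(2)] by (auto simp: add.commute)
  have e: "- b - a = - a - b" "b - - a = a + b" "b + - a = - a + b" by simp_all
  have b: "- b - a \<in> B" "b - - a \<in> B" "b + - a \<in> A" unfolding e by (fact a assms)+
  consider "d a = 1" "d b = 1" | "d a = 1" "d b = -1" | "d a = -1" "d b = 1" | "d a = -1" "d b = -1"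
    using d_values[of a] d_values[of b] ab by auto
  then show False
  proof cases
    case 1
    then show False using no_bad_pair assms by blast
  next
    case 2
    then show False using s.no_bad_pair[of "- b" a] a b assms by (simp add: d_minus add.commute)
  next
    case 3
    then show False using s.no_bad_pair[of b "- a"] a b assms by (simp add: d_minus)
  next
    case 4
    then show False using no_bad_pair[of "- a" "- b"] a assms by (simp add: d_minus)
  qed
qed

lemma plus_minus: "a \<in> A \<Longrightarrow> b \<in> B \<Longrightarrow> a - b \<in> A \<longleftrightarrow> a + b \<in> A"
  using no_bad_pair'[of a b] no_bad_pair'[of a "- b"] mix[of a b] mix[of a "- b"] negB[of b] not_both by auto

text \<open>The translations from \<open>B\<close> that keep \<open>a\<close> inside \<open>A\<close>. By \<open>Lo_span\<close> below, the whole coset of \<open>a\<close>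
  modulo their span stays in \<open>A\<close>.\<close>

definition Lo :: "int \<Rightarrow> int set" where "Lo a = {b \<in> B. a + b \<in> A}"

lemma Lo_minus: "a \<in> A \<Longrightarrow> b \<in> Lo a \<Longrightarrow> - b \<in> Lo a"
  using plus_minus[of a b] negB by (auto simp: Lo_def)

lemma mixB: "a \<in> A \<Longrightarrow> b \<in> B \<Longrightarrow> a + b \<notin> A \<Longrightarrow> a + b \<in> B \<and> d (a + b) = d b"
  using mix by blast

text \<open>If \<open>a + b + b'\<close> were outside \<open>A\<close>, the two ways of reaching it would force the signs of \<open>b\<close> and \<open>b'\<close>
  to be equal, whereas the two ways of reaching \<open>a + b - b'\<close> would force them to be opposite.\<close>

lemma Lo_trans:
  assumes a: "a \<in> A" and b: "b \<in> Lo a" and b': "b' \<in> Lo a"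
  shows "b' \<in> Lo (a + b)"
proof (rule ccontr)
  assume "b' \<notin> Lo (a + b)"
  have B: "b \<in> B" "b' \<in> B" "a + b \<in> A" "a + b' \<in> A" "a - b' \<in> A"
    using b b' plus_minus[OF a, of b'] by (auto simp: Lo_def)
  then have n: "a + b + b' \<notin> A" using \<open>b' \<notin> Lo (a + b)\<close> by (auto simp: Lo_def)
  then have "a + b - b' \<notin> A" using plus_minus[OF B(3,2)] by simp
  then have "d (a + b - b') = - d b'" using mixB[OF B(3) negB[OF B(2)]] by (simp add: d_minus)
  moreover have "d (a + b - b') = d b" using mixB[OF B(5,1)] \<open>a + b - b' \<notin> A\<close> by (simp add: algebra_simps)
  moreover have "d (a + b + b') = d b'" using mixB[OF B(3,2)] n by simp
  moreover have "d (a + b + b') = d b" using mixB[OF B(4,1)] n by (simp add: algebra_simps)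
  ultimately show False using d_values[of b] B by auto
qed

lemma Lo_shift:
  assumes "a \<in> A" "b \<in> Lo a"
  shows "a + b \<in> A" "Lo (a + b) = Lo a"
proof -
  show A: "a + b \<in> A" using assms by (simp add: Lo_def)
  show "Lo (a + b) = Lo a"
  proof
    show "Lo a \<subseteq> Lo (a + b)" using Lo_trans[OF assms] by auto
    have "- b \<in> Lo (a + b)" using Lo_trans[OF assms Lo_minus[OF assms]] .
    then show "Lo (a + b) \<subseteq> Lo a" using Lo_trans[OF A \<open>- b \<in> Lo (a + b)\<close>] by auto
  qed
qed

lemma Lo_span:
  assumes "a \<in> A" "h \<in> span_of (Lo a)"
  shows "a + h \<in> A \<and> Lo (a + h) = Lo a"
  using assms(2)
proof (induction rule: span_of.induct)
  case (add h x)
  then show ?case using Lo_shift[of "a + h" x] by (simp add: add.assoc)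
qed (use assms in simp)

end

context two_colors
begin

interpretation s: two_colors B A d n by (rule swap)

text \<open>Otherwise \<open>a + c \<plusminus> b\<close> would lie in \<open>A\<close>, and \<open>sum_in_other\<close> applied to \<open>c\<close> and \<open>a \<plusminus> b\<close> would give
  \<open>a + b\<close> and \<open>a - b\<close> the same sign, although \<open>mix\<close> gives them opposite signs.\<close>

lemma chain3:
  assumes "a \<in> A" "b \<in> B" "c \<in> B" and ca: "a + c \<in> A" and ab: "a + b \<in> B"
  shows "a + c + b \<in> B"
proof (rule ccontr)
  assume nB: "a + c + b \<notin> B"
  then have w: "a + c + b \<in> A" using mix[OF ca assms(2)] by auto
  have w': "a + c - b \<in> A" using plus_minus[OF ca assms(2)] w by simp
  have 1: "b + a \<in> B" "d (b + a) = d b" using mix[OF assms(1,2)] ab not_both by (auto simp: add.commute)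
  have nA: "a - b \<notin> A" using plus_minus[OF assms(1,2)] ab not_both by auto
  have 2: "a - b \<in> B" "d (a - b) = - d b" using mixB[OF assms(1) negB[OF assms(2)]] nA by (auto simp: d_minus)
  have "d (b + a) = - d c" using s.sum_in_other[OF assms(3) 1(1)] w by (simp add: algebra_simps)
  moreover have "d (a - b) = - d c" using s.sum_in_other[OF assms(3) 2(1)] w' by (simp add: algebra_simps)
  ultimately show False using 1 2 d_values[of b] assms by auto
qed

lemma chain3_span:
  assumes "a \<in> A" "b \<in> B" "c \<in> B" and ca: "a + c \<in> A" and ab: "a + b \<in> B"
  shows "c \<in> span_of (s.Lo b)"
proof -
  have a: "a \<in> s.Lo b" using assms by (simp add: s.Lo_def add.commute)
  have "a + c \<in> s.Lo b" using chain3[OF assms] ca by (simp add: s.Lo_def add_ac)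
  then show ?thesis using span_of.add[OF span_of_superset[OF s.Lo_minus[OF assms(2) a]]] by fastforce
qed

text \<open>If the sets were incomparable, \<open>chain3_span\<close> would place \<open>b'\<close> in the span of \<open>s.Lo b\<close> and \<open>b\<close> in that of
  \<open>s.Lo b'\<close>, and by \<open>Lo_span\<close> both sets would be equal to \<open>s.Lo (b + b')\<close>.\<close>

lemma Lo_nested:
  assumes "b \<in> B" "b' \<in> B"
  shows "s.Lo b \<subseteq> s.Lo b' \<or> s.Lo b' \<subseteq> s.Lo b"
proof (rule ccontr)
  assume "\<not> ?thesis"
  then obtain a a' where a: "a \<in> s.Lo b" "a \<notin> s.Lo b'" "a' \<in> s.Lo b'" "a' \<notin> s.Lo b" by auto
  then have A: "a \<in> A" "a' \<in> A" "a + b \<in> B" "a' + b' \<in> B" by (auto simp: s.Lo_def add.commute)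
  have A': "a + b' \<in> A" "a' + b \<in> A"
    using a A s.mixB[OF assms(2) A(1)] s.mixB[OF assms(1) A(2)] by (auto simp: s.Lo_def add.commute)
  have "b' \<in> span_of (s.Lo b)" by (rule chain3_span[of a]) (use A A' assms in auto)
  moreover have "b \<in> span_of (s.Lo b')" by (rule chain3_span[of a']) (use A A' assms in auto)
  ultimately have "s.Lo b = s.Lo b'"
    using s.Lo_span[OF assms(1), of b'] s.Lo_span[OF assms(2), of b] by (simp add: add.commute)
  then show False using a by auto
qed

text \<open>Suppose each set lies in the span of the other. The finitely many sets \<open>s.Lo b\<close> are nested; let \<open>b\<close>
  give the largest. Every \<open>a \<in> A\<close> lies in some \<open>s.Lo c\<close>, since otherwise \<open>a\<close> could be translated by all of
  the span of \<open>B\<close>, thus to \<open>a - a = 0\<close>. Hence \<open>s.Lo b = A\<close>, and \<open>b\<close> can be translated by \<open>- b\<close>, again to 0.\<close>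

theorem span_separates:
  assumes "A \<noteq> {}" "B \<noteq> {}"
  shows "(\<exists>a\<in>A. a \<notin> span_of B) \<or> (\<exists>b\<in>B. b \<notin> span_of A)"
proof (rule ccontr)
  assume neg: "\<not> ?thesis"
  have red: "s.Lo b \<in> s.Lo ` (B \<inter> {0..<n})" if "b \<in> B" for b
  proof -
    have e: "b mod n = b + n * (- (b div n))" by (simp add: minus_div_mult_eq_mod[symmetric] algebra_simps)
    have "s.Lo (b mod n) = s.Lo b"
      unfolding s.Lo_def e using s.perA_mult[of "b + _" "- (b div n)"] by (simp add: algebra_simps)
    moreover have "b mod n \<in> B" unfolding e using s.perA_mult[of b] that by blast
    ultimately show ?thesis using n_pos by (intro image_eqI[of _ _ "b mod n"]) auto
  qed
  have "finite (s.Lo ` (B \<inter> {0..<n}))" by simp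
  moreover have "s.Lo ` (B \<inter> {0..<n}) \<noteq> {}" using assms(2) red by blast
  ultimately obtain M where "M \<in> s.Lo ` (B \<inter> {0..<n})" and max: "\<And>N. N \<in> s.Lo ` (B \<inter> {0..<n}) \<Longrightarrow> M \<subseteq> N \<Longrightarrow> M = N"
    using finite_has_maximal by metis
  then obtain b where b: "b \<in> B" "M = s.Lo b" by auto
  have top: "s.Lo c \<subseteq> s.Lo b" if "c \<in> B" for c
  proof -
    have "s.Lo b \<subseteq> s.Lo c \<Longrightarrow> s.Lo b = s.Lo c" using max[OF red[OF that]] b(2) by simp
    then show ?thesis using Lo_nested[OF that b(1)] by (elim disjE) simp_all
  qed
  have "\<exists>c\<in>B. a \<in> s.Lo c" if "a \<in> A" for a
  proof (rule ccontr)
    assume "\<not> ?thesis"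
    then have "Lo a = B" using mixB[OF that] that by (auto simp: Lo_def s.Lo_def add.commute)
    moreover have "- a \<in> span_of B" using neg that span_of_minus[OF negB] by auto
    ultimately show False using Lo_span[OF that, of "- a"] zero_notin by simp
  qed
  then have "s.Lo b = A" using top by (fastforce simp: s.Lo_def)
  moreover have "- b \<in> span_of A" using neg b span_of_minus[OF negA] by auto
  ultimately show False using s.Lo_span[OF b(1), of "- b"] zero_notin by simp
qed

end

section \<open>Comparison of lowest order terms\<close>

definition supported :: "nat \<Rightarrow> (nat \<Rightarrow> 'a::zero) \<Rightarrow> bool" where
  "supported s f \<longleftrightarrow> (\<forall>i. \<not> s dvd i \<longrightarrow> f i = 0)"

lemma supportedD: "supported s f \<Longrightarrow> \<not> s dvd i \<Longrightarrow> f i = 0"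
  by (simp add: supported_def)

lemma supported_path_sum:
  fixes h :: "nat \<Rightarrow> 'a::comm_ring_1"
  assumes "supported s h"
  shows "supported s (path_sum S h)"
proof -
  have "path_sum S h k = 0" if "\<not> s dvd k" for k
    using that
  proof (induction k rule: less_induct)
    case (less k)
    have "path_sum S h i * h (k - i) = 0" if "i < k" for i
    proof (cases "s dvd i")
      case True
      then have "\<not> s dvd (k - i)" using less.prems that by (metis dvd_diffD less_imp_le)
      then show ?thesis using assms by (simp add: supportedD)
    qed (simp add: less that)
    then show ?case using less.prems by (cases "k = 0") (simp_all add: path_sum_pos)
  qed
  then show ?thesis by (simp add: supported_def)
qed

lemma path_sum_cong_supported:
  fixes h :: "nat \<Rightarrow> 'a::comm_ring_1"
  assumes h: "supported s h" and "\<And>i. 0 < i \<Longrightarrow> i \<le> k \<Longrightarrow> s dvd i \<Longrightarrow> i \<in> S \<longleftrightarrow> i \<in> T"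
  shows "path_sum S h k = path_sum T h k"
  using assms(2)
proof (induction k rule: less_induct)
  case (less k)
  show ?case
  proof (cases "k = 0 \<or> \<not> s dvd k")
    case True
    then show ?thesis using supported_path_sum[OF h] by (auto simp: supported_def)
  next
    case False
    then show ?thesis using less by (auto simp: path_sum_pos intro!: sum.cong)
  qed
qed

lemma seg_cong_supported:
  fixes h :: "nat \<Rightarrow> 'a::comm_ring_1"
  assumes "supported s h" "\<And>e. e \<le> g \<Longrightarrow> s dvd e \<Longrightarrow> j + e \<in> S \<longleftrightarrow> j' + e \<in> T"
  shows "seg S h j g = seg T h j' g"
proof -
  have "j \<in> S \<longleftrightarrow> j' \<in> T" using assms(2)[of 0] by simp
  moreover have "path_sum {i. i + j \<in> S} h g = path_sum {i. i + j' \<in> T} h g"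
    by (rule path_sum_cong_supported[OF assms(1)]) (use assms(2) in \<open>simp add: add.commute\<close>)
  ultimately show ?thesis by (simp add: seg_def)
qed

lemma act_cong_supported:
  fixes h :: "nat \<Rightarrow> 'a::comm_ring_1"
  assumes "supported s h" "supported s f"
    "\<And>i. i \<le> r \<Longrightarrow> s dvd i \<Longrightarrow> m + i \<in> S \<longleftrightarrow> m' + i \<in> T"
  shows "act S h m f r = act T h m' f r"
  unfolding act_def
proof (rule sum.cong)
  fix i assume i: "i \<in> {..r}"
  show "f i * seg S h (i + m) (r - i) = f i * seg T h (i + m') (r - i)"
  proof (cases "s dvd i")
    case True
    have "seg S h (i + m) (r - i) = seg T h (i + m') (r - i)"
    proof (rule seg_cong_supported[OF assms(1)])
      fix e assume "e \<le> r - i" "s dvd e"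
      then show "i + m + e \<in> S \<longleftrightarrow> i + m' + e \<in> T"
        using assms(3)[of "i + e"] i True by (simp add: add_ac)
    qed
    then show ?thesis by simp
  qed (simp add: supportedD[OF assms(2)])
qed simp

lemma supported_act:
  fixes h :: "nat \<Rightarrow> 'a::comm_ring_1"
  assumes "supported s h" "supported s f"
  shows "supported s (act S h m f)"
proof -
  have "act S h m f r = 0" if "\<not> s dvd r" for r
    unfolding act_def
  proof (rule sum.neutral, rule ballI)
    fix i assume i: "i \<in> {..r}"
    show "f i * seg S h (i + m) (r - i) = 0"
    proof (cases "s dvd i")
      case True
      then have "\<not> s dvd (r - i)" using that i by (metis atMost_iff dvd_diffD)
      then show ?thesis by (simp add: seg_def supportedD[OF supported_path_sum[OF assms(1)]])
    qed (simp add: supportedD[OF assms(2)])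
  qed
  then show ?thesis by (simp add: supported_def)
qed

text \<open>Path sums as power series over the reals. A field is needed to form the quotient of two such
  series, and real coefficients allow differentiation in the weights.\<close>

definition pf :: "nat set \<Rightarrow> (nat \<Rightarrow> real) \<Rightarrow> real fps" where
  "pf S h = Abs_fps (path_sum S h)"

definition actf :: "nat set \<Rightarrow> (nat \<Rightarrow> real) \<Rightarrow> nat \<Rightarrow> real fps \<Rightarrow> real fps" where
  "actf S h m f = Abs_fps (act S h m (fps_nth f))"

lemma pf_nth [simp]: "pf S h $ k = path_sum S h k" by (simp add: pf_def)
lemma actf_nth [simp]: "actf S h m f $ k = act S h m (fps_nth f) k" by (simp add: actf_def)

lemma fps_nth_pf [simp]: "fps_nth (pf S h) = path_sum S h" by (rule ext) simp
lemma fps_nth_actf [simp]: "fps_nth (actf S h m f) = act S h m (fps_nth f)" by (rule ext) simp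

lemma conv_fps: "conv (fps_nth f) (fps_nth g) k = (f * g) $ k"
  by (simp add: conv_def fps_mult_nth atMost_atLeast0)

text \<open>Multiplying the first part of a path by a series moves the starting point of its second part.\<close>

lemma act_mult:
  fixes h :: "nat \<Rightarrow> real"
  shows "act S h m (fps_nth (T * Q)) r = (\<Sum>l\<le>r. T $ l * act S h (m + l) (fps_nth Q) (r - l))"
proof -
  have "act S h m (fps_nth (T * Q)) r = (\<Sum>i\<le>r. \<Sum>l\<le>i. T $ l * (Q $ (i - l) * seg S h (i + m) (r - i)))"
    by (simp add: act_def fps_mult_nth atMost_atLeast0 sum_distrib_right mult.assoc)
  also have "\<dots> = (\<Sum>(i, l)\<in>(SIGMA i:{..r}. {..i}). T $ l * (Q $ (i - l) * seg S h (i + m) (r - i)))"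
    by (simp add: sum.Sigma)
  also have "\<dots> = (\<Sum>(l, i)\<in>(SIGMA l:{..r}. {..r - l}). T $ l * (Q $ i * seg S h (i + (m + l)) (r - l - i)))"
    by (rule sum.reindex_bij_witness[of _ "\<lambda>(l, i). (i + l, l)" "\<lambda>(i, l). (l, i - l)"]) (auto simp: add_ac)
  also have "\<dots> = (\<Sum>l\<le>r. T $ l * act S h (m + l) (fps_nth Q) (r - l))"
    by (simp add: act_def sum.Sigma[symmetric] sum_distrib_left)
  finally show ?thesis .
qed

text \<open>Continuing a path after a marked step commutes with multiplication by a series \<open>T\<close> as long as \<open>W\<close>, seen
  from \<open>m\<close> on, has as periods the exponents occurring in \<open>T\<close>. The first failure is recorded by a single
  coefficient.\<close>

lemma row_defect:
  fixes h :: "nat \<Rightarrow> real" and T Q :: "real fps"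
  assumes h: "supported s h" "supported s (fps_nth Q)" and "Q $ 0 = 1" and k: "k > 0" "r \<le> k"
    and per: "\<And>l e. 0 < l \<Longrightarrow> l < k \<Longrightarrow> T $ l \<noteq> 0 \<Longrightarrow> s dvd e \<Longrightarrow> l + e \<le> k \<Longrightarrow> m + l + e \<in> W \<longleftrightarrow> m + e \<in> W"
  shows "(actf W h m (T * Q) - T * actf W h m Q) $ r =
    (if r = k then T $ k * (of_bool (m + k \<in> W) - of_bool (m \<in> W)) else 0)"
proof -
  have "(actf W h m (T * Q) - T * actf W h m Q) $ r =
     (\<Sum>l\<le>r. T $ l * (act W h (m + l) (fps_nth Q) (r - l) - act W h m (fps_nth Q) (r - l)))"
    unfolding fps_sub_nth actf_nth act_mult fps_mult_nth atMost_atLeast0[symmetric]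
    by (simp add: sum_subtractf[symmetric] right_diff_distrib)
  also have "\<dots> = (\<Sum>l\<le>r. if l = k then T $ k * (of_bool (m + k \<in> W) - of_bool (m \<in> W)) else 0)"
  proof (rule sum.cong)
    fix l assume l: "l \<in> {..r}"
    show "T $ l * (act W h (m + l) (fps_nth Q) (r - l) - act W h m (fps_nth Q) (r - l)) =
      (if l = k then T $ k * (of_bool (m + k \<in> W) - of_bool (m \<in> W)) else 0)"
    proof (cases "l = k")
      case True
      then show ?thesis using l k assms(3) by (simp add: act_def seg_0)
    next
      case False
      have "act W h (m + l) (fps_nth Q) (r - l) = act W h m (fps_nth Q) (r - l)" if "T $ l \<noteq> 0" "l > 0"
        by (rule act_cong_supported[OF h]) (use per[OF that(2) _ that(1)] l k False in auto)
      then show ?thesis using False by (cases "l = 0"; cases "T $ l = 0") auto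
    qed
  qed simp
  finally show ?thesis using k by auto
qed

lemma fps_low_order:
  fixes f :: "real fps"
  assumes "\<And>r. r < m \<Longrightarrow> f $ r = 0"
  obtains u where "f = fps_X ^ m * u" "u $ 0 = f $ m"
proof
  show "f = fps_X ^ m * fps_shift m f"
    by (rule fps_ext) (auto simp: fps_X_power_mult_nth assms)
  show "fps_shift m f $ 0 = f $ m" by simp
qed

lemma fps_cong_order:
  fixes f g :: "real fps"
  assumes "\<And>r. r \<le> k \<Longrightarrow> f $ r = g $ r"
  obtains u where "f = g + fps_X ^ k * (fps_X * u)"
  using fps_low_order[of "Suc k" "f - g"] assms
  by (metis diff_add_cancel add.commute eq_iff_diff_eq_0 fps_sub_nth less_Suc_eq_le mult.assoc power_Suc2)

text \<open>The identities satisfied by the derivatives are here separated from their origin. Primed and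
  unprimed series belong to the two sets; \<open>P\<close> and \<open>Q\<close> are continued path series of the set and of
  its reversal, for two step lengths \<open>z\<close> and \<open>t\<close>, and \<open>c\<close> is a full block. Below degree \<open>k\<close> the primed series
  are \<open>th * q\<close>, \<open>p / th\<close>, \<open>th * Q\<close> and \<open>P / th\<close>. A deviation \<open>\<zeta>\<close> of \<open>Qz'\<close> in degree \<open>k\<close> forces by \<open>D1z\<close> the
  deviation \<open>- \<zeta>\<close> of \<open>Pz'\<close>, and likewise for \<open>\<tau>\<close> and \<open>t\<close>; then \<open>D2\<close> relates \<open>\<zeta>\<close> and \<open>\<tau>\<close>.\<close>

lemma lowest_terms:
  fixes p q p' q' c u v th Pz Pz' Qz Qz' Pt Pt' Qt Qt' dz dt :: "real fps"
  assumes one: "p $ 0 = 1" "q $ 0 = 1" "c $ 0 = 1" "th $ 0 = 1"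
    and k: "k > 0"
    and q': "q' = th * q"
    and pq: "\<And>r. r \<le> k \<Longrightarrow> (p' * q') $ r = (p * q) $ r"
    and D1z: "\<And>r. r \<le> k \<Longrightarrow> (p' * Qz' + Pz' * q') $ r = (p * Qz + Pz * q) $ r"
    and D1t: "\<And>r. r \<le> k \<Longrightarrow> (p' * Qt' + Pt' * q') $ r = (p * Qt + Pt * q) $ r"
    and D2: "\<And>r. r \<le> k \<Longrightarrow> (c * (u * p' * (Qz' + Qt') + v * q' * (Pz' + Pt')) + Pz' * Qt' + Pt' * Qz') $ r =
        (c * (u * p * (Qz + Qt) + v * q * (Pz + Pt)) + Pz * Qt + Pt * Qz) $ r"
    and dz: "\<And>r. r < k \<Longrightarrow> (Qz' - th * Qz) $ r = 0"
    and dt: "\<And>r. r < k \<Longrightarrow> (Qt' - th * Qt) $ r = 0"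
  defines "\<zeta> \<equiv> (Qz' - th * Qz) $ k" and "\<tau> \<equiv> (Qt' - th * Qt) $ k"
  shows "\<zeta> * (u $ 0 - v $ 0 + Pt $ 0 - Qt $ 0) + \<tau> * (u $ 0 - v $ 0 + Pz $ 0 - Qz $ 0) = 0"
proof -
  \<comment> \<open>Congruences modulo terms of degree greater than \<open>k\<close> become equations with an explicit
      multiple of \<open>Y * fps_X\<close>, so that they can be combined as polynomial identities.\<close>
  define Y where "Y = (fps_X :: real fps) ^ k"
  have Y0: "Y $ 0 = 0" "Y \<noteq> 0" using k by (auto simp: Y_def)
  obtain u0 where u0: "p' * q' = p * q + Y * (fps_X * u0)" using fps_cong_order[OF pq] unfolding Y_def by blast
  obtain u2 where u2: "p' * Qz' + Pz' * q' = p * Qz + Pz * q + Y * (fps_X * u2)" using fps_cong_order[OF D1z] unfolding Y_def by blast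
  obtain u3 where u3: "p' * Qt' + Pt' * q' = p * Qt + Pt * q + Y * (fps_X * u3)" using fps_cong_order[OF D1t] unfolding Y_def by blast
  obtain u4 where u4: "c * (u * p' * (Qz' + Qt') + v * q' * (Pz' + Pt')) + Pz' * Qt' + Pt' * Qz' =
        c * (u * p * (Qz + Qt) + v * q * (Pz + Pt)) + Pz * Qt + Pt * Qz + Y * (fps_X * u4)" using fps_cong_order[OF D2] unfolding Y_def by blast
  obtain vz where vz: "Qz' = th * Qz + Y * vz" "vz $ 0 = \<zeta>"
    using fps_low_order[OF dz] unfolding Y_def \<zeta>_def by (metis add.commute diff_add_cancel)
  obtain vt where vt: "Qt' = th * Qt + Y * vt" "vt $ 0 = \<tau>"
    using fps_low_order[OF dt] unfolding Y_def \<tau>_def by (metis add.commute diff_add_cancel)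
  define iq where "iq = inverse q"
  have iq: "q * iq = 1" using one(2) by (simp add: iq_def inverse_mult_eq_1')
  define it where "it = inverse th"
  have it: "th * it = 1" using one(4) by (simp add: it_def inverse_mult_eq_1')
  have iq0: "iq $ 0 = 1" "it $ 0 = 1" using one by (auto simp: iq_def it_def)
  define u1 where "u1 = u0 * iq"
  have u1: "th * p' = p + Y * (fps_X * u1)"
    using u0 iq unfolding u1_def q' by algebra
  define ez where "ez = it * iq * (th * (fps_X * u2) - p * vz - fps_X * u1 * Qz')"
  define et where "et = it * iq * (th * (fps_X * u3) - p * vt - fps_X * u1 * Qt')"
  have ez: "th * Pz' = Pz + Y * ez"
  proof -
    have "th * q * (th * Pz' - Pz) = Y * (th * (fps_X * u2) - p * vz - fps_X * u1 * Qz')"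
      using u2 u1 vz(1) q' by algebra
    then show ?thesis using iq it unfolding ez_def by algebra
  qed
  have et: "th * Pt' = Pt + Y * et"
  proof -
    have "th * q * (th * Pt' - Pt) = Y * (th * (fps_X * u3) - p * vt - fps_X * u1 * Qt')"
      using u3 u1 vt(1) q' by algebra
    then show ?thesis using iq it unfolding et_def by algebra
  qed
  have ez0: "ez $ 0 = - \<zeta>" "et $ 0 = - \<tau>" by (simp_all add: ez_def et_def one iq0 vz vt)
  have "0 = th * (c * (u * p' * (Qz' + Qt') + v * q' * (Pz' + Pt')) + Pz' * Qt' + Pt' * Qz') -
      th * (c * (u * p * (Qz + Qt) + v * q * (Pz + Pt)) + Pz * Qt + Pt * Qz + Y * (fps_X * u4))"
    unfolding u4 by simp
  also have "\<dots> = c * (u * (th * p') * (Qz' + Qt') + v * q' * (th * Pz' + th * Pt')) + th * Pz' * Qt' + th * Pt' * Qz' -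
      th * (c * (u * p * (Qz + Qt) + v * q * (Pz + Pt)) + Pz * Qt + Pt * Qz + Y * (fps_X * u4))"
    by (simp add: algebra_simps)
  also have "\<dots> = Y * (u * p * c * (vz + vt) + fps_X * u1 * u * c * (Qz' + Qt') + v * c * th * q * (ez + et) + Pz * vt + ez * th * Qt + Y * ez * vt
      + Pt * vz + et * th * Qz + Y * et * vz - th * (fps_X * u4))"
    by (simp only: u1 ez et q' vz(1) vt(1)) (simp add: algebra_simps)
  finally have "Y * (u * p * c * (vz + vt) + fps_X * u1 * u * c * (Qz' + Qt') + v * c * th * q * (ez + et) + Pz * vt + ez * th * Qt + Y * ez * vt
      + Pt * vz + et * th * Qz + Y * et * vz - th * (fps_X * u4)) = 0" by simp
  then have "(u * p * c * (vz + vt) + fps_X * u1 * u * c * (Qz' + Qt') + v * c * th * q * (ez + et) + Pz * vt + ez * th * Qt + Y * ez * vt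
      + Pt * vz + et * th * Qz + Y * et * vz - th * (fps_X * u4)) = 0" using Y0 by simp
  then have "(u * p * c * (vz + vt) + fps_X * u1 * u * c * (Qz' + Qt') + v * c * th * q * (ez + et) + Pz * vt + ez * th * Qt + Y * ez * vt
      + Pt * vz + et * th * Qz + Y * et * vz - th * (fps_X * u4)) $ 0 = 0" by simp
  then show ?thesis by (simp add: one vz vt ez0 Y0 algebra_simps)
qed

section \<open>Sets with the same path types\<close>

lemma conv_cong:
  "(\<And>i. i \<le> k \<Longrightarrow> f i = f' i) \<Longrightarrow> (\<And>i. i \<le> k \<Longrightarrow> g i = g' i) \<Longrightarrow> conv f g k = conv f' g' k"
  by (simp add: conv_def)

lemma rev_set_subset: "rev_set n S \<subseteq> {0<..<n}"
  by (auto simp: rev_set_def)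

lemma rev_set_rev_set: "S \<subseteq> {0<..<n} \<Longrightarrow> rev_set n (rev_set n S) = S"
  by (auto simp: rev_set_def)

lemma rev_set_off:
  assumes "\<And>i. \<not> s dvd i \<Longrightarrow> i \<in> S \<longleftrightarrow> i \<in> S'" "s dvd n" "\<not> s dvd i"
  shows "i \<in> rev_set n S \<longleftrightarrow> i \<in> rev_set n S'"
proof (cases "i < n")
  case True
  then have "\<not> s dvd (n - i)" using assms(2,3) by (metis dvd_diffD1 less_imp_le)
  then show ?thesis using assms(1) by (simp add: rev_set_def)
qed (simp add: rev_set_def)

text \<open>Condition (3) for two compositions of \<open>n\<close> with sets of partial sums \<open>S\<close> and \<open>S'\<close>.\<close>

locale equivalent_sets =
  fixes n :: nat and S S' :: "nat set"
  assumes S: "S \<subseteq> {0<..<n}" and S': "S' \<subseteq> {0<..<n}" and types: "path_types n S = path_types n S'"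
begin

abbreviation R where "R \<equiv> rev_set n S"
abbreviation R' where "R' \<equiv> rev_set n S'"

text \<open>If \<open>p\<close> and \<open>q\<close> are the path series of \<open>S\<close> and \<open>R\<close>, then \<open>p' q' = p q\<close> below degree \<open>n\<close>, so that
  \<open>q' = theta * q\<close> and, below degree \<open>n\<close>, \<open>p = theta * p'\<close>.\<close>

definition theta :: "(nat \<Rightarrow> real) \<Rightarrow> real fps" where
  "theta h = pf R' h * inverse (pf R h)"

lemma theta: "pf R' h = theta h * pf R h"
  by (simp add: theta_def mult.assoc inverse_mult_eq_1)

lemma theta_0 [simp]: "theta h $ 0 = 1"
  by (simp add: theta_def)

text \<open>The derivative identities for marked steps of lengths \<open>m\<close> and \<open>l\<close>, in a situation where the
  class of \<open>m + l\<close> modulo \<open>s\<close> is empty in one of \<open>S\<close>, \<open>R\<close> and full in the other. Then after two marked steps the path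
  either cannot be continued or is continued without restriction, and
  the second order identity involves only first order quantities. Its lowest order term
  compares the letters at \<open>m\<close> and \<open>m + k\<close> and at \<open>l\<close> and \<open>l + k\<close>.\<close>

theorem word_step:
  fixes h :: "nat \<Rightarrow> real"
  assumes s: "s dvd n" and h: "supported s h"
    and off: "\<And>i. \<not> s dvd i \<Longrightarrow> i \<in> S \<longleftrightarrow> i \<in> S'"
    and m: "\<not> s dvd m" "\<not> s dvd l" "\<not> s dvd (m + l)"
    and full: "\<And>e. s dvd e \<Longrightarrow> m + l + e < n \<Longrightarrow> (m + l + e \<in> S \<longleftrightarrow> \<not> up) \<and> (n - (m + l + e) \<in> S \<longleftrightarrow> up)"
    and k: "k > 0" "m + l + k < n"
    and perm: "\<And>j e. 0 < j \<Longrightarrow> j < k \<Longrightarrow> theta h $ j \<noteq> 0 \<Longrightarrow> s dvd e \<Longrightarrow> j + e \<le> k \<Longrightarrow> m + j + e \<in> R \<longleftrightarrow> m + e \<in> R"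
    and perl: "\<And>j e. 0 < j \<Longrightarrow> j < k \<Longrightarrow> theta h $ j \<noteq> 0 \<Longrightarrow> s dvd e \<Longrightarrow> j + e \<le> k \<Longrightarrow> l + j + e \<in> R \<longleftrightarrow> l + e \<in> R"
  shows "theta h $ k * ((of_bool (m + k \<in> R) - of_bool (m \<in> R)) * ((if up then 1 else - 1) + of_bool (l \<in> S) - of_bool (l \<in> R))
      + (of_bool (l + k \<in> R) - of_bool (l \<in> R)) * ((if up then 1 else - 1) + of_bool (m \<in> S) - of_bool (m \<in> R))) = 0"
proof -
  define p where "p = pf S h"
  define q where "q = pf R h"
  define p' where "p' = pf S' h"
  define q' where "q' = pf R' h"
  define c where "c = pf UNIV h"
  define u v :: "real fps" where "u = of_bool up" and "v = of_bool (\<not> up)"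
  note pq = p_def q_def p'_def q'_def
  have sup: "supported s (fps_nth (pf T h))" for T by (simp add: supported_path_sum[OF h])
  have m0: "m > 0" "l > 0" using m by (auto intro: Nat.gr0I)
  have act_off: "act T h i f r = act T' h i f r"
    if "\<And>j. \<not> s dvd j \<Longrightarrow> j \<in> T \<longleftrightarrow> j \<in> T'" "\<not> s dvd i" "supported s f" for T T' i f r
    by (rule act_cong_supported[OF h that(3)]) (use that in \<open>auto simp: dvd_add_left_iff\<close>)
  have actR: "act R' h i f r = act R h i f r" if "\<not> s dvd i" "supported s f" for i f r
    using act_off[OF _ that, of R R'] rev_set_off[OF off s] by simp
  have actS: "act S' h i f r = act S h i f r" if "\<not> s dvd i" "supported s f" for i f r
    using act_off[OF _ that, of S S'] off by simp
  have full': "(m + l + e \<in> S' \<longleftrightarrow> \<not> up) \<and> (n - (m + l + e) \<in> S' \<longleftrightarrow> up)" if e: "s dvd e" "m + l + e < n" for e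
  proof -
    have "\<not> s dvd (m + l + e)" using m(3) e(1) by (simp add: dvd_add_left_iff)
    moreover from this have "\<not> s dvd (n - (m + l + e))" using s e(2) by (metis dvd_diffD1 less_imp_le)
    ultimately show ?thesis using full[OF e] off by blast
  qed
  \<comment> \<open>On the class of \<open>m + l\<close> all positions are missing, and on the opposite class all are present.\<close>
  have act_empty: "act T h (m + l) f r = 0"
    if "\<And>e. s dvd e \<Longrightarrow> m + l + e < n \<Longrightarrow> m + l + e \<notin> T" "supported s f" "m + l + r < n" for T f r
  proof -
    have "act T h (m + l) f r = act {} h (m + l) f r"
      by (rule act_cong_supported[OF h that(2)]) (use that in auto)
    then show ?thesis by (simp add: act_def seg_def)
  qed
  have act_full: "act T h (m + l) f r = conv f (fps_nth c) r"
    if "\<And>e. s dvd e \<Longrightarrow> m + l + e < n \<Longrightarrow> m + l + e \<in> T" "supported s f" "m + l + r < n" for T f r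
  proof -
    have "act T h (m + l) f r = act UNIV h (m + l) f r"
      by (rule act_cong_supported[OF h that(2)]) (use that in auto)
    then show ?thesis by (simp add: act_def seg_def conv_def c_def)
  qed
  have sact: "supported s (act T h i f)" if "supported s f" for T i f
    by (rule supported_act[OF h that])
  have D2form: "(let R = rev_set n T; p = path_sum T h; q = path_sum R h in
      conv (act T h (m + l) (act T h m p)) q r + conv (act T h (m + l) (act T h l p)) q r
      + conv (act T h m p) (act R h l q) r + conv (act T h l p) (act R h m q) r
      + conv p (act R h (m + l) (act R h m q)) r + conv p (act R h (m + l) (act R h l q)) r) =
     (let R = rev_set n T; p = pf T h; q = pf R h in
      (c * (u * p * (actf R h m q + actf R h l q) + v * q * (actf T h m p + actf T h l p))
        + actf T h m p * actf R h l q + actf T h l p * actf R h m q) $ r)"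
    if full: "\<And>e. s dvd e \<Longrightarrow> m + l + e < n \<Longrightarrow> (m + l + e \<in> T \<longleftrightarrow> \<not> up) \<and> (n - (m + l + e) \<in> T \<longleftrightarrow> up)"
      and r: "m + l + r < n" for T r
  proof -
    let ?R = "rev_set n T"
    have fullR: "m + l + e \<in> ?R \<longleftrightarrow> up" if "s dvd e" "m + l + e < n" for e
      using full[OF that] that m0 by (simp add: rev_set_def)
    have empty: "conv (act W h (m + l) (act W h i (fps_nth (pf W h)))) g r = 0"
      if "\<And>e. s dvd e \<Longrightarrow> m + l + e < n \<Longrightarrow> m + l + e \<notin> W" for W i g
    proof -
      have "conv (act W h (m + l) (act W h i (path_sum W h))) g r = conv (\<lambda>_. 0) g r"
        by (rule conv_cong) (use that r sact supported_path_sum[OF h] act_empty in auto)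
      then show ?thesis by (simp add: conv_def)
    qed
    have full2: "conv (act W h (m + l) (act W h i (fps_nth (pf W h)))) (fps_nth g) r = (c * g * actf W h i (pf W h)) $ r"
      if "\<And>e. s dvd e \<Longrightarrow> m + l + e < n \<Longrightarrow> m + l + e \<in> W" for W i g
    proof -
      have "conv (act W h (m + l) (act W h i (path_sum W h))) (fps_nth g) r =
        conv (fps_nth (actf W h i (pf W h) * c)) (fps_nth g) r"
      proof (rule conv_cong)
        fix j assume "j \<le> r"
        then have "act W h (m + l) (act W h i (path_sum W h)) j = conv (act W h i (path_sum W h)) (fps_nth c) j"
          using that r sact supported_path_sum[OF h] act_full by auto
        also have "\<dots> = (actf W h i (pf W h) * c) $ j" by (simp add: conv_fps[symmetric])
        finally show "act W h (m + l) (act W h i (path_sum W h)) j = (actf W h i (pf W h) * c) $ j" .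
      qed simp
      then show ?thesis by (simp only: conv_fps fps_nth_pf) (simp add: mult_ac)
    qed
    have g: "conv (act T h i (path_sum T h)) (act ?R h j (path_sum ?R h)) r =
      (actf T h i (pf T h) * actf ?R h j (pf ?R h)) $ r" for i j
      by (simp add: conv_fps[symmetric])
    have e: "conv (act T h (m + l) (act T h i (path_sum T h))) (path_sum ?R h) r = (c * (v * pf ?R h * actf T h i (pf T h))) $ r" for i
      using empty[of T i "path_sum ?R h"] full2[of T i "pf ?R h"] full by (cases up) (simp_all add: v_def mult_ac)
    have f: "conv (path_sum T h) (act ?R h (m + l) (act ?R h i (path_sum ?R h))) r =
       (c * (u * pf T h * actf ?R h i (pf ?R h))) $ r" for i
      unfolding conv_commute[of "path_sum T h"]
      using empty[of ?R i "path_sum T h"] full2[of ?R i "pf T h"] fullR by (cases up) (simp_all add: u_def mult_ac)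
    show ?thesis by (simp add: Let_def e f g distrib_left)
  qed
  have D2: "(c * (u * p' * (actf R h m q' + actf R h l q') + v * q' * (actf S h m p' + actf S h l p')) + actf S h m p' * actf R h l q' + actf S h l p' * actf R h m q') $ r
     = (c * (u * p * (actf R h m q + actf R h l q) + v * q * (actf S h m p + actf S h l p)) + actf S h m p * actf R h l q + actf S h l p * actf R h m q) $ r"
    if r: "r \<le> k" for r
  proof -
    have A: "actf R' h i q' = actf R h i q'" "actf S' h i p' = actf S h i p'" if "\<not> s dvd i" for i
      using that sup by (auto intro!: fps_ext simp: actR actS pq)
    have r': "m + l + r < n" using r k by simp
    note D2form[OF full r', symmetric]
    also note second_derivative_eq[OF S S' types m0 r', of h]
    also note D2form[OF full' r']
    finally show ?thesis
      unfolding Let_def pq[symmetric] A[OF m(1)] A[OF m(2)] by (rule sym)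
  qed
  have D1: "(p' * actf R h i q' + actf S h i p' * q') $ r = (p * actf R h i q + actf S h i p * q) $ r"
    if i: "\<not> s dvd i" "i + k < n" and r: "r \<le> k" for i r
  proof -
    have A: "actf R' h i q' = actf R h i q'" "actf S' h i p' = actf S h i p'"
      using i sup by (auto intro!: fps_ext simp: actR actS pq)
    have i0: "i > 0" using i by (auto intro: Nat.gr0I)
    have "i + r < n" using i r by simp
    from first_derivative_eq[OF S S' types i0 this, of h]
    have "(p' * actf R' h i q' + actf S' h i p' * q') $ r = (p * actf R h i q + actf S h i p * q) $ r"
      by (simp add: Let_def pq conv_fps[symmetric])
    then show ?thesis unfolding A .
  qed
  have pq': "(p' * q') $ r = (p * q) $ r" if "r \<le> k" for r
    using conv_path_sum_eq[OF S S' types, of r h] that k by (simp add: pq conv_fps[symmetric])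
  have th: "q' = theta h * q" using theta[of h] by (simp add: pq)
  have one: "p $ 0 = 1" "q $ 0 = 1" "c $ 0 = 1" by (simp_all add: pq c_def)
  have defect: "(actf R h i q' - theta h * actf R h i q) $ r =
     (if r = k then theta h $ k * (of_bool (i + k \<in> R) - of_bool (i \<in> R)) else 0)"
    if "r \<le> k" "\<And>j e. 0 < j \<Longrightarrow> j < k \<Longrightarrow> theta h $ j \<noteq> 0 \<Longrightarrow> s dvd e \<Longrightarrow> j + e \<le> k \<Longrightarrow> i + j + e \<in> R \<longleftrightarrow> i + e \<in> R" for i r
    unfolding th by (rule row_defect[OF h _ one(2) k(1) that]) (use sup in \<open>simp_all add: q_def\<close>)
  have E: "(actf R h m q' - theta h * actf R h m q) $ k * (u $ 0 - v $ 0 + actf S h l p $ 0 - actf R h l q $ 0)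
     + (actf R h l q' - theta h * actf R h l q) $ k * (u $ 0 - v $ 0 + actf S h m p $ 0 - actf R h m q $ 0) = 0"
  proof (rule lowest_terms[OF one theta_0 k(1) th pq'])
    show "r \<le> k \<Longrightarrow> (p' * actf R h m q' + actf S h m p' * q') $ r = (p * actf R h m q + actf S h m p * q) $ r" for r
      by (rule D1) (use m k in auto)
    show "r \<le> k \<Longrightarrow> (p' * actf R h l q' + actf S h l p' * q') $ r = (p * actf R h l q + actf S h l p * q) $ r" for r
      by (rule D1) (use m k in auto)
    show "r < k \<Longrightarrow> (actf R h m q' - theta h * actf R h m q) $ r = 0" for r
      using defect[of r m] perm by simp
    show "r < k \<Longrightarrow> (actf R h l q' - theta h * actf R h l q) $ r = 0" for r
      using defect[of r l] perl by simp
  qed (use D2 in auto)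
  have Z: "actf T h i f $ 0 = of_bool (i \<in> T)" if "f $ 0 = 1" for T i f
    using that by (simp add: act_def seg_0)
  have dm: "(actf R h m q' - theta h * actf R h m q) $ k = theta h $ k * (of_bool (m + k \<in> R) - of_bool (m \<in> R))"
    using defect[of k m] perm by simp
  have dl: "(actf R h l q' - theta h * actf R h l q) $ k = theta h $ k * (of_bool (l + k \<in> R) - of_bool (l \<in> R))"
    using defect[of k l] perl by simp
  have uv: "u $ 0 - v $ 0 = (if up then 1 else - 1)" by (simp add: u_def v_def)
  show ?thesis using E unfolding dm dl uv Z[OF one(1)] Z[OF one(2)] by (simp only: distrib_left mult.assoc)
qed

end

section \<open>Periods on residue classes\<close>

lemma int_subgroup_generator:
  fixes P :: "int set"
  assumes n: "n > 0" "int n \<in> P" and add: "\<And>i j. i \<in> P \<Longrightarrow> j \<in> P \<Longrightarrow> i + j \<in> P" and neg: "\<And>i. i \<in> P \<Longrightarrow> - i \<in> P"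
  obtains g where "g > 0" "g dvd n" "\<And>k. k \<in> P \<longleftrightarrow> int g dvd k"
proof -
  define g where "g = (LEAST g. g > 0 \<and> int g \<in> P)"
  have g: "g > 0" "int g \<in> P" and least: "\<And>i. 0 < i \<Longrightarrow> int i \<in> P \<Longrightarrow> g \<le> i"
    using LeastI[of "\<lambda>g. g > 0 \<and> int g \<in> P" n] Least_le[of "\<lambda>g. g > 0 \<and> int g \<in> P"] n by (auto simp: g_def)
  have zero: "0 \<in> P" using add[OF n(2) neg[OF n(2)]] by simp
  have mul: "int g * int j \<in> P" for j
    by (induction j) (auto simp: zero g(2) distrib_left intro: add)
  have mult: "int g * j \<in> P" for j
    using mul[of "nat j"] neg[OF mul[of "nat (- j)"]] by (cases "j \<ge> 0") auto
  have iff: "k \<in> P \<longleftrightarrow> int g dvd k" for k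
  proof
    assume k: "k \<in> P"
    have "k mod int g = k + int g * (- (k div int g))" by (simp add: minus_div_mult_eq_mod[symmetric] algebra_simps)
    then have "k mod int g \<in> P" using add[OF k mult[of "- (k div int g)"]] by simp
    moreover have "0 \<le> k mod int g" "k mod int g < int g" using g by auto
    ultimately have "k mod int g = 0" using least[of "nat (k mod int g)"] by (cases "k mod int g = 0") auto
    then show "int g dvd k" by auto
  qed (auto simp: mult)
  moreover have "g dvd n" using iff[of "int n"] n(2) by simp
  ultimately show ?thesis using that g(1) by blast
qed

text \<open>Multiples of \<open>s\<close> below \<open>n\<close> leave room for a whole block of length \<open>s\<close>.\<close>

lemma mult_less_n:
  fixes n :: nat
  assumes "s dvd n" "s dvd e" "e < n"
  shows "e + s \<le> n"
proof -
  have "s dvd (n - e)" using assms by (simp add: dvd_diff_nat)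
  then have "s \<le> n - e" using assms by (intro dvd_imp_le) auto
  then show ?thesis using assms by simp
qed

context equivalent_sets
begin

lemma theta_rec: "theta h $ k = path_sum R' h k - (\<Sum>i<k. theta h $ i * path_sum R h (k - i))"
proof -
  have "path_sum R' h k = (\<Sum>i\<le>k. theta h $ i * path_sum R h (k - i))"
    using arg_cong[OF theta[of h], of "\<lambda>f. f $ k"] by (simp add: fps_mult_nth atMost_atLeast0)
  then show ?thesis by (simp add: lessThan_Suc_atMost[symmetric])
qed

lemma supported_theta:
  assumes "supported s h"
  shows "supported s (fps_nth (theta h))"
proof -
  have "theta h $ k = 0" if "\<not> s dvd k" for k
    using that
  proof (induction k rule: less_induct)
    case (less k)
    have "theta h $ i * path_sum R h (k - i) = 0" if "i < k" for i
    proof (cases "s dvd i")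
      case True
      then have "\<not> s dvd (k - i)" using less.prems that by (metis dvd_diffD less_imp_le)
      then show ?thesis by (simp add: supportedD[OF supported_path_sum[OF assms]])
    qed (simp add: less that)
    then have "(\<Sum>i<k. theta h $ i * path_sum R h (k - i)) = 0" by (intro sum.neutral) blast
    then show ?case using less.prems by (subst theta_rec) (simp add: supportedD[OF supported_path_sum[OF assms]])
  qed
  then show ?thesis by (simp add: supported_def)
qed

text \<open>The word that \<open>S\<close> spells on the positions congruent to \<open>z\<close> modulo \<open>s\<close> has period \<open>k\<close>, positions
  outside the range not being identified cyclically.\<close>

definition lin :: "nat \<Rightarrow> nat \<Rightarrow> nat \<Rightarrow> bool" where
  "lin s z k \<longleftrightarrow> (\<forall>e. s dvd e \<longrightarrow> z + e + k < n \<longrightarrow> (z + e + k \<in> S \<longleftrightarrow> z + e \<in> S))"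

text \<open>Moving by \<open>k\<close> changes every letter of the word on the class of \<open>z\<close> by the same amount.\<close>

definition step :: "nat \<Rightarrow> nat \<Rightarrow> nat \<Rightarrow> real \<Rightarrow> bool" where
  "step s z k \<kappa> \<longleftrightarrow> (\<forall>e. s dvd e \<longrightarrow> z + e + k < n \<longrightarrow> of_bool (z + e + k \<in> S) - of_bool (z + e \<in> S) = \<kappa>)"

lemma lin_step: "lin s z k \<longleftrightarrow> step s z k 0"
proof -
  have "of_bool a - of_bool b = (0::real) \<longleftrightarrow> (a \<longleftrightarrow> b)" for a b by (cases a; cases b) simp_all
  then show ?thesis by (simp only: lin_def step_def)
qed

text \<open>Either all degrees occurring in \<open>theta h\<close> are periods of the word on the class of \<open>z\<close>, or
  the first one that is not a period is a jump by a non-zero constant. As a letter cannot jump twice in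
  the same direction, this exception only concerns degrees that are large compared with \<open>n\<close>.\<close>

definition class_good :: "nat \<Rightarrow> nat \<Rightarrow> (nat \<Rightarrow> real) \<Rightarrow> bool" where
  "class_good s z h \<longleftrightarrow> (\<forall>k>0. theta h $ k \<noteq> 0 \<longrightarrow> lin s z k) \<or>
     (\<exists>k0>0. theta h $ k0 \<noteq> 0 \<and> (\<forall>k. 0 < k \<and> k < k0 \<and> theta h $ k \<noteq> 0 \<longrightarrow> lin s z k) \<and>
        (\<exists>\<kappa>. \<kappa> \<noteq> 0 \<and> step s z k0 \<kappa>))"

text \<open>\<open>word_step\<close> at the least degree \<open>k\<close> of \<open>theta h\<close> that is not a period of both words. On the class of
  \<open>z + t\<close> the two sets are as in \<open>word_step\<close>. If the class of \<open>t\<close>, too, is full in one of \<open>S\<close>, \<open>R\<close> and empty in the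
  other, the word on it is constant and the identity makes \<open>k\<close> a period for \<open>z\<close>. If the class of \<open>t\<close> is symmetric, the identity says that the jumps
  at any two positions of the two classes are opposite, hence constant on each class.\<close>

theorem class_periods:
  assumes s: "s dvd n" and h: "supported s h"
    and off: "\<And>i. \<not> s dvd i \<Longrightarrow> i \<in> S \<longleftrightarrow> i \<in> S'"
    and z: "0 < z" "0 < t" "z + t < s"
    and full: "\<And>e. s dvd e \<Longrightarrow> z + t + e < n \<Longrightarrow> (z + t + e \<in> S \<longleftrightarrow> \<not> up) \<and> (n - (z + t + e) \<in> S \<longleftrightarrow> up)"
    and symz: "\<And>e. s dvd e \<Longrightarrow> z + e < n \<Longrightarrow> n - (z + e) \<in> S \<longleftrightarrow> z + e \<in> S"
    and t: "(\<forall>e. s dvd e \<longrightarrow> t + e < n \<longrightarrow> (t + e \<in> S \<longleftrightarrow> up) \<and> (n - (t + e) \<in> S \<longleftrightarrow> \<not> up)) \<or>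
            (\<forall>e. s dvd e \<longrightarrow> t + e < n \<longrightarrow> (n - (t + e) \<in> S \<longleftrightarrow> t + e \<in> S))"
  shows "class_good s z h"
proof (cases "\<exists>k>0. theta h $ k \<noteq> 0 \<and> \<not> (lin s z k \<and> lin s t k)")
  case False
  then show ?thesis unfolding class_good_def by blast
next
  case True
  define k where "k = (LEAST k. k > 0 \<and> theta h $ k \<noteq> 0 \<and> \<not> (lin s z k \<and> lin s t k))"
  have k: "k > 0" "theta h $ k \<noteq> 0" "\<not> (lin s z k \<and> lin s t k)"
    using LeastI_ex[OF True] by (auto simp: k_def)
  have least: "lin s z j \<and> lin s t j" if "0 < j" "j < k" "theta h $ j \<noteq> 0" for j
    using not_less_Least[of j "\<lambda>k. k > 0 \<and> theta h $ k \<noteq> 0 \<and> \<not> (lin s z k \<and> lin s t k)"] that by (auto simp: k_def)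
  have sk: "s dvd j" if "theta h $ j \<noteq> 0" for j
    using supportedD[OF supported_theta[OF h]] that by blast
  have ndvd: "\<not> s dvd i + e" if "0 < i" "i < s" "s dvd e" for i e
    using that by (metis dvd_add_left_iff dvd_imp_le not_less)
  have Rz: "z + e \<in> R \<longleftrightarrow> z + e \<in> S" if "s dvd e" "z + e < n" for e
    using symz[OF that] that z by (simp add: rev_set_def)
  have perR: "i + j + e \<in> R \<longleftrightarrow> i + e \<in> R" if "i = z \<or> i = t" "0 < j" "j < k" "theta h $ j \<noteq> 0" "s dvd e" "i + j + e < n" for i j e
  proof -
    have i: "0 < i" "i < s" using that z by auto
    have e: "i + e < n" using that by simp
    have je: "s dvd (j + e)" using sk[OF that(4)] that(5) by simp
    show ?thesis
    proof (cases "\<forall>e. s dvd e \<longrightarrow> i + e < n \<longrightarrow> (n - (i + e) \<in> S \<longleftrightarrow> i + e \<in> S)")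
      case True
      have "lin s i j" using least[OF that(2-4)] that(1) by auto
      then have "i + e + j \<in> S \<longleftrightarrow> i + e \<in> S" using that(5,6) by (simp add: lin_def add_ac)
      moreover have "i + x \<in> R \<longleftrightarrow> i + x \<in> S" if "s dvd x" "i + x < n" for x
        using True that i by (simp add: rev_set_def)
      ultimately show ?thesis using that(5,6) e je by (metis add.assoc add.commute)
    next
      case False
      then have "i = t" using that(1) symz by auto
      then have "n - (i + x) \<in> S \<longleftrightarrow> \<not> up" if "s dvd x" "i + x < n" for x
        using t False that by auto
      then have "i + x \<in> R \<longleftrightarrow> \<not> up" if "s dvd x" "i + x < n" for x
        using that i by (simp add: rev_set_def)
      then show ?thesis using that(5,6) e je by (metis add.assoc)
    qed
  qed
  have main: "(of_bool (z + e + k \<in> R) - of_bool (z + e \<in> R)) * ((if up then 1 else - 1) + of_bool (t + e' \<in> S) - of_bool (t + e' \<in> R))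
      + (of_bool (t + e' + k \<in> R) - of_bool (t + e' \<in> R)) * ((if up then 1 else - 1) + of_bool (z + e \<in> S) - of_bool (z + e \<in> R)) = (0 :: real)"
    if e: "s dvd e" "s dvd e'" "z + e + (t + e') + k < n" for e e'
  proof -
    have nd: "\<not> s dvd z + e" "\<not> s dvd t + e'" "\<not> s dvd z + e + (t + e')"
      using ndvd[of z e] ndvd[of t e'] ndvd[of "z + t" "e + e'"] e z by (auto simp: add_ac)
    have "theta h $ k * ((of_bool (z + e + k \<in> R) - of_bool (z + e \<in> R)) * ((if up then 1 else - 1) + of_bool (t + e' \<in> S) - of_bool (t + e' \<in> R))
      + (of_bool (t + e' + k \<in> R) - of_bool (t + e' \<in> R)) * ((if up then 1 else - 1) + of_bool (z + e \<in> S) - of_bool (z + e \<in> R))) = 0"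
    proof (rule word_step[OF s h _ nd _ k(1) e(3)])
      fix x assume x: "s dvd x" "z + e + (t + e') + x < n"
      have eq: "z + e + (t + e') + x = z + t + (e + e' + x)" by simp
      have "s dvd e + e' + x" using e x by simp
      then show "(z + e + (t + e') + x \<in> S \<longleftrightarrow> \<not> up) \<and> (n - (z + e + (t + e') + x) \<in> S \<longleftrightarrow> up)"
        unfolding eq using full x(2)[unfolded eq] by blast
    next
      fix j x assume j: "0 < j" "j < k" "theta h $ j \<noteq> 0" "s dvd x" "j + x \<le> k"
      show "z + e + j + x \<in> R \<longleftrightarrow> z + e + x \<in> R"
        using perR[of z j "e + x"] j e by (simp add: add_ac)
      show "t + e' + j + x \<in> R \<longleftrightarrow> t + e' + x \<in> R"
        using perR[of t j "e' + x"] j e by (simp add: add_ac)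
    qed (use off in auto)
    then show ?thesis using k by simp
  qed
  have symR: "of_bool (z + e \<in> S) - of_bool (z + e \<in> R) = (0::real)" if "s dvd e" "z + e < n" for e
    using Rz[OF that] by simp
  consider (full) "\<And>e. s dvd e \<Longrightarrow> t + e < n \<Longrightarrow> (t + e \<in> S \<longleftrightarrow> up) \<and> (t + e \<in> R \<longleftrightarrow> \<not> up)"
    | (sym) "\<And>e. s dvd e \<Longrightarrow> t + e < n \<Longrightarrow> t + e \<in> R \<longleftrightarrow> t + e \<in> S"
  proof -
    have Rt: "t + e \<in> R \<longleftrightarrow> n - (t + e) \<in> S" if "t + e < n" for e
      using that z by (simp add: rev_set_def)
    from t show thesis
    proof
      assume "\<forall>e. s dvd e \<longrightarrow> t + e < n \<longrightarrow> (t + e \<in> S \<longleftrightarrow> up) \<and> (n - (t + e) \<in> S \<longleftrightarrow> \<not> up)"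
      then show thesis using that(1) Rt by blast
    next
      assume "\<forall>e. s dvd e \<longrightarrow> t + e < n \<longrightarrow> (n - (t + e) \<in> S \<longleftrightarrow> t + e \<in> S)"
      then show thesis using that(2) Rt by blast
    qed
  qed
  then show ?thesis
  proof cases
    case full
    have "lin s t k" unfolding lin_def using full sk[OF k(2)] by (metis add.assoc dvd_add add_lessD1)
    moreover have "lin s z k" unfolding lin_def
    proof (intro allI impI)
      fix e assume e: "s dvd e" "z + e + k < n"
      have lt: "z + e + (t + 0) + k < n" 
      proof -
        have "e + k < n" "s dvd (e + k)" using e sk[OF k(2)] by auto
        then have "e + k + s \<le> n" using mult_less_n[OF s] by blast
        then show ?thesis using z by simp
      qed
      have t0: "t \<in> S \<longleftrightarrow> up" "t \<in> R \<longleftrightarrow> \<not> up" "t + k \<in> R \<longleftrightarrow> \<not> up"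
        using full[of 0] full[of k] sk[OF k(2)] lt by auto
      have R: "z + e \<in> R \<longleftrightarrow> z + e \<in> S" "z + e + k \<in> R \<longleftrightarrow> z + e + k \<in> S"
        using Rz[of e] Rz[of "e + k"] e sk[OF k(2)] by (auto simp: add_ac)
      have "(of_bool (z + e + k \<in> S) - of_bool (z + e \<in> S)) * ((if up then 1 else - 1) + of_bool up - of_bool (\<not> up)) = (0::real)"
        using main[OF e(1) _ lt] t0 R by simp
      then show "z + e + k \<in> S \<longleftrightarrow> z + e \<in> S" by (cases up) (auto split: if_splits)
    qed
    ultimately show ?thesis using k(3) by simp
  next
    case sym
    have red: "(of_bool (z + e + k \<in> S) - of_bool (z + e \<in> S)) + (of_bool (t + e' + k \<in> S) - of_bool (t + e' \<in> S)) = (0::real)"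
      if "s dvd e" "s dvd e'" "z + e + (t + e') + k < n" for e e'
    proof -
      have R: "z + e \<in> R \<longleftrightarrow> z + e \<in> S" "z + e + k \<in> R \<longleftrightarrow> z + e + k \<in> S"
        "t + e' \<in> R \<longleftrightarrow> t + e' \<in> S" "t + e' + k \<in> R \<longleftrightarrow> t + e' + k \<in> S"
        using Rz[of e] Rz[of "e + k"] sym[of e'] sym[of "e' + k"] that sk[OF k(2)] by (auto simp: add_ac)
      show ?thesis using main[OF that] unfolding R by (cases up) (simp_all add: algebra_simps)
    qed
    define \<kappa> :: real where "\<kappa> = - (of_bool (t + k \<in> S) - of_bool (t \<in> S))"
    have lt: "z + e + (t + 0) + k < n" "z + 0 + (t + e) + k < n" if "s dvd e" "e + k < n" for e
    proof -
      have "s dvd (e + k)" using that sk[OF k(2)] by auto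
      then have "e + k + s \<le> n" using mult_less_n[OF s] that by blast
      then show "z + e + (t + 0) + k < n" "z + 0 + (t + e) + k < n" using z by simp_all
    qed
    have stepz: "step s z k \<kappa>" unfolding step_def
    proof (intro allI impI)
      fix e assume e: "s dvd e" "z + e + k < n"
      show "of_bool (z + e + k \<in> S) - of_bool (z + e \<in> S) = \<kappa>"
        using red[OF e(1) _ lt(1)[OF e(1)]] e(2) unfolding \<kappa>_def by simp
    qed
    have "\<kappa> \<noteq> 0"
    proof
      assume 0: "\<kappa> = 0"
      have "lin s z k" using stepz 0 by (simp add: lin_step)
      moreover have "lin s t k" unfolding lin_step step_def
      proof (intro allI impI)
        fix e assume e: "s dvd e" "t + e + k < n"
        have "of_bool (z + k \<in> S) - of_bool (z \<in> S) = (0::real)"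
          using stepz 0 lt(1)[of 0] e(2) unfolding step_def by auto
        then show "of_bool (t + e + k \<in> S) - of_bool (t + e \<in> S) = (0::real)"
          using red[OF _ e(1) lt(2)[OF e(1)]] e(2) by simp
      qed
      ultimately show False using k by simp
    qed
    then show ?thesis using stepz k least unfolding class_good_def by blast
  qed
qed

section \<open>Common periods\<close>

definition dif :: "nat set" where "dif = {i. (i \<in> S) \<noteq> (i \<in> S')}"

lemma dif_range: "b \<in> dif \<Longrightarrow> 0 < b \<and> b < n"
  using S S' by (auto simp: dif_def)

text \<open>The multiset of two-part coarsenings determines \<open>[m \<in> S] + [n - m \<in> S]\<close>; formally this is the first
  derivative identity at weight 0.\<close>

lemma symmetric_part:
  assumes "0 < m" "m < n"
  shows "of_bool (m \<in> S) + of_bool (n - m \<in> S) = (of_bool (m \<in> S') + of_bool (n - m \<in> S') :: int)"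
  using first_derivative_eq[OF S S' types assms(1), of 0 "\<lambda>_. 0 :: int"] assms
  by (simp add: Let_def conv_def act_def seg_0 rev_set_def add.commute of_bool_def)

lemma dif_sym: "b \<in> dif \<Longrightarrow> n - b \<in> dif"
  using symmetric_part[of b] dif_range[of b]
  by (cases "b \<in> S"; cases "b \<in> S'"; cases "n - b \<in> S"; cases "n - b \<in> S'") (auto simp: dif_def)

lemma dif_half:
  assumes "b \<in> dif"
  shows "2 * b \<noteq> n"
proof
  assume "2 * b = n"
  then have "n - b = b" by simp
  then show False using symmetric_part[of b] dif_range[OF assms] assms
    by (cases "b \<in> S"; cases "b \<in> S'") (auto simp: dif_def)
qed

text \<open>\<open>dif\<close> is symmetric and does not contain \<open>n / 2\<close>, so statements invariant under \<open>b \<mapsto> n - b\<close> can be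
  checked in the lower half.\<close>

lemma dif_small:
  assumes "b \<in> dif" "\<And>b. b \<in> dif \<Longrightarrow> 2 * b < n \<Longrightarrow> P b \<and> P (n - b)"
  shows "P b"
proof (cases "2 * b < n")
  case False
  then have "2 * (n - b) < n" using dif_half[OF assms(1)] dif_range[OF assms(1)] by linarith
  then show ?thesis using assms(2)[OF dif_sym[OF assms(1)]] dif_range[OF assms(1)] by simp
qed (use assms in blast)

text \<open>Every position where the two sets differ occurs as a degree of a suitable \<open>theta h\<close>: put weight on
  \<open>b\<close> alone.\<close>

lemma theta_single:
  assumes b: "b \<in> dif"
  defines "h \<equiv> \<lambda>m. if m = b then 1 else (0::real)"
  shows "theta h $ b \<noteq> 0" and "supported b h"
proof -
  have b0: "0 < b" "b < n" using dif_range[OF b] by auto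
  have p0: "path_sum T h k = 0" if "0 < k" "k < b" for T k
    using that by (auto simp: path_sum_pos h_def intro!: sum.neutral)
  have pb: "path_sum T h b = of_bool (b \<in> T)" for T
  proof -
    have "(\<Sum>i<b. path_sum T h i * h (b - i)) = (\<Sum>i<b. if i = 0 then 1 else 0)"
      using b0 by (intro sum.cong) (auto simp: h_def)
    then show ?thesis using b0 by (simp add: path_sum_pos)
  qed
  have "theta h $ b = path_sum R' h b - (\<Sum>i<b. theta h $ i * path_sum R h (b - i))" by (rule theta_rec)
  also have "(\<Sum>i<b. theta h $ i * path_sum R h (b - i)) = (\<Sum>i<b. if i = 0 then path_sum R h b else 0)"
    by (intro sum.cong) (auto simp: p0)
  finally have "theta h $ b = of_bool (b \<in> R') - of_bool (b \<in> R)" using b0 by (simp add: pb)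
  moreover have "(b \<in> R') \<noteq> (b \<in> R)" using dif_sym[OF b] b0 by (auto simp: dif_def rev_set_def)
  ultimately show "theta h $ b \<noteq> 0" by auto
  show "supported b h" by (simp add: supported_def h_def)
qed

lemma supported_mono: "supported b f \<Longrightarrow> s dvd b \<Longrightarrow> supported s f"
  unfolding supported_def using dvd_trans by blast

text \<open>The indicator of \<open>S\<close>, extended to a function on the integers of period \<open>n\<close>. Below, \<open>perset s\<close> is the group of periods of
  this function off the multiples of \<open>s\<close>, among the multiples of \<open>s\<close>.\<close>

definition X :: "int \<Rightarrow> bool" where "X i \<longleftrightarrow> nat (i mod int n) \<in> S"

lemma X_nat: "j < n \<Longrightarrow> X (int j) \<longleftrightarrow> j \<in> S"
  by (simp add: X_def)

lemma X_n: "X (i + int n) = X i"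
  by (simp add: X_def)

lemma X_mod: "X (i mod int n) = X i"
  by (simp add: X_def)

definition perset :: "nat \<Rightarrow> int set" where
  "perset s = {k. int s dvd k \<and> (\<forall>i. \<not> int s dvd i \<longrightarrow> X (i + k) = X i)}"

lemma perset_add: "k \<in> perset s \<Longrightarrow> l \<in> perset s \<Longrightarrow> k + l \<in> perset s"
  by (auto simp: perset_def add.assoc[symmetric] dvd_add_left_iff)

lemma perset_minus: assumes "k \<in> perset s" shows "- k \<in> perset s"
proof -
  have "X (i - k) = X i" if "\<not> int s dvd i" for i
  proof -
    have "\<not> int s dvd i - k" using assms that by (auto simp: perset_def dvd_diff_left_iff)
    then have "X (i - k + k) = X (i - k)" using assms unfolding perset_def by blast
    then show ?thesis by simp
  qed
  then show ?thesis using assms by (simp add: perset_def)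
qed

lemma perset_n: "s dvd n \<Longrightarrow> int n \<in> perset s"
  by (simp add: perset_def X_n)

lemma perset_generator:
  assumes "n > 0" "s dvd n"
  obtains g where "g > 0" "g dvd n" "\<And>k. k \<in> perset s \<longleftrightarrow> int g dvd k"
  using int_subgroup_generator[OF assms(1) perset_n[OF assms(2)] perset_add perset_minus] by metis

lemma lin_mult:
  assumes "lin s z k" "s dvd k"
  shows "lin s z (j * k)"
proof (induction j)
  case (Suc j)
  show ?case unfolding lin_def
  proof (intro allI impI)
    fix e assume e: "s dvd e" "z + e + Suc j * k < n"
    then have "z + (e + j * k) + k \<in> S \<longleftrightarrow> z + (e + j * k) \<in> S"
      using assms unfolding lin_def by (metis add.assoc add.commute dvd_add dvd_mult mult_Suc)
    moreover have "z + e + j * k \<in> S \<longleftrightarrow> z + e \<in> S" using Suc e unfolding lin_def by simp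
    ultimately show "z + e + Suc j * k \<in> S \<longleftrightarrow> z + e \<in> S" by (simp add: add_ac)
  qed
qed (simp add: lin_def)

lemma int_class:
  assumes "0 < z" "z < s" "int s dvd (i - int z)" "0 \<le> i"
  obtains e where "s dvd e" "i = int (z + e)"
proof -
  have "i \<ge> int z"
  proof (rule ccontr)
    assume "\<not> ?thesis"
    then have "0 < int z - i" "int z - i < int s" using assms by auto
    moreover have "int s dvd int z - i" using assms(3) by (metis dvd_minus_iff minus_diff_eq)
    ultimately show False using zdvd_not_zless by blast
  qed
  then have "i = int (z + nat (i - int z))" by simp
  moreover have "s dvd nat (i - int z)" using assms(3) \<open>i \<ge> int z\<close> by (metis int_dvd_int_iff diff_ge_0_iff_ge int_nat_eq)
  ultimately show ?thesis using that by blast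
qed

lemma class_not_dvd:
  assumes "0 < z" "z < s" "int s dvd (i - int z)"
  shows "\<not> int s dvd i"
proof
  assume "int s dvd i"
  then have "int s dvd int z" using assms(3) by (metis dvd_diff_right_iff)
  then show False using assms by (auto dest: dvd_imp_le)
qed

text \<open>The linear periods \<open>b\<close> and \<open>n - b\<close> together give the cyclic period \<open>b\<close>.\<close>

lemma cyclic_from_lin:
  assumes s: "s dvd n" "s dvd b" "0 < b" "b < n" and z: "0 < z" "z < s"
    and lin: "lin s z b" "lin s z (n - b)" and i: "int s dvd (i - int z)"
  shows "X (i + int b) = X i"
proof -
  have n: "n > 0" using s by simp
  have "int s dvd (i mod int n - int z)"
    using i s(1) by (metis dvd_diff_commute dvd_mod_iff int_dvd_int_iff mod_diff_left_eq)
  then obtain e where e: "s dvd e" "i mod int n = int (z + e)"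
    using int_class[OF z, of "i mod int n"] n by auto
  have lt: "z + e < n" using e(2) n by (metis of_nat_0_less_iff of_nat_less_iff pos_mod_bound)
  have Xi: "X i \<longleftrightarrow> z + e \<in> S" using X_nat[OF lt] e(2) X_mod[of i] by simp
  have "X (i + int b) = X (int (z + e + b))"
    using e(2) X_mod[of "i + int b"] X_mod[of "int (z + e + b)"] by (metis mod_add_left_eq of_nat_add)
  also have "\<dots> \<longleftrightarrow> z + e \<in> S"
  proof (cases "z + e + b < n")
    case True
    then show ?thesis using lin(1) e(1) X_nat[OF True] by (simp add: lin_def)
  next
    case False
    have ge: "z + e + b - n \<ge> z"
    proof -
      have "int s dvd (int (z + e + b - n) - int z)"
      proof -
        have "int (z + e + b - n) - int z = int e + int b - int n" using False by simp
        then show ?thesis using e(1) s by simp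
      qed
      from int_class[OF z this] obtain e'' where "int (z + e + b - n) = int (z + e'')" by auto
      then show ?thesis by simp
    qed
    define e' where "e' = e + b - n"
    have e': "z + e + b = z + e' + n" "s dvd e'" "z + e = z + e' + (n - b)"
      using ge False s e(1) by (auto simp: e'_def intro!: dvd_diff_nat)
    have "X (int (z + e + b)) = X (int (z + e'))" using X_n[of "int (z + e')"] by (simp add: e'(1))
    also have "\<dots> \<longleftrightarrow> z + e' \<in> S" using e' lt by (intro X_nat) simp
    also have "\<dots> \<longleftrightarrow> z + e \<in> S" using lin(2) e' lt unfolding lin_def by metis
    finally show ?thesis .
  qed
  finally show ?thesis using Xi by simp
qed

text \<open>A word of cyclic period \<open>g\<close> is seen completely in its first \<open>g\<close> positions. If \<open>k \<le> n - g\<close>, a constant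
  change under moving by \<open>k\<close> can be tested on all of them, and therefore holds cyclically;
  iterating, the change must be 0.\<close>

lemma window:
  assumes s: "s dvd g" "g \<le> n" "g > 0" and g: "\<And>k. k \<in> perset s \<longleftrightarrow> int g dvd k"
    and k: "s dvd k" "k \<le> n - g" and z: "0 < z" "z < s" and st: "step s z k \<kappa>"
  shows "\<kappa> = 0" and "int s dvd (i - int z) \<Longrightarrow> X (i + int k) = X i"
proof -
  have *: "of_bool (X (i + int k)) - of_bool (X i) = \<kappa>" if i: "int s dvd (i - int z)" for i
  proof -
    define i' where "i' = i mod int g"
    have i': "0 \<le> i'" "i' < int g" using s by (auto simp: i'_def)
    have e: "i = i' + int g * (i div int g)" by (simp add: i'_def)
    have per: "int g * (i div int g) \<in> perset s" unfolding g by simp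
    have sg: "int s dvd int g * (i div int g)" using s(1) by simp
    have i'z: "int s dvd (i' - int z)"
    proof -
      have "i' - int z = (i - int z) - int g * (i div int g)" using e by simp
      then show ?thesis using i sg by (metis dvd_diff)
    qed
    have nd: "\<not> int s dvd i'" "\<not> int s dvd (i' + int k)"
      using class_not_dvd[OF z i'z] k(1) by (auto simp: dvd_add_left_iff)
    have "X i = X i'" using per nd(1) e unfolding perset_def by (metis (mono_tags, lifting) mem_Collect_eq)
    moreover have "X (i + int k) = X (i' + int k)"
    proof -
      have "i + int k = (i' + int k) + int g * (i div int g)" using e by simp
      then show ?thesis using per nd(2) unfolding perset_def by (metis (mono_tags, lifting) mem_Collect_eq)
    qed
    moreover obtain e where "s dvd e" "i' = int (z + e)" using int_class[OF z i'z i'(1)] .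
    moreover from this have "z + e < g" using i' by simp
    ultimately show ?thesis using st k(2) s X_nat[of "z + e"] X_nat[of "z + e + k"] unfolding step_def by simp
  qed
  have "int s dvd (int z + int k - int z)" using k(1) by simp
  from *[OF this] *[of "int z"] show 0: "\<kappa> = 0"
    by (cases "X (int z)"; cases "X (int z + int k)"; cases "X (int z + int k + int k)") auto
  show "int s dvd (i - int z) \<Longrightarrow> X (i + int k) = X i"
    using *[of i] 0 by (cases "X i"; cases "X (i + int k)") auto
qed

text \<open>The invariant of the iteration: \<open>g\<close> generates the group of periods of \<open>S\<close> off the multiples of \<open>s\<close>, the two
  sets coincide off the multiples of \<open>g\<close>, and for weights on multiples of \<open>s\<close> the degrees of \<open>theta\<close> that
  are not too close to \<open>n\<close> are multiples of \<open>g\<close>. The goal is \<open>g = s\<close>.\<close>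

definition invar :: "nat \<Rightarrow> nat \<Rightarrow> bool" where
  "invar s g \<longleftrightarrow> s dvd n \<and> s dvd g \<and> 0 < g \<and> g dvd n \<and> (\<forall>k. k \<in> perset s \<longleftrightarrow> int g dvd k) \<and>
     (\<forall>b\<in>dif. g dvd b) \<and> (\<forall>h k. supported s h \<longrightarrow> theta h $ k \<noteq> 0 \<longrightarrow> k \<le> n - g \<longrightarrow> g dvd k)"

lemma int_class_ex:
  assumes "s > 0" "\<not> int s dvd i"
  obtains z where "0 < z" "z < s" "int s dvd (i - int z)"
proof
  have m: "0 \<le> i mod int s" "i mod int s < int s" "i mod int s \<noteq> 0" using assms by (auto simp: dvd_eq_mod_eq_0)
  show "0 < nat (i mod int s)" using m by simp
  show "nat (i mod int s) < s" using m by (simp add: nat_less_iff)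
  show "int s dvd (i - int (nat (i mod int s)))" using m by (simp add: minus_mod_eq_mult_div)
qed

text \<open>An element \<open>b\<close> of \<open>dif\<close> is a degree of some \<open>theta h\<close> with all degrees multiples of \<open>b\<close>, so it is a period
  of each word or a constant jump. For \<open>2 * b < n\<close> a jump would be repeated, which 0-1 words do not allow; the
  periods \<open>b\<close> rule out a jump by \<open>n - b\<close>. Hence all elements of \<open>dif\<close> are cyclic periods. For general \<open>theta h\<close>
  the bound \<open>k \<le> n - g\<close> allows \<open>window\<close> to exclude jumps.\<close>

theorem invar_base:
  assumes s: "s dvd n" and off: "\<And>b. b \<in> dif \<Longrightarrow> s dvd b" and n: "n > 0"
    and good: "\<And>z h. 0 < z \<Longrightarrow> z < s \<Longrightarrow> supported s h \<Longrightarrow> class_good s z h"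
  obtains g where "invar s g"
proof -
  have s0: "s > 0" using s n by (auto intro: Nat.gr0I)
  obtain g where g: "g > 0" "g dvd n" and gen: "\<And>k. k \<in> perset s \<longleftrightarrow> int g dvd k"
    using perset_generator[OF n s] by metis
  have sg: "s dvd g" using gen[of "int g"] by (simp add: perset_def)
  have gn: "g \<le> n" using g n by (simp add: dvd_imp_le)
  have lin: "lin s z b" if z: "0 < z" "z < s" and b: "b \<in> dif" for z b
  proof -
    have ge: "lin s z b \<or> (\<exists>\<kappa>. \<kappa> \<noteq> 0 \<and> step s z b \<kappa>)" if b: "b \<in> dif" for b
    proof -
      let ?h = "\<lambda>m. if m = b then 1 else (0::real)"
      have h: "theta ?h $ b \<noteq> 0" "supported b ?h" using theta_single[OF b] by auto
      have hb: "b dvd k" if "theta ?h $ k \<noteq> 0" for k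
        using supportedD[OF supported_theta[OF h(2)]] that by blast
      have b0: "0 < b" using dif_range[OF b] by simp
      have "class_good s z ?h" using good[OF z supported_mono[OF h(2) off[OF b]]] .
      then show ?thesis unfolding class_good_def
      proof (elim disjE exE conjE)
        fix k0 \<kappa> assume k0: "0 < k0" "theta ?h $ k0 \<noteq> 0" "\<forall>k. 0 < k \<and> k < k0 \<and> theta ?h $ k \<noteq> 0 \<longrightarrow> lin s z k" "\<kappa> \<noteq> 0" "step s z k0 \<kappa>"
        have "b \<le> k0" using hb[OF k0(2)] k0(1) by (simp add: dvd_imp_le)
        then show ?thesis using k0 h(1) b0 by (cases "b = k0") auto
      qed (use h b0 in blast)
    qed
    have half: "lin s z b" if b: "b \<in> dif" "2 * b < n" for b
    proof -
      have "\<kappa> = 0" if st: "step s z b \<kappa>" for \<kappa>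
      proof -
        have sb: "s dvd b" using off[OF b(1)] .
        have "2 * b + s \<le> n" by (rule mult_less_n[OF s]) (use sb b in auto)
        then have "z + 0 + b < n" "z + b + b < n" using z by simp_all
        then have "of_bool (z + b \<in> S) - of_bool (z \<in> S) = \<kappa>" "of_bool (z + b + b \<in> S) - of_bool (z + b \<in> S) = \<kappa>"
          using st[unfolded step_def, rule_format, of 0] st[unfolded step_def, rule_format, of b] sb by simp_all
        then show ?thesis by (cases "z \<in> S"; cases "z + b \<in> S"; cases "z + b + b \<in> S") auto
      qed
      then show ?thesis using ge[OF b(1)] by blast
    qed
    show ?thesis using b
    proof (rule dif_small)
      fix b assume b: "b \<in> dif" "2 * b < n"
      have sb: "s dvd b" "0 < b" "b < n" using off[OF b(1)] dif_range[OF b(1)] by auto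
      have "\<kappa> = 0" if st: "step s z (n - b) \<kappa>" for \<kappa>
      proof (rule ccontr)
        assume k0: "\<kappa> \<noteq> 0"
        have "s dvd (n - b)" using sb s by (simp add: dvd_diff_nat)
        then have "n - b + s \<le> n" using mult_less_n[OF s, of "n - b"] sb by linarith
        then have lt: "z + 0 + (n - b) < n" using z by simp
        then have k: "of_bool (z + (n - b) \<in> S) - of_bool (z \<in> S) = \<kappa>" using st[unfolded step_def, rule_format, of 0] by simp
        have all: "z + e \<in> S \<longleftrightarrow> z \<in> S" if "s dvd e" "z + e < n" for e
          using that
        proof (induction e rule: less_induct)
          case (less e)
          show ?case
          proof (cases "e < b")
            case False
            then obtain e' where e': "e = e' + b" by (metis le_add_diff_inverse2 not_less)
            then have d: "s dvd e'" using less.prems(1) sb by (simp add: dvd_add_left_iff)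
            then have "z + e' + b \<in> S \<longleftrightarrow> z + e' \<in> S"
              using half[OF b, unfolded lin_def, rule_format, of e'] less.prems(2) e' by (simp add: add.assoc)
            then show ?thesis using less.IH[of e'] less.prems sb e' d by (simp add: add.assoc)
          next
            case True
            \<comment> \<open>On the first block of length \<open>b\<close> the word is constant, because adding \<open>n - b\<close>
                changes it by the same non-zero amount everywhere.\<close>
            have "e + s \<le> b" by (rule mult_less_n) (use sb less.prems True in auto)
            then have "z + e + (n - b) < n" using z sb by simp
            then have "of_bool (z + e + (n - b) \<in> S) - of_bool (z + e \<in> S) = \<kappa>" using st less.prems unfolding step_def by blast
            then show ?thesis using k k0
              by (cases "z \<in> S"; cases "z + e \<in> S"; cases "z + (n - b) \<in> S"; cases "z + e + (n - b) \<in> S") auto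
          qed
        qed
        then have "z + (n - b) \<in> S \<longleftrightarrow> z \<in> S" using all[of "n - b"] lt sb s by (simp add: dvd_diff_nat)
        then show False using k k0 by simp
      qed
      then show "lin s z b \<and> lin s z (n - b)" using ge[OF dif_sym[OF b(1)]] half[OF b] by blast
    qed
  qed
  have difp: "g dvd b" if b: "b \<in> dif" for b
  proof -
    have sb: "s dvd b" "0 < b" "b < n" using off[OF b] dif_range[OF b] by auto
    have "X (i + int b) = X i" if i: "\<not> int s dvd i" for i
    proof -
      obtain z where z: "0 < z" "z < s" "int s dvd (i - int z)" using int_class_ex[OF s0 i] .
      show ?thesis by (rule cyclic_from_lin[OF s sb z(1,2) lin[OF z(1,2) b] lin[OF z(1,2) dif_sym[OF b]] z(3)])
    qed
    then have "int b \<in> perset s" using sb by (simp add: perset_def)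
    then show ?thesis unfolding gen by simp
  qed
  have th: "g dvd k" if h: "supported s h" "theta h $ k \<noteq> 0" "k \<le> n - g" for h k
  proof (cases "k = 0")
    case False
    have sk: "s dvd j" if "theta h $ j \<noteq> 0" for j
      using supportedD[OF supported_theta[OF h(1)], of j] that by metis
    have "X (i + int k) = X i" if i: "\<not> int s dvd i" for i
    proof -
      obtain z where z: "0 < z" "z < s" "int s dvd (i - int z)" using int_class_ex[OF s0 i] .
      have "lin s z k" using good[OF z(1,2) h(1)] unfolding class_good_def
      proof (elim disjE exE conjE)
        fix k0 \<kappa> assume k0: "0 < k0" "theta h $ k0 \<noteq> 0" "\<forall>k. 0 < k \<and> k < k0 \<and> theta h $ k \<noteq> 0 \<longrightarrow> lin s z k" "\<kappa> \<noteq> 0" "step s z k0 \<kappa>"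
        show ?thesis
        proof (cases "k < k0")
          case True
          then show ?thesis using k0(3) h(2) False by blast
        next
          case False
          then have "\<kappa> = 0" using window(1)[OF sg gn g(1) gen sk[OF k0(2)] _ z(1,2) k0(5)] h(3) by simp
          then show ?thesis using k0 by simp
        qed
      qed (use h False in blast)
      then show ?thesis using window(2)[OF sg gn g(1) gen sk[OF h(2)] h(3) z(1,2) _ z(3)] unfolding lin_step by blast
    qed
    then have "int k \<in> perset s" using sk[OF h(2)] by (simp add: perset_def)
    then show ?thesis unfolding gen by simp
  qed simp
  show ?thesis by (rule that[of g]) (use s sg g gen difp th in \<open>auto simp: invar_def\<close>)
qed

section \<open>Enlarging the modulus\<close>

lemma step_reflect:
  assumes s: "s dvd n" and k: "s dvd k" and z: "0 < z" "z < s"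
    and symz: "\<And>e. s dvd e \<Longrightarrow> z + e < n \<Longrightarrow> n - (z + e) \<in> S \<longleftrightarrow> z + e \<in> S"
    and st: "step s (s - z) k \<kappa>"
  shows "step s z k (- \<kappa>)"
  unfolding step_def
proof (intro allI impI)
  fix e assume e: "s dvd e" "z + e + k < n"
  have ek: "s dvd (e + k)" "e + k < n" using e k by auto
  then have le: "e + k + s \<le> n" using mult_less_n[OF s] by blast
  define e' where "e' = n - (e + k + s)"
  have e': "s dvd e'" using ek s by (simp add: e'_def dvd_diff_nat)
  have eq: "s - z + e' = n - (z + (e + k))" "s - z + e' + k = n - (z + e)"
    using le z by (simp_all add: e'_def)
  have lt: "n - (z + e) < n" using z e by simp
  have "of_bool (n - (z + e) \<in> S) - of_bool (n - (z + (e + k)) \<in> S) = \<kappa>"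
    using st[unfolded step_def, rule_format, OF e', unfolded eq(2), unfolded eq(1), OF lt] .
  then show "of_bool (z + e + k \<in> S) - of_bool (z + e \<in> S) = - \<kappa>"
    using symz[OF e(1)] symz[OF ek(1)] e(2) by (simp add: add.assoc)
qed

lemma class_good_reflect:
  assumes s: "s dvd n" and h: "supported s h" and z: "0 < z" "z < s"
    and symz: "\<And>e. s dvd e \<Longrightarrow> z + e < n \<Longrightarrow> n - (z + e) \<in> S \<longleftrightarrow> z + e \<in> S"
    and good: "class_good s (s - z) h"
  shows "class_good s z h"
proof -
  have sk: "s dvd j" if "theta h $ j \<noteq> 0" for j
    using supportedD[OF supported_theta[OF h], of j] that by metis
  have refl: "step s z j (- \<kappa>)" if "theta h $ j \<noteq> 0" "step s (s - z) j \<kappa>" for j \<kappa>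
    by (rule step_reflect[OF s sk[OF that(1)] z symz that(2)])
  have linr: "lin s z j" if "theta h $ j \<noteq> 0" "lin s (s - z) j" for j
    using refl[OF that(1), of 0] that(2) by (simp add: lin_step)
  show ?thesis using good unfolding class_good_def
  proof (elim disjE exE conjE)
    fix k0 \<kappa> assume "0 < k0" "theta h $ k0 \<noteq> 0"
      "\<forall>k. 0 < k \<and> k < k0 \<and> theta h $ k \<noteq> 0 \<longrightarrow> lin s (s - z) k" "\<kappa> \<noteq> 0" "step s (s - z) k0 \<kappa>"
    then show "(\<forall>k>0. theta h $ k \<noteq> 0 \<longrightarrow> lin s z k) \<or>
     (\<exists>k0>0. theta h $ k0 \<noteq> 0 \<and> (\<forall>k. 0 < k \<and> k < k0 \<and> theta h $ k \<noteq> 0 \<longrightarrow> lin s z k) \<and>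
        (\<exists>\<kappa>. \<kappa> \<noteq> 0 \<and> step s z k0 \<kappa>))"
      using linr refl[of k0 \<kappa>] by (intro disjI2 exI[of _ k0] conjI exI[of _ "- \<kappa>"]) auto
  qed (use linr in blast)
qed

text \<open>The formal derivative is the analytic one. Analytic derivatives also apply to \<open>theta\<close>, a quotient
  of path series.\<close>

lemma path_sum_deriv:
  fixes h :: "nat \<Rightarrow> real"
  assumes "h m = 0"
  shows "((\<lambda>x. path_sum T (h(m := x)) k) has_real_derivative (path_sum T (perturb h m) k $ Suc 0)) (at 0)"
proof (induction k rule: less_induct)
  case (less k)
  show ?case
  proof (cases "k > 0 \<and> k \<in> T")
    case False
    then show ?thesis by (cases "k = 0") (auto simp: path_sum_pos)
  next
    case True
    have h0: "h(m := 0) = h" by (metis fun_upd_triv assms)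
    have hd: "((\<lambda>x. (h(m := x)) j) has_real_derivative (if j = m then 1 else 0)) (at 0)" for j
      by (cases "j = m") auto
    have "((\<lambda>x. \<Sum>i<k. path_sum T (h(m := x)) i * (h(m := x)) (k - i)) has_real_derivative
       (\<Sum>i<k. path_sum T (perturb h m) i $ Suc 0 * (h(m := 0)) (k - i) + (if k - i = m then 1 else 0) * path_sum T (h(m := 0)) i)) (at 0)"
      by (intro DERIV_sum DERIV_mult less hd) auto
    also have "(\<Sum>i<k. path_sum T (perturb h m) i $ Suc 0 * (h(m := 0)) (k - i) + (if k - i = m then 1 else 0) * path_sum T (h(m := 0)) i)
      = path_sum T (perturb h m) k $ Suc 0"
      using True unfolding h0
      by (simp add: path_sum_pos fps_sum_nth fps_mult_nth_Suc_0 path_sum_perturb_0 sum.distrib mult.commute add.commute)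
    finally show ?thesis using True by (simp add: path_sum_pos)
  qed
qed

lemma theta_deriv:
  assumes "h m = 0"
  shows "\<exists>D. ((\<lambda>x. theta (h(m := x)) $ k) has_real_derivative D) (at 0)"
proof (induction k rule: less_induct)
  case (less k)
  then obtain D where D: "\<And>i. i < k \<Longrightarrow> ((\<lambda>x. theta (h(m := x)) $ i) has_real_derivative D i) (at 0)" by metis
  have "((\<lambda>x. path_sum R' (h(m := x)) k - (\<Sum>i<k. theta (h(m := x)) $ i * path_sum R (h(m := x)) (k - i)))
     has_real_derivative (path_sum R' (perturb h m) k $ Suc 0 -
      (\<Sum>i<k. D i * path_sum R (h(m := 0)) (k - i) + path_sum R (perturb h m) (k - i) $ Suc 0 * theta (h(m := 0)) $ i))) (at 0)"
    by (intro DERIV_diff DERIV_sum DERIV_mult path_sum_deriv D assms) auto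
  then show ?case unfolding theta_rec[symmetric] by blast
qed

text \<open>The equation \<open>q' = theta * q\<close> is differentiated with respect to a weight \<open>h m\<close>, where \<open>m\<close> is a multiple of \<open>s\<close> but not of \<open>g\<close>,
  at a point where all weights are on multiples of \<open>g\<close>. By the invariant only degrees
  divisible by \<open>g\<close> occur in \<open>theta\<close>, up to degree \<open>n - g\<close>, also for the perturbed weights, so the terms with the derivative of \<open>theta\<close>
  are multiplied by coefficients of \<open>q\<close> in degrees not divisible by \<open>g\<close>, which vanish.\<close>

lemma first_variation:
  assumes inv: "invar s g" and h: "supported g h" and m: "s dvd m" "\<not> g dvd m"
    and r: "g dvd r" "m + r \<le> n - g"
  shows "(actf R h m (pf R' h) - theta h * actf R h m (pf R h)) $ r = 0"
proof -
  have hm: "h m = 0" using supportedD[OF h m(2)] .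
  have m0: "m > 0" using m(2) by (auto intro: Nat.gr0I)
  define E where "E = m + r"
  define I where "I = {i. i \<le> E \<and> g dvd i}"
  have fin: "finite I" by (simp add: I_def)
  have h0: "h(m := 0) = h" by (metis fun_upd_triv hm)
  obtain D where D: "\<And>i. ((\<lambda>x. theta (h(m := x)) $ i) has_real_derivative D i) (at 0)"
    using theta_deriv[of h m, OF hm] by metis
  have eq: "path_sum R' (h(m := x)) E = (\<Sum>i\<in>I. theta (h(m := x)) $ i * path_sum R (h(m := x)) (E - i))" for x
  proof -
    have sup: "supported s (h(m := x))"
      using supported_mono[OF h] inv m by (auto simp: invar_def supported_def)
    have "path_sum R' (h(m := x)) E = (\<Sum>i\<le>E. theta (h(m := x)) $ i * path_sum R (h(m := x)) (E - i))"
      using theta_rec[of "h(m := x)" E] by (simp add: lessThan_Suc_atMost[symmetric])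
    \<comment> \<open>The bound \<open>E \<le> n - g\<close> is what makes the invariant applicable to the perturbed weights.\<close>
    also have "\<dots> = (\<Sum>i\<in>I. theta (h(m := x)) $ i * path_sum R (h(m := x)) (E - i))"
      using inv sup r by (intro sum.mono_neutral_right) (auto simp: I_def invar_def E_def)
    finally show ?thesis .
  qed
  have nd: "\<not> g dvd E - i" if "i \<in> I" for i
  proof
    assume "g dvd E - i"
    then have "g dvd E" using that by (metis (mono_tags, lifting) I_def dvd_diffD mem_Collect_eq)
    then show False using m(2) r(1) by (simp add: E_def dvd_add_left_iff)
  qed
  have "((\<lambda>x. \<Sum>i\<in>I. theta (h(m := x)) $ i * path_sum R (h(m := x)) (E - i)) has_real_derivative
     (\<Sum>i\<in>I. D i * path_sum R (h(m := 0)) (E - i) + path_sum R (perturb h m) (E - i) $ Suc 0 * theta (h(m := 0)) $ i)) (at 0)"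
    by (intro DERIV_sum DERIV_mult D path_sum_deriv[of h m, OF hm])
  moreover have "((\<lambda>x. \<Sum>i\<in>I. theta (h(m := x)) $ i * path_sum R (h(m := x)) (E - i)) has_real_derivative
     path_sum R' (perturb h m) E $ Suc 0) (at 0)"
    using path_sum_deriv[of h m R' E, OF hm] unfolding eq .
  ultimately have "path_sum R' (perturb h m) E $ Suc 0 =
     (\<Sum>i\<in>I. D i * path_sum R h (E - i) + path_sum R (perturb h m) (E - i) $ Suc 0 * theta h $ i)"
    unfolding h0 using DERIV_unique by blast
  also have "\<dots> = (\<Sum>i\<in>I. path_sum R (perturb h m) (E - i) $ Suc 0 * theta h $ i)"
    by (intro sum.cong refl) (simp add: supportedD[OF supported_path_sum[OF h] nd])
  also have "\<dots> = (\<Sum>i\<in>I. theta h $ i * (if m \<le> E - i then act R h m (path_sum R h) (E - i - m) else 0))"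
    by (simp add: path_sum_perturb_1[OF m0] mult.commute)
  also have "\<dots> = (\<Sum>i\<le>r. theta h $ i * act R h m (path_sum R h) (r - i))"
  proof (rule sum.mono_neutral_cong)
    fix i assume "i \<in> {..r} - I"
    then have "\<not> g dvd i" by (auto simp: I_def E_def)
    then show "theta h $ i * act R h m (path_sum R h) (r - i) = 0" using supportedD[OF supported_theta[OF h]] by simp
  qed (auto simp: I_def E_def)
  also have "\<dots> = (theta h * actf R h m (pf R h)) $ r"
    by (simp add: fps_mult_nth atMost_atLeast0)
  also have "path_sum R' (perturb h m) E $ Suc 0 = act R' h m (path_sum R' h) r"
    by (simp add: path_sum_perturb_1[OF m0] E_def)
  also have "act R' h m (path_sum R' h) r = act R h m (path_sum R' h) r"
  proof (rule act_cong_supported[OF h supported_path_sum[OF h]])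
    fix i assume "g dvd i"
    then have "\<not> g dvd m + i" using m by (simp add: dvd_add_left_iff)
    moreover have "j \<in> S \<longleftrightarrow> j \<in> S'" if "\<not> g dvd j" for j
      using inv that by (auto simp: invar_def dif_def)
    ultimately show "m + i \<in> R' \<longleftrightarrow> m + i \<in> R" using rev_set_off[of g S S' n] inv by (auto simp: invar_def)
  qed
  finally show ?thesis by simp
qed

text \<open>The modulus \<open>s\<close> is replaced by \<open>g\<close>. Residue classes modulo \<open>g\<close> that are not multiples of \<open>s\<close> are already \<open>g\<close>-periodic.
  On the others the word is symmetric; \<open>first_variation\<close> and \<open>row_defect\<close> make every degree
  of \<open>theta h\<close> a period, up to a last block, which the symmetry supplies. The common period \<open>g'\<close> of all these words
  then satisfies the invariant with respect to \<open>g\<close>.\<close>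

theorem invar_step:
  assumes inv: "invar s g" and ne: "dif \<noteq> {}"
    and sym: "\<And>i. 0 < i \<Longrightarrow> i < n \<Longrightarrow> s dvd i \<Longrightarrow> \<not> g dvd i \<Longrightarrow> n - i \<in> S \<longleftrightarrow> i \<in> S"
  obtains g' where "invar g g'"
proof -
  have g: "s dvd n" "s dvd g" "0 < g" "g dvd n" and gen: "\<And>k. k \<in> perset s \<longleftrightarrow> int g dvd k"
    and difg: "\<And>b. b \<in> dif \<Longrightarrow> g dvd b" using inv by (auto simp: invar_def)
  obtain b0 where b0: "b0 \<in> dif" using ne by auto
  have n: "n > 0" using dif_range[OF b0] by simp
  obtain g' where g': "g' > 0" "g' dvd n" and gen': "\<And>k. k \<in> perset g \<longleftrightarrow> int g' dvd k"
    using perset_generator[OF n g(4)] by metis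
  have gg': "g dvd g'" using gen'[of "int g'"] by (simp add: perset_def)
  have g'n: "g' \<le> n" using g' n by (simp add: dvd_imp_le)
  have lin3: "3 * g \<le> n"
  proof -
    have "2 * g < n"
      using b0
    proof (rule dif_small)
      fix b assume b: "b \<in> dif" "2 * b < n"
      then have "g \<le> b" using difg[OF b(1)] dif_range[OF b(1)] by (auto intro: dvd_imp_le)
      then show "2 * g < n \<and> 2 * g < n" using b by simp
    qed
    then show ?thesis using mult_less_n[OF g(4), of "2 * g"] by simp
  qed
  have symz: "n - (z + e) \<in> S \<longleftrightarrow> z + e \<in> S" if "0 < z" "z < g" "s dvd z" "g dvd e" "z + e < n" for z e
  proof -
    have "\<not> g dvd z" using that by (auto dest: dvd_imp_le)
    then have "\<not> g dvd z + e" using that by (simp add: dvd_add_left_iff)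
    moreover have "s dvd z + e" using that g(2) by (meson dvd_add dvd_trans)
    ultimately show ?thesis using sym that by simp
  qed
  have trunc: "z + e + k \<in> S \<longleftrightarrow> z + e \<in> S"
    if z: "0 < z" "z < g" "s dvd z" and h: "supported g h" and "theta h $ k \<noteq> 0" "k > 0" "g dvd e" "z + e + k \<le> n - g" for z h k e
    using that(5-)
  proof (induction k arbitrary: e rule: less_induct)
    case (less k)
    have gk: "g dvd k" using supportedD[OF supported_theta[OF h], of k] less.prems(1) by metis
    have RS: "z + x \<in> R \<longleftrightarrow> z + x \<in> S" if "g dvd x" "z + x < n" for x
      using symz[OF z that] that z by (simp add: rev_set_def)
    have m: "s dvd z + e" "\<not> g dvd z + e"
    proof -
      show "s dvd z + e" using z less.prems(3) g(2) by (meson dvd_add dvd_trans)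
      have "\<not> g dvd z" using z by (auto dest: dvd_imp_le)
      then show "\<not> g dvd z + e" using less.prems(3) by (simp add: dvd_add_left_iff)
    qed
    have "(actf R h (z + e) (theta h * pf R h) - theta h * actf R h (z + e) (pf R h)) $ k =
      (if k = k then theta h $ k * (of_bool (z + e + k \<in> R) - of_bool (z + e \<in> R)) else 0)"
    proof (rule row_defect[OF h])
      fix j x assume j: "0 < j" "j < k" "theta h $ j \<noteq> 0" "g dvd x" "j + x \<le> k"
      have gj: "g dvd j" using supportedD[OF supported_theta[OF h], of j] j(3) by metis
      have lt: "z + (e + x) + j \<le> n - g" using j less.prems(4) by simp
      have ex: "g dvd e + x" "g dvd e + x + j" using j less.prems(3) gj by auto
      have "z + (e + x) + j \<in> S \<longleftrightarrow> z + (e + x) \<in> S" using less.IH[OF j(2,3,1) ex(1) lt] .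
      then show "z + e + j + x \<in> R \<longleftrightarrow> z + e + x \<in> R"
        using RS[OF ex(1)] RS[OF ex(2)] lt g(3) lin3 by (simp add: add_ac)
    qed (use less.prems supported_path_sum[OF h] in auto)
    moreover have "(actf R h (z + e) (theta h * pf R h) - theta h * actf R h (z + e) (pf R h)) $ k = 0"
      unfolding theta[symmetric] by (rule first_variation[OF inv h m gk less.prems(4)])
    ultimately have "(of_bool (z + e + k \<in> R) :: real) = of_bool (z + e \<in> R)" using less.prems(1) by simp
    then have "z + e + k \<in> R \<longleftrightarrow> z + e \<in> R" by (simp only: of_bool_eq_iff)
    then show ?case using RS[of "e + k"] RS[of e] gk less.prems lin3 g(3) by (simp add: add_ac)
  qed
  have lin: "lin g z k" if z: "0 < z" "z < g" "s dvd z" and h: "supported g h" and k: "theta h $ k \<noteq> 0" "k > 0" "k \<noteq> n - g" for z h k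
    unfolding lin_def
  proof (intro allI impI)
    fix e assume e: "g dvd e" "z + e + k < n"
    have gk: "g dvd k" using supportedD[OF supported_theta[OF h], of k] k(1) by metis
    show "z + e + k \<in> S \<longleftrightarrow> z + e \<in> S"
    proof (cases "z + e + k \<le> n - g")
      case True
      then show ?thesis by (rule trunc[OF z h k(1,2) e(1)])
    next
      case False
      have ek: "g dvd (e + k)" "e + k < n" using e gk by auto
      then have le: "e + k + g \<le> n" using mult_less_n[OF g(4)] by blast
      have "e \<noteq> 0"
      proof
        assume "e = 0"
        then have "k \<le> n - g" using le by simp
        then have "k + g < n" using k(3) by simp
        then have "k + g + g \<le> n" using mult_less_n[OF g(4), of "k + g"] gk by simp
        then show False using False \<open>e = 0\<close> z by simp
      qed
      then have ge: "g \<le> e" using e(1) by (auto intro: dvd_imp_le)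
      define e' where "e' = n - (e + k + g)"
      have e': "g dvd e'" using ek g(4) by (simp add: e'_def dvd_diff_nat)
      have eq: "g - z + e' = n - (z + (e + k))" "g - z + e' + k = n - (z + e)"
        using le z by (simp_all add: e'_def)
      have z': "0 < g - z" "g - z < g" "s dvd g - z" using z g(2) by (auto intro: dvd_diff_nat)
      have "g - z + e' + k \<le> n - g" unfolding eq(2) using ge z by simp
      from trunc[OF z' h k(1,2) e' this, unfolded eq(2), unfolded eq(1)] show ?thesis
        using symz[OF z e(1)] symz[OF z ek(1)] e(2) by (simp add: add.assoc)
    qed
  qed
  have split: "\<not> int s dvd i \<or> (\<exists>z. 0 < z \<and> z < g \<and> s dvd z \<and> int g dvd (i - int z))" if i: "\<not> int g dvd i" for i
  proof (cases "int s dvd i")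
    case True
    obtain z where z: "0 < z" "z < g" "int g dvd (i - int z)" using int_class_ex[OF g(3) i] .
    then have "int s dvd i - (i - int z)" using True g(2) by (meson dvd_diff dvd_trans int_dvd_int_iff)
    then show ?thesis using z by auto
  qed simp
  have easy: "X (i + k) = X i" if "\<not> int s dvd i" "int g dvd k" for i k
    using that gen[of k] by (simp add: perset_def)
  have ling: "lin g z b" if z: "0 < z" "z < g" "s dvd z" and b: "b \<in> dif" for z b
  proof -
    have ge: "lin g z b" if b: "b \<in> dif" "b \<noteq> n - g" for b
      using lin[OF z supported_mono[OF theta_single(2)[OF b(1)] difg[OF b(1)]] theta_single(1)[OF b(1)] _ b(2)] dif_range[OF b(1)] by simp
    show ?thesis
    proof (cases "b = n - g")
      case True
      then have "g \<in> dif" using dif_sym[OF b] g(3) lin3 by simp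
      moreover have "g \<noteq> n - g" using lin3 g(3) by simp
      ultimately have "lin g z g" using ge by blast
      moreover obtain j where "b = j * g" using difg[OF b] by (metis dvd_def mult.commute)
      ultimately show ?thesis using lin_mult[of g z g j] by simp
    qed (use ge b in blast)
  qed
  have difg': "g' dvd b" if b: "b \<in> dif" for b
  proof -
    have sb: "g dvd b" "0 < b" "b < n" using difg[OF b] dif_range[OF b] by auto
    have "X (i + int b) = X i" if i: "\<not> int g dvd i" for i
    proof (cases "int s dvd i")
      case True
      then obtain z where z: "0 < z" "z < g" "s dvd z" "int g dvd (i - int z)" using split[OF i] by auto
      show ?thesis by (rule cyclic_from_lin[OF g(4) sb z(1,2) ling[OF z(1-3) b] ling[OF z(1-3) dif_sym[OF b]] z(4)])
    qed (use easy sb in simp)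
    then have "int b \<in> perset g" using sb by (simp add: perset_def)
    then show ?thesis unfolding gen' by simp
  qed
  have th: "g' dvd k" if h: "supported g h" "theta h $ k \<noteq> 0" "k \<le> n - g'" for h k
  proof (cases "k = 0 \<or> k = n - g")
    case True
    moreover have "g' = g" if "k = n - g" "k \<noteq> 0"
      using h(3) that gg' g'(1) g(3) lin3 by (metis diff_le_mono2 dvd_antisym dvd_imp_le le_antisym diff_diff_cancel g'n order_trans mult.commute le_add1 mult_2 add.commute nle_le)
    moreover have "g dvd n - g" using g(4) by (simp add: dvd_diff_nat)
    ultimately show ?thesis by (cases "k = 0") auto
  next
    case False
    have gk: "g dvd k" using supportedD[OF supported_theta[OF h(1)], of k] h(2) by metis
    have "X (i + int k) = X i" if i: "\<not> int g dvd i" for i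
    proof (cases "int s dvd i")
      case True
      then obtain z where z: "0 < z" "z < g" "s dvd z" "int g dvd (i - int z)" using split[OF i] by auto
      have "lin g z k" by (rule lin[OF z(1-3) h(1,2)]) (use False in auto)
      then show ?thesis using window(2)[OF gg' g'n g'(1) gen' gk h(3) z(1,2) _ z(4)] unfolding lin_step by blast
    qed (use easy gk in simp)
    then have "int k \<in> perset g" using gk by (simp add: perset_def)
    then show ?thesis unfolding gen' by simp
  qed
  show ?thesis by (rule that[of g']) (use g gg' g' gen' difg' th in \<open>auto simp: invar_def\<close>)
qed

text \<open>The largest \<open>s\<close> for which the invariant holds with some \<open>g\<close> has \<open>g = s\<close>, since otherwise
  \<open>invar_step\<close> would give the larger modulus \<open>g\<close>.\<close>

theorem periodic_decomposition:
  assumes base: "s1 dvd n" "\<And>b. b \<in> dif \<Longrightarrow> s1 dvd b" and ne: "dif \<noteq> {}"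
    and good: "\<And>z h. 0 < z \<Longrightarrow> z < s1 \<Longrightarrow> supported s1 h \<Longrightarrow> class_good s1 z h"
    and sym: "\<And>g i. g dvd n \<Longrightarrow> (\<And>b. b \<in> dif \<Longrightarrow> g dvd b) \<Longrightarrow> 0 < i \<Longrightarrow> i < n \<Longrightarrow> s1 dvd i \<Longrightarrow> \<not> g dvd i
       \<Longrightarrow> n - i \<in> S \<longleftrightarrow> i \<in> S"
  obtains s where "s1 dvd s" "s dvd n" "0 < s" "s < n" "\<And>b. b \<in> dif \<Longrightarrow> s dvd b"
    "\<And>i k. \<not> int s dvd i \<Longrightarrow> int s dvd k \<Longrightarrow> X (i + k) = X i"
proof -
  obtain b0 where b0: "b0 \<in> dif" using ne by auto
  have n: "n > 0" using dif_range[OF b0] by simp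
  define P where "P s \<longleftrightarrow> s1 dvd s \<and> (\<exists>g. invar s g)" for s
  obtain g where "invar s1 g" using invar_base[OF base n good] by metis
  then have P1: "P s1" by (auto simp: P_def)
  have bound: "s \<le> n" if "P s" for s using that n by (auto simp: P_def invar_def intro: dvd_imp_le)
  have fin: "finite {s. P s}" by (rule finite_subset[of _ "{..n}"]) (use bound in auto)
  define s where "s = Max {s. P s}"
  have s: "P s" "\<And>s'. P s' \<Longrightarrow> s' \<le> s"
    using Max_in[OF fin] P1 Max_ge[OF fin] by (auto simp: s_def)
  from s(1) obtain g where inv: "invar s g" and s1: "s1 dvd s" by (auto simp: P_def)
  have g: "s dvd n" "s dvd g" "g dvd n" "0 < g" using inv by (auto simp: invar_def)
  have dg: "g dvd b" if "b \<in> dif" for b using inv that by (auto simp: invar_def)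
  obtain g' where "invar g g'"
  proof (rule invar_step[OF inv ne])
    fix i assume "0 < i" "i < n" "s dvd i" "\<not> g dvd i"
    then show "n - i \<in> S \<longleftrightarrow> i \<in> S" using sym[OF g(3) dg] s1 dvd_trans by blast
  qed
  then have "P g" using s1 g(2) by (auto simp: P_def intro: dvd_trans)
  then have "g = s" using s(2)[of g] g by (simp add: dvd_imp_le le_antisym)
  then have inv: "invar s s" using inv by simp
  have s0: "0 < s" using inv by (simp add: invar_def)
  have db: "s dvd b" if "b \<in> dif" for b using dg that \<open>g = s\<close> by simp
  have lt: "s < n" using db[OF b0] dif_range[OF b0] by (meson dvd_imp_le le_less_trans)
  have per: "X (i + k) = X i" if "\<not> int s dvd i" "int s dvd k" for i k
  proof -
    have "k \<in> perset s" using inv that(2) by (simp add: invar_def)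
    then show ?thesis using that(1) by (simp add: perset_def)
  qed
  show ?thesis by (rule that[OF s1 g(1) s0 lt db per])
qed

end

section \<open>Finding the decomposition\<close>

lemma path_types_rev_set:
  assumes "n > 0"
  shows "path_types n (rev_set n S) = path_types n S"
proof -
  have "bij_betw rev (paths (insert n (rev_set n S)) n) (paths (insert n S) n)"
    by (rule bij_betw_rev_paths[OF assms]) (auto simp: rev_set_def)
  then have "mset_set (paths (insert n S) n) = image_mset rev (mset_set (paths (insert n (rev_set n S)) n))"
    by (metis bij_betw_imp_inj_on bij_betw_imp_surj_on image_mset_mset_set)
  then show ?thesis by (simp add: path_types_def image_mset.compositionality comp_def)
qed

text \<open>The antisymmetric part of the indicator of \<open>T\<close>, extended to a function on the integers of period \<open>n\<close>. The symmetric
  part is the same for \<open>S\<close> and \<open>S'\<close> by \<open>symmetric_part\<close>.\<close>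

definition asym :: "nat \<Rightarrow> nat set \<Rightarrow> int \<Rightarrow> int" where
  "asym n T i = of_bool (nat (i mod int n) \<in> T) - of_bool (nat ((- i) mod int n) \<in> T)"

lemma asym_minus: "asym n T (- i) = - asym n T i"
  by (simp add: asym_def)

lemma asym_add_n: "asym n T (i + int n) = asym n T i"
proof -
  have "(- (i + int n)) mod int n = (- i) mod int n"
    by (metis minus_add_distrib mod_add_self2 add_uminus_conv_diff minus_mod_self2)
  then show ?thesis by (simp add: asym_def)
qed

lemma asym_nat: "0 < i \<Longrightarrow> i < n \<Longrightarrow> asym n T (int i) = of_bool (i \<in> T) - of_bool (n - i \<in> T)"
proof -
  assume i: "0 < i" "i < n"
  have "(- int i) mod int n = int n - int i"
    using i by (metis mod_pos_pos_trivial diff_ge_0_iff_ge less_imp_le minus_mod_self1 of_nat_0_le_iff of_nat_less_iff uminus_add_conv_diff add.commute diff_less_eq less_add_same_cancel1 mod_add_self1 of_nat_0_less_iff add_uminus_conv_diff of_nat_mono)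
  then show ?thesis using i by (simp add: asym_def nat_diff_distrib')
qed

lemma asym_0 [simp]: "asym n T 0 = 0"
  by (simp add: asym_def)

lemma asym_mod: "asym n T (i mod int n) = asym n T i"
  by (simp add: asym_def mod_minus_eq)

lemma asym_values: "asym n T i = 1 \<or> asym n T i = 0 \<or> asym n T i = -1"
  by (auto simp: asym_def of_bool_def)

context equivalent_sets
begin

abbreviation d where "d \<equiv> asym n S"
abbreviation d' where "d' \<equiv> asym n S'"

text \<open>The symmetric parts coincide, and they vanish modulo 2 exactly where the antisymmetric parts do.\<close>

lemma asym_square:
  assumes "n > 0"
  shows "d i * d i = d' i * d' i"
proof -
  have "0 \<le> i mod int n" "i mod int n < int n" using assms by auto
  then obtain j where j: "i mod int n = int j" "j < n" by (metis nonneg_int_cases of_nat_less_iff)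
  have "d (int j) * d (int j) = d' (int j) * d' (int j)"
  proof (cases "j = 0")
    case False
    then show ?thesis using j symmetric_part[of j]
      by (cases "j \<in> S"; cases "n - j \<in> S"; cases "j \<in> S'"; cases "n - j \<in> S'") (auto simp: asym_nat)
  qed simp
  then show ?thesis using asym_mod[of n _ i] j by metis
qed

text \<open>The second derivative identity at weight 0, written in symmetric and antisymmetric parts.\<close>

lemma asym_sum_nat:
  assumes "0 < a" "0 < b" "a + b < n"
  shows "asym n S a * asym n S b - asym n S (int a + int b) * (asym n S a + asym n S b) = 
    asym n S' a * asym n S' b - asym n S' (int a + int b) * (asym n S' a + asym n S' b)"
proof -
  define x where "x T i = (of_bool (i \<in> T) :: int)" for T :: "nat set" and i
  define D where "D T = x T a * x T (a + b) + x T b * x T (a + b) + x T a * x T (n - b) + x T b * x T (n - a)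
     + x T (n - a) * x T (n - (a + b)) + x T (n - b) * x T (n - (a + b))" for T
  have D: "D S = D S'"
    using second_derivative_eq[OF S S' types assms(1,2), of 0 "\<lambda>_. 0 :: int"] assms
    by (simp add: Let_def conv_def act_def seg_0 rev_set_def add_ac D_def x_def of_bool_def mult_ac)
  have sym: "x S i + x S (n - i) = x S' i + x S' (n - i)" if "0 < i" "i < n" for i
    using symmetric_part[OF that] by (simp add: x_def)
  have as: "asym n T i = x T i - x T (n - i)" if "0 < i" "i < n" for T i
    using asym_nat[OF that] by (simp add: x_def)
  have eq: "asym n T a * asym n T b - asym n T (int a + int b) * (asym n T a + asym n T b) =
     (x T a + x T (n - a)) * (x T b + x T (n - b)) + (x T (a + b) + x T (n - (a + b))) * (x T a + x T (n - a) + (x T b + x T (n - b))) - 2 * D T" for T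
  proof -
    have "asym n T (int a + int b) = x T (a + b) - x T (n - (a + b))" using as[of "a + b" T] assms by simp
    moreover have "asym n T a = x T a - x T (n - a)" "asym n T b = x T b - x T (n - b)" using as assms by auto
    ultimately show ?thesis unfolding D_def by (simp only:) (simp add: algebra_simps)
  qed
  show ?thesis unfolding eq D using sym[of a] sym[of b] sym[of "a + b"] assms by simp
qed

lemma asym_sum:
  assumes n: "n > 0"
  shows "d a * d b - d (a + b) * (d a + d b) = d' a * d' b - d' (a + b) * (d' a + d' b)"
proof -
  have red: ?thesis if "d (a mod int n) * d (b mod int n) - d (a mod int n + b mod int n) * (d (a mod int n) + d (b mod int n))
     = d' (a mod int n) * d' (b mod int n) - d' (a mod int n + b mod int n) * (d' (a mod int n) + d' (b mod int n))"
    using that unfolding asym_mod using asym_mod[of n _ "a mod int n + b mod int n"] asym_mod[of n _ "a + b"]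
    by (simp add: mod_add_eq)
  have nn: "0 \<le> a mod int n" "a mod int n < int n" "0 \<le> b mod int n" "b mod int n < int n" using n by auto
  then obtain i where i: "a mod int n = int i" "i < n" by (metis nonneg_int_cases of_nat_less_iff)
  from nn obtain j where j: "b mod int n = int j" "j < n" by (metis nonneg_int_cases of_nat_less_iff)
  show ?thesis
  proof (rule red, unfold i j)
    consider "i = 0" | "j = 0" | "0 < i" "0 < j" "i + j < n" | "0 < i" "0 < j" "i + j = n" | "0 < i" "0 < j" "i + j > n" by linarith
    then show "d (int i) * d (int j) - d (int i + int j) * (d (int i) + d (int j)) =
       d' (int i) * d' (int j) - d' (int i + int j) * (d' (int i) + d' (int j))"
    proof cases
      case 1
      then show ?thesis using asym_square[OF n, of "int j"] by simp
    next
      case 2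
      then show ?thesis using asym_square[OF n, of "int i"] by simp
    next
      case 3
      then show ?thesis by (rule asym_sum_nat)
    next
      case 4
      then have e: "int j = - int i + int n" by simp
      have "asym n T (int j) = - asym n T (int i)" "asym n T (int i + int j) = 0" for T
        unfolding e using asym_add_n[of n T "- int i"] asym_add_n[of n T 0] by (simp_all add: asym_minus)
      then show ?thesis using asym_square[OF n, of "int i"] by simp
    next
      case 5
      have e: "int (n - i) = - int i + int n" "int (n - j) = - int j + int n" using i j by auto
      have f: "asym n T (int (n - i)) = - asym n T (int i)" "asym n T (int (n - j)) = - asym n T (int j)" for T
        unfolding e asym_add_n by (simp_all add: asym_minus)
      have f': "asym n T (int (n - i) + int (n - j)) = - asym n T (int i + int j)" for T
      proof -
        have "int (n - i) + int (n - j) = (- (int i + int j) + int n) + int n" unfolding e by simp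
        then show ?thesis by (simp only: asym_add_n asym_minus)
      qed
      have "0 < n - i" "0 < n - j" "n - i + (n - j) < n" using 5 i j by linarith+
      from asym_sum_nat[OF this] show ?thesis unfolding f f' by (simp add: algebra_simps)
    qed
  qed
qed

definition agree :: "int set" where "agree = {i. d i \<noteq> 0 \<and> d' i = d i}"
definition differ :: "int set" where "differ = {i. d i \<noteq> 0 \<and> d' i = - d i}"

lemma agree_or_differ: "n > 0 \<Longrightarrow> d i \<noteq> 0 \<Longrightarrow> i \<in> agree \<or> i \<in> differ"
  using asym_square[of i] asym_values[of n S i] asym_values[of n S' i] by (auto simp: agree_def differ_def)

text \<open>For \<open>a\<close> in \<open>agree\<close> and \<open>b\<close> in \<open>differ\<close> the relation \<open>asym_sum\<close> becomes
  \<open>2 d a d b = d (a + b) (d a + d b) - d' (a + b) (d a - d b)\<close>, which leaves only the two possibilities of \<open>mix\<close>.\<close>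

lemma two_colors_agree_differ:
  assumes n: "n > 0"
  shows "two_colors agree differ d (int n)"
proof
  show "int n > 0" using n by simp
  show "i \<in> agree \<Longrightarrow> i + int n \<in> agree" "i \<in> differ \<Longrightarrow> i + int n \<in> differ" for i
    by (simp_all add: agree_def differ_def asym_add_n)
  show "i \<in> agree \<Longrightarrow> - i \<in> agree" "i \<in> differ \<Longrightarrow> - i \<in> differ" for i
    by (simp_all add: agree_def differ_def asym_minus)
  show "d (- i) = - d i" for i by (rule asym_minus)
  show "i \<in> agree \<union> differ \<Longrightarrow> d i = 1 \<or> d i = - 1" for i
    using asym_values[of n S i] by (auto simp: agree_def differ_def)
  show "agree \<inter> differ = {}" by (auto simp: agree_def differ_def)
  show "a + b \<in> agree \<and> d (a + b) = d a \<or> a + b \<in> differ \<and> d (a + b) = d b"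
    if a: "a \<in> agree" and b: "b \<in> differ" for a b
  proof -
    have E: "d a * d b - d (a + b) * (d a + d b) = - (d a * d b) - d' (a + b) * (d a - d b)"
      using asym_sum[OF n, of a b] a b by (simp add: agree_def differ_def)
    have "d a = 1 \<or> d a = -1" "d b = 1 \<or> d b = -1" using a b asym_values[of n S a] asym_values[of n S b]
      by (auto simp: agree_def differ_def)
    moreover have "d (a + b) = 0 \<Longrightarrow> d' (a + b) = 0" using asym_square[OF n, of "a + b"] by simp
    moreover have "d (a + b) \<noteq> 0 \<Longrightarrow> d' (a + b) = d (a + b) \<or> d' (a + b) = - d (a + b)"
      using agree_or_differ[OF n, of "a + b"] by (auto simp: agree_def differ_def)
    ultimately show ?thesis using E asym_values[of n S "a + b"]
      by (auto simp: agree_def differ_def)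
  qed
qed

lemma dif_iff:
  assumes "0 < i" "i < n"
  shows "i \<in> dif \<longleftrightarrow> int i \<in> differ"
  using symmetric_part[OF assms] asym_nat[OF assms, of S] asym_nat[OF assms, of S']
  by (cases "i \<in> S"; cases "n - i \<in> S"; cases "i \<in> S'"; cases "n - i \<in> S'") (auto simp: dif_def differ_def)

lemma differ_mod:
  assumes n: "n > 0" and b: "b \<in> differ"
  obtains j where "j \<in> dif" "b mod int n = int j"
proof -
  have "0 \<le> b mod int n" "b mod int n < int n" using n by auto
  then obtain j where j: "b mod int n = int j" "j < n" by (metis nonneg_int_cases of_nat_less_iff)
  have d: "int j \<in> differ" using b asym_mod[of n _ b] j by (simp add: differ_def)
  then have "j \<noteq> 0" by (auto simp: differ_def intro: Nat.gr0I)
  then have "j \<in> dif" using dif_iff[of j] d j by simp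
  then show ?thesis using that j by blast
qed

lemma X_asym: assumes "0 < i" "i < n"
  shows "asym n S (int i) = 0 \<Longrightarrow> n - i \<in> S \<longleftrightarrow> i \<in> S"
    and "asym n S (int i) = 1 \<Longrightarrow> i \<in> S \<and> n - i \<notin> S"
    and "asym n S (int i) = -1 \<Longrightarrow> i \<notin> S \<and> n - i \<in> S"
  using asym_nat[OF assms, of S] by (cases "i \<in> S"; cases "n - i \<in> S"; simp)+

text \<open>Let \<open>s0\<close> generate the span of \<open>differ\<close>, let \<open>A\<close> be the part of \<open>agree\<close> off the multiples of \<open>s0\<close>,
  and let \<open>s1\<close> generate the group \<open>K\<close> of periods of \<open>A\<close> and of \<open>d\<close> on \<open>A\<close>. Outside \<open>A\<close> and off the multiples of \<open>s1\<close>, \<open>S\<close> is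
  symmetric. If \<open>z\<close> is such a position, then \<open>z\<close> is not in \<open>K\<close>, which gives an \<open>a \<in> A\<close> such that the class of
  \<open>- a\<close> is the sum of the classes of \<open>z\<close> and \<open>t = - (a + z)\<close>, as required for
  \<open>class_periods\<close>. So all residue classes modulo \<open>s1\<close> are good, and \<open>periodic_decomposition\<close> applies.\<close>

theorem split_differ:
  assumes n: "n > 0" and ne: "differ \<noteq> {}" and a0: "a0 \<in> agree" "a0 \<notin> span_of differ"
  obtains s where "s dvd n" "1 < s" "s < n" "\<And>i. \<not> s dvd i \<Longrightarrow> i \<in> S \<longleftrightarrow> i \<in> S'"
    "\<And>i k. \<not> int s dvd i \<Longrightarrow> int s dvd k \<Longrightarrow> X (i + k) = X i"
proof -
  interpret tc: two_colors agree differ d "int n" by (rule two_colors_agree_differ[OF n])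
  obtain b0 where b0: "b0 \<in> differ" using ne by auto
  have "int n \<in> span_of differ"
    using span_of.add[OF span_of_superset[OF tc.perB[OF b0]] tc.negB[OF b0]] by simp
  then obtain s0 where s0: "s0 > 0" "s0 dvd n" and span: "\<And>k. k \<in> span_of differ \<longleftrightarrow> int s0 dvd k"
    using int_subgroup_generator[OF n, of "span_of differ"] span_of_add span_of_minus[OF tc.negB] by metis
  define A where "A = {a \<in> agree. \<not> int s0 dvd a}"
  have a0A: "a0 \<in> A" using a0 span by (simp add: A_def)
  have Aneg: "- a \<in> A \<and> d (- a) = - d a" if "a \<in> A" for a
    using that tc.negA by (simp add: A_def asym_minus)
  have A0: "0 \<notin> A" by (simp add: A_def)
  have bs: "int s0 dvd b" if "b \<in> differ" for b using span_of_superset[OF that] span by simp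
  have Ashift: "a + k \<in> A \<and> d (a + k) = d a" if "a \<in> A" "k \<in> span_of differ" for a k
    using that(2)
  proof (induction rule: span_of.induct)
    case (add h x)
    have "\<not> int s0 dvd a + h + x" using add bs span that by (auto simp: A_def dvd_add_left_iff)
    then have "a + h + x \<notin> differ" using bs by blast
    then show ?case using tc.mix[of "a + h" x] add \<open>\<not> int s0 dvd a + h + x\<close> by (auto simp: A_def add.assoc)
  qed (use that in simp)
  define K where "K = {k. \<forall>a\<in>A. a + k \<in> A \<and> d (a + k) = d a}"
  have spanK: "k \<in> K" if "int s0 dvd k" for k using Ashift that span by (auto simp: K_def)
  have Kadd: "k + l \<in> K" if "k \<in> K" "l \<in> K" for k l using that by (auto simp: K_def add.assoc[symmetric])
  have Kmult: "int j * k \<in> K" if "k \<in> K" for j k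
  proof (induction j)
    case (Suc j)
    then show ?case using Kadd[OF that Suc] by (simp add: distrib_right add.commute)
  qed (simp add: spanK)
  have Kneg: "- k \<in> K" if "k \<in> K" for k
  proof -
    have "int (n - 1) * k + int n * (- k) \<in> K"
      using s0(2) by (intro Kadd Kmult that spanK) (simp add: dvd_mult2)
    moreover have "int (n - 1) * k + int n * (- k) = - k" using n by (simp add: of_nat_diff algebra_simps)
    ultimately show ?thesis by simp
  qed
  have "int n \<in> K" using s0 spanK by simp
  then obtain s1 where s1: "s1 > 0" "s1 dvd n" and Kgen: "\<And>k. k \<in> K \<longleftrightarrow> int s1 dvd k"
    using int_subgroup_generator[OF n, of K] Kadd Kneg by metis
  have s10: "int s1 dvd int s0" using spanK[of "int s0"] Kgen by simp
  have AK: "\<not> int s1 dvd a" if "a \<in> A" for a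
  proof
    assume "int s1 dvd a"
    then have "- a \<in> K" using Kgen by simp
    then show False using that A0 by (auto simp: K_def)
  qed
  have AsK: "a + k \<in> A \<and> d (a + k) = d a" if "a \<in> A" "int s1 dvd k" for a k
    using that Kgen by (auto simp: K_def)
  have bs1: "int s1 dvd b" if "b \<in> differ" for b using bs[OF that] s10 dvd_trans by blast
  have dA: "i \<in> A" if "d i \<noteq> 0" "\<not> int s1 dvd i" for i
  proof -
    have "\<not> int s0 dvd i" using that(2) s10 dvd_trans by blast
    moreover have "i \<notin> differ" using that(2) bs1 by blast
    ultimately show ?thesis using agree_or_differ[OF n that(1)] by (simp add: A_def)
  qed
  have zero_class: "d (i + k) = 0" if "i \<notin> A" "\<not> int s1 dvd i" "int s1 dvd k" for i k
  proof (rule ccontr)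
    assume "d (i + k) \<noteq> 0"
    moreover have "\<not> int s1 dvd i + k" using that by (simp add: dvd_add_left_iff)
    ultimately have "i + k \<in> A" using dA by blast
    then show False using AsK[of "i + k" "- k"] that by simp
  qed
  have difs1: "s1 dvd b" if "b \<in> dif" for b
    using dif_iff[of b] dif_range[OF that] bs1[of "int b"] that by simp
  have key: "class_good s1 z h"
    if h: "supported s1 h" and z: "0 < z" "0 < t" "z + t < s1" and a: "a \<in> A" "int s1 dvd int z + int t + a"
      and zz: "\<And>e. int s1 dvd e \<Longrightarrow> d (int z + e) = 0"
      and tt: "(\<forall>e. int s1 dvd e \<longrightarrow> d (int t + e) = d a) \<or> (\<forall>e. int s1 dvd e \<longrightarrow> d (int t + e) = 0)"
    for h z t a
  proof (rule class_periods[OF s1(2) h _ z, where up = "d a = 1"])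
    show "i \<in> S \<longleftrightarrow> i \<in> S'" if "\<not> s1 dvd i" for i
      using difs1[of i] that by (auto simp: dif_def)
    have da: "d a = 1 \<or> d a = -1" using a tc.d_values by (auto simp: A_def)
    fix e assume e: "s1 dvd e"
    show "(z + t + e \<in> S \<longleftrightarrow> \<not> d a = 1) \<and> (n - (z + t + e) \<in> S \<longleftrightarrow> d a = 1)" if "z + t + e < n"
    proof -
      have "int s1 dvd int z + int t + a + int e" using a(2) e by simp
      from AsK[OF _ this, of "- a"] Aneg[OF a(1)] have "d (- a + (int z + int t + a + int e)) = - d a" by simp
      then have "d (int (z + t + e)) = - d a" by (simp add: algebra_simps)
      then show ?thesis using X_asym[of "z + t + e"] that z da by auto
    qed
    show "n - (z + e) \<in> S \<longleftrightarrow> z + e \<in> S" if "z + e < n"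
      using X_asym(1)[of "z + e"] zz[of "int e"] e that z by simp
  next
    have da: "d a = 1 \<or> d a = -1" using a tc.d_values by (auto simp: A_def)
    show "(\<forall>e. s1 dvd e \<longrightarrow> t + e < n \<longrightarrow> (t + e \<in> S \<longleftrightarrow> d a = 1) \<and> (n - (t + e) \<in> S \<longleftrightarrow> \<not> d a = 1)) \<or>
            (\<forall>e. s1 dvd e \<longrightarrow> t + e < n \<longrightarrow> (n - (t + e) \<in> S \<longleftrightarrow> t + e \<in> S))"
      using tt
    proof (elim disjE)
      assume tt: "\<forall>e. int s1 dvd e \<longrightarrow> d (int t + e) = d a"
      have "(t + e \<in> S \<longleftrightarrow> d a = 1) \<and> (n - (t + e) \<in> S \<longleftrightarrow> \<not> d a = 1)" if "s1 dvd e" "t + e < n" for e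
        using X_asym[of "t + e"] tt[rule_format, of "int e"] that z da by auto
      then show ?thesis by blast
    next
      assume tt: "\<forall>e. int s1 dvd e \<longrightarrow> d (int t + e) = 0"
      have "n - (t + e) \<in> S \<longleftrightarrow> t + e \<in> S" if "s1 dvd e" "t + e < n" for e
        using X_asym(1)[of "t + e"] tt[rule_format, of "int e"] that z by simp
      then show ?thesis by blast
    qed
  qed
  have good: "class_good s1 z h" if z: "0 < z" "z < s1" and h: "supported s1 h" for z h
  proof (cases "int z \<in> A")
    case True
    have sk: "s1 dvd j" if "theta h $ j \<noteq> 0" for j
      using supportedD[OF supported_theta[OF h], of j] that by metis
    have const: "z + e \<in> S \<longleftrightarrow> d (int z) = 1" if "s1 dvd e" "z + e < n" for e
    proof -
      have "d (int (z + e)) = d (int z)" using AsK[OF True, of "int e"] that by simp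
      moreover have "d (int z) = 1 \<or> d (int z) = -1" using True tc.d_values by (auto simp: A_def)
      ultimately show ?thesis using X_asym[of "z + e"] that z by auto
    qed
    have "lin s1 z k" if "s1 dvd k" for k
      unfolding lin_def
    proof (intro allI impI)
      fix e assume "s1 dvd e" "z + e + k < n"
      then show "z + e + k \<in> S \<longleftrightarrow> z + e \<in> S" using const[of e] const[of "e + k"] that by (simp add: add.assoc)
    qed
    then show ?thesis using sk unfolding class_good_def by blast
  next
    case False
    have nz: "\<not> int s1 dvd int z" using z by (auto dest: dvd_imp_le)
    then have "int z \<notin> K" using Kgen by simp
    then obtain a where a: "a \<in> A" "\<not> (a + int z \<in> A \<and> d (a + int z) = d a)" by (auto simp: K_def)
    \<comment> \<open>The case distinction below arranges representatives of \<open>z\<close> and \<open>t\<close> with sum less than \<open>s1\<close>, negating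
        both classes if necessary.\<close>
    define t where "t = - (a + int z)"
    have nt: "\<not> int s1 dvd t"
    proof
      assume "int s1 dvd t"
      then have "int s1 dvd a + int z" unfolding t_def by (simp only: dvd_minus_iff)
      then have "- a + (a + int z) \<in> A" using AsK[of "- a" "a + int z"] Aneg[OF a(1)] by blast
      then show False using False by simp
    qed
    have tt: "(\<forall>e. int s1 dvd e \<longrightarrow> d (t + e) = d a) \<or> (\<forall>e. int s1 dvd e \<longrightarrow> d (t + e) = 0)"
    proof (cases "t \<in> A")
      case True
      have "a + int z = - t" by (simp add: t_def)
      then have aza: "a + int z \<in> A" using Aneg[OF True] by simp
      then have "d (a + int z) \<noteq> d a" using a by simp
      moreover have "d (a + int z) = 1 \<or> d (a + int z) = -1" "d a = 1 \<or> d a = -1"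
        using aza a(1) tc.d_values unfolding A_def by blast+
      moreover have "d t = - d (a + int z)" unfolding t_def by (rule asym_minus)
      ultimately have "d t = d a" by auto
      then show ?thesis using AsK[OF True] by simp
    next
      case False
      then show ?thesis using zero_class[OF False nt] by simp
    qed
    have zz: "d (int z + e) = 0" if "int s1 dvd e" for e using zero_class[OF False nz that] .
    define t0 where "t0 = nat (t mod int s1)"
    have m: "0 \<le> t mod int s1" "t mod int s1 < int s1" "t mod int s1 \<noteq> 0" using s1 nt by (auto simp: dvd_eq_mod_eq_0)
    have t0: "0 < t0" "t0 < s1" "int s1 dvd int t0 - t"
      using m by (simp_all add: t0_def nat_less_iff mod_eq_dvd_iff[symmetric])
    have ta: "d (int t0 + e) = d (t + (int t0 - t + e))" for e by simp
    have tt0: "(\<forall>e. int s1 dvd e \<longrightarrow> d (int t0 + e) = d a) \<or> (\<forall>e. int s1 dvd e \<longrightarrow> d (int t0 + e) = 0)"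
    proof -
      have s: "int s1 dvd int t0 - t + e" if "int s1 dvd e" for e using t0(3) that by (rule dvd_add)
      show ?thesis using tt
      proof (elim disjE)
        assume "\<forall>e. int s1 dvd e \<longrightarrow> d (t + e) = d a"
        then have "d (int t0 + e) = d a" if "int s1 dvd e" for e using s[OF that] ta[of e] by metis
        then show ?thesis by blast
      next
        assume "\<forall>e. int s1 dvd e \<longrightarrow> d (t + e) = 0"
        then have "d (int t0 + e) = 0" if "int s1 dvd e" for e using s[OF that] ta[of e] by metis
        then show ?thesis by blast
      qed
    qed
    have zta: "int s1 dvd int z + int t0 + a"
    proof -
      have "int z + int t0 + a = int t0 - t" by (simp add: t_def)
      with t0(3) show ?thesis by (simp only:)
    qed
    have ne: "z + t0 \<noteq> s1"
    proof
      assume "z + t0 = s1"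
      then have "int z + int t0 = int s1" by simp
      then have "int s1 dvd a" using zta by simp
      then show False using AK[OF a(1)] by simp
    qed
    show ?thesis
    proof (cases "z + t0 < s1")
      case True
      show ?thesis by (rule key[OF h z(1) t0(1) True a(1) zta zz tt0])
    next
      case False
      have symz: "n - (z + e) \<in> S \<longleftrightarrow> z + e \<in> S" if "s1 dvd e" "z + e < n" for e
        using X_asym(1)[of "z + e"] zz[of "int e"] that z by simp
      have cg: "class_good s1 (s1 - z) h"
      proof (rule key[OF h, of "s1 - z" "s1 - t0" "- a"])
        show "0 < s1 - z" "0 < s1 - t0" "s1 - z + (s1 - t0) < s1" using False ne z t0 by auto
        show "- a \<in> A" using Aneg[OF a(1)] by simp
        have e: "int (s1 - z) + int (s1 - t0) + - a = 2 * int s1 - (int z + int t0 + a)" using z t0 by (simp add: of_nat_diff)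
        have "int s1 dvd 2 * int s1 - (int z + int t0 + a)" using zta by (intro dvd_diff) simp_all
        then show "int s1 dvd int (s1 - z) + int (s1 - t0) + - a" by (simp only: e)
        show "d (int (s1 - z) + e) = 0" if "int s1 dvd e" for e
        proof -
          have "int (s1 - z) + e = - (int z + (- e - int s1))" using z by (simp add: of_nat_diff)
          then show ?thesis using zz[of "- e - int s1"] that by (simp only: asym_minus) simp
        qed
        have flip: "d (int (s1 - t0) + e) = - d (int t0 + (- e - int s1))" for e
        proof -
          have "int (s1 - t0) + e = - (int t0 + (- e - int s1))" using t0 by (simp add: of_nat_diff)
          then show ?thesis by (simp only: asym_minus)
        qed
        have ds: "int s1 dvd - e - int s1" if "int s1 dvd e" for e using that by simp
        show "(\<forall>e. int s1 dvd e \<longrightarrow> d (int (s1 - t0) + e) = d (- a)) \<or> (\<forall>e. int s1 dvd e \<longrightarrow> d (int (s1 - t0) + e) = 0)"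
          using tt0
        proof (elim disjE)
          assume t: "\<forall>e. int s1 dvd e \<longrightarrow> d (int t0 + e) = d a"
          have "d (int (s1 - t0) + e) = d (- a)" if "int s1 dvd e" for e
            using t[rule_format, OF ds[OF that]] flip[of e] asym_minus[of n S a] by simp
          then show ?thesis by blast
        next
          assume t: "\<forall>e. int s1 dvd e \<longrightarrow> d (int t0 + e) = 0"
          have "d (int (s1 - t0) + e) = 0" if "int s1 dvd e" for e
            using t[rule_format, OF ds[OF that]] flip[of e] by simp
          then show ?thesis by blast
        qed
      qed
      show ?thesis by (rule class_good_reflect[OF s1(2) h z _ cg]) (rule symz)
    qed
  qed
  have dn: "dif \<noteq> {}"
  proof -
    obtain j where "j \<in> dif" using differ_mod[OF n b0] .
    then show ?thesis by auto
  qed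
  have sym: "n - i \<in> S \<longleftrightarrow> i \<in> S"
    if g: "g dvd n" "\<And>b. b \<in> dif \<Longrightarrow> g dvd b" and i: "0 < i" "i < n" "s1 dvd i" "\<not> g dvd i" for g i
  proof (rule X_asym(1)[OF i(1,2)], rule ccontr)
    have gb: "int g dvd b" if bd: "b \<in> differ" for b
    proof -
      obtain j where j: "j \<in> dif" "b mod int n = int j" using differ_mod[OF n bd] .
      then have "int g dvd b mod int n" using g(2)[OF j(1)] by simp
      then show ?thesis using g(1) by (metis dvd_mod_iff int_dvd_int_iff)
    qed
    have gs: "int g dvd k" if "k \<in> span_of differ" for k using that
    proof (induction rule: span_of.induct)
      case (add h x)
      then show ?case using dvd_add[OF add.IH gb[OF add.hyps(2)]] by simp
    qed simp
    assume "d (int i) \<noteq> 0"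
    from agree_or_differ[OF n this] show False
    proof (elim disjE)
      assume "int i \<in> agree"
      moreover have "int i \<notin> A" using AK[of "int i"] i(3) by auto
      ultimately have "int i \<in> span_of differ" using span by (simp add: A_def)
      then show False using gs[of "int i"] i(4) by simp
    qed (use gb[of "int i"] i(4) in auto)
  qed
  show ?thesis
  proof (rule periodic_decomposition[OF s1(2) _ dn])
    show "b \<in> dif \<Longrightarrow> s1 dvd b" for b by (rule difs1)
    show "0 < z \<Longrightarrow> z < s1 \<Longrightarrow> supported s1 h \<Longrightarrow> class_good s1 z h" for z h by (rule good)
    show "n - i \<in> S \<longleftrightarrow> i \<in> S" if "g dvd n" "\<And>b. b \<in> dif \<Longrightarrow> g dvd b" "0 < i" "i < n" "s1 dvd i" "\<not> g dvd i" for g i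
      by (rule sym[OF that(1) _ that(3-6)]) (rule that(2))
    fix s assume s: "s1 dvd s" "s dvd n" "0 < s" "s < n" "\<And>b. b \<in> dif \<Longrightarrow> s dvd b"
      "\<And>i k. \<not> int s dvd i \<Longrightarrow> int s dvd k \<Longrightarrow> X (i + k) = X i"
    have "s1 \<noteq> 1" using AK[OF a0A] by auto
    moreover have "s1 \<le> s" using s by (simp add: dvd_imp_le)
    ultimately have "1 < s" using s1(1) by simp
    show ?thesis
    proof (rule that[OF s(2) \<open>1 < s\<close> s(4)])
      show "i \<in> S \<longleftrightarrow> i \<in> S'" if "\<not> s dvd i" for i using s(5)[of i] that by (auto simp: dif_def)
      show "X (i + k) = X i" if "\<not> int s dvd i" "int s dvd k" for i k using s(6)[OF that] .
    qed
  qed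
qed

lemma eq_if_no_differ:
  assumes "n > 0" "differ = {}"
  shows "S' = S"
proof -
  have "i \<notin> dif" for i using dif_iff[of i] dif_range[of i] assms by blast
  then show ?thesis by (auto simp: dif_def)
qed

lemma reversed: 
  assumes "n > 0"
  shows "equivalent_sets n S (rev_set n S')"
  by unfold_locales (use S types path_types_rev_set[OF assms] rev_set_subset in auto)

end

lemma asym_rev_set:
  assumes "n > 0" "S \<subseteq> {0<..<n}"
  shows "asym n (rev_set n S) i = - asym n S i"
proof -
  have "0 \<le> i mod int n" "i mod int n < int n" using assms by auto
  then obtain j where j: "i mod int n = int j" "j < n" by (metis nonneg_int_cases of_nat_less_iff)
  have "asym n (rev_set n S) (int j) = - asym n S (int j)"
  proof (cases "j = 0")
    case False
    then show ?thesis using j by (simp add: asym_nat rev_set_def)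
  qed simp
  then show ?thesis using asym_mod[of n _ i] j by metis
qed

text \<open>Reversing \<open>S'\<close> exchanges \<open>agree\<close> and \<open>differ\<close>, so by \<open>span_separates\<close> one of the two versions of \<open>S'\<close>
  satisfies the hypothesis of \<open>split_differ\<close>.\<close>

theorem equivalent_sets_decompose:
  assumes n: "n > 0" and eq: "equivalent_sets n S S'" and ne: "S' \<noteq> S" "S' \<noteq> rev_set n S"
  obtains s S'' where "S'' = S' \<or> S'' = rev_set n S'" "s dvd n" "1 < s" "s < n"
    "\<And>i. \<not> s dvd i \<Longrightarrow> i \<in> S \<longleftrightarrow> i \<in> S''"
    "\<And>i j. 0 < i \<Longrightarrow> i < n \<Longrightarrow> 0 < j \<Longrightarrow> j < n \<Longrightarrow> \<not> s dvd i \<Longrightarrow> i mod s = j mod s \<Longrightarrow> i \<in> S \<longleftrightarrow> j \<in> S"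
proof -
  note result = that
  interpret E: equivalent_sets n S S' by (rule eq)
  interpret F: equivalent_sets n S "rev_set n S'" by (rule E.reversed[OF n])
  interpret tc: two_colors E.agree E.differ E.d "int n" by (rule E.two_colors_agree_differ[OF n])
  have swap: "F.agree = E.differ" "F.differ = E.agree"
    by (auto simp: E.agree_def F.agree_def E.differ_def F.differ_def asym_rev_set[OF n E.S'])
  have 1: "E.differ \<noteq> {}" using E.eq_if_no_differ[OF n] ne(1) by blast
  have 2: "F.differ \<noteq> {}"
  proof
    assume "F.differ = {}"
    then have e: "rev_set n S' = S" by (rule F.eq_if_no_differ[OF n])
    from arg_cong[OF e, of "rev_set n"] have "S' = rev_set n S" by (rule trans[OF rev_set_rev_set[OF E.S', symmetric]])
    then show False using ne(2) by blast
  qed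
  have fin: thesis
    if S'': "S'' = S' \<or> S'' = rev_set n S'" and s: "s dvd n" "1 < s" "s < n" "\<And>i. \<not> s dvd i \<Longrightarrow> i \<in> S \<longleftrightarrow> i \<in> S''"
      and per: "\<And>i k. \<not> int s dvd i \<Longrightarrow> int s dvd k \<Longrightarrow> nat ((i + k) mod int n) \<in> S \<longleftrightarrow> nat (i mod int n) \<in> S" for s S''
  proof (rule result[OF S'' s])
    fix i j assume ij: "0 < i" "i < n" "0 < j" "j < n" "\<not> s dvd i" "i mod s = j mod s"
    have "int s dvd int j - int i"
      using ij(6) by (metis mod_eq_dvd_iff of_nat_mod)
    from per[OF _ this, of "int i"] ij show "i \<in> S \<longleftrightarrow> j \<in> S" by simp
  qed
  from tc.span_separates swap 1 2 consider a where "a \<in> E.agree" "a \<notin> span_of E.differ" | a where "a \<in> F.agree" "a \<notin> span_of F.differ"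
    by auto
  then show thesis
  proof cases
    case 1
    obtain s where "s dvd n" "1 < s" "s < n" "\<And>i. \<not> s dvd i \<Longrightarrow> i \<in> S \<longleftrightarrow> i \<in> S'"
      "\<And>i k. \<not> int s dvd i \<Longrightarrow> int s dvd k \<Longrightarrow> E.X (i + k) = E.X i"
      using E.split_differ[OF n \<open>E.differ \<noteq> {}\<close> 1] by metis
    then show thesis by (intro fin[of S' s]) (simp_all add: E.X_def)
  next
    case 2
    obtain s where "s dvd n" "1 < s" "s < n" "\<And>i. \<not> s dvd i \<Longrightarrow> i \<in> S \<longleftrightarrow> i \<in> rev_set n S'"
      "\<And>i k. \<not> int s dvd i \<Longrightarrow> int s dvd k \<Longrightarrow> F.X (i + k) = F.X i"
      using F.split_differ[OF n \<open>F.differ \<noteq> {}\<close> 2] by metis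
    then show thesis by (intro fin[of "rev_set n S'" s]) (simp_all add: F.X_def)
  qed
qed

section \<open>Compositions and their partial sums\<close>

declare sum_list_eq_0_iff [simp del]

text \<open>Including 0 and the total sum makes partial sums compatible with concatenation, also for empty lists.\<close>

definition ps :: "nat list \<Rightarrow> nat set" where
  "ps \<beta> = {sum_list (take i \<beta>) | i. i \<le> length \<beta>}"

lemma ps_Nil [simp]: "ps [] = {0}"
  by (auto simp: ps_def)

lemma zero_in_ps [simp]: "0 \<in> ps \<beta>"
  by (auto simp: ps_def intro!: exI[of _ 0])

lemma sum_in_ps [simp]: "sum_list \<beta> \<in> ps \<beta>"
  by (auto simp: ps_def intro!: exI[of _ "length \<beta>"])

lemma ps_Cons: "ps (b # \<beta>) = insert 0 ((+) b ` ps \<beta>)"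
proof -
  have "x \<in> ps (b # \<beta>) \<longleftrightarrow> x = 0 \<or> (\<exists>i\<le>length \<beta>. x = b + sum_list (take i \<beta>))" for x
  proof
    assume "x \<in> ps (b # \<beta>)"
    then obtain i where "x = sum_list (take i (b # \<beta>))" "i \<le> Suc (length \<beta>)" by (auto simp: ps_def)
    then show "x = 0 \<or> (\<exists>i\<le>length \<beta>. x = b + sum_list (take i \<beta>))" by (cases i) auto
  next
    assume "x = 0 \<or> (\<exists>i\<le>length \<beta>. x = b + sum_list (take i \<beta>))"
    then show "x \<in> ps (b # \<beta>)"
    proof
      assume "\<exists>i\<le>length \<beta>. x = b + sum_list (take i \<beta>)"
      then obtain i where "i \<le> length \<beta>" "x = sum_list (take (Suc i) (b # \<beta>))" by auto
      then show ?thesis unfolding ps_def by (intro CollectI exI[of _ "Suc i"]) auto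
    qed simp
  qed
  then show ?thesis by (auto simp: ps_def[of \<beta>])
qed

lemma ps_append: "ps (\<alpha> @ \<beta>) = ps \<alpha> \<union> (+) (sum_list \<alpha>) ` ps \<beta>"
  by (induction \<alpha>) (auto simp: ps_Cons image_image add.assoc)

lemma take_sum_iff:
  assumes "composition \<beta>" "i \<le> length \<beta>"
  shows "sum_list (take i \<beta>) = 0 \<longleftrightarrow> i = 0" "sum_list (take i \<beta>) = sum_list \<beta> \<longleftrightarrow> i = length \<beta>"
proof -
  show "sum_list (take i \<beta>) = 0 \<longleftrightarrow> i = 0"
    using length_le_sum_take[OF assms] by (cases "i = 0") (auto simp del: sum_list_eq_0_iff)
  show "sum_list (take i \<beta>) = sum_list \<beta> \<longleftrightarrow> i = length \<beta>"
    using sum_take_diff[OF assms order_refl] assms(2) by (cases "i = length \<beta>") auto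
qed

lemma partial_sums_ps:
  assumes "composition \<beta>"
  shows "partial_sums \<beta> = ps \<beta> - {0, sum_list \<beta>}"
proof -
  have eq: "sum_list (take i \<beta>) = 0 \<longleftrightarrow> i = 0" "sum_list (take i \<beta>) = sum_list \<beta> \<longleftrightarrow> i = length \<beta>"
    if "i \<le> length \<beta>" for i
    using take_sum_iff[OF assms that] by auto
  show ?thesis
  proof (intro equalityI subsetI)
    fix x assume "x \<in> partial_sums \<beta>"
    then obtain i where "1 \<le> i" "i < length \<beta>" "x = sum_list (take i \<beta>)" by (auto simp: partial_sums_def)
    then show "x \<in> ps \<beta> - {0, sum_list \<beta>}" using eq[of i] by (auto simp: ps_def intro: exI[of _ i])
  next
    fix x assume "x \<in> ps \<beta> - {0, sum_list \<beta>}"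
    then obtain i where "i \<le> length \<beta>" "x = sum_list (take i \<beta>)" "x \<noteq> 0" "x \<noteq> sum_list \<beta>" by (auto simp: ps_def)
    then show "x \<in> partial_sums \<beta>" using eq[of i] by (auto simp: partial_sums_def intro!: exI[of _ i] Nat.gr0I)
  qed
qed

lemma ps_partial_sums: "composition \<beta> \<Longrightarrow> ps \<beta> = {0, sum_list \<beta>} \<union> partial_sums \<beta>"
  by (auto simp: partial_sums_ps)

lemma ps_le: "x \<in> ps \<beta> \<Longrightarrow> x \<le> sum_list \<beta>"
  using sum_take_mono[of _ "length \<beta>" \<beta>] by (auto simp: ps_def)

lemma partial_sums_subset: "composition \<beta> \<Longrightarrow> partial_sums \<beta> \<subseteq> {0<..<sum_list \<beta>}"
  using ps_le[of _ \<beta>] by (fastforce simp: partial_sums_ps)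

lemma composition_sum_0: "composition \<beta> \<Longrightarrow> sum_list \<beta> = 0 \<longleftrightarrow> \<beta> = []"
  using length_composition_le[of \<beta>] by auto

lemma coarsens_ps:
  assumes "composition \<alpha>" "composition \<beta>" "sum_list \<alpha> = sum_list \<beta>" "ps \<alpha> \<subseteq> ps \<beta>"
  shows "coarsens \<alpha> \<beta>"
  using assms
proof (induction \<alpha> arbitrary: \<beta>)
  case Nil
  then have "\<beta> = []" by (simp add: composition_sum_0)
  then show ?case by (auto simp: coarsens_def)
next
  case (Cons a \<alpha>)
  have "a \<in> ps \<beta>" using Cons.prems(4) zero_in_ps[of \<alpha>] by (auto simp: ps_Cons)
  then obtain j where j: "j \<le> length \<beta>" "a = sum_list (take j \<beta>)" by (auto simp: ps_def)
  let ?b = "take j \<beta>" and ?\<beta> = "drop j \<beta>"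
  have spl: "\<beta> = ?b @ ?\<beta>" by simp
  have c: "composition ?\<beta>" using Cons.prems(2) spl by (metis composition_append)
  have s: "sum_list \<beta> = a + sum_list ?\<beta>" using j by (metis spl sum_list_append)
  have "ps \<alpha> \<subseteq> ps ?\<beta>"
  proof
    fix x assume x: "x \<in> ps \<alpha>"
    show "x \<in> ps ?\<beta>"
    proof (cases "x = 0")
      case False
      have "a + x \<in> ps \<beta>" using x Cons.prems(4) by (auto simp: ps_Cons)
      also have "ps \<beta> = ps ?b \<union> (+) a ` ps ?\<beta>" using ps_append[of ?b ?\<beta>] j by simp
      finally show ?thesis using ps_le[of "a + x" ?b] j False by auto
    qed simp
  qed
  then have "coarsens \<alpha> ?\<beta>" using Cons.IH[of ?\<beta>] Cons.prems c s by simp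
  then obtain bs where bs: "[] \<notin> set bs" "concat bs = ?\<beta>" "map sum_list bs = \<alpha>" by (auto simp: coarsens_def)
  have "?b \<noteq> []"
  proof
    assume "?b = []"
    from arg_cong[OF this, of sum_list] show False using j(2) Cons.prems(1) by simp
  qed
  then have "[] \<notin> set (?b # bs)" using bs(1) by (metis set_ConsD)
  moreover have "concat (?b # bs) = \<beta>" by (simp only: concat.simps bs(2) append_take_drop_id)
  moreover have "map sum_list (?b # bs) = a # \<alpha>" by (simp only: list.map bs(3) j(2))
  ultimately show ?case unfolding coarsens_def by (intro exI[of _ "?b # bs"] conjI)
qed

lemma ps_coarsens:
  assumes "coarsens \<alpha> \<beta>" "composition \<beta>"
  shows "composition \<alpha>" "sum_list \<alpha> = sum_list \<beta>" "ps \<alpha> \<subseteq> ps \<beta>"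
proof -
  obtain bs where bs: "[] \<notin> set bs" "concat bs = \<beta>" "map sum_list bs = \<alpha>" using assms(1) by (auto simp: coarsens_def)
  have "composition (map sum_list bs) \<and> ps (map sum_list bs) \<subseteq> ps (concat bs)"
    if "[] \<notin> set bs" "composition (concat bs)" for bs
    using that
  proof (induction bs)
    case (Cons b bs)
    have "sum_list b > 0" using Cons.prems composition_sum_0[of b] by auto
    then show ?case using Cons by (auto simp: ps_Cons ps_append)
  qed simp
  from this[OF bs(1)] bs assms(2) show "composition \<alpha>" "ps \<alpha> \<subseteq> ps \<beta>" by auto
  show "sum_list \<alpha> = sum_list \<beta>" by (rule sum_list_coarsens[OF assms(1)])
qed

lemma coarsens_iff:
  "composition \<beta> \<Longrightarrow> coarsens \<alpha> \<beta> \<longleftrightarrow> composition \<alpha> \<and> sum_list \<alpha> = sum_list \<beta> \<and> ps \<alpha> \<subseteq> ps \<beta>"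
  using coarsens_ps ps_coarsens by blast

lemma paths_ps: "\<alpha> \<in> paths S k \<longleftrightarrow> composition \<alpha> \<and> sum_list \<alpha> = k \<and> ps \<alpha> - {0} \<subseteq> S"
proof -
  have "(\<forall>i\<in>{1..length \<alpha>}. sum_list (take i \<alpha>) \<in> S) \<longleftrightarrow> ps \<alpha> - {0} \<subseteq> S" if "composition \<alpha>"
  proof -
    have eq: "sum_list (take i \<alpha>) = 0 \<longleftrightarrow> i = 0" if "i \<le> length \<alpha>" for i
      using take_sum_iff[OF \<open>composition \<alpha>\<close> that] by auto
    show ?thesis
    proof
      assume L: "\<forall>i\<in>{1..length \<alpha>}. sum_list (take i \<alpha>) \<in> S"
      show "ps \<alpha> - {0} \<subseteq> S"
      proof
        fix x assume "x \<in> ps \<alpha> - {0}"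
        then obtain i where "i \<le> length \<alpha>" "x = sum_list (take i \<alpha>)" "x \<noteq> 0" by (auto simp: ps_def)
        then show "x \<in> S" using L eq[of i] by (cases i) auto
      qed
    next
      assume "ps \<alpha> - {0} \<subseteq> S"
      moreover have "sum_list (take i \<alpha>) \<in> ps \<alpha> - {0}" if "i \<in> {1..length \<alpha>}" for i
        using eq[of i] that by (auto simp: ps_def)
      ultimately show "\<forall>i\<in>{1..length \<alpha>}. sum_list (take i \<alpha>) \<in> S" by blast
    qed
  qed
  then show ?thesis by (auto simp: paths_def)
qed

lemma coarsenings_paths:
  assumes "composition \<beta>"
  shows "{\<alpha>. coarsens \<alpha> \<beta>} = paths (insert (sum_list \<beta>) (partial_sums \<beta>)) (sum_list \<beta>)"
proof -
  have "ps \<alpha> \<subseteq> ps \<beta> \<longleftrightarrow> ps \<alpha> - {0} \<subseteq> insert (sum_list \<beta>) (partial_sums \<beta>)" for \<alpha>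
    using ps_partial_sums[OF assms] partial_sums_subset[OF assms] zero_in_ps[of \<alpha>] by auto
  then show ?thesis by (auto simp: coarsens_iff[OF assms] paths_ps)
qed

lemma coarsening_partitions_eq_iff:
  assumes "composition \<beta>" "composition \<gamma>" "sum_list \<beta> = n" "sum_list \<gamma> = n"
  shows "coarsening_partitions \<beta> = coarsening_partitions \<gamma> \<longleftrightarrow>
     path_types n (partial_sums \<beta>) = path_types n (partial_sums \<gamma>)"
proof -
  have 1: "coarsening_partitions \<delta> = image_mset (\<lambda>M. rev (sorted_list_of_multiset M)) (path_types n (partial_sums \<delta>))"
    if "composition \<delta>" "sum_list \<delta> = n" for \<delta>
    using that unfolding coarsening_partitions_def path_types_def coarsenings_paths[OF that(1)]
    by (simp add: image_mset.compositionality comp_def partition_of_def[abs_def])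
  have 2: "path_types n (partial_sums \<delta>) = image_mset mset (coarsening_partitions \<delta>)"
    if "composition \<delta>" "sum_list \<delta> = n" for \<delta>
    using 1[OF that] by (simp add: image_mset.compositionality comp_def)
  show ?thesis
  proof
    assume "coarsening_partitions \<beta> = coarsening_partitions \<gamma>"
    then show "path_types n (partial_sums \<beta>) = path_types n (partial_sums \<gamma>)"
      unfolding 2[OF assms(1,3)] 2[OF assms(2,4)] by (rule arg_cong)
  next
    assume "path_types n (partial_sums \<beta>) = path_types n (partial_sums \<gamma>)"
    then show "coarsening_partitions \<beta> = coarsening_partitions \<gamma>"
      unfolding 1[OF assms(1,3)] 1[OF assms(2,4)] by (rule arg_cong)
  qed
qed

lemma coarsens_same_length:
  assumes "coarsens \<alpha> \<beta>" "length \<beta> \<le> length \<alpha>"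
  shows "\<alpha> = \<beta>"
proof -
  have "map sum_list bs = concat bs" if "[] \<notin> set bs" "length (concat bs) \<le> length bs" for bs :: "nat list list"
    using that
  proof (induction bs)
    case (Cons b bs)
    have "length bs \<le> length (concat bs)"
      using Cons.prems(1)
    proof (induction bs)
      case (Cons c bs)
      then show ?case by (cases c) auto
    qed simp
    moreover have "length b \<ge> 1" using Cons.prems(1) by (cases b) auto
    ultimately have "length b = 1" "length (concat bs) \<le> length bs" using Cons.prems(2) by auto
    moreover obtain x where "b = [x]" using \<open>length b = 1\<close> by (cases b) auto
    ultimately show ?case using Cons by auto
  qed simp
  then show ?thesis using assms unfolding coarsens_def by (metis length_map)
qed

lemma composition_eqI:
  assumes "composition \<beta>" "composition \<gamma>" "sum_list \<beta> = sum_list \<gamma>" "partial_sums \<beta> = partial_sums \<gamma>"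
  shows "\<beta> = \<gamma>"
proof -
  have "ps \<beta> = ps \<gamma>" using assms by (simp add: ps_partial_sums)
  then have "coarsens \<beta> \<gamma>" "coarsens \<gamma> \<beta>" using assms by (auto simp: coarsens_iff)
  then show ?thesis using coarsens_same_length length_coarsens by blast
qed

lemma partial_sums_append:
  assumes "composition (\<alpha> @ \<beta>)" "\<alpha> \<noteq> []" "\<beta> \<noteq> []"
  shows "partial_sums (\<alpha> @ \<beta>) = partial_sums \<alpha> \<union> {sum_list \<alpha>} \<union> (+) (sum_list \<alpha>) ` partial_sums \<beta>"
proof -
  have c: "composition \<alpha>" "composition \<beta>" using assms by auto
  then have "sum_list \<alpha> > 0" "sum_list \<beta> > 0" using assms composition_sum_0 by auto
  then show ?thesis
    using partial_sums_subset[OF c(1)] partial_sums_subset[OF c(2)]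
    unfolding partial_sums_ps[OF assms(1)] ps_append ps_partial_sums[OF c(1)] ps_partial_sums[OF c(2)] by auto
qed

lemma composition_of_set:
  assumes "S \<subseteq> {0<..<n}" "n > 0"
  obtains \<beta> where "composition \<beta>" "sum_list \<beta> = n" "partial_sums \<beta> = S"
  using assms
proof (induction n arbitrary: S thesis rule: less_induct)
  case (less n)
  show ?case
  proof (cases "S = {}")
    case True
    then show ?thesis using less.prems(1)[of "[n]"] less.prems(3) by (auto simp: partial_sums_def)
  next
    case False
    have fin: "finite S" using less.prems(2) by (rule finite_subset) simp
    define m where "m = Max S"
    have m: "m \<in> S" "\<And>i. i \<in> S \<Longrightarrow> i \<le> m" using Max_in[OF fin False] Max_ge[OF fin] by (auto simp: m_def)
    then have mn: "0 < m" "m < n" using less.prems(2) by auto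
    have "S - {m} \<subseteq> {0<..<m}" using m(2) less.prems(2) by fastforce
    then obtain \<beta> where \<beta>: "composition \<beta>" "sum_list \<beta> = m" "partial_sums \<beta> = S - {m}"
      using less.IH[OF mn(2) _ _ mn(1)] by metis
    have "partial_sums [n - m] = {}" by (auto simp: partial_sums_def)
    moreover have "\<beta> \<noteq> []" using \<beta>(2) mn(1) by auto
    ultimately have "partial_sums (\<beta> @ [n - m]) = S"
      using partial_sums_append[of \<beta> "[n - m]"] \<beta> mn m(1) by auto
    then show ?thesis using less.prems(1)[of "\<beta> @ [n - m]"] \<beta> mn by auto
  qed
qed

lemma partial_sums_rev:
  assumes "composition \<beta>"
  shows "partial_sums (rev \<beta>) = rev_set (sum_list \<beta>) (partial_sums \<beta>)"
proof -
  have "ps (rev \<beta>) = {x. x \<le> sum_list \<beta> \<and> sum_list \<beta> - x \<in> ps \<beta>}"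
  proof (induction \<beta>)
    case (Cons b \<beta>)
    have "x \<in> ps (rev (b # \<beta>)) \<longleftrightarrow> (x \<le> sum_list \<beta> \<and> sum_list \<beta> - x \<in> ps \<beta>) \<or> x = sum_list \<beta> + b" for x
      unfolding rev.simps ps_append Cons by (auto simp: ps_Cons)
    moreover have "x \<le> sum_list (b # \<beta>) \<and> sum_list (b # \<beta>) - x \<in> ps (b # \<beta>) \<longleftrightarrow>
       (x \<le> sum_list \<beta> \<and> sum_list \<beta> - x \<in> ps \<beta>) \<or> x = sum_list \<beta> + b" for x
      unfolding sum_list.Cons
    proof
      assume x: "x \<le> b + sum_list \<beta> \<and> b + sum_list \<beta> - x \<in> ps (b # \<beta>)"
      then consider "b + sum_list \<beta> - x = 0" | y where "y \<in> ps \<beta>" "b + sum_list \<beta> - x = b + y" by (auto simp: ps_Cons)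
      then show "(x \<le> sum_list \<beta> \<and> sum_list \<beta> - x \<in> ps \<beta>) \<or> x = sum_list \<beta> + b"
      proof cases
        case 2
        then have "x + y = sum_list \<beta>" using x by linarith
        then have "x \<le> sum_list \<beta>" "sum_list \<beta> - x = y" by auto
        then show ?thesis using 2 by simp
      qed (use x in simp)
    next
      assume "(x \<le> sum_list \<beta> \<and> sum_list \<beta> - x \<in> ps \<beta>) \<or> x = sum_list \<beta> + b"
      then show "x \<le> b + sum_list \<beta> \<and> b + sum_list \<beta> - x \<in> ps (b # \<beta>)"
      proof
        assume x: "x \<le> sum_list \<beta> \<and> sum_list \<beta> - x \<in> ps \<beta>"
        then have e: "b + sum_list \<beta> - x = b + (sum_list \<beta> - x)" and le: "x \<le> b + sum_list \<beta>" by linarith+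
        show ?thesis unfolding e ps_Cons using x le by blast
      qed simp
    qed
    ultimately show ?case by (intro set_eqI) (simp only: mem_Collect_eq)
  qed simp
  then have "x \<in> partial_sums (rev \<beta>) \<longleftrightarrow> x \<noteq> 0 \<and> x \<noteq> sum_list \<beta> \<and> x \<le> sum_list \<beta> \<and> sum_list \<beta> - x \<in> ps \<beta>" for x
    using assms by (auto simp: partial_sums_ps[of "rev \<beta>"])
  moreover have "x \<in> rev_set (sum_list \<beta>) (partial_sums \<beta>) \<longleftrightarrow> x \<noteq> 0 \<and> x \<noteq> sum_list \<beta> \<and> x \<le> sum_list \<beta> \<and> sum_list \<beta> - x \<in> ps \<beta>" for x
    by (cases "x = 0"; cases "x < sum_list \<beta>") (auto simp: rev_set_def partial_sums_ps[OF assms])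
  ultimately show ?thesis by blast
qed

section \<open>Operations on compositions\<close>

lemma near_concat_Cons [simp]: "\<alpha> \<noteq> [] \<Longrightarrow> \<alpha> \<odot> (b # \<beta>) = butlast \<alpha> @ (last \<alpha> + b) # \<beta>"
  by (cases \<alpha>) auto

lemma near_concat_Nil2 [simp]: "\<alpha> \<odot> [] = \<alpha>"
  by (cases \<alpha>) auto

lemma near_concat_snoc: "(\<alpha> @ [a]) \<odot> (b # \<beta>) = \<alpha> @ (a + b) # \<beta>"
  by simp

lemma near_concat_append: "\<beta> \<noteq> [] \<Longrightarrow> \<alpha> \<odot> (\<beta> @ \<gamma>) = (\<alpha> \<odot> \<beta>) @ \<gamma>"
  by (cases \<alpha>; cases \<beta>) auto

lemma sum_near_concat: "sum_list (\<alpha> \<odot> \<beta>) = sum_list \<alpha> + sum_list \<beta>"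
  by (cases \<alpha> rule: rev_cases; cases \<beta>) (auto simp del: near_concat.simps(3) simp: near_concat_snoc)

lemma composition_near_concat: "composition \<alpha> \<Longrightarrow> composition \<beta> \<Longrightarrow> composition (\<alpha> \<odot> \<beta>)"
  by (cases \<alpha> rule: rev_cases; cases \<beta>) (auto simp: near_concat_snoc simp del: near_concat.simps(3))

lemma near_concat_assoc: "(\<alpha> \<odot> \<beta>) \<odot> \<gamma> = \<alpha> \<odot> (\<beta> \<odot> \<gamma>)"
proof (cases "\<alpha> = [] \<or> \<beta> = [] \<or> \<gamma> = []")
  case False
  then obtain \<alpha>' a c \<gamma>' where e: "\<alpha> = \<alpha>' @ [a]" "\<gamma> = c # \<gamma>'" by (metis rev_exhaust list.exhaust)
  show ?thesis
  proof (cases "length \<beta> = 1")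
    case True
    then obtain b where "\<beta> = [b]" by (cases \<beta>) auto
    then show ?thesis by (simp add: e)
  next
    case F: False
    then obtain b \<beta>' b' where b: "\<beta> = b # \<beta>' @ [b']" using False by (cases \<beta>; cases "tl \<beta>" rule: rev_cases) auto
    show ?thesis unfolding e b by (simp add: butlast_append)
  qed
qed auto

lemma near_power_add: "near_power \<delta> (a + b) = near_power \<delta> a \<odot> near_power \<delta> b"
  by (induction a) (auto simp: near_concat_assoc)

lemma composition_near_power: "composition \<delta> \<Longrightarrow> composition (near_power \<delta> a)"
  by (induction a) (auto simp: composition_near_concat)

lemma sum_near_power: "sum_list (near_power \<delta> a) = a * sum_list \<delta>"
  by (induction a) (auto simp: sum_near_concat)

lemma composition_circ: "composition \<delta> \<Longrightarrow> composition (\<alpha> \<circ>\<^sub>c \<delta>)"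
  unfolding comp_circ_def by (induction \<alpha>) (auto simp: composition_near_power)

lemma sum_circ: "sum_list (\<alpha> \<circ>\<^sub>c \<delta>) = sum_list \<alpha> * sum_list \<delta>"
  unfolding comp_circ_def by (induction \<alpha>) (auto simp: sum_near_power algebra_simps)

lemma circ_Nil [simp]: "[] \<circ>\<^sub>c \<delta> = []" by (simp add: comp_circ_def)

lemma circ_Cons: "(a # \<alpha>) \<circ>\<^sub>c \<delta> = near_power \<delta> a @ (\<alpha> \<circ>\<^sub>c \<delta>)" by (simp add: comp_circ_def)

lemma near_power_nonempty: "composition \<delta> \<Longrightarrow> \<delta> \<noteq> [] \<Longrightarrow> a > 0 \<Longrightarrow> near_power \<delta> a \<noteq> []"
  using sum_near_power[of \<delta> a] composition_sum_0[of \<delta>] by auto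

lemma ps_near_concat:
  assumes "composition \<alpha>" "composition \<beta>" "\<alpha> \<noteq> []" "\<beta> \<noteq> []"
  shows "ps (\<alpha> \<odot> \<beta>) = (ps \<alpha> - {sum_list \<alpha>}) \<union> (+) (sum_list \<alpha>) ` (ps \<beta> - {0})"
proof -
  obtain \<alpha>' a b \<beta>' where e: "\<alpha> = \<alpha>' @ [a]" "\<beta> = b # \<beta>'" using assms by (metis rev_exhaust list.exhaust)
  have pos: "a > 0" "b > 0" using assms e by auto
  have "sum_list \<alpha>' + a \<notin> ps \<alpha>'" using ps_le[of "sum_list \<alpha>' + a" \<alpha>'] pos by auto
  then have A: "ps \<alpha> - {sum_list \<alpha>} = ps \<alpha>'"
    using pos by (auto simp: e ps_append ps_Cons)
  have B: "ps \<beta> - {0} = (+) b ` ps \<beta>'"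
    using pos by (auto simp: e ps_Cons)
  show ?thesis unfolding A B unfolding e near_concat_snoc ps_append ps_Cons
    by (auto simp: image_image add.assoc)
qed

lemma partial_sums_near_concat:
  assumes "composition \<alpha>" "composition \<beta>"
  shows "partial_sums (\<alpha> \<odot> \<beta>) = partial_sums \<alpha> \<union> (+) (sum_list \<alpha>) ` partial_sums \<beta>"
proof (cases "\<alpha> = [] \<or> \<beta> = []")
  case True
  have "partial_sums [] = {}" by (simp add: partial_sums_def)
  then show ?thesis using True by auto
next
  case False
  then have ne: "\<alpha> \<noteq> []" "\<beta> \<noteq> []" by auto
  have pos: "sum_list \<alpha> > 0" "sum_list \<beta> > 0" using assms ne composition_sum_0 by auto
  have "sum_list \<alpha> + sum_list \<beta> \<notin> ps \<alpha>" using ps_le[of "sum_list \<alpha> + sum_list \<beta>" \<alpha>] pos by auto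
  then show ?thesis using pos
    unfolding partial_sums_ps[OF composition_near_concat[OF assms]] partial_sums_ps[OF assms(1)] partial_sums_ps[OF assms(2)]
      ps_near_concat[OF assms ne] sum_near_concat by auto
qed

lemma partial_sums_near_power:
  assumes "composition \<delta>"
  defines "s \<equiv> sum_list \<delta>"
  shows "partial_sums (near_power \<delta> a) = {i. i < a * s \<and> i mod s \<in> partial_sums \<delta>}"
proof (induction a)
  case 0
  then show ?case by (simp add: partial_sums_def)
next
  case (Suc a)
  have sub: "partial_sums \<delta> \<subseteq> {0<..<s}" using partial_sums_subset[OF assms(1)] by (simp add: s_def)
  have "partial_sums (near_power \<delta> (Suc a)) = partial_sums \<delta> \<union> (+) s ` {i. i < a * s \<and> i mod s \<in> partial_sums \<delta>}"
    using partial_sums_near_concat[OF assms(1) composition_near_power[OF assms(1)]] by (simp add: Suc s_def)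
  also have "\<dots> = {i. i < Suc a * s \<and> i mod s \<in> partial_sums \<delta>}"
  proof (intro equalityI subsetI)
    fix i assume "i \<in> {i. i < Suc a * s \<and> i mod s \<in> partial_sums \<delta>}"
    then have i: "i < s + a * s" "i mod s \<in> partial_sums \<delta>" by auto
    show "i \<in> partial_sums \<delta> \<union> (+) s ` {i. i < a * s \<and> i mod s \<in> partial_sums \<delta>}"
    proof (cases "i < s")
      case False
      then obtain j where j: "i = s + j" by (metis le_Suc_ex not_less)
      then have "j < a * s" "j mod s \<in> partial_sums \<delta>" using i by auto
      then show ?thesis using j by blast
    qed (use i in simp)
  qed (use sub in auto)
  finally show ?case .
qed

text \<open>Off the multiples of \<open>s\<close>, the set of partial sums of \<open>\<alpha> \<circ> \<delta>\<close> repeats that of \<open>\<delta>\<close> with period \<open>s\<close>;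
  the multiples of \<open>s\<close> are governed by \<open>\<alpha>\<close>. By \<open>composition_eqI\<close> this description determines
  \<open>\<alpha> \<circ> \<delta>\<close>, and the laws below are read off from it.\<close>

theorem partial_sums_circ:
  assumes "composition \<alpha>" "composition \<delta>" "\<delta> \<noteq> []"
  defines "s \<equiv> sum_list \<delta>"
  shows "partial_sums (\<alpha> \<circ>\<^sub>c \<delta>) =
    {i. i < sum_list \<alpha> * s \<and> (if s dvd i then i div s \<in> partial_sums \<alpha> else i mod s \<in> partial_sums \<delta>)}"
  using assms(1)
proof (induction \<alpha>)
  case Nil
  then show ?case by (simp add: partial_sums_def)
next
  case (Cons a \<alpha>)
  have s0: "s > 0" using assms composition_sum_0[of \<delta>] by auto
  have sub: "partial_sums \<delta> \<subseteq> {0<..<s}" using partial_sums_subset[OF assms(2)] by (simp add: s_def)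
  have nd: "\<not> s dvd i" if "i mod s \<in> partial_sums \<delta>" for i using sub that by (auto simp: dvd_eq_mod_eq_0)
  have a0: "a > 0" "composition \<alpha>" using Cons.prems by auto
  show ?case
  proof (cases "\<alpha> = []")
    case True
    have "partial_sums [a] = {}" by (auto simp: partial_sums_def)
    then show ?thesis using nd partial_sums_near_power[OF assms(2), of a] by (auto simp: True circ_Cons s_def)
  next
    case False
    have ne: "near_power \<delta> a \<noteq> []" "\<alpha> \<circ>\<^sub>c \<delta> \<noteq> []"
      using near_power_nonempty[OF assms(2,3) a0(1)] False sum_circ[of \<alpha> \<delta>] composition_sum_0[OF a0(2)] s0 by (auto simp: s_def)
    have c: "composition (near_power \<delta> a @ (\<alpha> \<circ>\<^sub>c \<delta>))"
      using assms(2) by (simp add: composition_near_power composition_circ)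
    have "partial_sums ((a # \<alpha>) \<circ>\<^sub>c \<delta>) = {i. i < a * s \<and> i mod s \<in> partial_sums \<delta>} \<union> {a * s} \<union>
      (+) (a * s) ` {i. i < sum_list \<alpha> * s \<and> (if s dvd i then i div s \<in> partial_sums \<alpha> else i mod s \<in> partial_sums \<delta>)}"
      unfolding circ_Cons partial_sums_append[OF c ne] Cons.IH[OF a0(2)]
      using partial_sums_near_power[OF assms(2), of a] sum_near_power[of \<delta> a] by (simp add: s_def)
    also have "\<dots> = {i. i < sum_list (a # \<alpha>) * s \<and> (if s dvd i then i div s \<in> partial_sums (a # \<alpha>) else i mod s \<in> partial_sums \<delta>)}"
    proof -
      have pa: "partial_sums (a # \<alpha>) = insert a ((+) a ` partial_sums \<alpha>)"
        using partial_sums_append[of "[a]" \<alpha>] False Cons.prems by (auto simp: partial_sums_def[of "[a]"])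
      have subA: "partial_sums \<alpha> \<subseteq> {0<..<sum_list \<alpha>}" by (rule partial_sums_subset[OF a0(2)])
      have \<alpha>0: "sum_list \<alpha> > 0" using composition_sum_0[OF a0(2)] False by simp
      show ?thesis
      proof (intro set_eqI)
        fix i
        consider "i < a * s" | "i = a * s" | "a * s < i" by linarith
        then show "i \<in> {i. i < a * s \<and> i mod s \<in> partial_sums \<delta>} \<union> {a * s} \<union>
            (+) (a * s) ` {i. i < sum_list \<alpha> * s \<and> (if s dvd i then i div s \<in> partial_sums \<alpha> else i mod s \<in> partial_sums \<delta>)} \<longleftrightarrow>
          i \<in> {i. i < sum_list (a # \<alpha>) * s \<and> (if s dvd i then i div s \<in> partial_sums (a # \<alpha>) else i mod s \<in> partial_sums \<delta>)}"
        proof cases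
          case 1
          then have "i div s < a" using s0 by (simp add: div_less_iff_less_mult)
          then have "i div s \<notin> partial_sums (a # \<alpha>)" using pa by auto
          moreover have "0 \<notin> partial_sums \<delta>" using sub by auto
          ultimately show ?thesis using 1 nd by (auto simp: distrib_right)
        next
          case 2
          then show ?thesis using s0 \<alpha>0 pa by simp
        next
          case ai: 3
          obtain j where 3: "i = a * s + j" "j > 0" using less_imp_add_positive[OF ai] by auto
          have "i div s = a + j div s" "i mod s = j mod s" "s dvd i \<longleftrightarrow> s dvd j" using 3 s0 by auto
          moreover have "a + j div s \<in> partial_sums (a # \<alpha>) \<longleftrightarrow> j div s \<in> partial_sums \<alpha>" if "s dvd j"
            using that 3 s0 by (auto simp: pa elim!: dvdE)
          ultimately show ?thesis using 3 by (auto simp: distrib_right)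
        qed
      qed
    qed
    finally show ?thesis .
  qed
qed

lemma circ_nonempty:
  assumes "composition \<alpha>" "composition \<beta>" "\<alpha> \<noteq> []" "\<beta> \<noteq> []"
  shows "\<alpha> \<circ>\<^sub>c \<beta> \<noteq> []"
proof
  assume e: "\<alpha> \<circ>\<^sub>c \<beta> = []"
  have "sum_list \<alpha> * sum_list \<beta> = 0" unfolding sum_circ[symmetric] e by simp
  then show False using assms composition_sum_0 by simp
qed

lemma circ_assoc:
  assumes "composition \<alpha>" "composition \<beta>" "composition \<gamma>" "\<beta> \<noteq> []" "\<gamma> \<noteq> []"
  shows "(\<alpha> \<circ>\<^sub>c \<beta>) \<circ>\<^sub>c \<gamma> = \<alpha> \<circ>\<^sub>c (\<beta> \<circ>\<^sub>c \<gamma>)"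
proof (rule composition_eqI)
  define t where "t = sum_list \<beta>"
  define s where "s = sum_list \<gamma>"
  have pos: "t > 0" "s > 0" using assms composition_sum_0 by (auto simp: t_def s_def)
  have ne: "\<beta> \<circ>\<^sub>c \<gamma> \<noteq> []" by (rule circ_nonempty[OF assms(2,3,4,5)])
  show "partial_sums ((\<alpha> \<circ>\<^sub>c \<beta>) \<circ>\<^sub>c \<gamma>) = partial_sums (\<alpha> \<circ>\<^sub>c (\<beta> \<circ>\<^sub>c \<gamma>))"
  proof (intro set_eqI)
    fix i
    have L: "i \<in> partial_sums ((\<alpha> \<circ>\<^sub>c \<beta>) \<circ>\<^sub>c \<gamma>) \<longleftrightarrow> i < sum_list \<alpha> * t * s \<and>
      (if s dvd i then i div s < sum_list \<alpha> * t \<and> (if t dvd i div s then i div s div t \<in> partial_sums \<alpha> else i div s mod t \<in> partial_sums \<beta>)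
       else i mod s \<in> partial_sums \<gamma>)"
      using partial_sums_circ[OF composition_circ[OF assms(2)] assms(3,5), of \<alpha>] partial_sums_circ[OF assms(1,2,4)]
      by (simp add: sum_circ t_def s_def)
    have R: "i \<in> partial_sums (\<alpha> \<circ>\<^sub>c (\<beta> \<circ>\<^sub>c \<gamma>)) \<longleftrightarrow> i < sum_list \<alpha> * (t * s) \<and>
      (if t * s dvd i then i div (t * s) \<in> partial_sums \<alpha> else i mod (t * s) < t * s \<and>
        (if s dvd i mod (t * s) then i mod (t * s) div s \<in> partial_sums \<beta> else i mod (t * s) mod s \<in> partial_sums \<gamma>))"
      using partial_sums_circ[OF assms(1) composition_circ[OF assms(3)] ne] partial_sums_circ[OF assms(2,3,5)]
      by (simp add: sum_circ t_def s_def)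
    have e1: "i mod (t * s) mod s = i mod s" by (simp add: mod_mod_cancel)
    have e2: "s dvd i mod (t * s) \<longleftrightarrow> s dvd i" by (simp add: dvd_mod_iff)
    have e3: "i mod (t * s) div s = i div s mod t" using pos by (simp add: mod_mult2_eq mult.commute[of t s])
    have e4: "t * s dvd i \<longleftrightarrow> s dvd i \<and> t dvd i div s"
      using pos by (metis dvd_div_iff_mult dvd_mult_right less_not_refl2 mult.commute)
    have e5: "i div (t * s) = i div s div t" by (simp add: div_mult2_eq mult.commute[of t s])
    have e6: "i div s < sum_list \<alpha> * t" if "i < sum_list \<alpha> * t * s" using that pos by (simp add: div_less_iff_less_mult)
    have e7: "i mod (t * s) < t * s" using pos by simp
    show "i \<in> partial_sums ((\<alpha> \<circ>\<^sub>c \<beta>) \<circ>\<^sub>c \<gamma>) \<longleftrightarrow> i \<in> partial_sums (\<alpha> \<circ>\<^sub>c (\<beta> \<circ>\<^sub>c \<gamma>))"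
      unfolding L R e1 e2 e3 e4 e5 using e6 e7 by (cases "s dvd i") (auto simp: mult.assoc)
  qed
qed (use assms in \<open>auto simp: composition_circ sum_circ mult.assoc\<close>)

text \<open>\<open>circ_list\<close> is bracketed to the right; associativity splits off the last factor instead. The last factor is
  the one that is determined by the periodic part of the set of partial sums.\<close>

lemma circ_list_snoc:
  assumes "bs \<noteq> []" "\<forall>b\<in>set (bs @ [c]). composition b \<and> b \<noteq> []"
  shows "circ_list (bs @ [c]) = circ_list bs \<circ>\<^sub>c c"
    and "composition (circ_list bs)" "circ_list bs \<noteq> []"
proof -
  have "circ_list (bs @ [c]) = circ_list bs \<circ>\<^sub>c c \<and> composition (circ_list bs) \<and> circ_list bs \<noteq> []"
    using assms
  proof (induction bs)
    case (Cons b bs)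
    show ?case
    proof (cases bs)
      case (Cons b' bs')
      have IH: "circ_list (bs @ [c]) = circ_list bs \<circ>\<^sub>c c" "composition (circ_list bs)" "circ_list bs \<noteq> []"
        using Cons.IH Cons.prems \<open>bs = b' # bs'\<close> by auto
      have "circ_list (b # bs) = b \<circ>\<^sub>c circ_list bs" "circ_list ((b # bs) @ [c]) = b \<circ>\<^sub>c circ_list (bs @ [c])"
        using \<open>bs = b' # bs'\<close> by simp_all
      then show ?thesis using Cons.prems IH circ_assoc[of b "circ_list bs" c]
        by (simp add: composition_circ circ_nonempty)
    qed (use Cons.prems in auto)
  qed simp
  then show "circ_list (bs @ [c]) = circ_list bs \<circ>\<^sub>c c" "composition (circ_list bs)" "circ_list bs \<noteq> []" by auto
qed

lemma rev_circ:
  assumes "composition \<alpha>" "composition \<delta>" "\<delta> \<noteq> []"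
  shows "rev (\<alpha> \<circ>\<^sub>c \<delta>) = rev \<alpha> \<circ>\<^sub>c rev \<delta>"
proof (rule composition_eqI)
  define s where "s = sum_list \<delta>"
  define n where "n = sum_list \<alpha>"
  have s0: "s > 0" using assms composition_sum_0[of \<delta>] by (auto simp: s_def)
  have sub: "partial_sums \<alpha> \<subseteq> {0<..<n}" "partial_sums \<delta> \<subseteq> {0<..<s}"
    using partial_sums_subset assms by (auto simp: n_def s_def)
  show "partial_sums (rev (\<alpha> \<circ>\<^sub>c \<delta>)) = partial_sums (rev \<alpha> \<circ>\<^sub>c rev \<delta>)"
  proof (intro set_eqI)
    fix i
    have L: "i \<in> partial_sums (rev (\<alpha> \<circ>\<^sub>c \<delta>)) \<longleftrightarrow> 0 < i \<and> i < n * s \<and> n * s - i < n * s \<and>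
        (if s dvd n * s - i then (n * s - i) div s \<in> partial_sums \<alpha> else (n * s - i) mod s \<in> partial_sums \<delta>)"
      using partial_sums_rev[OF composition_circ[OF assms(2)], of \<alpha>] partial_sums_circ[OF assms]
      by (simp add: rev_set_def sum_circ n_def s_def)
    have R: "i \<in> partial_sums (rev \<alpha> \<circ>\<^sub>c rev \<delta>) \<longleftrightarrow> i < n * s \<and>
      (if s dvd i then 0 < i div s \<and> i div s < n \<and> n - i div s \<in> partial_sums \<alpha>
       else 0 < i mod s \<and> i mod s < s \<and> s - i mod s \<in> partial_sums \<delta>)"
      using partial_sums_circ[of "rev \<alpha>" "rev \<delta>"] assms by (simp add: partial_sums_rev rev_set_def n_def s_def)
    show "i \<in> partial_sums (rev (\<alpha> \<circ>\<^sub>c \<delta>)) \<longleftrightarrow> i \<in> partial_sums (rev \<alpha> \<circ>\<^sub>c rev \<delta>)"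
    proof (cases "0 < i \<and> i < n * s")
      case False
      have "\<not> (i < n * s \<and> (if s dvd i then 0 < i div s \<and> i div s < n \<and> n - i div s \<in> partial_sums \<alpha>
       else 0 < i mod s \<and> i mod s < s \<and> s - i mod s \<in> partial_sums \<delta>))"
        using False by (cases "i = 0") auto
      then show ?thesis using False unfolding L R by blast
    next
      case True
      show ?thesis
      proof (cases "s dvd i")
        case T: True
        then obtain j where j: "i = s * j" by (auto elim: dvdE)
        have jn: "0 < j" "j < n" using True j by (auto simp: mult.commute)
        have "n * s - i = s * (n - j)" using j by (simp add: algebra_simps diff_mult_distrib2)
        then show ?thesis unfolding L R using True T j jn s0 by simp
      next
        case F: False
        define r where "r = i mod s"
        have r: "0 < r" "r < s" using F s0 by (auto simp: r_def dvd_eq_mod_eq_0)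
        have "i = s * (i div s) + r" by (simp add: r_def)
        moreover have "i div s < n" using True s0 by (simp add: div_less_iff_less_mult)
        ultimately have e: "n * s - i = s * (n - 1 - i div s) + (s - r)"
        proof -
          obtain k where k: "n = Suc (i div s + k)" using \<open>i div s < n\<close> less_imp_Suc_add by blast
          have "n * s = s * (i div s) + s * k + s" by (simp add: k algebra_simps)
          then have "n * s - i = s * k + (s - r)" using \<open>i = s * (i div s) + r\<close> r by linarith
          then show ?thesis by (simp add: k)
        qed
        have "(n * s - i) mod s = s - r" unfolding e by (subst mod_mult_self4) (use r in simp)
        moreover from this have "\<not> s dvd n * s - i" using r by (simp add: dvd_eq_mod_eq_0)
        moreover have "n * s - i < n * s" using True by linarith
        ultimately show ?thesis unfolding L R using True F r by (simp add: r_def)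
      qed
    qed
  qed
qed (use assms in \<open>auto simp: composition_circ sum_circ\<close>)

lemma rev_circ_list:
  assumes "bs \<noteq> []" "\<forall>b\<in>set bs. composition b \<and> b \<noteq> []"
  shows "rev (circ_list bs) = circ_list (map rev bs)"
  using assms
proof (induction bs rule: rev_induct)
  case (snoc c bs)
  show ?case
  proof (cases "bs = []")
    case False
    have 1: "circ_list (bs @ [c]) = circ_list bs \<circ>\<^sub>c c" "composition (circ_list bs)" "circ_list bs \<noteq> []"
      using circ_list_snoc[OF False snoc.prems(2)] by auto
    have 2: "circ_list (map rev bs @ [rev c]) = circ_list (map rev bs) \<circ>\<^sub>c rev c"
      by (rule circ_list_snoc(1)) (use False snoc.prems in auto)
    show ?thesis using 1 2 snoc False rev_circ[of "circ_list bs" c] by simp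
  qed simp
qed simp

section \<open>Coarsening polynomials\<close>

definition csum :: "nat list \<Rightarrow> (nat \<Rightarrow> 'a::comm_ring_1) \<Rightarrow> 'a" where
  "csum \<beta> h = path_sum (insert (sum_list \<beta>) (partial_sums \<beta>)) h (sum_list \<beta>)"

lemma csum_coarsenings:
  "composition \<beta> \<Longrightarrow> csum \<beta> h = (\<Sum>\<alpha> | coarsens \<alpha> \<beta>. prod_list (map h \<alpha>))"
  by (simp add: csum_def path_sum_paths coarsenings_paths)

lemma csum_path_types: "csum \<beta> h = (\<Sum>t\<in>#path_types (sum_list \<beta>) (partial_sums \<beta>). \<Prod>x\<in>#t. h x)"
  by (simp add: csum_def path_sum_path_types)

text \<open>A path to \<open>k\<close> either avoids \<open>a\<close> or is cut by it into two paths.\<close>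

lemma path_sum_visit:
  fixes h :: "nat \<Rightarrow> 'a::comm_ring_1"
  assumes "0 < a" "a < k"
  shows "path_sum (insert a T) h k = path_sum (T - {a}) h k + path_sum (insert a T) h a * path_sum {i. i + a \<in> T} h (k - a)"
  using assms(2)
proof (induction k rule: less_induct)
  case (less k)
  let ?L = "path_sum (insert a T) h" and ?M = "path_sum (T - {a}) h" and ?N = "path_sum {i. i + a \<in> T} h"
  show ?case
  proof (cases "k \<in> T")
    case False
    then show ?thesis using less.prems assms(1) by (simp add: path_sum_pos)
  next
    case True
    have low: "?L i = ?M i" if "i < a" for i by (rule path_sum_cong) (use that in auto)
    have Ma: "?M a = 0" using assms(1) by (simp add: path_sum_pos)
    have "?L k = (\<Sum>i<k. ?L i * h (k - i))" using True less.prems by (simp add: path_sum_pos)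
    also have "\<dots> = (\<Sum>i<k. ?M i * h (k - i) + (if a \<le> i then ?L a * ?N (i - a) * h (k - i) else 0))"
    proof (rule sum.cong)
      fix i assume "i \<in> {..<k}"
      then consider "i < a" | "i = a" | "a < i" "i < k" by (cases "i < a"; cases "i = a") auto
      then show "?L i * h (k - i) = ?M i * h (k - i) + (if a \<le> i then ?L a * ?N (i - a) * h (k - i) else 0)"
      proof cases
        case 3
        then show ?thesis using less.IH[OF 3(2,1)] by (simp add: distrib_right)
      qed (simp_all add: low Ma)
    qed simp
    also have "\<dots> = ?M k + (\<Sum>i<k. if a \<le> i then ?L a * ?N (i - a) * h (k - i) else 0)"
      using True less.prems by (simp add: sum.distrib path_sum_pos)
    also have "(\<Sum>i<k. if a \<le> i then ?L a * ?N (i - a) * h (k - i) else 0) = (\<Sum>i\<in>{a..<k}. ?L a * ?N (i - a) * h (k - i))"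
      by (intro sum.mono_neutral_cong_right) auto
    also have "\<dots> = (\<Sum>i<k - a. ?L a * (?N i * h (k - a - i)))"
      by (rule sum.reindex_bij_witness[of _ "\<lambda>i. i + a" "\<lambda>i. i - a"]) (auto simp: mult.assoc add.commute)
    also have "\<dots> = ?L a * ?N (k - a)"
      using True less.prems by (simp add: path_sum_pos sum_distrib_left)
    finally show ?thesis .
  qed
qed

lemma csum_singleton: "a > 0 \<Longrightarrow> csum [a] h = h a"
proof -
  assume a: "a > 0"
  have e: "partial_sums [a] = {}" by (auto simp: partial_sums_def)
  have "(\<Sum>i<a. path_sum {a} h i * h (a - i)) = (\<Sum>i<a. if i = 0 then h a else 0)"
    by (intro sum.cong) (auto simp: path_sum_pos)
  then show ?thesis using a by (simp add: csum_def e path_sum_pos)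
qed

text \<open>A coarsening of a concatenation either respects the seam or merges the two components adjacent to it.\<close>

lemma csum_append:
  assumes c: "composition \<alpha>" "composition \<beta>" and ne: "\<alpha> \<noteq> []" "\<beta> \<noteq> []"
  shows "csum (\<alpha> @ \<beta>) h = csum \<alpha> h * csum \<beta> h + csum (\<alpha> \<odot> \<beta>) h"
proof -
  define a where "a = sum_list \<alpha>"
  define b where "b = sum_list \<beta>"
  have pos: "a > 0" "b > 0" using c ne composition_sum_0 by (auto simp: a_def b_def)
  define T where "T = insert (a + b) (partial_sums (\<alpha> \<odot> \<beta>))"
  have T: "T = insert (a + b) (partial_sums \<alpha> \<union> (+) a ` partial_sums \<beta>)"
    by (simp add: T_def partial_sums_near_concat[OF c] a_def)
  have sub: "partial_sums \<alpha> \<subseteq> {0<..<a}" "partial_sums \<beta> \<subseteq> {0<..<b}"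
    using partial_sums_subset c by (auto simp: a_def b_def)
  have "insert (a + b) (partial_sums (\<alpha> @ \<beta>)) = insert a T"
    using partial_sums_append[of \<alpha> \<beta>] c ne by (auto simp: T a_def)
  then have "csum (\<alpha> @ \<beta>) h = path_sum (insert a T) h (a + b)"
    by (simp add: csum_def a_def b_def)
  also have "\<dots> = path_sum (T - {a}) h (a + b) + path_sum (insert a T) h a * path_sum {i. i + a \<in> T} h (a + b - a)"
    by (rule path_sum_visit) (use pos in auto)
  also have "path_sum (T - {a}) h (a + b) = csum (\<alpha> \<odot> \<beta>) h"
  proof -
    have "a \<notin> T" using sub pos by (auto simp: T)
    then have "T - {a} = T" by simp
    then show ?thesis by (simp add: csum_def sum_near_concat T_def a_def b_def)
  qed
  also have "path_sum (insert a T) h a = csum \<alpha> h"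
    unfolding csum_def a_def[symmetric] by (rule path_sum_cong) (use sub pos in \<open>auto simp: T\<close>)
  also have "path_sum {i. i + a \<in> T} h (a + b - a) = csum \<beta> h"
    unfolding csum_def b_def[symmetric] diff_add_inverse
    by (rule path_sum_cong) (use sub pos in \<open>auto simp: T add.commute\<close>)
  finally show ?thesis by (simp add: add.commute)
qed

text \<open>Induction on the number of components of \<open>\<alpha>\<close>: both sides satisfy the recursion \<open>csum_append\<close> for splitting off the
  first component.\<close>

theorem csum_circ:
  assumes "composition \<alpha>" "composition \<delta>" "\<alpha> \<noteq> []" "\<delta> \<noteq> []"
  shows "csum (\<alpha> \<circ>\<^sub>c \<delta>) h = csum \<alpha> (\<lambda>a. csum (near_power \<delta> a) h)"
  using assms(1,3)
proof (induction "length \<alpha>" arbitrary: \<alpha> rule: less_induct)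
  case less
  obtain a \<alpha>' where \<alpha>: "\<alpha> = a # \<alpha>'" "a > 0" using less.prems by (cases \<alpha>) auto
  show ?case
  proof (cases \<alpha>')
    case Nil
    then show ?thesis using \<alpha> by (simp add: circ_Cons csum_singleton)
  next
    case (Cons b \<alpha>'')
    have c: "composition (b # \<alpha>'')" "composition ((a + b) # \<alpha>'')" using less.prems \<alpha> Cons by auto
    have np: "composition (near_power \<delta> x)" for x by (rule composition_near_power[OF assms(2)])
    have npn: "near_power \<delta> x \<noteq> []" if "x > 0" for x by (rule near_power_nonempty[OF assms(2,4) that])
    have cc: "composition ((b # \<alpha>'') \<circ>\<^sub>c \<delta>)" by (rule composition_circ[OF assms(2)])
    have ccn: "(b # \<alpha>'') \<circ>\<^sub>c \<delta> \<noteq> []" using circ_nonempty[OF c(1) assms(2) _ assms(4)] by simp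
    have merge: "near_power \<delta> a \<odot> ((b # \<alpha>'') \<circ>\<^sub>c \<delta>) = ((a + b) # \<alpha>'') \<circ>\<^sub>c \<delta>"
      using npn[of b] c(1) by (simp add: circ_Cons near_concat_append near_power_add)
    have "csum (\<alpha> \<circ>\<^sub>c \<delta>) h = csum (near_power \<delta> a) h * csum ((b # \<alpha>'') \<circ>\<^sub>c \<delta>) h + csum (((a + b) # \<alpha>'') \<circ>\<^sub>c \<delta>) h"
      unfolding merge[symmetric] \<alpha> Cons circ_Cons[of a] by (rule csum_append[OF np cc npn[OF \<alpha>(2)] ccn])
    also have "\<dots> = csum [a] (\<lambda>a. csum (near_power \<delta> a) h) * csum (b # \<alpha>'') (\<lambda>a. csum (near_power \<delta> a) h)
       + csum ((a + b) # \<alpha>'') (\<lambda>a. csum (near_power \<delta> a) h)"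
      using less.hyps[of "b # \<alpha>''"] less.hyps[of "(a + b) # \<alpha>''"] c \<alpha> Cons by (simp add: csum_singleton)
    also have "\<dots> = csum \<alpha> (\<lambda>a. csum (near_power \<delta> a) h)"
      using csum_append[of "[a]" "b # \<alpha>''" "\<lambda>a. csum (near_power \<delta> a) h"] c \<alpha> Cons by simp
    finally show ?thesis .
  qed
qed

lemma csum_rev:
  assumes "composition \<beta>"
  shows "csum (rev \<beta>) h = csum \<beta> h"
proof (cases "\<beta> = []")
  case False
  then have pos: "sum_list \<beta> > 0" using assms composition_sum_0 by auto
  show ?thesis unfolding csum_def partial_sums_rev[OF assms]
    using path_sum_reverse[OF pos, of "rev_set (sum_list \<beta>) (partial_sums \<beta>)" "partial_sums \<beta>" h]
    by (simp add: rev_set_def)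
qed simp

lemma csum_circ_cong:
  assumes "composition \<alpha>" "composition \<alpha>'" "\<alpha> \<noteq> []" "\<alpha>' \<noteq> []" "composition \<delta>" "\<delta> \<noteq> []"
    and "\<And>h :: nat \<Rightarrow> 'a::comm_ring_1. csum \<alpha> h = csum \<alpha>' h" and "\<delta>' = \<delta> \<or> \<delta>' = rev \<delta>"
  shows "csum (\<alpha> \<circ>\<^sub>c \<delta>) (h :: nat \<Rightarrow> 'a) = csum (\<alpha>' \<circ>\<^sub>c \<delta>') h"
proof -
  have "near_power (rev \<delta>) a = rev (near_power \<delta> a)" if "a > 0" for a
    using rev_circ[of "[a]" \<delta>] assms that by (simp add: circ_Cons)
  then have "csum (near_power (rev \<delta>) a) h = csum (near_power \<delta> a) h" for a
    using csum_rev[OF composition_near_power[OF assms(5)], of a] by (cases "a = 0") auto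
  then have "(\<lambda>a. csum (near_power \<delta>' a) h) = (\<lambda>a. csum (near_power \<delta> a) h)"
    using assms(8) by auto
  moreover have "composition \<delta>'" "\<delta>' \<noteq> []" using assms by auto
  ultimately show ?thesis using assms by (simp add: csum_circ)
qed

theorem csum_circ_list:
  assumes "bs \<noteq> []" "length cs = length bs" "\<forall>b\<in>set bs. composition b \<and> b \<noteq> []"
    "\<forall>i<length bs. cs ! i = bs ! i \<or> cs ! i = rev (bs ! i)"
  shows "csum (circ_list bs) (h :: nat \<Rightarrow> 'a::comm_ring_1) = csum (circ_list cs) h"
  using assms
proof (induction bs arbitrary: cs h rule: rev_induct)
  case (snoc b bs)
  obtain cs' c where cs: "cs = cs' @ [c]" "length cs' = length bs" using snoc.prems(2) by (cases cs rule: rev_cases) auto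
  have c: "c = b \<or> c = rev b" using snoc.prems(4)[rule_format, of "length bs"] cs by (simp add: nth_append)
  have cs'i: "\<forall>i<length bs. cs' ! i = bs ! i \<or> cs' ! i = rev (bs ! i)"
  proof (intro allI impI)
    fix i assume "i < length bs"
    then show "cs' ! i = bs ! i \<or> cs' ! i = rev (bs ! i)"
      using snoc.prems(4)[rule_format, of i] cs by (simp add: nth_append)
  qed
  have b: "composition b" "b \<noteq> []" using snoc.prems(3) by auto
  show ?case
  proof (cases "bs = []")
    case True
    then show ?thesis using c cs csum_rev[OF b(1), of h] by auto
  next
    case False
    then have ne: "cs' \<noteq> []" using cs by auto
    have cp: "\<forall>x\<in>set (cs' @ [c]). composition x \<and> x \<noteq> []"
    proof
      fix x assume "x \<in> set (cs' @ [c])"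
      then consider i where "i < length cs'" "x = cs' ! i" | "x = c" by (auto simp: in_set_conv_nth)
      then show "composition x \<and> x \<noteq> []"
      proof cases
        case 1
        then have "x = bs ! i \<or> x = rev (bs ! i)" "bs ! i \<in> set bs" using cs'i cs by auto
        then show ?thesis using snoc.prems(3) by auto
      qed (use c b in auto)
    qed
    have 1: "circ_list (bs @ [b]) = circ_list bs \<circ>\<^sub>c b" "composition (circ_list bs)" "circ_list bs \<noteq> []"
      using circ_list_snoc[OF False, of b] snoc.prems(3) by auto
    have 2: "circ_list (cs' @ [c]) = circ_list cs' \<circ>\<^sub>c c" "composition (circ_list cs')" "circ_list cs' \<noteq> []"
      using circ_list_snoc[OF ne cp] by auto
    have IH: "csum (circ_list bs) h = csum (circ_list cs') h" for h :: "nat \<Rightarrow> 'a"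
      by (rule snoc.IH[OF False cs(2) _ cs'i]) (use snoc.prems(3) in auto)
    show ?thesis unfolding cs(1) 1(1) 2(1)
      by (rule csum_circ_cong[OF 1(2) 2(2) 1(3) 2(3) b IH c])
  qed
qed simp

section \<open>A multiset of partitions is determined by its generating function\<close>

lemma digit_bound:
  fixes b :: nat
  assumes "\<And>x. x < m \<Longrightarrow> c x < b"
  shows "(\<Sum>x<m. c x * b ^ x) < b ^ m"
  using assms
proof (induction m)
  case (Suc m)
  have "(\<Sum>x<Suc m. c x * b ^ x) < b ^ m + c m * b ^ m" using Suc by simp
  also have "\<dots> = (c m + 1) * b ^ m" by simp
  also have "\<dots> \<le> b * b ^ m" using Suc.prems[of m] by (intro mult_right_mono) auto
  finally show ?case by simp
qed simp

lemma digits_unique: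
  fixes b :: nat
  assumes "\<And>x. x < m \<Longrightarrow> c x < b" "\<And>x. x < m \<Longrightarrow> c' x < b" "(\<Sum>x<m. c x * b ^ x) = (\<Sum>x<m. c' x * b ^ x)" "x < m"
  shows "c x = c' x"
  using assms
proof (induction m)
  case (Suc m)
  let ?s = "\<Sum>x<m. c x * b ^ x" and ?s' = "\<Sum>x<m. c' x * b ^ x"
  have lt: "?s < b ^ m" "?s' < b ^ m" using Suc.prems by (auto intro!: digit_bound)
  have eq: "?s + c m * b ^ m = ?s' + c' m * b ^ m" using Suc.prems(3) by simp
  have b: "b ^ m > 0" using lt(1) by linarith
  have "(?s + c m * b ^ m) div b ^ m = c m" "(?s' + c' m * b ^ m) div b ^ m = c' m" using lt b by simp_all
  then have "c m = c' m" using eq by simp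
  moreover from this have "?s = ?s'" using eq by simp
  ultimately show ?case using Suc by (cases "x = m") auto
qed simp

lemma sum_mset_digits:
  fixes b :: nat
  assumes "\<And>x. x \<in># t \<Longrightarrow> x < m"
  shows "(\<Sum>x\<in>#t. b ^ x) = (\<Sum>x<m. count t x * b ^ x)"
  using assms
proof (induction t)
  case (add y t)
  have "(\<Sum>x<m. count (add_mset y t) x * b ^ x) = (\<Sum>x<m. count t x * b ^ x + (if x = y then b ^ x else 0))"
    by (intro sum.cong) auto
  also have "\<dots> = (\<Sum>x<m. count t x * b ^ x) + b ^ y"
    using add.prems[of y] by (simp add: sum.distrib)
  finally show ?case using add by simp
qed simp

lemma sum_mset_power_inj:
  fixes b :: nat
  assumes "size t < b" "size t' < b" "(\<Sum>x\<in>#t. b ^ x) = (\<Sum>x\<in>#t'. b ^ x)"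
  shows "t = t'"
proof (rule multiset_eqI)
  fix y
  define m where "m = Suc (Max (insert y (set_mset (t + t'))))"
  have m: "x < m" if "x \<in># t \<or> x \<in># t' \<or> x = y" for x
    using that unfolding m_def by (intro le_imp_less_Suc Max_ge) auto
  show "count t y = count t' y"
  proof (rule digits_unique[of m "count t" b "count t'"])
    show "count t x < b" for x using count_le_size[of t x] assms(1) by simp
    show "count t' x < b" for x using count_le_size[of t' x] assms(2) by simp
    show "(\<Sum>x<m. count t x * b ^ x) = (\<Sum>x<m. count t' x * b ^ x)"
      using assms(3) sum_mset_digits[of t m b] sum_mset_digits[of t' m b] m by simp
  qed (use m in auto)
qed

text \<open>Substituting \<open>h x = z ^ (b ^ x)\<close> turns the product over a type \<open>t\<close> into \<open>z\<close> to a power that has the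
  multiplicities of \<open>t\<close> as digits in base \<open>b\<close>. For \<open>b\<close> larger than all sizes different types give
  different powers, and the multiplicity of a type can be read off from a polynomial in \<open>z\<close>.\<close>

theorem types_separated:
  fixes A B :: "nat multiset multiset"
  assumes "\<And>h :: nat \<Rightarrow> complex. (\<Sum>t\<in>#A. \<Prod>x\<in>#t. h x) = (\<Sum>t\<in>#B. \<Prod>x\<in>#t. h x)"
  shows "A = B"
proof (rule multiset_eqI)
  fix u :: "nat multiset"
  define b where "b = Suc (size u + (\<Sum>t\<in>#A + B. size t))"
  define w where "w t = (\<Sum>x\<in>#t. b ^ x)" for t
  define p where "p C = (\<Sum>t\<in>#C. monom (1::complex) (w t))" for C
  have small: "size t < b" if "t \<in># A \<or> t \<in># B \<or> t = u" for t
  proof -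
    have "size t \<le> (\<Sum>t\<in>#C. size t)" if "t \<in># C" for C
      using that by (auto dest!: multi_member_split)
    from this[of A] this[of B] that show ?thesis by (auto simp: b_def)
  qed
  have pow: "(\<Prod>x\<in>#t. z ^ (b ^ x)) = z ^ w t" for z :: complex and t
    by (induction t) (auto simp: w_def power_add)
  have pp: "poly (p C) z = (\<Sum>t\<in>#C. \<Prod>x\<in>#t. z ^ (b ^ x))" for C z
    unfolding pow p_def by (induction C) (auto simp: poly_monom)
  have "poly (p A) = poly (p B)" by (rule ext) (simp add: pp assms)
  then have pAB: "p A = p B" by (simp add: poly_eq_poly_eq_iff)
  have cf: "coeff (p C) k = of_nat (size {#t \<in># C. w t = k#})" for C k
    unfolding p_def by (induction C) auto
  have "{#t \<in># C. w t = w u#} = {#t \<in># C. t = u#}" if "C = A \<or> C = B" for C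
    using sum_mset_power_inj[of _ b u] small that by (intro filter_mset_cong) (auto simp: w_def)
  then have "coeff (p A) (w u) = of_nat (count A u)" "coeff (p B) (w u) = of_nat (count B u)"
    by (simp_all add: cf filter_eq_replicate_mset)
  then show "count A u = count B u" using pAB by simp
qed

section \<open>Coarsenings and factorizations\<close>

text \<open>Condition (5).\<close>

definition related :: "nat list \<Rightarrow> nat list \<Rightarrow> bool" where
  "related \<beta> \<gamma> \<longleftrightarrow> (\<exists>\<beta>s \<gamma>s. length \<beta>s \<ge> 1 \<and> length \<gamma>s = length \<beta>s \<and>
          (\<forall>b\<in>set \<beta>s. composition b) \<and> (\<forall>g\<in>set \<gamma>s. composition g) \<and>
          \<beta> = circ_list \<beta>s \<and> \<gamma> = circ_list \<gamma>s \<and>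
          (\<forall>i<length \<beta>s. \<gamma>s ! i = \<beta>s ! i \<or> \<gamma>s ! i = rev (\<beta>s ! i)))"

text \<open>An empty factor makes the whole product empty. This separates the degenerate factorizations that \<open>related\<close>
  admits from those with non-empty factors, to which the laws for \<open>\<circ>\<close> apply.\<close>

lemma sum_circ_list_zero: "[] \<in> set bs \<Longrightarrow> sum_list (circ_list bs) = 0"
  by (induction bs rule: circ_list.induct) (auto simp: sum_circ)

lemma related_csum:
  assumes "related \<beta> \<gamma>" "sum_list \<beta> > 0"
  shows "csum \<beta> (h :: nat \<Rightarrow> 'a::comm_ring_1) = csum \<gamma> h"
proof -
  obtain bs cs where bs: "length bs \<ge> 1" "length cs = length bs" "\<forall>b\<in>set bs. composition b"
     "\<beta> = circ_list bs" "\<gamma> = circ_list cs" "\<forall>i<length bs. cs ! i = bs ! i \<or> cs ! i = rev (bs ! i)"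
    using assms(1) by (auto simp: related_def)
  have "[] \<notin> set bs" using sum_circ_list_zero[of bs] assms(2) bs by auto
  then have "\<forall>b\<in>set bs. composition b \<and> b \<noteq> []" using bs by auto
  moreover have "bs \<noteq> []" using bs by auto
  ultimately show ?thesis unfolding bs(4,5) by (intro csum_circ_list bs)
qed

lemma path_types_eq_iff_csum:
  assumes "sum_list \<beta> = n" "sum_list \<gamma> = n"
  shows "path_types n (partial_sums \<beta>) = path_types n (partial_sums \<gamma>) \<longleftrightarrow>
    (\<forall>h :: nat \<Rightarrow> complex. csum \<beta> h = csum \<gamma> h)"
  using types_separated[of "path_types n (partial_sums \<beta>)" "path_types n (partial_sums \<gamma>)"] assms
  by (auto simp: csum_path_types)

text \<open>With weights on the multiples of \<open>s\<close> only, a path sees only the stops that are multiples of \<open>s\<close>.\<close>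

lemma path_sum_stretch:
  fixes h :: "nat \<Rightarrow> 'a::comm_ring_1"
  assumes s: "s > 0" and "\<And>i. 0 < i \<Longrightarrow> i \<le> k \<Longrightarrow> i * s \<in> T \<longleftrightarrow> i \<in> T'"
  defines "h' \<equiv> \<lambda>j. if s dvd j then h (j div s) else 0"
  shows "path_sum T h' (k * s) = path_sum T' h k"
  using assms(2)
proof (induction k rule: less_induct)
  case (less k)
  show ?case
  proof (cases "k > 0 \<and> k \<in> T'")
    case False
    then show ?thesis using less.prems[of k] s by (cases "k = 0") (auto simp: path_sum_pos)
  next
    case True
    have sup: "supported s h'" by (simp add: supported_def h'_def)
    have "path_sum T h' (k * s) = (\<Sum>i<k * s. path_sum T h' i * h' (k * s - i))"
      using True less.prems[of k] s by (simp add: path_sum_pos)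
    also have "\<dots> = (\<Sum>i\<in>(\<lambda>i. i * s) ` {..<k}. path_sum T h' i * h' (k * s - i))"
    proof (rule sum.mono_neutral_right)
      show "\<forall>i\<in>{..<k * s} - (\<lambda>i. i * s) ` {..<k}. path_sum T h' i * h' (k * s - i) = 0"
      proof
        fix i assume i: "i \<in> {..<k * s} - (\<lambda>i. i * s) ` {..<k}"
        have "\<not> s dvd i"
        proof
          assume "s dvd i"
          then obtain j where "i = j * s" by (metis dvd_def mult.commute)
          then show False using i s by auto
        qed
        then show "path_sum T h' i * h' (k * s - i) = 0"
          by (simp add: supportedD[OF supported_path_sum[OF sup]])
      qed
    qed (use s in auto)
    also have "\<dots> = (\<Sum>i<k. path_sum T h' (i * s) * h' (k * s - i * s))"
      using s by (subst sum.reindex) (auto simp: inj_on_def)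
    also have "\<dots> = (\<Sum>i<k. path_sum T' h i * h (k - i))"
    proof (rule sum.cong)
      fix i assume i: "i \<in> {..<k}"
      have "k * s - i * s = (k - i) * s" by (simp add: diff_mult_distrib)
      then show "path_sum T h' (i * s) * h' (k * s - i * s) = path_sum T' h i * h (k - i)"
        using less.IH[of i] less.prems i s by (simp add: h'_def)
    qed simp
    finally show ?thesis using True by (simp add: path_sum_pos)
  qed
qed

lemma factorI:
  assumes \<beta>: "composition \<beta>" "sum_list \<beta> = n" and s: "s dvd n" and \<delta>: "composition \<delta>" "sum_list \<delta> = s" "\<delta> \<noteq> []"
    and \<alpha>: "composition \<alpha>" "sum_list \<alpha> = n div s"
    and a: "\<And>i. 0 < i \<Longrightarrow> i < n div s \<Longrightarrow> i \<in> partial_sums \<alpha> \<longleftrightarrow> i * s \<in> partial_sums \<beta>"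
    and d: "\<And>i. 0 < i \<Longrightarrow> i < n \<Longrightarrow> \<not> s dvd i \<Longrightarrow> i mod s \<in> partial_sums \<delta> \<longleftrightarrow> i \<in> partial_sums \<beta>"
  shows "\<beta> = \<alpha> \<circ>\<^sub>c \<delta>"
proof (rule composition_eqI)
  have s0: "s > 0" using \<delta> composition_sum_0[of \<delta>] by auto
  have n: "n div s * s = n" using s by simp
  show "partial_sums \<beta> = partial_sums (\<alpha> \<circ>\<^sub>c \<delta>)"
  proof (intro set_eqI)
    fix i
    have R: "i \<in> partial_sums (\<alpha> \<circ>\<^sub>c \<delta>) \<longleftrightarrow> i < n \<and> (if s dvd i then i div s \<in> partial_sums \<alpha> else i mod s \<in> partial_sums \<delta>)"
      using partial_sums_circ[OF \<alpha>(1) \<delta>(1,3)] by (simp add: \<delta>(2) \<alpha>(2) n)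
    have sub: "partial_sums \<beta> \<subseteq> {0<..<n}" "partial_sums \<alpha> \<subseteq> {0<..<n div s}"
      using partial_sums_subset[OF \<beta>(1)] partial_sums_subset[OF \<alpha>(1)] \<beta> \<alpha> by auto
    show "i \<in> partial_sums \<beta> \<longleftrightarrow> i \<in> partial_sums (\<alpha> \<circ>\<^sub>c \<delta>)"
    proof (cases "0 < i \<and> i < n")
      case True
      show ?thesis
      proof (cases "s dvd i")
        case T: True
        then obtain j where j: "i = j * s" by (metis dvd_def mult.commute)
        have "j * s < (n div s) * s" using True j n by simp
        then have "j < n div s" by (simp only: mult_less_cancel2)
        moreover have "0 < j" using True j by simp
        ultimately have j': "0 < j" "j < n div s" by auto
        then show ?thesis unfolding R using a[OF j'] j s0 True by simp
      qed (unfold R, use d[of i] True in simp)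
    next
      case False
      have "i \<notin> partial_sums \<beta>" using sub False by auto
      moreover have "0 \<notin> partial_sums \<alpha>" using sub by auto
      ultimately show ?thesis unfolding R using False by (cases "i = 0") auto
    qed
  qed
  show "sum_list \<beta> = sum_list (\<alpha> \<circ>\<^sub>c \<delta>)" by (simp add: sum_circ \<alpha> \<beta> \<delta> n)
qed (use assms in \<open>auto simp: composition_circ\<close>)

definition strongly_related :: "nat list \<Rightarrow> nat list \<Rightarrow> bool" where
  "strongly_related \<beta> \<gamma> \<longleftrightarrow> (\<exists>bs cs. bs \<noteq> [] \<and> length cs = length bs \<and>
     (\<forall>b\<in>set bs. composition b \<and> b \<noteq> []) \<and> (\<forall>c\<in>set cs. composition c \<and> c \<noteq> []) \<and>
     \<beta> = circ_list bs \<and> \<gamma> = circ_list cs \<and> (\<forall>i<length bs. cs ! i = bs ! i \<or> cs ! i = rev (bs ! i)))"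

lemma strongly_related_imp: "strongly_related \<beta> \<gamma> \<Longrightarrow> related \<beta> \<gamma>"
proof -
  assume "strongly_related \<beta> \<gamma>"
  then obtain bs cs where "bs \<noteq> []" "length cs = length bs"
     "(\<forall>b\<in>set bs. composition b \<and> b \<noteq> []) \<and> (\<forall>c\<in>set cs. composition c \<and> c \<noteq> [])"
     "\<beta> = circ_list bs" "\<gamma> = circ_list cs" "\<forall>i<length bs. cs ! i = bs ! i \<or> cs ! i = rev (bs ! i)"
    unfolding strongly_related_def by blast
  then show ?thesis unfolding related_def by (intro exI[of _ bs] exI[of _ cs]) (auto simp: Suc_le_eq)
qed

lemma strongly_related_single: "composition \<beta> \<Longrightarrow> \<beta> \<noteq> [] \<Longrightarrow> \<gamma> = \<beta> \<or> \<gamma> = rev \<beta> \<Longrightarrow> strongly_related \<beta> \<gamma>"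
  unfolding strongly_related_def by (intro exI[of _ "[\<beta>]"] exI[of _ "[\<gamma>]"]) auto

lemma strongly_related_circ:
  assumes "strongly_related \<alpha> \<alpha>'" "composition \<delta>" "\<delta> \<noteq> []"
  shows "strongly_related (\<alpha> \<circ>\<^sub>c \<delta>) (\<alpha>' \<circ>\<^sub>c \<delta>)" "strongly_related (\<alpha> \<circ>\<^sub>c \<delta>) (rev (\<alpha>' \<circ>\<^sub>c \<delta>))"
proof -
  obtain bs cs where bs: "bs \<noteq> []" "length cs = length bs"
     "\<forall>b\<in>set bs. composition b \<and> b \<noteq> []" "\<forall>c\<in>set cs. composition c \<and> c \<noteq> []"
     "\<alpha> = circ_list bs" "\<alpha>' = circ_list cs" "\<forall>i<length bs. cs ! i = bs ! i \<or> cs ! i = rev (bs ! i)"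
    using assms(1) unfolding strongly_related_def by blast
  have cs: "cs \<noteq> []" using bs by auto
  have 1: "circ_list (bs @ [\<delta>]) = \<alpha> \<circ>\<^sub>c \<delta>" unfolding bs(5) by (rule circ_list_snoc(1)) (use bs assms in auto)
  have 2: "circ_list (cs @ [\<delta>]) = \<alpha>' \<circ>\<^sub>c \<delta>" unfolding bs(6) by (rule circ_list_snoc(1)) (use bs assms cs in auto)
  have 3: "rev (circ_list (cs @ [\<delta>])) = circ_list (map rev (cs @ [\<delta>]))" by (rule rev_circ_list) (use bs assms in auto)
  have nth: "xs ! i = (bs @ [\<delta>]) ! i \<or> xs ! i = rev ((bs @ [\<delta>]) ! i)"
    if "xs = cs @ [\<delta>] \<or> xs = map rev (cs @ [\<delta>])" "i < length (bs @ [\<delta>])" for xs i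
  proof (cases "i < length bs")
    case True
    then have "cs ! i = bs ! i \<or> cs ! i = rev (bs ! i)" using bs(7) by blast
    then show ?thesis using that(1) True bs(2) by (auto simp: nth_append)
  next
    case False
    then have "i = length bs" using that(2) by simp
    then show ?thesis using that(1) bs(2) by (auto simp: nth_append)
  qed
  show "strongly_related (\<alpha> \<circ>\<^sub>c \<delta>) (\<alpha>' \<circ>\<^sub>c \<delta>)"
    unfolding strongly_related_def 1[symmetric] 2[symmetric]
    by (intro exI[of _ "bs @ [\<delta>]"] exI[of _ "cs @ [\<delta>]"]) (use bs assms nth in auto)
  show "strongly_related (\<alpha> \<circ>\<^sub>c \<delta>) (rev (\<alpha>' \<circ>\<^sub>c \<delta>))"
    unfolding strongly_related_def 1[symmetric] 2[symmetric] 3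
    by (intro exI[of _ "bs @ [\<delta>]"] exI[of _ "map rev (cs @ [\<delta>])"]) (use bs assms nth in auto)
qed

text \<open>Induction on \<open>n\<close>. The set-theoretic decomposition gives a last factor \<open>\<delta>\<close> common to \<open>\<beta>\<close> and to \<open>\<gamma>\<close> or its reversal.
  The remaining factors \<open>\<alpha>\<close>, \<open>\<alpha>'\<close> are compared by stretched weights.\<close>

theorem types_imp_strongly_related:
  assumes "composition \<beta>" "composition \<gamma>" "sum_list \<beta> = n" "sum_list \<gamma> = n" "n > 0"
    "path_types n (partial_sums \<beta>) = path_types n (partial_sums \<gamma>)"
  shows "strongly_related \<beta> \<gamma>"
  using assms
proof (induction n arbitrary: \<beta> \<gamma> rule: less_induct)
  case (less n)
  define S where "S = partial_sums \<beta>"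
  define S' where "S' = partial_sums \<gamma>"
  have sub: "S \<subseteq> {0<..<n}" "S' \<subseteq> {0<..<n}" using partial_sums_subset[OF less.prems(1)] partial_sums_subset[OF less.prems(2)] less.prems(3,4)
    by (simp_all add: S_def S'_def)
  have \<beta>ne: "\<beta> \<noteq> []" using less.prems by auto
  show ?case
  proof (cases "S' = S \<or> S' = rev_set n S")
    case True
    then have "\<gamma> = \<beta> \<or> \<gamma> = rev \<beta>"
      using composition_eqI[of \<gamma> \<beta>] composition_eqI[of \<gamma> "rev \<beta>"] partial_sums_rev[OF less.prems(1)] less.prems
      by (auto simp: S_def S'_def)
    then show ?thesis using strongly_related_single less.prems(1) \<beta>ne by blast
  next
    case False
    have eq: "equivalent_sets n S S'" by unfold_locales (use sub less.prems in \<open>auto simp: S_def S'_def\<close>)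
    from equivalent_sets_decompose[OF less.prems(5) eq] False
    obtain s S'' where S'': "S'' = S' \<or> S'' = rev_set n S'" and s: "s dvd n" "1 < s" "s < n"
      and off: "\<And>i. \<not> s dvd i \<Longrightarrow> i \<in> S \<longleftrightarrow> i \<in> S''"
      and per: "\<And>i j. 0 < i \<Longrightarrow> i < n \<Longrightarrow> 0 < j \<Longrightarrow> j < n \<Longrightarrow> \<not> s dvd i \<Longrightarrow> i mod s = j mod s \<Longrightarrow> i \<in> S \<longleftrightarrow> j \<in> S"
      by metis
    define \<gamma>' where "\<gamma>' = (if S'' = S' then \<gamma> else rev \<gamma>)"
    have \<gamma>': "composition \<gamma>'" "sum_list \<gamma>' = n" "partial_sums \<gamma>' = S''" "\<gamma> = \<gamma>' \<or> \<gamma> = rev \<gamma>'"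
      using less.prems S'' partial_sums_rev[OF less.prems(2)] by (auto simp: \<gamma>'_def S'_def)
    have types: "path_types n S = path_types n S''"
      using S'' less.prems(5,6) path_types_rev_set[OF less.prems(5)] by (auto simp: S_def S'_def)
    define N where "N = n div s"
    have N: "n = N * s" "N < n" "0 < N" using s by (auto simp: N_def div_greater_zero_iff)
    have s0: "0 < s" using s(2) by simp
    have "{i \<in> S. i < s} \<subseteq> {0<..<s}" using sub(1) by auto
    then obtain \<delta> where \<delta>: "composition \<delta>" "sum_list \<delta> = s" "partial_sums \<delta> = {i \<in> S. i < s}"
      by (rule composition_of_set[OF _ s0]) (rule that)
    have \<delta>ne: "\<delta> \<noteq> []" using \<delta>(2) s0 by auto
    have below: "{i. 0 < i \<and> i < N \<and> i * s \<in> T} \<subseteq> {0<..<N}" for T by auto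
    obtain \<alpha> where \<alpha>: "composition \<alpha>" "sum_list \<alpha> = N" "partial_sums \<alpha> = {i. 0 < i \<and> i < N \<and> i * s \<in> S}"
      by (rule composition_of_set[OF below N(3)]) (rule that)
    obtain \<alpha>' where \<alpha>': "composition \<alpha>'" "sum_list \<alpha>' = N" "partial_sums \<alpha>' = {i. 0 < i \<and> i < N \<and> i * s \<in> S''}"
      by (rule composition_of_set[OF below N(3)]) (rule that)
    have perd: "i mod s \<in> partial_sums \<delta> \<longleftrightarrow> i \<in> S" if "0 < i" "i < n" "\<not> s dvd i" for i
    proof -
      have "0 < i mod s" using that(3) by (simp add: mod_greater_zero_iff_not_dvd)
      moreover have "i mod s < s" using s0 by simp
      ultimately have "i \<in> S \<longleftrightarrow> i mod s \<in> S" using s(3)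
        by (intro per that) simp_all
      then show ?thesis using \<open>i mod s < s\<close> by (simp add: \<delta>(3))
    qed
    have b: "\<beta> = \<alpha> \<circ>\<^sub>c \<delta>"
    proof (rule factorI[OF less.prems(1,3) s(1) \<delta>(1,2) \<delta>ne \<alpha>(1) \<alpha>(2)[unfolded N_def]])
      show "i \<in> partial_sums \<alpha> \<longleftrightarrow> i * s \<in> partial_sums \<beta>" if "0 < i" "i < n div s" for i
        using that by (simp add: \<alpha>(3) N_def S_def)
      show "i mod s \<in> partial_sums \<delta> \<longleftrightarrow> i \<in> partial_sums \<beta>" if "0 < i" "i < n" "\<not> s dvd i" for i
        using perd[OF that] by (simp add: S_def)
    qed
    have g: "\<gamma>' = \<alpha>' \<circ>\<^sub>c \<delta>"
    proof (rule factorI[OF \<gamma>'(1,2) s(1) \<delta>(1,2) \<delta>ne \<alpha>'(1) \<alpha>'(2)[unfolded N_def]])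
      show "i \<in> partial_sums \<alpha>' \<longleftrightarrow> i * s \<in> partial_sums \<gamma>'" if "0 < i" "i < n div s" for i
        using that by (simp add: \<alpha>'(3) N_def \<gamma>'(3))
      show "i mod s \<in> partial_sums \<delta> \<longleftrightarrow> i \<in> partial_sums \<gamma>'" if "0 < i" "i < n" "\<not> s dvd i" for i
        using perd[OF that] off[OF that(3)] by (simp add: \<gamma>'(3))
    qed
    have "csum \<alpha> h = csum \<alpha>' h" for h :: "nat \<Rightarrow> complex"
    proof -
      let ?h = "\<lambda>j. if s dvd j then h (j div s) else 0"
      have "path_sum (insert n T) ?h (N * s) = csum a h"
        if a: "sum_list a = N" "partial_sums a = {i. 0 < i \<and> i < N \<and> i * s \<in> T}" for a T
      proof -
        have "path_sum (insert n T) ?h (N * s) = path_sum (insert N (partial_sums a)) h N"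
        proof (rule path_sum_stretch[OF s0])
          fix i :: nat assume i: "0 < i" "i \<le> N"
          have "i * s = n \<longleftrightarrow> i = N" unfolding N(1) using s0 by simp
          then show "i * s \<in> insert n T \<longleftrightarrow> i \<in> insert N (partial_sums a)" using i by (auto simp: a(2))
        qed
        then show ?thesis by (simp only: csum_def a(1))
      qed
      from this[OF \<alpha>(2,3)] this[OF \<alpha>'(2,3)] show ?thesis
        using types by (simp add: N(1)[symmetric] path_sum_path_types)
    qed
    then have "path_types N (partial_sums \<alpha>) = path_types N (partial_sums \<alpha>')"
      using path_types_eq_iff_csum[OF \<alpha>(2) \<alpha>'(2)] by blast
    then have "strongly_related \<alpha> \<alpha>'" using less.IH[OF N(2) \<alpha>(1) \<alpha>'(1) \<alpha>(2) \<alpha>'(2) N(3)] by blast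
    from strongly_related_circ[OF this \<delta>(1) \<delta>ne] show ?thesis
      using \<gamma>'(4) unfolding b[symmetric] g[symmetric] by auto
  qed
qed

theorem coarsening_partitions_iff_related:
  assumes "\<beta> \<Turnstile>\<^sub>c n" "\<gamma> \<Turnstile>\<^sub>c n"
  shows "coarsening_partitions \<beta> = coarsening_partitions \<gamma> \<longleftrightarrow> related \<beta> \<gamma>"
proof -
  have c: "composition \<beta>" "composition \<gamma>" "sum_list \<beta> = n" "sum_list \<gamma> = n"
    using assms by (auto simp: composition_of_def)
  show ?thesis
  proof (cases "n = 0")
    case True
    then have "\<beta> = []" "\<gamma> = []" using c composition_sum_0 by auto
    moreover have "related [] []" unfolding related_def by (intro exI[of _ "[[]]"]) auto
    ultimately show ?thesis by simp
  next
    case False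
    show ?thesis unfolding coarsening_partitions_eq_iff[OF c]
    proof
      assume "path_types n (partial_sums \<beta>) = path_types n (partial_sums \<gamma>)"
      then show "related \<beta> \<gamma>" using types_imp_strongly_related[OF c] False strongly_related_imp by simp
    next
      assume "related \<beta> \<gamma>"
      then show "path_types n (partial_sums \<beta>) = path_types n (partial_sums \<gamma>)"
        using related_csum[of \<beta> \<gamma>] False c by (subst path_types_eq_iff_csum) auto
    qed
  qed
qed

section \<open>Words with a prescribed descent set\<close>

definition word_descents :: "nat list \<Rightarrow> nat set" where
  "word_descents w = {i. 0 < i \<and> i < length w \<and> w ! i < w ! (i - 1)}"

definition ribbon_words :: "nat list \<Rightarrow> nat list set" where
  "ribbon_words \<beta> = {w. length w = sum_list \<beta> \<and> word_descents w = partial_sums \<beta>}"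

definition letters_below :: "nat \<Rightarrow> nat list set" where
  "letters_below N = {w. set w \<subseteq> {..<N}}"

text \<open>The generating function of the words, in the variables \<open>x 0, \<dots>, x (N - 1)\<close>.\<close>

definition wsum :: "nat \<Rightarrow> (nat \<Rightarrow> 'a::comm_ring_1) \<Rightarrow> nat list \<Rightarrow> 'a" where
  "wsum N x \<beta> = (\<Sum>w\<in>ribbon_words \<beta> \<inter> letters_below N. prod_list (map x w))"

lemma finite_ribbon_words: "finite (ribbon_words \<beta> \<inter> letters_below N)"
  by (rule finite_subset[OF _ finite_lists_length_eq[of "{..<N}" "sum_list \<beta>"]])
    (auto simp: ribbon_words_def letters_below_def)

lemma word_descents_append:
  assumes "u \<noteq> []" "v \<noteq> []"
  shows "word_descents (u @ v) = word_descents u \<union> (+) (length u) ` word_descents v \<union>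
     (if hd v < last u then {length u} else {})"
proof -
  have "i \<in> word_descents (u @ v) \<longleftrightarrow> i \<in> word_descents u \<or> i \<in> (+) (length u) ` word_descents v \<or>
     (i = length u \<and> hd v < last u)" for i
  proof (cases i "length u" rule: linorder_cases)
    case less
    then show ?thesis by (auto simp: word_descents_def nth_append)
  next
    case equal
    then show ?thesis using assms by (auto simp: word_descents_def nth_append last_conv_nth hd_conv_nth)
  next
    case greater
    then obtain j where j: "i = length u + j" "0 < j" using less_imp_add_positive by blast
    have "\<not> j - Suc 0 + length u < length u" by simp
    then have "i \<in> word_descents (u @ v) \<longleftrightarrow> j \<in> word_descents v"
      using j by (auto simp: word_descents_def nth_append)
    then show ?thesis using j by (auto simp: word_descents_def)
  qed
  then show ?thesis by auto
qed

lemma ribbon_words_append: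
  assumes c: "composition \<alpha>" "composition \<beta>" and ne: "\<alpha> \<noteq> []" "\<beta> \<noteq> []"
    and w: "length w = sum_list \<alpha> + sum_list \<beta>"
  defines "u \<equiv> take (sum_list \<alpha>) w" and "v \<equiv> drop (sum_list \<alpha>) w"
  shows "w \<in> ribbon_words (\<alpha> @ \<beta>) \<longleftrightarrow> u \<in> ribbon_words \<alpha> \<and> v \<in> ribbon_words \<beta> \<and> hd v < last u"
    and "w \<in> ribbon_words (\<alpha> \<odot> \<beta>) \<longleftrightarrow> u \<in> ribbon_words \<alpha> \<and> v \<in> ribbon_words \<beta> \<and> \<not> hd v < last u"
proof -
  let ?a = "sum_list \<alpha>" and ?A = "partial_sums \<alpha>" and ?B = "(+) (sum_list \<alpha>) ` partial_sums \<beta>"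
  have pos: "?a > 0" "sum_list \<beta> > 0" using c ne composition_sum_0 by auto
  have len: "length u = ?a" "length v = sum_list \<beta>" using w by (auto simp: u_def v_def)
  then have uv: "u \<noteq> []" "v \<noteq> []" using pos by auto
  have wuv: "w = u @ v" by (simp add: u_def v_def)
  let ?U = "word_descents u" and ?V = "(+) ?a ` word_descents v" and ?D = "if hd v < last u then {?a} else {}"
  have wd: "word_descents w = ?U \<union> ?V \<union> ?D"
    unfolding wuv word_descents_append[OF uv] len ..
  have sub: "?A \<subseteq> {..<?a}" "?U \<subseteq> {..<?a}" "?B \<subseteq> {?a<..}" "?V \<subseteq> {?a<..}"
    using partial_sums_subset[OF c(1)] partial_sums_subset[OF c(2)] len by (auto simp: word_descents_def)
  have inj: "?V = ?B \<longleftrightarrow> word_descents v = partial_sums \<beta>" by (rule inj_image_eq_iff) simp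
  have split: "?U \<union> ?V \<union> X = ?A \<union> ?B \<union> Y \<longleftrightarrow> ?U = ?A \<and> ?V = ?B \<and> X = Y"
    if "X \<subseteq> {?a}" "Y \<subseteq> {?a}" for X Y
  proof -
    have 1: "(P \<union> Q \<union> Z) \<inter> {..<?a} = P" "(P \<union> Q \<union> Z) \<inter> {?a<..} = Q" "(P \<union> Q \<union> Z) \<inter> {?a} = Z"
      if "P \<subseteq> {..<?a}" "Q \<subseteq> {?a<..}" "Z \<subseteq> {?a}" for P Q Z using that by auto
    show ?thesis using 1[OF sub(2,4) that(1)] 1[OF sub(1,3) that(2)] by metis
  qed
  have r1: "partial_sums (\<alpha> @ \<beta>) = ?A \<union> ?B \<union> {?a}" using partial_sums_append[of \<alpha> \<beta>] c ne by auto
  have r2: "partial_sums (\<alpha> \<odot> \<beta>) = ?A \<union> ?B \<union> {}" using partial_sums_near_concat[OF c] by simp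
  show "w \<in> ribbon_words (\<alpha> @ \<beta>) \<longleftrightarrow> u \<in> ribbon_words \<alpha> \<and> v \<in> ribbon_words \<beta> \<and> hd v < last u"
    using split[of ?D "{?a}"] w len unfolding ribbon_words_def mem_Collect_eq r1 wd inj by auto
  show "w \<in> ribbon_words (\<alpha> \<odot> \<beta>) \<longleftrightarrow> u \<in> ribbon_words \<alpha> \<and> v \<in> ribbon_words \<beta> \<and> \<not> hd v < last u"
    using split[of ?D "{}"] w len unfolding ribbon_words_def mem_Collect_eq r2 wd inj by (auto simp: sum_near_concat)
qed

text \<open>Concatenating two words either creates a descent at the seam or does not.\<close>

theorem wsum_mult:
  assumes c: "composition \<alpha>" "composition \<beta>" and ne: "\<alpha> \<noteq> []" "\<beta> \<noteq> []"
  shows "wsum N x \<alpha> * wsum N x \<beta> = wsum N x (\<alpha> @ \<beta>) + wsum N x (\<alpha> \<odot> \<beta>)"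
proof -
  let ?W = "\<lambda>\<beta>. ribbon_words \<beta> \<inter> letters_below N"
  have "wsum N x \<alpha> * wsum N x \<beta> = (\<Sum>p\<in>?W \<alpha> \<times> ?W \<beta>. prod_list (map x (fst p)) * prod_list (map x (snd p)))"
    by (simp add: wsum_def sum_product sum.cartesian_product case_prod_beta)
  also have "\<dots> = (\<Sum>w\<in>?W (\<alpha> @ \<beta>) \<union> ?W (\<alpha> \<odot> \<beta>). prod_list (map x w))"
  proof (rule sum.reindex_bij_witness[of _ "\<lambda>w. (take (sum_list \<alpha>) w, drop (sum_list \<alpha>) w)" "\<lambda>p. fst p @ snd p"])
    fix p assume p: "p \<in> ?W \<alpha> \<times> ?W \<beta>"
    then have len: "length (fst p) = sum_list \<alpha>" "length (snd p) = sum_list \<beta>" by (auto simp: ribbon_words_def)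
    show "(take (sum_list \<alpha>) (fst p @ snd p), drop (sum_list \<alpha>) (fst p @ snd p)) = p" using len by simp
    show "fst p @ snd p \<in> ?W (\<alpha> @ \<beta>) \<union> ?W (\<alpha> \<odot> \<beta>)"
      using ribbon_words_append[OF c ne, of "fst p @ snd p"] len p by (auto simp: letters_below_def)
    show "prod_list (map x (fst p @ snd p)) = prod_list (map x (fst p)) * prod_list (map x (snd p))" by simp
  next
    fix w assume w: "w \<in> ?W (\<alpha> @ \<beta>) \<union> ?W (\<alpha> \<odot> \<beta>)"
    then have len: "length w = sum_list \<alpha> + sum_list \<beta>" by (auto simp: ribbon_words_def sum_near_concat)
    show "(take (sum_list \<alpha>) w, drop (sum_list \<alpha>) w) \<in> ?W \<alpha> \<times> ?W \<beta>"
      using ribbon_words_append[OF c ne len] w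
      by (auto simp: letters_below_def dest!: in_set_takeD in_set_dropD)
  qed auto
  also have "\<dots> = wsum N x (\<alpha> @ \<beta>) + wsum N x (\<alpha> \<odot> \<beta>)"
    unfolding wsum_def
  proof (rule sum.union_disjoint)
    show "?W (\<alpha> @ \<beta>) \<inter> ?W (\<alpha> \<odot> \<beta>) = {}"
    proof (intro equals0I)
      fix w assume w: "w \<in> ?W (\<alpha> @ \<beta>) \<inter> ?W (\<alpha> \<odot> \<beta>)"
      then have "length w = sum_list \<alpha> + sum_list \<beta>" by (simp add: ribbon_words_def)
      from ribbon_words_append[OF c ne this] w show False by blast
    qed
  qed (rule finite_ribbon_words)+
  finally show ?thesis .
qed

text \<open>The complete homogeneous symmetric function of degree \<open>k\<close> in \<open>N\<close> variables.\<close>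

definition hsum :: "nat \<Rightarrow> (nat \<Rightarrow> 'a::comm_ring_1) \<Rightarrow> nat \<Rightarrow> 'a" where
  "hsum N x k = (\<Sum>w | sorted w \<and> length w = k \<and> set w \<subseteq> {..<N}. prod_list (map x w))"

lemma word_descents_empty_iff: "word_descents w = {} \<longleftrightarrow> sorted w"
proof -
  have "word_descents w = {} \<longleftrightarrow> (\<forall>i. Suc i < length w \<longrightarrow> w ! i \<le> w ! Suc i)"
  proof
    assume e: "word_descents w = {}"
    show "\<forall>i. Suc i < length w \<longrightarrow> w ! i \<le> w ! Suc i"
    proof (intro allI impI)
      fix i assume "Suc i < length w"
      moreover have "Suc i \<notin> word_descents w" using e by simp
      ultimately show "w ! i \<le> w ! Suc i" by (simp add: word_descents_def)
    qed
  next
    assume R: "\<forall>i. Suc i < length w \<longrightarrow> w ! i \<le> w ! Suc i"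
    have "i \<notin> word_descents w" for i
      using R[rule_format, of "i - 1"] by (auto simp: word_descents_def)
    then show "word_descents w = {}" by blast
  qed
  then show ?thesis by (simp add: sorted_iff_nth_Suc)
qed

lemma wsum_singleton: "wsum N x [k] = hsum N x k"
  unfolding wsum_def hsum_def
  by (rule sum.cong) (auto simp: ribbon_words_def letters_below_def partial_sums_def word_descents_empty_iff)

text \<open>\<open>wsum_mult\<close> and \<open>csum_append\<close> are the same recursion, apart from a sign that the factor
  \<open>(-1) ^ length \<beta>\<close> and the negated weights absorb.\<close>

theorem wsum_csum:
  assumes "composition \<beta>" "\<beta> \<noteq> []"
  shows "wsum N x \<beta> = (-1) ^ length \<beta> * csum \<beta> (\<lambda>k. - hsum N x k)"
  using assms
proof (induction "length \<beta>" arbitrary: \<beta> rule: less_induct)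
  case less
  obtain a \<beta>' where \<beta>: "\<beta> = a # \<beta>'" "a > 0" using less.prems by (cases \<beta>) auto
  show ?case
  proof (cases \<beta>')
    case Nil
    then show ?thesis using \<beta> by (simp add: csum_singleton wsum_singleton)
  next
    case (Cons b \<beta>'')
    let ?h = "\<lambda>k. - hsum N x k"
    have c: "composition (b # \<beta>'')" "composition ((a + b) # \<beta>'')" using less.prems \<beta> Cons by auto
    have "wsum N x [a] * wsum N x (b # \<beta>'') = wsum N x \<beta> + wsum N x ((a + b) # \<beta>'')"
      using wsum_mult[of "[a]" "b # \<beta>''" N x] c \<beta> Cons by simp
    then have "wsum N x \<beta> = hsum N x a * wsum N x (b # \<beta>'') - wsum N x ((a + b) # \<beta>'')"
      by (simp add: wsum_singleton)
    also have "\<dots> = hsum N x a * ((-1) ^ length \<beta>' * csum (b # \<beta>'') ?h) - (-1) ^ length \<beta>' * csum ((a + b) # \<beta>'') ?h"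
      using less.hyps[of "b # \<beta>''"] less.hyps[of "(a + b) # \<beta>''"] c \<beta> Cons by simp
    also have "\<dots> = (-1) ^ length \<beta> * (csum [a] ?h * csum (b # \<beta>'') ?h + csum ((a + b) # \<beta>'') ?h)"
      using \<beta> by (simp add: csum_singleton algebra_simps)
    also have "csum [a] ?h * csum (b # \<beta>'') ?h + csum ((a + b) # \<beta>'') ?h = csum \<beta> ?h"
      using csum_append[of "[a]" "b # \<beta>''" ?h] c \<beta> Cons by simp
    finally show ?thesis .
  qed
qed

section \<open>Prescribing complete homogeneous functions\<close>

lemma hsum_0 [simp]: "hsum N x 0 = 1"
proof -
  have "{w :: nat list. sorted w \<and> length w = 0 \<and> set w \<subseteq> {..<N}} = {[]}" by auto
  then show ?thesis unfolding hsum_def by simp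
qed

lemma finite_sorted_words: "finite {w :: nat list. sorted w \<and> length w = k \<and> set w \<subseteq> {..<N}}"
  by (rule finite_subset[OF _ finite_lists_length_eq[of "{..<N}" k]]) auto

text \<open>A weakly increasing word ends in the largest letter or does not contain it.\<close>

lemma hsum_Suc: "hsum (Suc N) x (Suc k) = hsum N x (Suc k) + x N * hsum (Suc N) x k"
proof -
  let ?A = "\<lambda>N k. {w :: nat list. sorted w \<and> length w = k \<and> set w \<subseteq> {..<N}}"
  have "?A (Suc N) (Suc k) = ?A N (Suc k) \<union> (\<lambda>w. w @ [N]) ` ?A (Suc N) k"
  proof (intro equalityI subsetI)
    fix w assume w: "w \<in> ?A (Suc N) (Suc k)"
    then obtain u a where u: "w = u @ [a]" by (cases w rule: rev_cases) auto
    show "w \<in> ?A N (Suc k) \<union> (\<lambda>w. w @ [N]) ` ?A (Suc N) k"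
    proof (cases "a = N")
      case True
      then show ?thesis using w u by (auto simp: sorted_append)
    next
      case False
      then have "a < N" using w u by auto
      then have "w \<in> ?A N (Suc k)" using w u by (auto simp: sorted_append)
      then show ?thesis by blast
    qed
  qed (auto simp: sorted_append less_Suc_eq_le subset_iff)
  note split = this
  have disj: "?A N (Suc k) \<inter> (\<lambda>w. w @ [N]) ` ?A (Suc N) k = {}" by auto
  have "hsum (Suc N) x (Suc k) = hsum N x (Suc k) + (\<Sum>w\<in>(\<lambda>w. w @ [N]) ` ?A (Suc N) k. prod_list (map x w))"
    unfolding hsum_def split by (rule sum.union_disjoint[OF finite_sorted_words finite_imageI[OF finite_sorted_words] disj])
  also have "(\<Sum>w\<in>(\<lambda>w. w @ [N]) ` ?A (Suc N) k. prod_list (map x w)) = x N * hsum (Suc N) x k"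
    unfolding hsum_def by (subst sum.reindex) (auto simp: inj_on_def sum_distrib_left mult.commute)
  finally show ?thesis .
qed

lemma hsum_generating_function:
  "Abs_fps (hsum N x) * fps_of_poly (\<Prod>i<N. [:1, - x i:]) = 1"
proof (induction N)
  case 0
  have "hsum 0 x k = (if k = 0 then 1 else 0)" for k
  proof (cases k)
    case (Suc k')
    then have "{w :: nat list. sorted w \<and> length w = k \<and> set w \<subseteq> {..<0}} = {}" by auto
    then show ?thesis unfolding hsum_def using Suc by (simp only: sum.empty) simp
  qed simp
  then have "Abs_fps (hsum 0 x) = 1" by (simp add: fps_eq_iff)
  then show ?case by simp
next
  case (Suc N)
  have "Abs_fps (hsum (Suc N) x) * fps_of_poly [:1, - x N:] = Abs_fps (hsum N x)"
  proof (rule fps_ext)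
    fix k
    have e: "fps_of_poly [:1, - x N:] = 1 - fps_const (x N) * fps_X"
      by (rule fps_ext) (auto simp: coeff_pCons split: nat.split)
    have "(Abs_fps (hsum (Suc N) x) * fps_of_poly [:1, - x N:]) $ k =
       hsum (Suc N) x k - x N * (if k = 0 then 0 else hsum (Suc N) x (k - 1))"
      unfolding e right_diff_distrib mult.left_commute[of "Abs_fps _"] by simp
    also have "\<dots> = Abs_fps (hsum N x) $ k"
      by (cases k) (auto simp: hsum_Suc)
    finally show "(Abs_fps (hsum (Suc N) x) * fps_of_poly [:1, - x N:]) $ k = Abs_fps (hsum N x) $ k" .
  qed
  then have "Abs_fps (hsum (Suc N) x) * fps_of_poly (\<Prod>i<Suc N. [:1, - x i:]) =
      Abs_fps (hsum N x) * fps_of_poly (\<Prod>i<N. [:1, - x i:])"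
    by (simp only: prod.lessThan_Suc fps_of_poly_mult mult.assoc mult.commute[of "fps_of_poly (\<Prod>i<N. _ i)"])
       (simp only: mult.assoc[symmetric])
  then show ?case using Suc by simp
qed

lemma linear_factorization:
  fixes q :: "complex poly"
  assumes "poly q 0 = 1"
  shows "\<exists>N x. q = (\<Prod>i<(N :: nat). [:1, - x i:])"
  using assms
proof (induction "degree q" arbitrary: q)
  case 0
  obtain c where "q = [:c:]" by (rule degree_eq_zeroE[of q]) (use 0(1) in simp)
  then have "q = (\<Prod>i<(0 :: nat). [:1, - 0:])" using 0(2) by (simp add: one_pCons)
  then show ?case by (intro exI[of _ 0] exI[of _ "\<lambda>_. 0"])
next
  case (Suc d)
  then obtain a where a: "poly q a = 0" using alg_closed_imp_poly_has_root[of q] by auto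
  then have "[:- a, 1:] dvd q" by (simp only: poly_eq_0_iff_dvd)
  then obtain r where r: "q = [:- a, 1:] * r" by (rule dvdE)
  have a0: "a \<noteq> 0" using a Suc.prems by (metis zero_neq_one)
  let ?r = "smult (- a) r"
  have "[:- a, 1:] = smult (- a) [:1, - (1 / a):]" using a0 by simp
  then have q: "q = [:1, - (1 / a):] * ?r" unfolding r by (simp only: mult_smult_left mult_smult_right)
  have "r \<noteq> 0" using Suc.prems unfolding r by auto
  then have "degree q = Suc (degree ?r)" unfolding r using a0 by (subst degree_mult_eq) auto
  then have d: "d = degree ?r" using Suc.hyps(2) by simp
  have "poly ?r 0 = 1" using Suc.prems unfolding q by simp
  from Suc.hyps(1)[OF d this] obtain N :: nat and x where Nx: "?r = (\<Prod>i<N. [:1, - x i:])" by (elim exE)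
  have "(\<Prod>i<N. [:1, - (x(N := 1 / a)) i:]) = ?r" unfolding Nx by (rule prod.cong) auto
  then have "q = (\<Prod>i<Suc N. [:1, - (x(N := 1 / a)) i:])"
    unfolding prod.lessThan_Suc q by (simp only: mult.commute fun_upd_same)
  then show ?case by (intro exI)
qed

lemma fps_left_cancel_upto:
  fixes f g :: "'a::comm_ring_1 fps"
  assumes "f * p = g * q" "\<And>i. i \<le> n \<Longrightarrow> p $ i = q $ i" "p $ 0 = 1" "k \<le> n"
  shows "f $ k = g $ k"
  using assms(4)
proof (induction k rule: less_induct)
  case (less k)
  have q0: "q $ 0 = 1" using assms(2)[of 0] assms(3) by simp
  have "(f * p) $ k = (\<Sum>i<k. f $ i * p $ (k - i)) + f $ k"
    if "p $ 0 = 1" for f p :: "'a fps" using that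
    by (simp add: fps_mult_nth atLeast0AtMost lessThan_Suc_atMost[symmetric])
  note expand = this
  have "(\<Sum>i<k. f $ i * p $ (k - i)) = (\<Sum>i<k. g $ i * q $ (k - i))"
    using less assms(2) by (intro sum.cong) auto
  then show ?case using expand[OF assms(3), of f] expand[OF q0, of g] assms(1) by simp
qed

text \<open>The generating function of the \<open>hsum N x k\<close> is the inverse of \<open>\<Prod>i<N. (1 - x i t)\<close>, and every polynomial with
  constant term 1 is such a product. So it suffices to truncate the inverse of the desired generating function after degree \<open>n\<close>.\<close>

theorem hsum_prescribed:
  fixes h :: "nat \<Rightarrow> complex"
  shows "\<exists>N x. \<forall>k. 0 < k \<and> k \<le> n \<longrightarrow> hsum N x k = h k"
proof -
  define H where "H = Abs_fps (\<lambda>k. if k = 0 then 1 else h k)"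
  define q where "q = Poly (map (fps_nth (inverse H)) [0..<Suc n])"
  have H0: "H $ 0 = 1" by (simp add: H_def)
  have cq: "coeff q i = inverse H $ i" if "i \<le> n" for i
    using that by (simp add: q_def nth_default_def del: upt_Suc)
  have "poly q 0 = 1" using cq[of 0] H0 by (simp add: poly_0_coeff_0)
  then obtain N :: nat and x where Nx: "q = (\<Prod>i<N. [:1, - x i:])" using linear_factorization by blast
  have "Abs_fps (hsum N x) * fps_of_poly q = H * inverse H"
    using hsum_generating_function[of N x] H0 by (simp add: Nx inverse_mult_eq_1')
  then have "Abs_fps (hsum N x) $ k = H $ k" if "k \<le> n" for k
    by (rule fps_left_cancel_upto[of _ _ _ _ n]) (use that cq cq[of 0] H0 in auto)
  then show ?thesis by (intro exI[of _ N] exI[of _ x]) (auto simp: H_def)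
qed

section \<open>Ribbon tableaux as words\<close>

text \<open>The number of steps after which the walk along the ribbon reaches the box \<open>(i, j)\<close>.\<close>

definition walk_position :: "nat list \<Rightarrow> nat \<times> nat \<Rightarrow> nat" where
  "walk_position \<beta> = (\<lambda>(i, j). j + (length \<beta> - Suc i))"

definition tableau_of_word :: "nat list \<Rightarrow> nat list \<Rightarrow> nat \<times> nat \<Rightarrow> nat" where
  "tableau_of_word \<beta> w = restrict (\<lambda>d. w ! walk_position \<beta> d) (ribbon \<beta>)"

lemma mem_ribbon_position:
  "(i, j) \<in> ribbon \<beta> \<longleftrightarrow> i < length \<beta> \<and>
     sum_list (take (length \<beta> - Suc i) \<beta>) \<le> walk_position \<beta> (i, j) \<and>
     walk_position \<beta> (i, j) < sum_list (take (Suc (length \<beta> - Suc i)) \<beta>)"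
proof (cases "i < length \<beta>")
  case True
  then have "Suc (length \<beta> - Suc i) = length \<beta> - i" by simp
  then show ?thesis by (simp add: mem_ribbon walk_position_def)
qed (simp add: mem_ribbon)

lemma bij_walk_position:
  assumes "composition \<beta>"
  shows "bij_betw (walk_position \<beta>) (ribbon \<beta>) {..<sum_list \<beta>}"
proof -
  let ?k = "length \<beta>" and ?P = "\<lambda>r. sum_list (take r \<beta>)"
  have "inj_on (walk_position \<beta>) (ribbon \<beta>)"
  proof (rule inj_onI)
    fix d e assume d: "d \<in> ribbon \<beta>" and e: "e \<in> ribbon \<beta>" and eq: "walk_position \<beta> d = walk_position \<beta> e"
    obtain i j i' j' where de: "d = (i, j)" "e = (i', j')" by (cases d; cases e)
    note m = d[unfolded de(1) mem_ribbon_position, folded de(1)]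
      e[unfolded de(2) mem_ribbon_position, folded de(2), folded eq]
    have "\<not> ?k - Suc i < ?k - Suc i'" "\<not> ?k - Suc i' < ?k - Suc i"
      using m sum_take_mono[of "Suc (?k - Suc i)" "?k - Suc i'" \<beta>] sum_take_mono[of "Suc (?k - Suc i')" "?k - Suc i" \<beta>]
      by linarith+
    then have "i = i'" using m by linarith
    then show "d = e" using eq by (simp add: de walk_position_def)
  qed
  moreover have "walk_position \<beta> ` ribbon \<beta> = {..<sum_list \<beta>}"
  proof (intro equalityI subsetI)
    fix p assume "p \<in> walk_position \<beta> ` ribbon \<beta>"
    then obtain i j where ij: "(i, j) \<in> ribbon \<beta>" "p = walk_position \<beta> (i, j)" by auto
    then have "i < ?k" "p < ?P (Suc (?k - Suc i))" unfolding mem_ribbon_position by blast+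
    then have "p < ?P ?k" using sum_take_mono[of "Suc (?k - Suc i)" ?k \<beta>] by linarith
    then show "p \<in> {..<sum_list \<beta>}" by simp
  next
    fix p assume "p \<in> {..<sum_list \<beta>}"
    then obtain r where r: "r < ?k" "r \<le> p" "?P r \<le> p" "p < ?P (Suc r)"
      using ribbon_walk[OF assms, of p] by auto
    have e: "?k - Suc (?k - Suc r) = r" using r(1) by simp
    have pos: "walk_position \<beta> (?k - Suc r, p - r) = p" using r by (simp add: walk_position_def e)
    have "(?k - Suc r, p - r) \<in> ribbon \<beta>" unfolding mem_ribbon_position pos e using r by simp
    then show "p \<in> walk_position \<beta> ` ribbon \<beta>" using pos by force
  qed
  ultimately show ?thesis by (simp add: bij_betw_def)
qed

text \<open>Consecutive boxes of the walk are neighbours, in the same row or, when the walk enters a new row, in the same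
  column. The row and column conditions for them are the prescribed ascents and descents.\<close>

lemma semistandard_imp_descents:
  assumes c: "composition \<beta>" and len: "length w = sum_list \<beta>" and ss: "semistandard (ribbon \<beta>) (tableau_of_word \<beta> w)"
  shows "word_descents w = partial_sums \<beta>"
proof (rule set_eqI)
  let ?k = "length \<beta>" and ?P = "\<lambda>r. sum_list (take r \<beta>)"
  have row: "w ! walk_position \<beta> (i, j) \<le> w ! walk_position \<beta> (i, j')"
    if "(i, j) \<in> ribbon \<beta>" "(i, j') \<in> ribbon \<beta>" "j < j'" for i j j'
    using ss that by (auto simp: semistandard_def tableau_of_word_def)
  have col: "w ! walk_position \<beta> (i, j) < w ! walk_position \<beta> (i', j)"
    if "(i, j) \<in> ribbon \<beta>" "(i', j) \<in> ribbon \<beta>" "i < i'" for i i' j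
    using ss that by (auto simp: semistandard_def tableau_of_word_def)
  fix q
  show "q \<in> word_descents w \<longleftrightarrow> q \<in> partial_sums \<beta>"
  proof (cases "0 < q \<and> q < sum_list \<beta>")
    case False
    then show ?thesis using partial_sums_subset[OF c] len by (auto simp: word_descents_def)
  next
    case True
    then obtain s where s: "s < ?k" "?P s \<le> q" "q < ?P (Suc s)" by (metis ribbon_walk[OF c])
    have sP: "s \<le> ?P s" using length_le_sum_take[OF c] s by simp
    have e: "?k - Suc (?k - Suc s) = s" using s(1) by simp
    have pos: "walk_position \<beta> (?k - Suc s, p - s) = p" if "s \<le> p" for p
      using that by (simp add: walk_position_def e)
    have box: "(?k - Suc s, p - s) \<in> ribbon \<beta>" if "?P s \<le> p" "p < ?P (Suc s)" for p
      using that sP s(1) pos[of p] unfolding mem_ribbon_position e by auto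
    show ?thesis
    proof (cases "q = ?P s")
      case q: True
      then have s0: "s > 0" using True by (cases s) auto
      define t where "t = s - 1"
      have t: "s = Suc t" using s0 by (simp add: t_def)
      have e': "?k - Suc (?k - Suc t) = t" using s(1) t by simp
      have "?P t + (s - t) \<le> ?P s" by (rule sum_take_diff[OF c]) (use t s in auto)
      then have Pt: "?P t < q" using q t by simp
      have tP: "t \<le> ?P t" using length_le_sum_take[OF c] s t by simp
      have pos': "walk_position \<beta> (?k - Suc t, q - s) = q - 1"
        using e' tP Pt t by (simp add: walk_position_def)
      have box': "(?k - Suc t, q - s) \<in> ribbon \<beta>"
        unfolding mem_ribbon_position pos' e' using Pt q t s(1) by auto
      have "?k - Suc s < ?k - Suc t" using s(1) t by simp
      from col[OF box[of q] box' this] have "w ! q < w ! (q - 1)"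
        using s pos[of q] pos' sP by simp
      moreover have "q \<in> partial_sums \<beta>" using q s0 s(1) by (auto simp: partial_sums_def)
      ultimately show ?thesis using True len by (simp add: word_descents_def)
    next
      case q: False
      then have lt: "?P s < q" using s by simp
      have "q \<notin> partial_sums \<beta>"
      proof
        assume "q \<in> partial_sums \<beta>"
        then obtain r where r: "q = ?P r" by (auto simp: partial_sums_def)
        have "\<not> r \<le> s" using sum_take_mono[of r s \<beta>] lt r by auto
        moreover have "\<not> Suc s \<le> r" using sum_take_mono[of "Suc s" r \<beta>] s(3) r by auto
        ultimately show False by linarith
      qed
      moreover have "w ! (q - 1) \<le> w ! q"
        using row[OF box[of "q - 1"] box[of q]] pos[of q] pos[of "q - 1"] s lt sP by auto
      ultimately show ?thesis by (auto simp: word_descents_def)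
    qed
  qed
qed

text \<open>Boxes of one row occupy consecutive positions without a partial sum in between; for two boxes of one
  column every position after that of the lower one, up to that of the upper one, is a partial sum. The conditions for distant boxes follow
  by chaining those for neighbours.\<close>

lemma descents_imp_semistandard:
  assumes c: "composition \<beta>" and len: "length w = sum_list \<beta>" and wd: "word_descents w = partial_sums \<beta>"
  shows "semistandard (ribbon \<beta>) (tableau_of_word \<beta> w)"
proof -
  let ?k = "length \<beta>" and ?P = "\<lambda>r. sum_list (take r \<beta>)"
  have row: "w ! walk_position \<beta> (i, j) \<le> w ! walk_position \<beta> (i, j')"
    if ij: "(i, j) \<in> ribbon \<beta>" "(i, j') \<in> ribbon \<beta>" "j < j'" for i j j'
  proof -
    define r where "r = ?k - Suc i"
    define p where "p = walk_position \<beta> (i, j)"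
    define p' where "p' = walk_position \<beta> (i, j')"
    have pp: "p = j + r" "p' = j' + r" by (simp_all only: p_def p'_def walk_position_def r_def prod.case)
    have b: "?P r \<le> p" "p' < ?P (Suc r)" "p < p'"
      using ij(1)[unfolded mem_ribbon_position] ij(2)[unfolded mem_ribbon_position] ij(3)
      by (simp_all only: p_def[symmetric] p'_def[symmetric] r_def[symmetric]) (simp only: pp)
    have "p' < sum_list \<beta>" using bij_betw_apply[OF bij_walk_position[OF c] ij(2)] by (simp add: p'_def)
    have up: "w ! q \<le> w ! Suc q" if "p \<le> q" "q < p'" for q
    proof -
      have "Suc q \<notin> partial_sums \<beta>"
      proof
        assume "Suc q \<in> partial_sums \<beta>"
        then obtain s where s: "Suc q = ?P s" by (auto simp: partial_sums_def)
        have "\<not> s \<le> r" using sum_take_mono[of s r \<beta>] b that s by auto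
        moreover have "\<not> Suc r \<le> s" using sum_take_mono[of "Suc r" s \<beta>] b that s by auto
        ultimately show False by linarith
      qed
      then show ?thesis using that \<open>p' < sum_list \<beta>\<close> len unfolding wd[symmetric] by (simp add: word_descents_def)
    qed
    have "w ! p \<le> w ! q" if "p \<le> q" "q \<le> p'" for q
      using that
    proof (induction q rule: dec_induct)
      case (step q)
      then show ?case using \<open>p \<le> q\<close> step.IH up[of q] by simp
    qed simp
    then show ?thesis using b by (simp add: p_def p'_def)
  qed
  have col: "w ! walk_position \<beta> (i, j) < w ! walk_position \<beta> (i', j)"
    if ij: "(i, j) \<in> ribbon \<beta>" "(i', j) \<in> ribbon \<beta>" "i < i'" for i i' j
  proof -
    define r where "r = ?k - Suc i"
    define t where "t = ?k - Suc i'"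
    have pp: "walk_position \<beta> (i, j) = j + r" "walk_position \<beta> (i', j) = j + t"
      by (simp_all only: walk_position_def r_def t_def prod.case)
    have m: "i < ?k" "i' < ?k" "?P r \<le> j + r" "j + t < ?P (Suc t)"
      using ij(1)[unfolded mem_ribbon_position pp, folded r_def] ij(2)[unfolded mem_ribbon_position pp, folded t_def] by blast+
    then have b: "?P r \<le> j + r" "j + t < ?P (Suc t)" "t < r" "r < ?k"
      using ij(3) by (simp_all add: r_def t_def)
    have down: "w ! (j + s) < w ! (j + s - 1)" if "t < s" "s \<le> r" for s
    proof -
      have "?P (Suc t) + (s - Suc t) \<le> ?P s" "?P s + (r - s) \<le> ?P r"
        by (rule sum_take_diff[OF c]; use b that in linarith)+
      then have "j + s = ?P s" using b that by linarith
      then have "j + s \<in> word_descents w" unfolding wd partial_sums_def using that b by auto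
      then show ?thesis by (simp add: word_descents_def)
    qed
    have "w ! (j + s) < w ! (j + t)" if "Suc t \<le> s" "s \<le> r" for s
      using that
    proof (induction s rule: dec_induct)
      case base
      then show ?case using down[of "Suc t"] by simp
    next
      case (step s)
      then show ?case using down[of "Suc s"] by simp
    qed
    from this[of r] show ?thesis unfolding pp using b by simp
  qed
  show ?thesis unfolding semistandard_def tableau_of_word_def
    by (intro conjI allI impI) (auto simp: row col)
qed

lemma mset_tableau_of_word:
  assumes "composition \<beta>" "length w = sum_list \<beta>"
  shows "image_mset (tableau_of_word \<beta> w) (mset_set (ribbon \<beta>)) = mset w"
proof -
  note bij = bij_walk_position[OF assms(1)]
  have fin: "finite (ribbon \<beta>)" using bij_betw_finite[OF bij] by simp
  have "image_mset (tableau_of_word \<beta> w) (mset_set (ribbon \<beta>)) =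
      image_mset (\<lambda>d. w ! walk_position \<beta> d) (mset_set (ribbon \<beta>))"
    by (rule image_mset_cong) (simp add: tableau_of_word_def fin)
  also have "\<dots> = image_mset ((!) w) (image_mset (walk_position \<beta>) (mset_set (ribbon \<beta>)))"
    by (simp add: image_mset.compositionality comp_def)
  also have "\<dots> = image_mset ((!) w) (mset_set {0..<length w})"
    using bij assms(2) by (simp add: image_mset_mset_set bij_betw_def atLeast0LessThan)
  also have "\<dots> = mset (map ((!) w) [0..<length w])" by simp
  also have "\<dots> = mset w" by (simp only: map_nth)
  finally show ?thesis .
qed

theorem ribbon_schur_words:
  assumes c: "composition \<beta>"
  shows "ribbon_schur \<beta> m = of_nat (card {w \<in> ribbon_words \<beta>. mset w = m})"
proof -
  let ?D = "ribbon \<beta>" and ?n = "sum_list \<beta>" and ?pos = "walk_position \<beta>"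
  let ?g = "\<lambda>T. map (\<lambda>p. T (inv_into ?D ?pos p)) [0..<?n]"
  note bij = bij_walk_position[OF c]
  have inv: "inv_into ?D ?pos p \<in> ?D" "?pos (inv_into ?D ?pos p) = p" if "p < ?n" for p
    using bij that by (auto simp: bij_betw_def f_inv_into_f intro!: inv_into_into)
  have left: "?g (tableau_of_word \<beta> w) = w" if "length w = ?n" for w
    using that inv by (intro nth_equalityI) (auto simp: tableau_of_word_def)
  have right: "tableau_of_word \<beta> (?g T) = T" if "T \<in> extensional ?D" for T
  proof (rule extensionalityI[of _ ?D])
    fix d assume d: "d \<in> ?D"
    then have "?pos d < ?n" using bij_betw_apply[OF bij d] by simp
    then show "tableau_of_word \<beta> (?g T) d = T d"
      using d bij by (simp add: tableau_of_word_def bij_betw_inv_into_left)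
  qed (use that in \<open>simp_all add: tableau_of_word_def\<close>)
  have "bij_betw (tableau_of_word \<beta>) {w \<in> ribbon_words \<beta>. mset w = m}
     {T. semistandard ?D T \<and> image_mset T (mset_set ?D) = m}"
  proof (rule bij_betw_byWitness[where f' = ?g])
    show "\<forall>w\<in>{w \<in> ribbon_words \<beta>. mset w = m}. ?g (tableau_of_word \<beta> w) = w"
      using left by (simp add: ribbon_words_def)
    show "\<forall>T\<in>{T. semistandard ?D T \<and> image_mset T (mset_set ?D) = m}. tableau_of_word \<beta> (?g T) = T"
      using right by (simp add: semistandard_def)
    show "tableau_of_word \<beta> ` {w \<in> ribbon_words \<beta>. mset w = m} \<subseteq>
        {T. semistandard ?D T \<and> image_mset T (mset_set ?D) = m}"
      using descents_imp_semistandard[OF c] mset_tableau_of_word[OF c] by (auto simp: ribbon_words_def)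
    show "?g ` {T. semistandard ?D T \<and> image_mset T (mset_set ?D) = m} \<subseteq> {w \<in> ribbon_words \<beta>. mset w = m}"
    proof (rule image_subsetI)
      fix T assume T: "T \<in> {T. semistandard ?D T \<and> image_mset T (mset_set ?D) = m}"
      then have r: "tableau_of_word \<beta> (?g T) = T" by (intro right) (simp add: semistandard_def)
      have l: "length (?g T) = sum_list \<beta>" by simp
      have "word_descents (?g T) = partial_sums \<beta>"
        by (rule semistandard_imp_descents[OF c l]) (use T r in simp)
      moreover have "mset (?g T) = m" unfolding mset_tableau_of_word[OF c l, symmetric] r using T by simp
      ultimately show "?g T \<in> {w \<in> ribbon_words \<beta>. mset w = m}" using l unfolding ribbon_words_def by blast
    qed
  qed
  then show ?thesis unfolding ribbon_schur_def skew_schur_def by (simp add: bij_betw_same_card)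
qed

section \<open>Equality of ribbon Schur functions\<close>

definition word_contents :: "nat \<Rightarrow> nat list \<Rightarrow> nat multiset multiset" where
  "word_contents N \<beta> = image_mset mset (mset_set (ribbon_words \<beta> \<inter> letters_below N))"

lemma wsum_word_contents: "wsum N x \<beta> = (\<Sum>t\<in>#word_contents N \<beta>. \<Prod>i\<in>#t. x i)"
proof -
  have "(\<Prod>i\<in>#mset w. x i) = prod_list (map x w)" for w by (induction w) simp_all
  then show ?thesis
    unfolding wsum_def word_contents_def sum_unfold_sum_mset image_mset.compositionality comp_def by (simp only:)
qed

lemma count_word_contents:
  "count (word_contents N \<beta>) m = (if set_mset m \<subseteq> {..<N} then card {w \<in> ribbon_words \<beta>. mset w = m} else 0)"
proof -
  let ?X = "ribbon_words \<beta> \<inter> letters_below N"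
  have "(\<Sum>w | w \<in># mset_set ?X \<and> m = mset w. count (mset_set ?X) w) = (\<Sum>w | w \<in> ?X \<and> mset w = m. 1)"
    by (rule sum.cong) (auto simp: finite_ribbon_words)
  then have 1: "count (word_contents N \<beta>) m = card {w. w \<in> ?X \<and> mset w = m}"
    unfolding word_contents_def count_image_mset' by (simp only: card_eq_sum)
  have 2: "w \<in> letters_below N \<longleftrightarrow> set_mset m \<subseteq> {..<N}" if "mset w = m" for w
    unfolding letters_below_def that[symmetric] by simp
  show ?thesis
  proof (cases "set_mset m \<subseteq> {..<N}")
    case True
    then have "{w. w \<in> ?X \<and> mset w = m} = {w \<in> ribbon_words \<beta>. mset w = m}" using 2 by blast
    then show ?thesis using 1 True by simp
  next
    case False
    then have "{w. w \<in> ?X \<and> mset w = m} = {}" using 2 by blast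
    then have "card {w. w \<in> ?X \<and> mset w = m} = 0" by (simp only: card.empty)
    then show ?thesis using 1 False by simp
  qed
qed

lemma ribbon_schur_eq_iff_wsum:
  assumes "composition \<beta>" "composition \<gamma>"
  shows "ribbon_schur \<beta> = ribbon_schur \<gamma> \<longleftrightarrow> (\<forall>N (x :: nat \<Rightarrow> complex). wsum N x \<beta> = wsum N x \<gamma>)"
proof
  assume eq: "ribbon_schur \<beta> = ribbon_schur \<gamma>"
  have "card {w \<in> ribbon_words \<beta>. mset w = m} = card {w \<in> ribbon_words \<gamma>. mset w = m}" for m
    using fun_cong[OF eq, of m] unfolding ribbon_schur_words[OF assms(1)] ribbon_schur_words[OF assms(2)] of_nat_eq_iff .
  then have "word_contents N \<beta> = word_contents N \<gamma>" for N
    by (intro multiset_eqI) (simp only: count_word_contents)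
  then show "\<forall>N (x :: nat \<Rightarrow> complex). wsum N x \<beta> = wsum N x \<gamma>" by (simp only: wsum_word_contents) simp
next
  assume eq: "\<forall>N (x :: nat \<Rightarrow> complex). wsum N x \<beta> = wsum N x \<gamma>"
  have *: "word_contents N \<beta> = word_contents N \<gamma>" for N
    by (rule types_separated) (rule eq[unfolded wsum_word_contents, rule_format])
  show "ribbon_schur \<beta> = ribbon_schur \<gamma>"
  proof
    fix m :: "nat multiset"
    define N where "N = Suc (Max (insert 0 (set_mset m)))"
    have sub: "set_mset m \<subseteq> {..<N}" unfolding N_def by (auto simp: less_Suc_eq_le)
    have "count (word_contents N \<beta>) m = count (word_contents N \<gamma>) m" by (simp only: *)
    then have "card {w \<in> ribbon_words \<beta>. mset w = m} = card {w \<in> ribbon_words \<gamma>. mset w = m}"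
      unfolding count_word_contents if_P[OF sub] .
    then show "ribbon_schur \<beta> m = ribbon_schur \<gamma> m"
      by (simp only: ribbon_schur_words[OF assms(1)] ribbon_schur_words[OF assms(2)])
  qed
qed

text \<open>\<open>\<beta>\<close> is a coarsening of itself, so some coarsening of \<open>\<gamma>\<close> has as many components as \<open>\<beta>\<close>.\<close>

lemma length_le_if_coarsening_partitions_eq:
  assumes "coarsening_partitions \<beta> = coarsening_partitions \<gamma>"
  shows "length \<beta> \<le> length \<gamma>"
proof -
  have "coarsens \<beta> \<beta>" unfolding coarsens_def by (intro exI[of _ "map (\<lambda>x. [x]) \<beta>"]) (auto simp: comp_def)
  then have "partition_of \<beta> \<in># coarsening_partitions \<beta>"
    by (simp add: coarsening_partitions_def finite_coarsenings)
  then obtain \<alpha> where "coarsens \<alpha> \<gamma>" "partition_of \<beta> = partition_of \<alpha>"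
    unfolding assms by (auto simp: coarsening_partitions_def finite_coarsenings)
  moreover from arg_cong[OF this(2), of length] have "length \<beta> = length \<alpha>" by (simp add: partition_of_def)
  ultimately show ?thesis using length_coarsens by simp
qed

lemma csum_cong:
  assumes "composition \<beta>" "\<And>k. 0 < k \<Longrightarrow> k \<le> sum_list \<beta> \<Longrightarrow> h k = h' k"
  shows "csum \<beta> h = csum \<beta> h'"
  unfolding csum_coarsenings[OF assms(1)]
proof (intro sum.cong arg_cong[of _ _ prod_list] map_cong refl)
  fix \<alpha> k assume "\<alpha> \<in> {\<alpha>. coarsens \<alpha> \<beta>}" "k \<in> set \<alpha>"
  then have "composition \<alpha>" "sum_list \<alpha> = sum_list \<beta>" using ps_coarsens assms(1) by auto
  then show "h k = h' k"
    using assms(2) \<open>k \<in> set \<alpha>\<close> member_le_sum_list[of k \<alpha>] by (auto simp: composition_def)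
qed

text \<open>Only the coarsest composition contributes. This value fixes the sign in \<open>wsum_csum\<close>.\<close>

lemma csum_delta:
  assumes "sum_list \<beta> > 0"
  shows "csum \<beta> (\<lambda>k. if k = sum_list \<beta> then 1 else 0) = 1"
proof -
  let ?n = "sum_list \<beta>" and ?h = "\<lambda>k. if k = sum_list \<beta> then 1 else 0"
  have "csum \<beta> ?h = (\<Sum>i<?n. path_sum (insert ?n (partial_sums \<beta>)) ?h i * ?h (?n - i))"
    using assms by (simp add: csum_def path_sum_pos)
  also have "\<dots> = (\<Sum>i<?n. if i = 0 then 1 else 0)" by (rule sum.cong) auto
  also have "\<dots> = 1" using assms by simp
  finally show ?thesis .
qed

text \<open>By \<open>wsum_csum\<close> and \<open>hsum_prescribed\<close> the two statements are the equality of \<open>csum \<beta>\<close> and \<open>csum \<gamma>\<close>, apart from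
  the sign \<open>(-1) ^ length\<close>. In one direction the sign is known because equal multisets of partitions have the
  same longest element, in the other it is found by putting weight on \<open>n\<close> alone.\<close>

theorem ribbon_schur_eq_iff:
  assumes c: "composition \<beta>" "composition \<gamma>" and n: "sum_list \<beta> = n" "sum_list \<gamma> = n" "n > 0"
  shows "ribbon_schur \<beta> = ribbon_schur \<gamma> \<longleftrightarrow> coarsening_partitions \<beta> = coarsening_partitions \<gamma>"
proof -
  have ne: "\<beta> \<noteq> []" "\<gamma> \<noteq> []" using n by auto
  show ?thesis
  proof
    assume eq: "coarsening_partitions \<beta> = coarsening_partitions \<gamma>"
    then have "length \<beta> = length \<gamma>" by (simp add: length_le_if_coarsening_partitions_eq le_antisym)
    moreover have "csum \<beta> h = csum \<gamma> h" for h :: "nat \<Rightarrow> complex"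
      using eq coarsening_partitions_eq_iff[OF c n(1,2)] path_types_eq_iff_csum[OF n(1,2)] by blast
    ultimately show "ribbon_schur \<beta> = ribbon_schur \<gamma>"
      unfolding ribbon_schur_eq_iff_wsum[OF c] by (simp add: wsum_csum c ne)
  next
    assume "ribbon_schur \<beta> = ribbon_schur \<gamma>"
    then have ws: "wsum N x \<beta> = wsum N x \<gamma>" for N and x :: "nat \<Rightarrow> complex"
      unfolding ribbon_schur_eq_iff_wsum[OF c] by blast
    have signed: "(-1) ^ length \<beta> * csum \<beta> h = (-1) ^ length \<gamma> * csum \<gamma> h" for h :: "nat \<Rightarrow> complex"
    proof -
      obtain N x where Nx: "\<forall>k. 0 < k \<and> k \<le> n \<longrightarrow> hsum N x k = - h k" using hsum_prescribed[of n "\<lambda>k. - h k"] by blast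
      have "csum \<beta> (\<lambda>k. - hsum N x k) = csum \<beta> h" by (rule csum_cong[OF c(1)]) (use Nx n in simp)
      moreover have "csum \<gamma> (\<lambda>k. - hsum N x k) = csum \<gamma> h" by (rule csum_cong[OF c(2)]) (use Nx n in simp)
      ultimately show ?thesis using ws[of N x] by (simp add: wsum_csum c ne)
    qed
    have "(-1 :: complex) ^ length \<beta> = (-1) ^ length \<gamma>"
      using signed[of "\<lambda>k. if k = n then 1 else 0"] csum_delta[of \<beta>, where ?'a = complex]
        csum_delta[of \<gamma>, where ?'a = complex] n by simp
    then have "csum \<beta> h = csum \<gamma> h" for h :: "nat \<Rightarrow> complex" using signed[of h] by simp
    then show "coarsening_partitions \<beta> = coarsening_partitions \<gamma>"
      using coarsening_partitions_eq_iff[OF c n(1,2)] path_types_eq_iff_csum[OF n(1,2)] by blast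
  qed
qed

section \<open>Coefficients in the fundamental basis\<close>

lemma card_partial_sums:
  assumes "composition \<beta>"
  shows "card (partial_sums \<beta>) = length \<beta> - 1"
proof -
  have "partial_sums \<beta> = (\<lambda>i. sum_list (take i \<beta>)) ` {1..<length \<beta>}" by (auto simp: partial_sums_def)
  moreover have "inj_on (\<lambda>i. sum_list (take i \<beta>)) {1..<length \<beta>}"
  proof (rule linorder_inj_onI)
    fix i j assume "i < j" "i \<in> {1..<length \<beta>}" "j \<in> {1..<length \<beta>}"
    then have "sum_list (take i \<beta>) + (j - i) \<le> sum_list (take j \<beta>)" by (intro sum_take_diff assms) auto
    then show "sum_list (take i \<beta>) \<noteq> sum_list (take j \<beta>)" using \<open>i < j\<close> by linarith
  qed auto
  ultimately show ?thesis by (simp add: card_image)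
qed

lemma coarsens_partial_sums:
  assumes "composition \<beta>"
  shows "coarsens \<alpha> \<beta> \<longleftrightarrow> composition \<alpha> \<and> sum_list \<alpha> = sum_list \<beta> \<and> partial_sums \<alpha> \<subseteq> partial_sums \<beta>"
proof -
  have "ps \<alpha> \<subseteq> ps \<beta> \<longleftrightarrow> partial_sums \<alpha> \<subseteq> partial_sums \<beta>" if "composition \<alpha>" "sum_list \<alpha> = sum_list \<beta>"
  proof -
    have "0 \<notin> partial_sums \<alpha>" "sum_list \<beta> \<notin> partial_sums \<alpha>" using partial_sums_subset[OF that(1)] that(2) by auto
    then show ?thesis unfolding ps_partial_sums[OF that(1)] ps_partial_sums[OF assms] that(2) by blast
  qed
  then show ?thesis using coarsens_iff[OF assms] by blast
qed

lemma bij_partial_sums_coarsenings: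
  assumes "composition \<beta>" "sum_list \<beta> > 0"
  shows "bij_betw partial_sums {\<alpha>. coarsens \<alpha> \<beta>} (Pow (partial_sums \<beta>))"
proof (rule bij_betw_imageI)
  show "inj_on partial_sums {\<alpha>. coarsens \<alpha> \<beta>}"
  proof (rule inj_onI)
    fix \<alpha> \<alpha>' assume "\<alpha> \<in> {\<alpha>. coarsens \<alpha> \<beta>}" "\<alpha>' \<in> {\<alpha>. coarsens \<alpha> \<beta>}" "partial_sums \<alpha> = partial_sums \<alpha>'"
    then show "\<alpha> = \<alpha>'" by (intro composition_eqI) (simp_all add: coarsens_partial_sums[OF assms(1)])
  qed
  show "partial_sums ` {\<alpha>. coarsens \<alpha> \<beta>} = Pow (partial_sums \<beta>)"
  proof (intro equalityI subsetI)
    fix S assume S: "S \<in> Pow (partial_sums \<beta>)"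
    then have "S \<subseteq> {0<..<sum_list \<beta>}" using partial_sums_subset[OF assms(1)] by blast
    then obtain \<alpha> where \<alpha>: "composition \<alpha>" "sum_list \<alpha> = sum_list \<beta>" "partial_sums \<alpha> = S"
      using composition_of_set[OF _ assms(2)] by blast
    have "coarsens \<alpha> \<beta>" unfolding coarsens_partial_sums[OF assms(1)] \<alpha>(3) using \<alpha> S by simp
    then show "S \<in> partial_sums ` {\<alpha>. coarsens \<alpha> \<beta>}" using \<alpha>(3) by blast
  qed (auto simp: coarsens_partial_sums[OF assms(1)])
qed

text \<open>Moebius inversion in the boolean lattice of the coarsenings of \<open>\<beta>\<close>, identified with the subsets of \<open>partial_sums \<beta>\<close>.\<close>

lemma coarsening_inversion:
  fixes A c :: "nat list \<Rightarrow> rat"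
  assumes \<beta>: "composition \<beta>" "sum_list \<beta> > 0"
    and A: "\<And>\<delta>. composition \<delta> \<Longrightarrow> sum_list \<delta> = sum_list \<beta> \<Longrightarrow> A \<delta> = (\<Sum>\<alpha> | coarsens \<alpha> \<delta>. c \<alpha>)"
  shows "c \<beta> = (\<Sum>\<alpha> | coarsens \<alpha> \<beta>. (-1) ^ (length \<beta> - length \<alpha>) * A \<alpha>)"
proof -
  define comp where "comp S = (THE \<alpha>. composition \<alpha> \<and> sum_list \<alpha> = sum_list \<beta> \<and> partial_sums \<alpha> = S)" for S
  have comp: "comp (partial_sums \<alpha>) = \<alpha>" if "composition \<alpha>" "sum_list \<alpha> = sum_list \<beta>" for \<alpha>
    unfolding comp_def by (rule the_equality) (simp_all add: that composition_eqI)
  have g: "(\<Sum>T\<in>Pow (partial_sums \<delta>). c (comp T)) = A \<delta>" if \<delta>: "composition \<delta>" "sum_list \<delta> = sum_list \<beta>" for \<delta>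
  proof -
    have "(\<Sum>T\<in>Pow (partial_sums \<delta>). c (comp T)) = (\<Sum>\<alpha> | coarsens \<alpha> \<delta>. c (comp (partial_sums \<alpha>)))"
      by (rule sum.reindex_bij_betw[OF bij_partial_sums_coarsenings, symmetric]) (use \<delta> \<beta> in auto)
    also have "\<dots> = (\<Sum>\<alpha> | coarsens \<alpha> \<delta>. c \<alpha>)"
      by (rule sum.cong) (use coarsens_partial_sums[OF \<delta>(1)] \<delta>(2) comp in auto)
    finally show ?thesis using A[OF \<delta>] by simp
  qed
  have "finite (partial_sums \<beta>)" using partial_sums_subset[OF \<beta>(1)] by (rule finite_subset) simp
  from inclusion_exclusion_mobius[OF refl this, of "\<lambda>T. c (comp T)"]
  have "c \<beta> = (\<Sum>T\<in>Pow (partial_sums \<beta>). (-1) ^ (card (partial_sums \<beta>) - card T) * (\<Sum>U\<in>Pow T. c (comp U)))"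
    by (simp add: comp[OF \<beta>(1) refl])
  also have "\<dots> = (\<Sum>\<alpha> | coarsens \<alpha> \<beta>. (-1) ^ (card (partial_sums \<beta>) - card (partial_sums \<alpha>)) *
      (\<Sum>U\<in>Pow (partial_sums \<alpha>). c (comp U)))"
    by (rule sum.reindex_bij_betw[OF bij_partial_sums_coarsenings[OF \<beta>], symmetric])
  also have "\<dots> = (\<Sum>\<alpha> | coarsens \<alpha> \<beta>. (-1) ^ (length \<beta> - length \<alpha>) * A \<alpha>)"
  proof (rule sum.cong)
    fix \<alpha> assume "\<alpha> \<in> {\<alpha>. coarsens \<alpha> \<beta>}"
    then have \<alpha>: "composition \<alpha>" "sum_list \<alpha> = sum_list \<beta>" using coarsens_partial_sums[OF \<beta>(1)] by auto
    then have "\<alpha> \<noteq> []" using \<beta>(2) by auto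
    then have "length \<beta> - 1 - (length \<alpha> - 1) = length \<beta> - length \<alpha>" by (cases \<alpha>) auto
    then show "(-1) ^ (card (partial_sums \<beta>) - card (partial_sums \<alpha>)) * (\<Sum>U\<in>Pow (partial_sums \<alpha>). c (comp U)) =
       (-1) ^ (length \<beta> - length \<alpha>) * A \<alpha>"
      unfolding g[OF \<alpha>] card_partial_sums[OF \<alpha>(1)] card_partial_sums[OF \<beta>(1)] by (simp only:)
  qed simp
  finally show ?thesis .
qed

text \<open>The converse inversion, obtained by applying the previous lemma to functions with alternating signs.\<close>

lemma coarsening_inversion':
  fixes A :: "nat list \<Rightarrow> rat"
  assumes \<beta>: "composition \<beta>" "sum_list \<beta> > 0"
  shows "(\<Sum>\<alpha> | coarsens \<alpha> \<beta>. \<Sum>\<delta> | coarsens \<delta> \<alpha>. (-1) ^ (length \<alpha> - length \<delta>) * A \<delta>) = A \<beta>"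
proof -
  define s where "s \<alpha> = (-1 :: rat) ^ length \<alpha>" for \<alpha> :: "nat list"
  have ss: "s \<alpha> * s \<alpha> = 1" for \<alpha> by (simp add: s_def flip: power_add)
  have sd: "(-1) ^ (length \<alpha> - length \<delta>) = s \<alpha> * s \<delta>" if "coarsens \<delta> \<alpha>" for \<alpha> \<delta>
  proof -
    have "s \<alpha> = (-1) ^ (length \<alpha> - length \<delta>) * s \<delta>"
      using length_coarsens[OF that] by (simp add: s_def flip: power_add)
    then show ?thesis using ss[of \<delta>] by (simp add: mult.assoc)
  qed
  define B where "B \<alpha> = (\<Sum>\<delta> | coarsens \<delta> \<alpha>. s \<delta> * A \<delta>)" for \<alpha>
  have "s \<beta> * A \<beta> = (\<Sum>\<alpha> | coarsens \<alpha> \<beta>. (-1) ^ (length \<beta> - length \<alpha>) * B \<alpha>)"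
    by (rule coarsening_inversion[OF \<beta>]) (simp add: B_def)
  also have "\<dots> = s \<beta> * (\<Sum>\<alpha> | coarsens \<alpha> \<beta>. s \<alpha> * B \<alpha>)"
    unfolding sum_distrib_left by (rule sum.cong) (auto simp: sd)
  also have "(\<Sum>\<alpha> | coarsens \<alpha> \<beta>. s \<alpha> * B \<alpha>) =
      (\<Sum>\<alpha> | coarsens \<alpha> \<beta>. \<Sum>\<delta> | coarsens \<delta> \<alpha>. (-1) ^ (length \<alpha> - length \<delta>) * A \<delta>)"
    unfolding B_def sum_distrib_left by (intro sum.cong) (auto simp: sd)
  finally have "s \<beta> * (s \<beta> * A \<beta>) = s \<beta> * (s \<beta> *
    (\<Sum>\<alpha> | coarsens \<alpha> \<beta>. \<Sum>\<delta> | coarsens \<delta> \<alpha>. (-1) ^ (length \<alpha> - length \<delta>) * A \<delta>))" by simp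
  then show ?thesis by (simp add: ss flip: mult.assoc)
qed

text \<open>The exponents of a monomial in the order of its variables. By \<open>monomial_qsym_eq\<close> the monomial occurs in \<open>M\<^sub>\<gamma>\<close> for
  exactly one composition, this one.\<close>

definition exponents :: "nat multiset \<Rightarrow> nat list" where
  "exponents m = map (count m) (sorted_list_of_set (set_mset m))"

lemma composition_exponents: "composition (exponents m)"
  by (simp add: composition_def exponents_def)

lemma sum_exponents: "sum_list (exponents m) = size m"
  by (simp add: exponents_def size_multiset_overloaded_eq sum_list_distinct_conv_sum_set)

lemma count_power_monomial:
  assumes "length is = length \<beta>" "distinct is"
  shows "j < length is \<Longrightarrow> count (power_monomial is \<beta>) (is ! j) = \<beta> ! j"
    and "i \<notin> set is \<Longrightarrow> count (power_monomial is \<beta>) i = 0"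
proof -
  have *: "(j < length is \<longrightarrow> count (power_monomial is \<beta>) (is ! j) = \<beta> ! j) \<and>
     (i \<notin> set is \<longrightarrow> count (power_monomial is \<beta>) i = 0)" for j i
    using assms
  proof (induction "is" \<beta> arbitrary: i j rule: list_induct2)
    case (Cons x xs y ys)
    then show ?case by (cases j) (auto simp: power_monomial_def)
  qed (simp add: power_monomial_def)
  show "j < length is \<Longrightarrow> count (power_monomial is \<beta>) (is ! j) = \<beta> ! j"
    and "i \<notin> set is \<Longrightarrow> count (power_monomial is \<beta>) i = 0" using *[of j i] by auto
qed

lemma power_monomial_iff:
  assumes "composition \<beta>" "length is = length \<beta>" "sorted_wrt (<) is"
  shows "power_monomial is \<beta> = m \<longleftrightarrow> is = sorted_list_of_set (set_mset m) \<and> \<beta> = exponents m"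
proof -
  have d: "distinct is" "sorted is" using assms(3) by (auto simp: strict_sorted_iff)
  note cnt = count_power_monomial[OF assms(2) d(1)]
  show ?thesis
  proof
    assume m: "power_monomial is \<beta> = m"
    have "set_mset m = set is"
    proof (intro equalityI subsetI)
      fix i assume i: "i \<in># m"
      show "i \<in> set is"
      proof (rule ccontr)
        assume "i \<notin> set is"
        then have "count m i = 0" using cnt(2)[of i] m by simp
        with i show False by (simp only: count_eq_zero_iff) simp
      qed
    next
      fix i assume "i \<in> set is"
      then obtain j where j: "j < length is" "i = is ! j" by (auto simp: in_set_conv_nth)
      then have "count m i = \<beta> ! j" using cnt(1)[OF j(1)] m by simp
      moreover have "\<beta> ! j \<in> set \<beta>" using assms(2) j by simp
      ultimately have "0 < count m i" using assms(1) by (simp only: composition_def)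
      then show "i \<in># m" by (simp only: count_greater_zero_iff)
    qed
    then have 1: "is = sorted_list_of_set (set_mset m)"
      using d by (simp add: sorted_list_of_set.idem_if_sorted_distinct)
    moreover have "\<beta> = exponents m"
      unfolding exponents_def 1[symmetric] by (rule nth_equalityI) (use assms(2) cnt(1) m in auto)
    ultimately show "is = sorted_list_of_set (set_mset m) \<and> \<beta> = exponents m" by blast
  next
    assume R: "is = sorted_list_of_set (set_mset m) \<and> \<beta> = exponents m"
    then have set: "set is = set_mset m" by simp
    have \<beta>: "\<beta> = map (count m) is" using R by (simp add: exponents_def)
    show "power_monomial is \<beta> = m"
    proof (rule multiset_eqI)
      fix i
      show "count (power_monomial is \<beta>) i = count m i"
      proof (cases "i \<in> set is")
        case True
        then obtain j where j: "j < length is" "i = is ! j" by (auto simp: in_set_conv_nth)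
        then show ?thesis using cnt(1)[OF j(1)] \<beta> by simp
      next
        case False
        then show ?thesis using cnt(2)[OF False] set by (simp add: not_in_iff)
      qed
    qed
  qed
qed

lemma monomial_qsym_eq:
  assumes "composition \<gamma>"
  shows "monomial_qsym \<gamma> m = (if \<gamma> = exponents m then 1 else 0)"
proof -
  have "{is. length is = length \<gamma> \<and> sorted_wrt (<) is \<and> power_monomial is \<gamma> = m} =
     (if \<gamma> = exponents m then {sorted_list_of_set (set_mset m)} else {})"
    using power_monomial_iff[OF assms, of _ m] by (auto simp: exponents_def)
  then show ?thesis by (simp add: monomial_qsym_def)
qed

lemma fundamental_qsym_eq:
  "fundamental_qsym \<beta> m = (if coarsens \<beta> (exponents m) then 1 else 0)"
proof -
  have "fundamental_qsym \<beta> m = (\<Sum>\<gamma> | composition \<gamma> \<and> coarsens \<beta> \<gamma>. if \<gamma> = exponents m then 1 else 0)"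
    unfolding fundamental_qsym_def by (rule sum.cong) (auto simp: monomial_qsym_eq)
  also have "\<dots> = (if coarsens \<beta> (exponents m) then 1 else 0)"
    using finite_refinements by (simp add: composition_exponents)
  finally show ?thesis .
qed

lemma fundamental_expansion_eq:
  assumes "fundamental_expansion f c"
  shows "f m = (\<Sum>\<alpha> | coarsens \<alpha> (exponents m). c \<alpha>)"
proof -
  have fin: "finite {\<alpha>. c \<alpha> \<noteq> 0}" and f: "f = (\<lambda>m. \<Sum>\<alpha> | c \<alpha> \<noteq> 0. c \<alpha> * fundamental_qsym \<alpha> m)"
    using assms by (auto simp: fundamental_expansion_def)
  have "f m = (\<Sum>\<alpha>\<in>{\<alpha>. c \<alpha> \<noteq> 0} \<inter> {\<alpha>. coarsens \<alpha> (exponents m)}. c \<alpha>)"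
    unfolding f fundamental_qsym_eq by (simp add: sum.inter_restrict[OF fin] if_distrib cong: if_cong)
  also have "\<dots> = (\<Sum>\<alpha> | coarsens \<alpha> (exponents m). c \<alpha>)"
    by (rule sum.mono_neutral_left) (auto simp: finite_coarsenings)
  finally show ?thesis .
qed

lemma exponents_power_monomial:
  assumes "composition \<delta>"
  shows "exponents (power_monomial [0..<length \<delta>] \<delta>) = \<delta>"
proof -
  have "\<delta> = exponents (power_monomial [0..<length \<delta>] \<delta>)"
    by (rule conjunct2[OF iffD1[OF power_monomial_iff[OF assms _ _] refl]]) simp_all
  then show ?thesis ..
qed

lemma mset_exponents: "mset (exponents m) = image_mset (count m) (mset_set (set_mset m))"
  using mset_set_set[of "sorted_list_of_set (set_mset m)"] by (simp add: exponents_def)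

lemma mset_exponents_image:
  assumes "inj_on \<pi> (set_mset m)"
  shows "mset (exponents (image_mset \<pi> m)) = mset (exponents m)"
proof -
  have "image_mset (count (image_mset \<pi> m)) (image_mset \<pi> (mset_set (set_mset m))) = image_mset (count m) (mset_set (set_mset m))"
    unfolding image_mset.compositionality
  proof (rule image_mset_cong)
    fix i assume i: "i \<in># mset_set (set_mset m)"
    have "\<pi> -` {\<pi> i} \<inter> set_mset m = {i}" using assms i by (auto dest: inj_onD)
    then show "(count (image_mset \<pi> m) \<circ> \<pi>) i = count m i" by (simp add: count_image_mset)
  qed
  then show ?thesis by (simp add: mset_exponents image_mset_mset_set[OF assms])
qed

text \<open>The multiplicities of two such monomials agree as multisets on the finite set of all variables involved, the
  absent ones counted with multiplicity 0; a bijection matching them extends to all variables.\<close>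

lemma obtain_variable_permutation:
  assumes "mset (exponents m) = mset (exponents m')"
  obtains \<pi> where "bij \<pi>" "image_mset \<pi> m = m'"
proof -
  let ?A = "set_mset m \<union> set_mset m'"
  have zeros: "image_mset (count k) (mset_set ?A) = mset (exponents k) + replicate_mset (card ?A - length (exponents k)) 0"
    if "set_mset k \<subseteq> ?A" for k
  proof -
    have "mset_set ?A = mset_set (set_mset k) + mset_set (?A - set_mset k)"
      using that by (subst mset_set_Union[symmetric]) (auto simp: Un_absorb1 intro!: arg_cong[of _ _ mset_set])
    moreover have "image_mset (count k) (mset_set (?A - set_mset k)) = image_mset (\<lambda>_. 0) (mset_set (?A - set_mset k))"
      by (rule image_mset_cong) (auto simp: not_in_iff)
    moreover have "card (?A - set_mset k) = card ?A - length (exponents k)"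
      using that by (simp add: card_Diff_subset exponents_def)
    ultimately show ?thesis by (simp add: mset_exponents image_mset_const_eq)
  qed
  have "image_mset (count m) (mset_set ?A) = image_mset (count m') (mset_set ?A)"
    using zeros[of m] zeros[of m'] assms mset_eq_length[OF assms] by simp
  then obtain \<pi> where \<pi>: "\<pi> permutes ?A" "\<forall>i\<in>?A. count m i = count m' (\<pi> i)"
    using image_mset_eq_implies_permutes[of ?A "count m" "count m'"] by auto
  have b: "bij \<pi>" by (rule permutes_bij[OF \<pi>(1)])
  have eq: "count m i = count m' (\<pi> i)" for i
  proof (cases "i \<in> ?A")
    case False
    then have "count m i = 0" "count m' i = 0" by (simp_all add: count_eq_zero_iff)
    then show ?thesis using permutes_not_in[OF \<pi>(1) False] by simp
  qed (use \<pi>(2) in blast)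
  have "image_mset \<pi> m = m'"
  proof (rule multiset_eqI)
    fix j
    obtain i where i: "j = \<pi> i" using surjD[OF bij_is_surj[OF b]] by blast
    have "count (image_mset \<pi> m) (\<pi> i) = count m i"
      using bij_is_inj[OF b] by (induction m) (auto dest: injD)
    then show "count (image_mset \<pi> m) j = count m' j" unfolding i eq[of i] .
  qed
  then show ?thesis using that b by blast
qed

lemma symmetric_function_exponents:
  assumes "symmetric_function f" "mset (exponents m) = mset (exponents m')"
  shows "f m = f m'"
proof -
  obtain \<pi> where \<pi>: "bij \<pi>" "image_mset \<pi> m = m'" by (rule obtain_variable_permutation[OF assms(2)])
  have "f (image_mset \<pi> m) = f m" using assms(1) \<pi>(1) unfolding symmetric_function_def by blast
  then show ?thesis by (simp only: \<pi>(2))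
qed

text \<open>In the inversion formula for \<open>c \<beta>\<close> the sign and, by symmetry of \<open>f\<close>, the coefficient of a coarsening depend only on its
  partition, so the formula is a sum over the multiset \<open>coarsening_partitions \<beta>\<close>.\<close>

theorem coefficients_if_coarsening_partitions:
  assumes \<beta>: "composition \<beta>" "composition \<gamma>" "sum_list \<beta> = n" "sum_list \<gamma> = n" "n > 0"
    and eq: "coarsening_partitions \<beta> = coarsening_partitions \<gamma>"
    and f: "symmetric_function f" "fundamental_expansion f c"
  shows "c \<beta> = c \<gamma>"
proof -
  define A where "A \<alpha> = f (power_monomial [0..<length \<alpha>] \<alpha>)" for \<alpha>
  have A: "A \<delta> = (\<Sum>\<alpha> | coarsens \<alpha> \<delta>. c \<alpha>)" if "composition \<delta>" for \<delta>
    unfolding A_def fundamental_expansion_eq[OF f(2)] exponents_power_monomial[OF that] ..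
  have sym: "A (partition_of \<alpha>) = A \<alpha>" if "composition \<alpha>" for \<alpha>
  proof -
    have "composition (partition_of \<alpha>)" using that by (simp add: composition_def partition_of_def)
    then show ?thesis unfolding A_def
      by (intro symmetric_function_exponents[OF f(1)])
        (use that in \<open>simp only: exponents_power_monomial, simp add: partition_of_def\<close>)
  qed
  have c: "c \<delta> = (\<Sum>\<mu>\<in>#coarsening_partitions \<delta>. (-1) ^ (length \<delta> - length \<mu>) * A \<mu>)"
    if \<delta>: "composition \<delta>" "sum_list \<delta> = n" for \<delta>
  proof -
    have "c \<delta> = (\<Sum>\<alpha> | coarsens \<alpha> \<delta>. (-1) ^ (length \<delta> - length \<alpha>) * A \<alpha>)"
      by (rule coarsening_inversion) (use \<delta> \<beta> A in auto)
    also have "\<dots> = (\<Sum>\<alpha> | coarsens \<alpha> \<delta>. (-1) ^ (length \<delta> - length (partition_of \<alpha>)) * A (partition_of \<alpha>))"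
      by (rule sum.cong) (use ps_coarsens[OF _ \<delta>(1)] sym in \<open>auto simp: partition_of_def\<close>)
    also have "\<dots> = (\<Sum>\<mu>\<in>#coarsening_partitions \<delta>. (-1) ^ (length \<delta> - length \<mu>) * A \<mu>)"
      unfolding coarsening_partitions_def sum_unfold_sum_mset image_mset.compositionality comp_def ..
    finally show ?thesis .
  qed
  have "length \<beta> = length \<gamma>"
    using length_le_if_coarsening_partitions_eq[OF eq] length_le_if_coarsening_partitions_eq[OF eq[symmetric]] by simp
  then show ?thesis using c[OF \<beta>(1,3)] c[OF \<beta>(2,4)] eq by simp
qed

text \<open>The monomial symmetric function of the partition obtained by sorting \<open>\<mu>\<close>.\<close>

definition monomial_sym :: "nat list \<Rightarrow> series" where
  "monomial_sym \<mu> m = (if mset (exponents m) = mset \<mu> then 1 else 0)"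

lemma symmetric_monomial_sym: "symmetric_function (monomial_sym \<mu>)"
  unfolding symmetric_function_def
proof (intro conjI allI impI exI)
  fix m assume "monomial_sym \<mu> m \<noteq> 0"
  then have "mset (exponents m) = mset \<mu>" by (simp add: monomial_sym_def split: if_splits)
  then have "sum_list (exponents m) = sum_list \<mu>" by (metis sum_mset_sum_list)
  then show "size m \<le> sum_list \<mu>" by (simp add: sum_exponents)
next
  fix \<pi> :: "nat \<Rightarrow> nat" and m assume "bij \<pi>"
  then have "inj_on \<pi> (set_mset m)" by (meson bij_is_inj inj_on_subset subset_UNIV)
  then show "monomial_sym \<mu> (image_mset \<pi> m) = monomial_sym \<mu> m"
    by (simp add: monomial_sym_def mset_exponents_image)
qed

lemma monomial_sym_expansion:
  assumes "n > 0" "sum_list \<mu> = n"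
  defines "c \<equiv> \<lambda>\<alpha>. if composition \<alpha> \<and> sum_list \<alpha> = n
     then \<Sum>\<delta> | coarsens \<delta> \<alpha>. (-1) ^ (length \<alpha> - length \<delta>) * (if mset \<delta> = mset \<mu> then 1 else 0) else 0"
  shows "fundamental_expansion (monomial_sym \<mu>) c"
  unfolding fundamental_expansion_def
proof (intro conjI allI impI)
  have sub: "{\<alpha>. c \<alpha> \<noteq> 0} \<subseteq> {\<alpha>. sum_list \<alpha> = n \<and> length \<alpha> \<le> n}"
    using length_composition_le by (auto simp: c_def split: if_splits)
  then show fin: "finite {\<alpha>. c \<alpha> \<noteq> 0}" by (rule finite_subset) (rule finite_lists_sum_length)
  show "composition \<alpha>" if "c \<alpha> \<noteq> 0" for \<alpha> using that by (auto simp: c_def split: if_splits)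
  show "monomial_sym \<mu> = (\<lambda>m. \<Sum>\<alpha> | c \<alpha> \<noteq> 0. c \<alpha> * fundamental_qsym \<alpha> m)"
  proof
    fix m
    have "(\<Sum>\<alpha> | c \<alpha> \<noteq> 0. c \<alpha> * fundamental_qsym \<alpha> m) = (\<Sum>\<alpha>\<in>{\<alpha>. c \<alpha> \<noteq> 0} \<inter> {\<alpha>. coarsens \<alpha> (exponents m)}. c \<alpha>)"
      unfolding fundamental_qsym_eq by (simp add: sum.inter_restrict[OF fin] if_distrib cong: if_cong)
    also have "\<dots> = (\<Sum>\<alpha> | coarsens \<alpha> (exponents m). c \<alpha>)"
      by (rule sum.mono_neutral_left) (auto simp: finite_coarsenings)
    also have "\<dots> = monomial_sym \<mu> m"
    proof (cases "size m = n")
      case True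
      have s: "sum_list (exponents m) = n" using True by (simp add: sum_exponents)
      have "(\<Sum>\<alpha> | coarsens \<alpha> (exponents m). c \<alpha>) = (\<Sum>\<alpha> | coarsens \<alpha> (exponents m).
         \<Sum>\<delta> | coarsens \<delta> \<alpha>. (-1) ^ (length \<alpha> - length \<delta>) * (if mset \<delta> = mset \<mu> then 1 else 0))"
        by (rule sum.cong) (use ps_coarsens[OF _ composition_exponents, of _ m] s in \<open>auto simp: c_def\<close>)
      also have "\<dots> = monomial_sym \<mu> m"
        using coarsening_inversion'[OF composition_exponents, of m "\<lambda>\<delta>. if mset \<delta> = mset \<mu> then 1 else 0"] s assms(1)
        by (simp add: monomial_sym_def)
      finally show ?thesis .
    next
      case False
      have "c \<alpha> = 0" if "coarsens \<alpha> (exponents m)" for \<alpha>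
        using sum_list_coarsens[OF that] False by (simp add: c_def sum_exponents)
      then have "(\<Sum>\<alpha> | coarsens \<alpha> (exponents m). c \<alpha>) = 0" by simp
      moreover have "mset (exponents m) \<noteq> mset \<mu>"
        using False sum_exponents[of m] assms(2) by (metis sum_mset_sum_list)
      ultimately show ?thesis by (simp add: monomial_sym_def)
    qed
    finally show "monomial_sym \<mu> m = (\<Sum>\<alpha> | c \<alpha> \<noteq> 0. c \<alpha> * fundamental_qsym \<alpha> m)" ..
  qed
qed

lemma partition_of_eq_iff: "partition_of \<alpha> = partition_of \<delta> \<longleftrightarrow> mset \<alpha> = mset \<delta>"
  unfolding partition_of_def rev_is_rev_conv
  by (metis mset_sort properties_for_sort sorted_sort)

text \<open>The coefficients of the monomial symmetric functions count coarsenings with a given partition, up to a sign that is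
  lost on taking absolute values.\<close>

theorem coarsening_partitions_if_coefficients:
  assumes \<beta>: "composition \<beta>" "composition \<gamma>" "sum_list \<beta> = n" "sum_list \<gamma> = n" "n > 0"
    and eq: "\<And>f c. symmetric_function f \<Longrightarrow> fundamental_expansion f c \<Longrightarrow> c \<beta> = c \<gamma>"
  shows "coarsening_partitions \<beta> = coarsening_partitions \<gamma>"
proof (rule multiset_eqI)
  fix \<mu>
  let ?N = "\<lambda>\<delta>. card {\<alpha>. coarsens \<alpha> \<delta> \<and> partition_of \<alpha> = \<mu>}"
  have count: "count (coarsening_partitions \<delta>) \<mu> = ?N \<delta>" for \<delta>
  proof -
    have "(\<Sum>\<alpha> | \<alpha> \<in># mset_set {\<alpha>. coarsens \<alpha> \<delta>} \<and> \<mu> = partition_of \<alpha>. count (mset_set {\<alpha>. coarsens \<alpha> \<delta>}) \<alpha>) =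
       (\<Sum>\<alpha> | coarsens \<alpha> \<delta> \<and> partition_of \<alpha> = \<mu>. 1)"
      by (rule sum.cong) (auto simp: finite_coarsenings)
    then show ?thesis unfolding coarsening_partitions_def count_image_mset' by (simp only: card_eq_sum)
  qed
  have "?N \<beta> = ?N \<gamma>"
  proof (cases "\<exists>\<alpha>. sum_list \<alpha> = n \<and> partition_of \<alpha> = \<mu>")
    case False
    have "{\<alpha>. coarsens \<alpha> \<delta> \<and> partition_of \<alpha> = \<mu>} = {}" if "sum_list \<delta> = n" for \<delta>
      using False sum_list_coarsens[of _ \<delta>] that by auto
    from this[OF \<beta>(3)] this[OF \<beta>(4)] show ?thesis by (simp only:)
  next
    case True
    then obtain \<kappa> where \<kappa>: "sum_list \<kappa> = n" "partition_of \<kappa> = \<mu>" by blast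
    have N: "?N \<delta> = card {\<alpha>. coarsens \<alpha> \<delta> \<and> mset \<alpha> = mset \<kappa>}" for \<delta>
      unfolding \<kappa>(2)[symmetric] partition_of_eq_iff ..
    have val: "(\<Sum>\<alpha> | coarsens \<alpha> \<delta>. (-1) ^ (length \<delta> - length \<alpha>) * (if mset \<alpha> = mset \<kappa> then 1 else 0)) =
        ((-1) ^ (length \<delta> - length \<kappa>) * of_nat (?N \<delta>) :: rat)" for \<delta>
    proof -
      have "(\<Sum>\<alpha> | coarsens \<alpha> \<delta>. (-1) ^ (length \<delta> - length \<alpha>) * (if mset \<alpha> = mset \<kappa> then 1 else 0)) =
          (\<Sum>\<alpha> | coarsens \<alpha> \<delta>. if mset \<alpha> = mset \<kappa> then (-1 :: rat) ^ (length \<delta> - length \<kappa>) else 0)"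
        by (rule sum.cong) (auto dest: mset_eq_length)
      also have "\<dots> = (\<Sum>\<alpha> | coarsens \<alpha> \<delta> \<and> mset \<alpha> = mset \<kappa>. (-1) ^ (length \<delta> - length \<kappa>))"
        using sum.inter_filter[OF finite_coarsenings[of \<delta>], of "\<lambda>_. (-1 :: rat) ^ (length \<delta> - length \<kappa>)" "\<lambda>\<alpha>. mset \<alpha> = mset \<kappa>"]
        by simp
      finally show ?thesis by (simp add: N)
    qed
    from eq[OF symmetric_monomial_sym monomial_sym_expansion[OF \<beta>(5) \<kappa>(1)]]
    have "(-1) ^ (length \<beta> - length \<kappa>) * of_nat (?N \<beta>) = ((-1) ^ (length \<gamma> - length \<kappa>) * of_nat (?N \<gamma>) :: rat)"
      using \<beta> unfolding val by simp
    from arg_cong[OF this, of abs] have "of_nat (?N \<beta>) = (of_nat (?N \<gamma>) :: rat)" by (simp add: abs_mult power_abs)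
    then show ?thesis by (simp only: of_nat_eq_iff)
  qed
  then show "count (coarsening_partitions \<beta>) \<mu> = count (coarsening_partitions \<gamma>) \<mu>" by (simp only: count)
qed

section \<open>Standardization of words\<close>

definition ascents :: "nat list \<Rightarrow> nat set" where
  "ascents v = {i. 0 < i \<and> i < length v \<and> v ! (i - 1) < v ! i}"

text \<open>The word that has the \<open>a\<close>-th letter of \<open>v\<close> at position \<open>\<sigma> a\<close>. For sorted \<open>v\<close>, and \<open>\<sigma>\<close> increasing on equal
  letters, \<open>inv \<sigma>\<close> is the standardization of this word.\<close>

definition word_of_perm :: "nat list \<Rightarrow> (nat \<Rightarrow> nat) \<Rightarrow> nat list" where
  "word_of_perm v \<sigma> = map (\<lambda>i. v ! (inv \<sigma> (Suc i) - 1)) [0..<length v]"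

context
  fixes v :: "nat list" and n :: nat
  assumes sorted_v: "sorted v" and length_v: "length v = n"
begin

text \<open>Between two equal letters of a sorted word there is no ascent, hence \<open>\<sigma>\<close> has no descent there.\<close>

lemma increasing_on_levels:
  assumes \<sigma>: "\<sigma> permutes {1..n}" "descents n \<sigma> \<subseteq> ascents v"
    and ab: "1 \<le> a" "a < b" "b \<le> n" "v ! (a - 1) = v ! (b - 1)"
  shows "\<sigma> a < \<sigma> b"
proof -
  have up: "\<sigma> c < \<sigma> (Suc c)" if c: "a \<le> c" "c < b" for c
  proof -
    have "v ! (a - 1) \<le> v ! (c - 1)" "v ! (c - 1) \<le> v ! c" "v ! c \<le> v ! (b - 1)"
      by (rule sorted_nth_mono[OF sorted_v]; use ab(1-3) c length_v in linarith)+
    then have "c \<notin> ascents v" using ab(4) by (auto simp: ascents_def)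
    then have "c \<notin> descents n \<sigma>" using \<sigma>(2) by blast
    then have "\<sigma> c \<le> \<sigma> (Suc c)" using ab c by (simp add: descents_def)
    moreover have "\<sigma> c \<noteq> \<sigma> (Suc c)" using permutes_inj[OF \<sigma>(1)] by (metis injD n_not_Suc_n)
    ultimately show ?thesis by simp
  qed
  have "\<sigma> a < \<sigma> c" if "Suc a \<le> c" "c \<le> b" for c
    using that
  proof (induction c rule: dec_induct)
    case base
    then show ?case using up[of a] by simp
  next
    case (step c)
    then show ?case using up[of c] by simp
  qed
  then show ?thesis using ab by simp
qed

lemma length_word_of_perm [simp]: "length (word_of_perm v \<sigma>) = n"
  by (simp add: word_of_perm_def length_v)

lemma word_of_perm_nth:
  assumes "0 < i" "i \<le> n"
  shows "word_of_perm v \<sigma> ! (i - 1) = v ! (inv \<sigma> i - 1)"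
  using assms by (cases i) (simp_all add: word_of_perm_def length_v)

lemma word_of_perm_apply:
  assumes "\<sigma> permutes {1..n}" "1 \<le> a" "a \<le> n"
  shows "word_of_perm v \<sigma> ! (\<sigma> a - 1) = v ! (a - 1)"
proof -
  have "\<sigma> a \<in> {1..n}" using permutes_in_image[OF assms(1), of a] assms by simp
  then show ?thesis using word_of_perm_nth[of "\<sigma> a" \<sigma>] permutes_inverses(2)[OF assms(1), of a] by simp
qed

lemma word_descents_word_of_perm:
  assumes \<sigma>: "\<sigma> permutes {1..n}" "descents n \<sigma> \<subseteq> ascents v"
  shows "word_descents (word_of_perm v \<sigma>) = descents n (inv \<sigma>)"
proof (rule set_eqI)
  fix i
  show "i \<in> word_descents (word_of_perm v \<sigma>) \<longleftrightarrow> i \<in> descents n (inv \<sigma>)"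
  proof (cases "0 < i \<and> i < n")
    case False
    then show ?thesis by (auto simp: word_descents_def descents_def)
  next
    case True
    define p where "p = inv \<sigma> i"
    define q where "q = inv \<sigma> (Suc i)"
    have in_n: "p \<in> {1..n}" "q \<in> {1..n}"
      using permutes_in_image[OF permutes_inv[OF \<sigma>(1)]] True by (auto simp: p_def q_def)
    have \<sigma>pq: "\<sigma> p = i" "\<sigma> q = Suc i" using permutes_inverses(1)[OF \<sigma>(1)] by (simp_all add: p_def q_def)
    have w: "word_of_perm v \<sigma> ! (i - 1) = v ! (p - 1)" "word_of_perm v \<sigma> ! i = v ! (q - 1)"
      using word_of_perm_nth[of i \<sigma>] word_of_perm_nth[of "Suc i" \<sigma>] True by (simp_all add: p_def q_def)
    have "v ! (q - 1) < v ! (p - 1) \<longleftrightarrow> q < p"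
    proof
      assume lt: "v ! (q - 1) < v ! (p - 1)"
      show "q < p"
      proof (rule ccontr)
        assume "\<not> q < p"
        then have "v ! (p - 1) \<le> v ! (q - 1)" using in_n length_v by (intro sorted_nth_mono[OF sorted_v]) auto
        then show False using lt by simp
      qed
    next
      assume lt: "q < p"
      have "v ! (q - 1) \<le> v ! (p - 1)" using in_n length_v lt by (intro sorted_nth_mono[OF sorted_v]) auto
      moreover have "v ! (q - 1) \<noteq> v ! (p - 1)"
        using increasing_on_levels[OF \<sigma>, of q p] in_n lt \<sigma>pq by auto
      ultimately show "v ! (q - 1) < v ! (p - 1)" by simp
    qed
    then show ?thesis using True
      unfolding word_descents_def descents_def mem_Collect_eq w by (simp add: p_def q_def)
  qed
qed

lemma mset_word_of_perm:
  assumes "\<sigma> permutes {1..n}"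
  shows "mset (word_of_perm v \<sigma>) = mset v"
proof -
  let ?g = "\<lambda>a. v ! (a - 1)"
  have p: "inv \<sigma> permutes {1..n}" by (rule permutes_inv[OF assms])
  have Suc: "image_mset Suc (mset_set {0..<n}) = mset_set {1..n}"
    by (subst image_mset_mset_set) (auto simp: image_Suc_atLeastLessThan atLeastLessThanSuc_atLeastAtMost)
  have "mset (word_of_perm v \<sigma>) = image_mset (\<lambda>i. ?g (inv \<sigma> (Suc i))) (mset_set {0..<n})"
    by (simp add: word_of_perm_def length_v)
  also have "\<dots> = image_mset ?g (image_mset (inv \<sigma>) (image_mset Suc (mset_set {0..<n})))"
    by (simp add: image_mset.compositionality comp_def)
  also have "image_mset (inv \<sigma>) (image_mset Suc (mset_set {0..<n})) = mset_set {1..n}"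
    unfolding Suc image_mset_mset_set[OF permutes_inj_on[OF p]] permutes_image[OF p] ..
  also have "image_mset ?g (mset_set {1..n}) = image_mset (\<lambda>i. v ! i) (mset_set {0..<n})"
    unfolding Suc[symmetric] image_mset.compositionality by (simp add: comp_def)
  also have "\<dots> = mset (map ((!) v) [0..<length v])" by (simp add: length_v)
  also have "\<dots> = mset v" by (simp only: map_nth)
  finally show ?thesis .
qed

text \<open>Consider the first \<open>a\<close> at which the permutations differ. Each of them takes the value of the other one at a later place with
  an equal letter, so by \<open>increasing_on_levels\<close> its own value at \<open>a\<close> is smaller, which cannot hold for
  both.\<close>

lemma word_of_perm_inj:
  assumes \<sigma>: "\<sigma> permutes {1..n}" "descents n \<sigma> \<subseteq> ascents v"
    and \<tau>: "\<tau> permutes {1..n}" "descents n \<tau> \<subseteq> ascents v"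
    and eq: "word_of_perm v \<sigma> = word_of_perm v \<tau>"
  shows "\<sigma> = \<tau>"
proof
  have first_difference: "\<tau> a < \<sigma> a"
    if \<sigma>: "\<sigma> permutes {1..n}" "descents n \<sigma> \<subseteq> ascents v"
      and \<tau>: "\<tau> permutes {1..n}" "descents n \<tau> \<subseteq> ascents v"
      and eq: "word_of_perm v \<sigma> = word_of_perm v \<tau>"
      and a: "1 \<le> a" "a \<le> n" "\<sigma> a \<noteq> \<tau> a" and IH: "\<And>b. b < a \<Longrightarrow> \<sigma> b = \<tau> b" for \<sigma> \<tau> a
  proof -
    define b where "b = inv \<tau> (\<sigma> a)"
    have \<tau>b: "\<tau> b = \<sigma> a" using permutes_inverses(1)[OF \<tau>(1)] by (simp add: b_def)
    have "\<sigma> a \<in> {1..n}" using permutes_in_image[OF \<sigma>(1), of a] a by simp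
    then have b: "b \<in> {1..n}" using permutes_in_image[OF permutes_inv[OF \<tau>(1)]] by (simp add: b_def)
    have "v ! (b - 1) = v ! (a - 1)"
      using word_of_perm_apply[OF \<tau>(1), of b] word_of_perm_apply[OF \<sigma>(1), of a] a b eq \<tau>b by simp
    moreover have "a < b"
    proof (rule ccontr)
      assume "\<not> a < b"
      moreover have "b \<noteq> a" using \<tau>b a by auto
      ultimately have "b < a" by simp
      then have "\<sigma> b = \<sigma> a" using IH \<tau>b by simp
      then show False using permutes_inj[OF \<sigma>(1)] \<open>b < a\<close> by (auto dest: injD)
    qed
    ultimately show ?thesis using increasing_on_levels[OF \<tau>, of a b] a b \<tau>b by simp
  qed
  fix a
  show "\<sigma> a = \<tau> a"
  proof (induction a rule: less_induct)
    case (less a)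
    show ?case
    proof (cases "a \<in> {1..n}")
      case False
      then show ?thesis using permutes_not_in[OF \<sigma>(1)] permutes_not_in[OF \<tau>(1)] by simp
    next
      case True
      show ?thesis
      proof (rule ccontr)
        assume ne: "\<sigma> a \<noteq> \<tau> a"
        have "\<tau> a < \<sigma> a"
          by (rule first_difference[OF \<sigma> \<tau> eq]) (use True ne less in auto)
        moreover have "\<sigma> a < \<tau> a"
          by (rule first_difference[OF \<tau> \<sigma> eq[symmetric]]) (use True ne less in auto)
        ultimately show False by simp
      qed
    qed
  qed
qed

text \<open>The required permutation lists the positions of \<open>w\<close> sorted stably by their letters.\<close>

lemma word_of_perm_surj:
  assumes w: "mset w = mset v"
  obtains \<sigma> where "\<sigma> permutes {1..n}" "descents n \<sigma> \<subseteq> ascents v" "word_of_perm v \<sigma> = w"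
proof -
  define L where "L = sort_key ((!) w) [0..<n]"
  have len_w: "length w = n" using mset_eq_length[OF w] length_v by simp
  have L: "distinct L" "set L = {0..<n}" "length L = n" by (simp_all add: L_def)
  have "mset (map ((!) w) L) = mset (map ((!) w) [0..<length w])" by (simp add: L_def len_w)
  also have "\<dots> = mset w" by (simp only: map_nth)
  finally have "mset (map ((!) w) L) = mset v" using w by simp
  moreover have "sorted (map ((!) w) L)" by (simp add: L_def)
  ultimately have Lv: "map ((!) w) L = v" using sorted_v by (metis properties_for_sort)
  have wL: "w ! (L ! j) = v ! j" if "j < n" for j using that L(3) by (simp add: Lv[symmetric])
  define \<sigma> where "\<sigma> a = (if a \<in> {1..n} then Suc (L ! (a - 1)) else a)" for a
  have nthL: "L ! j < n" if "j < n" for j using nth_mem[of j L] L that by simp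
  have "bij_betw \<sigma> {1..n} {1..n}"
  proof (rule bij_betw_imageI)
    show inj: "inj_on \<sigma> {1..n}"
      by (rule inj_onI) (use L in \<open>auto simp: \<sigma>_def nth_eq_iff_index_eq\<close>)
    have "\<sigma> ` {1..n} \<subseteq> {1..n}" using nthL by (auto simp: \<sigma>_def Suc_le_eq)
    then show "\<sigma> ` {1..n} = {1..n}" using inj by (intro endo_inj_surj) auto
  qed
  then have \<sigma>: "\<sigma> permutes {1..n}" by (rule bij_imp_permutes) (auto simp: \<sigma>_def)
  have desc: "descents n \<sigma> \<subseteq> ascents v"
  proof
    fix a assume "a \<in> descents n \<sigma>"
    then have a: "1 \<le> a" "a < n" "\<sigma> (a + 1) < \<sigma> a" by (auto simp: descents_def)
    define i where "i = a - 1"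
    have i: "a = Suc i" using a by (simp add: i_def)
    have lt: "L ! Suc i < L ! i" using a i by (simp add: \<sigma>_def)
    have "v ! i \<le> v ! Suc i" using a i length_v by (intro sorted_nth_mono[OF sorted_v]) auto
    moreover have "v ! i \<noteq> v ! Suc i"
    proof
      assume e: "v ! i = v ! Suc i"
      let ?P = "\<lambda>x. w ! x = v ! i"
      have "L = take i L @ L ! i # L ! Suc i # drop (Suc (Suc i)) L"
        using a i L(3) by (simp add: id_take_nth_drop[symmetric] Cons_nth_drop_Suc)
      then have "filter ?P L = filter ?P (take i L @ L ! i # L ! Suc i # drop (Suc (Suc i)) L)" by (rule arg_cong)
      also have "\<dots> = filter ?P (take i L) @ L ! i # L ! Suc i # filter ?P (drop (Suc (Suc i)) L)"
        using wL[of i] wL[of "Suc i"] e a i by simp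
      finally have f: "filter ?P L = filter ?P (take i L) @ L ! i # L ! Suc i # filter ?P (drop (Suc (Suc i)) L)" .
      have "filter ?P L = filter ?P [0..<n]" unfolding L_def by (rule sort_key_stable)
      then have "sorted (filter ?P L)" by (simp add: sorted_wrt_filter)
      then show False unfolding f using lt by (simp add: sorted_append)
    qed
    ultimately show "a \<in> ascents v" using a i length_v by (simp add: ascents_def)
  qed
  have "word_of_perm v \<sigma> = w"
  proof (rule nth_equalityI)
    fix i assume "i < length (word_of_perm v \<sigma>)"
    then have i: "i < n" by simp
    then obtain j where j: "j < n" "i = L ! j" using L by (metis atLeast0LessThan in_set_conv_nth lessThan_iff)
    have "\<sigma> (Suc j) = Suc i" using j by (simp add: \<sigma>_def)
    then have "inv \<sigma> (Suc i) = Suc j" using permutes_inverses(2)[OF \<sigma>] by metis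
    then show "word_of_perm v \<sigma> ! i = w ! i" using i j wL by (simp add: word_of_perm_def length_v)
  qed (simp add: len_w)
  then show ?thesis using that \<sigma> desc by blast
qed

theorem card_words_perms:
  assumes "sum_list \<beta> = n"
  shows "card {w \<in> ribbon_words \<beta>. mset w = mset v} =
    card {\<sigma>. \<sigma> permutes {1..n} \<and> descents n \<sigma> \<subseteq> ascents v \<and> descents n (inv \<sigma>) = partial_sums \<beta>}"
proof -
  have "bij_betw (word_of_perm v)
     {\<sigma>. \<sigma> permutes {1..n} \<and> descents n \<sigma> \<subseteq> ascents v \<and> descents n (inv \<sigma>) = partial_sums \<beta>}
     {w \<in> ribbon_words \<beta>. mset w = mset v}" (is "bij_betw _ ?P ?W")
  proof (rule bij_betw_imageI)
    show "inj_on (word_of_perm v) ?P"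
      by (rule inj_onI) (simp add: word_of_perm_inj)
    show "word_of_perm v ` ?P = ?W"
    proof (intro equalityI subsetI)
      fix w assume "w \<in> word_of_perm v ` ?P"
      then show "w \<in> ?W" using word_descents_word_of_perm mset_word_of_perm assms by (auto simp: ribbon_words_def)
    next
      fix w assume w: "w \<in> ?W"
      then have "mset w = mset v" by simp
      then obtain \<sigma> where \<sigma>: "\<sigma> permutes {1..n}" "descents n \<sigma> \<subseteq> ascents v" "word_of_perm v \<sigma> = w"
        by (rule word_of_perm_surj)
      then have "descents n (inv \<sigma>) = partial_sums \<beta>"
        using word_descents_word_of_perm[OF \<sigma>(1,2)] w by (simp add: ribbon_words_def)
      then show "w \<in> word_of_perm v ` ?P" using \<sigma> by blast
    qed
  qed
  then show ?thesis by (simp add: bij_betw_same_card)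
qed

end

definition descent_count :: "nat \<Rightarrow> nat set \<Rightarrow> nat set \<Rightarrow> nat" where
  "descent_count n U S = card {\<sigma>. \<sigma> permutes {1..n} \<and> descents n \<sigma> = U \<and> descents n (inv \<sigma>) = S}"

lemma ribbon_words_descent_count:
  assumes "sorted v" "length v = sum_list \<beta>"
  shows "card {w \<in> ribbon_words \<beta>. mset w = mset v} =
    (\<Sum>U\<in>Pow (ascents v). descent_count (sum_list \<beta>) U (partial_sums \<beta>))"
proof -
  let ?n = "sum_list \<beta>" and ?S = "partial_sums \<beta>"
  let ?X = "\<lambda>U. {\<sigma>. \<sigma> permutes {1..?n} \<and> descents ?n \<sigma> = U \<and> descents ?n (inv \<sigma>) = ?S}"
  have fin: "finite (ascents v)" by (rule finite_subset[of _ "{..<length v}"]) (auto simp: ascents_def)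
  have "{\<sigma>. \<sigma> permutes {1..?n} \<and> descents ?n \<sigma> \<subseteq> ascents v \<and> descents ?n (inv \<sigma>) = ?S} = (\<Union>U\<in>Pow (ascents v). ?X U)"
    by auto
  also have "card \<dots> = (\<Sum>U\<in>Pow (ascents v). card (?X U))"
  proof (rule card_UN_disjoint)
    have "finite {\<sigma>. \<sigma> permutes {1..?n}}" by (rule finite_permutations) simp
    then show "\<forall>U\<in>Pow (ascents v). finite (?X U)" by (auto intro: finite_subset[rotated])
  qed (use fin in auto)
  finally show ?thesis unfolding card_words_perms[OF assms refl] descent_count_def .
qed

text \<open>The letter at a position counts the elements of \<open>T\<close> up to it.\<close>

lemma sorted_word_with_ascents:
  assumes "T \<subseteq> {0<..<n}"
  obtains v where "sorted v" "length v = n" "ascents v = T"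
proof -
  define v where "v = map (\<lambda>i. card {t \<in> T. t \<le> i}) [0..<n]"
  have fin: "finite {t \<in> T. t \<le> i}" for i by (rule finite_subset[of _ "{..i}"]) auto
  have "sorted v" by (auto simp: sorted_iff_nth_mono v_def intro!: card_mono fin)
  moreover have "ascents v = T"
  proof (rule set_eqI)
    fix i
    show "i \<in> ascents v \<longleftrightarrow> i \<in> T"
    proof (cases "0 < i \<and> i < n")
      case True
      then obtain j where j: "i = Suc j" by (cases i) auto
      have "{t \<in> T. t \<le> i} = (if i \<in> T then insert i {t \<in> T. t \<le> j} else {t \<in> T. t \<le> j})"
        unfolding j by (auto simp: le_Suc_eq)
      moreover have "i \<notin> {t \<in> T. t \<le> j}" using j by auto
      ultimately have "card {t \<in> T. t \<le> i} = card {t \<in> T. t \<le> j} + (if i \<in> T then 1 else 0)"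
        using fin[of j] by simp
      then show ?thesis using True j by (simp add: ascents_def v_def)
    qed (use assms in \<open>auto simp: ascents_def v_def\<close>)
  qed
  ultimately show ?thesis using that[of v] by (simp add: v_def)
qed

text \<open>The coefficient of \<open>r\<^sub>\<beta>\<close> at a monomial with sorted word \<open>v\<close> is the sum of the descent counts over all subsets of the ascents of
  \<open>v\<close>. All subsets of \<open>{1..n-1}\<close> occur as sets of ascents, so these sums determine the single
  counts by Moebius inversion.\<close>

theorem ribbon_schur_eq_iff_descent_counts:
  assumes c: "composition \<beta>" "composition \<gamma>" and n: "sum_list \<beta> = n" "sum_list \<gamma> = n" "n > 0"
  shows "ribbon_schur \<beta> = ribbon_schur \<gamma> \<longleftrightarrow>
    (\<forall>\<alpha>. \<alpha> \<Turnstile>\<^sub>c n \<longrightarrow> descent_count n (partial_sums \<alpha>) (partial_sums \<beta>) = descent_count n (partial_sums \<alpha>) (partial_sums \<gamma>))"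
proof
  assume eq: "ribbon_schur \<beta> = ribbon_schur \<gamma>"
  have sums: "(\<Sum>U\<in>Pow T. descent_count n U (partial_sums \<beta>)) = (\<Sum>U\<in>Pow T. descent_count n U (partial_sums \<gamma>))"
    if T: "T \<subseteq> {0<..<n}" for T
  proof -
    obtain v where v: "sorted v" "length v = n" "ascents v = T" by (rule sorted_word_with_ascents[OF T])
    have "card {w \<in> ribbon_words \<beta>. mset w = mset v} = card {w \<in> ribbon_words \<gamma>. mset w = mset v}"
      using fun_cong[OF eq, of "mset v"]
      unfolding ribbon_schur_words[OF c(1)] ribbon_schur_words[OF c(2)] of_nat_eq_iff .
    then show ?thesis
      using ribbon_words_descent_count[of v \<beta>] ribbon_words_descent_count[of v \<gamma>] v n by simp
  qed
  show "\<forall>\<alpha>. \<alpha> \<Turnstile>\<^sub>c n \<longrightarrow> descent_count n (partial_sums \<alpha>) (partial_sums \<beta>) = descent_count n (partial_sums \<alpha>) (partial_sums \<gamma>)"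
  proof (intro allI impI)
    fix \<alpha> assume "\<alpha> \<Turnstile>\<^sub>c n"
    then have T: "partial_sums \<alpha> \<subseteq> {0<..<n}" using partial_sums_subset[of \<alpha>] by (auto simp: composition_of_def)
    let ?T = "partial_sums \<alpha>"
    have fin: "finite ?T" using T by (rule finite_subset) simp
    have mob: "int (descent_count n ?T S) =
        (\<Sum>V\<in>Pow ?T. (-1) ^ (card ?T - card V) * int (\<Sum>U\<in>Pow V. descent_count n U S))" for S
      by (rule inclusion_exclusion_mobius[OF _ fin]) simp
    have "(\<Sum>V\<in>Pow ?T. (-1) ^ (card ?T - card V) * int (\<Sum>U\<in>Pow V. descent_count n U (partial_sums \<beta>))) =
      (\<Sum>V\<in>Pow ?T. (-1) ^ (card ?T - card V) * int (\<Sum>U\<in>Pow V. descent_count n U (partial_sums \<gamma>)))"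
    proof (rule sum.cong)
      fix V assume "V \<in> Pow ?T"
      then have "V \<subseteq> {0<..<n}" using T by blast
      then show "(-1) ^ (card ?T - card V) * int (\<Sum>U\<in>Pow V. descent_count n U (partial_sums \<beta>)) =
        (-1) ^ (card ?T - card V) * int (\<Sum>U\<in>Pow V. descent_count n U (partial_sums \<gamma>))" by (simp only: sums)
    qed simp
    then show "descent_count n ?T (partial_sums \<beta>) = descent_count n ?T (partial_sums \<gamma>)"
      unfolding mob[symmetric] of_nat_eq_iff .
  qed
next
  assume eq: "\<forall>\<alpha>. \<alpha> \<Turnstile>\<^sub>c n \<longrightarrow> descent_count n (partial_sums \<alpha>) (partial_sums \<beta>) = descent_count n (partial_sums \<alpha>) (partial_sums \<gamma>)"
  show "ribbon_schur \<beta> = ribbon_schur \<gamma>"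
  proof
    fix m :: "nat multiset"
    have "card {w \<in> ribbon_words \<beta>. mset w = m} = card {w \<in> ribbon_words \<gamma>. mset w = m}"
    proof (cases "size m = n")
      case False
      then have "{w \<in> ribbon_words \<delta>. mset w = m} = {}" if "sum_list \<delta> = n" for \<delta>
        using that by (auto simp: ribbon_words_def)
      from this[OF n(1)] this[OF n(2)] show ?thesis by (simp only:)
    next
      case True
      define v where "v = sorted_list_of_multiset m"
      have v: "sorted v" "mset v = m" by (simp_all add: v_def)
      have len: "length v = n" using True v(2) size_mset[of v] by simp
      have "descent_count n U (partial_sums \<beta>) = descent_count n U (partial_sums \<gamma>)" if "U \<in> Pow (ascents v)" for U
      proof -
        have "U \<subseteq> {0<..<n}" using that len by (auto simp: ascents_def)
        then obtain \<alpha> where \<alpha>: "composition \<alpha>" "sum_list \<alpha> = n" "partial_sums \<alpha> = U"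
          by (rule composition_of_set[OF _ n(3)]) (rule that)
        then show ?thesis using eq[rule_format, of \<alpha>] by (simp add: composition_of_def)
      qed
      then show ?thesis
        using ribbon_words_descent_count[OF v(1), of \<beta>] ribbon_words_descent_count[OF v(1), of \<gamma>] len n v(2) by simp
    qed
    then show "ribbon_schur \<beta> m = ribbon_schur \<gamma> m" by (simp add: ribbon_schur_words c)
  qed
qed

theorem corollary4p2:
  fixes n :: nat and \<beta> \<gamma> :: "nat list"
  assumes "\<beta> \<Turnstile>\<^sub>c n" and "\<gamma> \<Turnstile>\<^sub>c n"
  shows "let
      c1 = (ribbon_schur \<beta> = ribbon_schur \<gamma>);
      c2 = (\<forall>f c. symmetric_function f \<and> fundamental_expansion f c \<longrightarrow> c \<beta> = c \<gamma>);
      c3 = (coarsening_partitions \<beta> = coarsening_partitions \<gamma>);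
      c4 = (\<forall>\<alpha>. \<alpha> \<Turnstile>\<^sub>c n \<longrightarrow>
          card {\<sigma>. \<sigma> permutes {1..n} \<and> descents n \<sigma> = partial_sums \<alpha> \<and>
                    descents n (inv \<sigma>) = partial_sums \<beta>} =
          card {\<sigma>. \<sigma> permutes {1..n} \<and> descents n \<sigma> = partial_sums \<alpha> \<and>
                    descents n (inv \<sigma>) = partial_sums \<gamma>});
      c5 = (\<exists>\<beta>s \<gamma>s. length \<beta>s \<ge> 1 \<and> length \<gamma>s = length \<beta>s \<and>
          (\<forall>b\<in>set \<beta>s. composition b) \<and> (\<forall>g\<in>set \<gamma>s. composition g) \<and>
          \<beta> = circ_list \<beta>s \<and> \<gamma> = circ_list \<gamma>s \<and>
          (\<forall>i<length \<beta>s. \<gamma>s ! i = \<beta>s ! i \<or> \<gamma>s ! i = rev (\<beta>s ! i)))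
    in (c1 \<longleftrightarrow> c2) \<and> (c2 \<longleftrightarrow> c3) \<and> (c3 \<longleftrightarrow> c4) \<and> (c4 \<longleftrightarrow> c5)"
proof (cases "n = 0")
  case True
  then have "\<gamma> = \<beta>" using assms composition_sum_0 by (auto simp: composition_of_def)
  moreover have "related \<beta> \<beta>" using coarsening_partitions_iff_related[OF assms(1) assms(1)] by simp
  ultimately show ?thesis unfolding Let_def related_def by simp
next
  case False
  have c: "composition \<beta>" "composition \<gamma>" "sum_list \<beta> = n" "sum_list \<gamma> = n" "n > 0"
    using assms False by (auto simp: composition_of_def)
  note c1_c3 = ribbon_schur_eq_iff[OF c]
  have c2_c3: "(\<forall>f c. symmetric_function f \<and> fundamental_expansion f c \<longrightarrow> c \<beta> = c \<gamma>) \<longleftrightarrow>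
      coarsening_partitions \<beta> = coarsening_partitions \<gamma>"
    using coefficients_if_coarsening_partitions[OF c] coarsening_partitions_if_coefficients[OF c] by blast
  note c1_c4 = ribbon_schur_eq_iff_descent_counts[OF c, unfolded descent_count_def]
  note c3_c5 = coarsening_partitions_iff_related[OF assms, unfolded related_def]
  show ?thesis unfolding Let_def using c1_c3 c2_c3 c1_c4 c3_c5 by argo
qed

end
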